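(* Let $K\subset\mathbb{R}^4$ be compact. There exists $\delta=\delta(K)>0$, depending only on $K$, such that for each $\lambda=(c_0,d_0,b_0^\rho,b_0^\phi)\in K$ there is a unique $(-1)$-homogeneous axisymmetric solution $(u_\lambda,p_\lambda)\in C^\infty(\Omega_\delta\setminus\{x'=0\})$ of $$-\Delta u+(u\cdot\nabla)u+\nabla p=0,\qquad\operatorname{div}u=0$$ in $\Omega_\delta\setminus\{x'=0\}$ with $|u_\lambda|=o(|x'|^{-1})$ as $x'\to0$ for each fixed $x_3>0$ and with parameter $\lambda$ (in the sense defined in the context), and such that the following holds. The solution $(u_\lambda,p_\lambda)$ depends smoothly on $\lambda$. Moreover, for every integer $L\ge0$ there exists a constant $C>0$, depending only on $K$ and $L$, such that for every $\lambda\in K$, every multi-index $\beta\in\mathbb{N}^4$ and $k,l\in\mathbb{N}$ with $|\beta|+k+l\le L$, and every $x\in\Omega_\delta\setminus\{x'=0\}$, $$|\nabla_{x'}^k\partial_3^l\partial_\lambda^\beta u'_\lambda|\le\begin{cases}Cx_3^{-k-l-1}\rho^{-k+1}(|\ln\rho|+1),&k=0\text{ or }k=1,\\ Cx_3^{-k-l-1}\rho^{-k+1},&k\ge2,\end{cases}$$ $$|\nabla_{x'}^k\partial_3^l\partial_\lambda^\beta u^3_\lambda|\le\begin{cases}Cx_3^{-k-l-1}(|\ln\rho|+1),&k=0,\\ Cx_3^{-k-l-1}\rho^{-k},&k\ge1,\end{cases}$$ $$|\nabla_{x'}^k\partial_3^l\partial_\lambda^\beta p_\lambda|\le\begin{cases}Cx_3^{-k-l-2}(|\ln\rho|+1),&k=0,\\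 Cx_3^{-k-l-2}\rho^{-k},&k\ge1.\end{cases}$$
   Context: Write $x=(x_1,x_2,x_3)\in\mathbb{R}^3$, $x'=(x_1,x_2)$, $r=|x'|$; $\phi$ is the azimuthal angle about the $x_3$-axis. Throughout $x_3>0$ and $\rho=r/x_3$. With $(e_r,e_\phi,e_3)$ the cylindrical orthonormal frame and $e_\rho:=e_r$, write $u=u^\rho e_\rho+u^\phi e_\phi+u^3e_3$ and $u'=u^\rho e_\rho+u^\phi e_\phi=u^1e_1+u^2e_2$. For $\delta>0$, $\Omega_\delta=\{x\in\mathbb{R}^3:|x'|<\delta x_3,\ x_3>0\}$. $\mathbb{N}$ is the set of nonnegative integers. A function $f$ is $(-\alpha)$-homogeneous if $f(sx)=s^{-\alpha}f(x)$ for all $s>0$. A solution $(u,p)$ is $(-1)$-homogeneous if $u$ is $(-1)$-homogeneous and $p$ is $(-2)$-homogeneous; it is axisymmetric if $u^\rho,u^\phi,u^3,p$ are independent of $\phi$. $(u,p)$ has parameter $\lambda=(c_0,d_0,b_0^\rho,b_0^\phi)$ if on $\{x_3=1\}$: $c_0=\lim_{\rho\to0^+}\rho\partial_\rho p$, $d_0=\lim_{\rho\to0^+}(p-c_0\ln\rho)$, $b_0^\rho=\lim_{\rho\to0^+}\frac1\rho(u^\rho-\frac12c_0\rho\ln\rho)$, $b_0^\phi=\lim_{\rho\to0^+}\frac1\rho u^\phi$. $\nabla_{x'}^k\partial_3^l\partial_\lambda^\beta f$ denotes any mixed derivative of order $k$ in the Cartesian variables $x'$, order $l$ in $x_3$,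 and multi-index $\beta$ in the parameter $\lambda$. Derivatives in $\lambda$ at points of $K$ are understood by regarding $(u_\lambda,p_\lambda)$ as defined in $\Omega_\delta\setminus\{x'=0\}$ for all $\lambda$ in a neighbourhood of $K$ (with $\delta$ still depending only on $K$). *)

theory Defs
  imports "HOL-Analysis.Analysis" "HOL-Library.Landau_Symbols"
begin

section \<open>Partial derivatives and smoothness\<close>

definition dir_deriv ::
  "'a::euclidean_space \<Rightarrow> ('a \<Rightarrow> 'b::real_normed_vector) \<Rightarrow> 'a \<Rightarrow> 'b"
  where "dir_deriv v f x = frechet_derivative f (at x) v"

fun partials ::
  "'a::euclidean_space list \<Rightarrow> ('a \<Rightarrow> 'b::real_normed_vector) \<Rightarrow> 'a \<Rightarrow> 'b"
  where
    "partials [] f = f"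
  | "partials (v # vs) f = dir_deriv v (partials vs f)"

text \<open>
  For open \<open>S\<close> this is the usual notion of a smooth function: if every iterated partial
  derivative is differentiable, every iterated partial derivative is also continuous.
\<close>
definition C_infinity_on ::
  "'a::euclidean_space set \<Rightarrow> ('a \<Rightarrow> 'b::real_normed_vector) \<Rightarrow> bool"
  where "C_infinity_on S f \<longleftrightarrow>
    (\<forall>vs. set vs \<subseteq> Basis \<longrightarrow> (\<forall>x\<in>S. partials vs f differentiable (at x)))"

definition laplacian ::
  "('a::euclidean_space \<Rightarrow> 'b::real_normed_vector) \<Rightarrow> 'a \<Rightarrow> 'b"
  where "laplacian f x = (\<Sum>b\<in>Basis. dir_deriv b (dir_deriv b f) x)"

definition gradient :: "('a::euclidean_space \<Rightarrow> real) \<Rightarrow> 'a \<Rightarrow> 'a"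
  where "gradient f x = (\<Sum>b\<in>Basis. dir_deriv b f x *\<^sub>R b)"

definition divergence :: "('a::euclidean_space \<Rightarrow> 'a) \<Rightarrow> 'a \<Rightarrow> real"
  where "divergence u x = (\<Sum>b\<in>Basis. dir_deriv b u x \<bullet> b)"

definition convection :: "('a::euclidean_space \<Rightarrow> 'a) \<Rightarrow> ('a \<Rightarrow> 'a) \<Rightarrow> 'a \<Rightarrow> 'a"
  where "convection u w x = (\<Sum>b\<in>Basis. (u x \<bullet> b) *\<^sub>R dir_deriv b w x)"

definition stationary_NS_on ::
  "(real^3) set \<Rightarrow> (real^3 \<Rightarrow> real^3) \<Rightarrow> (real^3 \<Rightarrow> real) \<Rightarrow> bool"
  where "stationary_NS_on S u p \<longleftrightarrow>
    (\<forall>x\<in>S. - laplacian u x + convection u u x + gradient p x = 0 \<and> divergence u x = 0)"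

section \<open>Cylindrical geometry\<close>

text \<open>\<open>horiz x\<close> is \<open>x' = (x\<^sub>1, x\<^sub>2)\<close>; it is applied both to points and to velocities.\<close>
definition horiz :: "real^3 \<Rightarrow> real^2"
  where "horiz x = vector [x $ 1, x $ 2]"

definition rho :: "real^3 \<Rightarrow> real"
  where "rho x = norm (horiz x) / x $ 3"

definition cone :: "real \<Rightarrow> (real^3) set"
  where "cone \<delta> = {x. norm (horiz x) < \<delta> * x $ 3 \<and> x $ 3 > 0}"

definition punctured_cone :: "real \<Rightarrow> (real^3) set"
  where "punctured_cone \<delta> = cone \<delta> - {x. horiz x = 0}"

definition cyl :: "real \<Rightarrow> real \<Rightarrow> real \<Rightarrow> real^3"
  where "cyl r \<phi> z = vector [r * cos \<phi>, r * sin \<phi>, z]"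

definition e_rho :: "real^3 \<Rightarrow> real^3"
  where "e_rho x = (1 / norm (horiz x)) *\<^sub>R vector [x $ 1, x $ 2, 0]"

definition e_phi :: "real^3 \<Rightarrow> real^3"
  where "e_phi x = (1 / norm (horiz x)) *\<^sub>R vector [- x $ 2, x $ 1, 0]"

definition comp_rho :: "(real^3 \<Rightarrow> real^3) \<Rightarrow> real^3 \<Rightarrow> real"
  where "comp_rho u x = u x \<bullet> e_rho x"

definition comp_phi :: "(real^3 \<Rightarrow> real^3) \<Rightarrow> real^3 \<Rightarrow> real"
  where "comp_phi u x = u x \<bullet> e_phi x"

definition indep_of_phi_on :: "(real^3) set \<Rightarrow> (real^3 \<Rightarrow> real) \<Rightarrow> bool"
  where "indep_of_phi_on S f \<longleftrightarrow>
    (\<forall>r>0. \<forall>z \<phi> \<psi>. cyl r \<phi> z \<in> S \<longrightarrow> cyl r \<psi> z \<in> S \<longrightarrow> f (cyl r \<phi> z) = f (cyl r \<psi> z))"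

definition axisymmetric_on ::
  "(real^3) set \<Rightarrow> (real^3 \<Rightarrow> real^3) \<Rightarrow> (real^3 \<Rightarrow> real) \<Rightarrow> bool"
  where "axisymmetric_on S u p \<longleftrightarrow>
    indep_of_phi_on S (comp_rho u) \<and> indep_of_phi_on S (comp_phi u) \<and>
    indep_of_phi_on S (\<lambda>x. u x $ 3) \<and> indep_of_phi_on S p"

definition homogeneous_on ::
  "(real^3) set \<Rightarrow> real \<Rightarrow> (real^3 \<Rightarrow> 'b::real_vector) \<Rightarrow> bool"
  where "homogeneous_on S a f \<longleftrightarrow> (\<forall>s>0. \<forall>x\<in>S. f (s *\<^sub>R x) = (s powr a) *\<^sub>R f x)"

definition small_near_axis :: "(real^3 \<Rightarrow> real^3) \<Rightarrow> bool"
  where "small_near_axis u \<longleftrightarrow>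
    (\<forall>z>0. (\<lambda>y::real^2. norm (u (vector [y $ 1, y $ 2, z]))) \<in> o[at 0](\<lambda>y. 1 / norm y))"

text \<open>
  The parameter is \<open>\<mu> = (c\<^sub>0, d\<^sub>0, b\<^sub>0\<^sup>\<rho>, b\<^sub>0\<^sup>\<phi>)\<close>. On \<open>x\<^sub>3 = 1\<close> one has \<open>r = \<rho>\<close>; the limits are
  required along every ray \<open>\<phi> = const\<close>, which for axisymmetric \<open>(u, p)\<close> is the same as along
  a single one.
\<close>
definition has_parameter ::
  "(real^3 \<Rightarrow> real^3) \<Rightarrow> (real^3 \<Rightarrow> real) \<Rightarrow> real^4 \<Rightarrow> bool"
  where "has_parameter u p \<mu> \<longleftrightarrow> (\<forall>\<phi>.
    ((\<lambda>\<rho>. \<rho> * deriv (\<lambda>s. p (cyl s \<phi> 1)) \<rho>) \<longlongrightarrow> \<mu> $ 1) (at_right 0) \<and>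
    ((\<lambda>\<rho>. p (cyl \<rho> \<phi> 1) - \<mu> $ 1 * ln \<rho>) \<longlongrightarrow> \<mu> $ 2) (at_right 0) \<and>
    ((\<lambda>\<rho>. (1 / \<rho>) * (comp_rho u (cyl \<rho> \<phi> 1) - 1/2 * \<mu> $ 1 * \<rho> * ln \<rho>)) \<longlongrightarrow> \<mu> $ 3) (at_right 0) \<and>
    ((\<lambda>\<rho>. (1 / \<rho>) * comp_phi u (cyl \<rho> \<phi> 1)) \<longlongrightarrow> \<mu> $ 4) (at_right 0))"

definition is_solution ::
  "real \<Rightarrow> real^4 \<Rightarrow> (real^3 \<Rightarrow> real^3) \<Rightarrow> (real^3 \<Rightarrow> real) \<Rightarrow> bool"
  where "is_solution \<delta> \<mu> u p \<longleftrightarrow>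
    C_infinity_on (punctured_cone \<delta>) u \<and> C_infinity_on (punctured_cone \<delta>) p \<and>
    stationary_NS_on (punctured_cone \<delta>) u p \<and>
    homogeneous_on (punctured_cone \<delta>) (-1) u \<and> homogeneous_on (punctured_cone \<delta>) (-2) p \<and>
    axisymmetric_on (punctured_cone \<delta>) u p \<and>
    small_near_axis u \<and>
    has_parameter u p \<mu>"

section \<open>Mixed derivatives in the parameter and in space\<close>

text \<open>
  Families \<open>u\<^sub>\<mu>(x)\<close> are treated as functions of \<open>(\<mu>, x)\<close>. The list \<open>vs\<close> of coordinate
  directions, in any order, has \<open>k\<close> entries in the \<open>x'\<close> directions, \<open>l\<close> in the \<open>x\<^sub>3\<close> direction
  and \<open>\<beta>\<^sub>i\<close> in the \<open>i\<close>-th parameter direction.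
\<close>
definition mixed_directions ::
  "nat \<Rightarrow> nat \<Rightarrow> nat^4 \<Rightarrow> ((real^4) \<times> (real^3)) list \<Rightarrow> bool"
  where "mixed_directions k l \<beta> vs \<longleftrightarrow>
    set vs \<subseteq> Basis \<and>
    count_list vs (0, axis 1 1) + count_list vs (0, axis 2 1) = k \<and>
    count_list vs (0, axis 3 1) = l \<and>
    (\<forall>i. count_list vs (axis i 1, 0) = \<beta> $ i)"

end

theory Submission imports Defs "HOL-Real_Asymp.Real_Asymp" begin

text \<open>
  In terms of \<open>s = \<rho>\<^sup>2\<close> the equations for homogeneous axisymmetric fields form an ordinary differential
  system with a singular point at \<open>s = 0\<close>, where \<open>|u| = o(1/r)\<close> selects the solutions with at most
  logarithmic singularity. The divergence equation expresses \<open>h = u\<^sup>3\<close> through \<open>n = A - h\<close> and \<open>n'\<close>; after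
  integrating the momentum equations, \<open>h\<close> and the pressure become algebraic in the unknowns of a closed
  first-order system. Once the logarithm \<open>n = y - (c\<^sub>0/2) ln \<rho>\<close> is split off, this is
  a Volterra system with initial values at the axis and coefficients given by the parameter. Picard iteration in
  the Banach algebra of bounded continuous functions of \<open>\<rho>\<close> converges together with all derivatives in
  the parameter on an interval depending only on \<open>K\<close>; uniqueness is a weighted Gronwall argument. For the
  estimates, \<open>\<rho> d/d\<rho>\<close> maps the regular parts of the profiles to bounded functions of the same kind, so the
  solution is a symbol in \<open>x'\<close> with only the logarithms written out as exceptions.
\<close>

text \<open>On the unit sphere the polar velocity is u_theta = \<open>n\<close> tan theta. The
  divergence equation turns the definition of \<open>E\<close> into the Riccati equation 2 s (1 + s)
  n' = s (n^2/2 - n) - E/s, and E/(1 + s) is the right-hand side of Slezkin's equation for sin theta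
  u_theta. Three derivatives of \<open>E\<close> leave e' = -(3 e + B g)/(2 (1 + s)): without swirl
  \<open>E\<close> is explicit, and with swirl the system still closes. The obstacle is the
  logarithm: n behaves like -(c_0/2) ln \<rho>, so the Riccati equation contains ln \<rho> and its
  square, unbounded in the variable s. Since ds = 2 \<rho> d\<rho>, passing to \<rho> supplies a
  factor that makes every coefficient bounded. The four parameters become the data g = b_0^phi, k =
  c_0/2, e = b_0^rho - d_0/2 and c_0/2 - b_0^rho for n + (c_0/2) ln \<rho>. For an arbitrary
  solution only limits of undifferentiated profiles are at hand; those of g and k have to be
  recovered from the equations, and |u| = o(1/r) fixes the constant of integration in n.\<close>

section \<open>Calculus of iterated partial derivatives\<close>

lemma partials_append: "partials (vs @ ws) f = partials vs (partials ws f)"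
  by (induction vs) auto

lemma dir_deriv_eq:
  assumes "(f has_derivative f') (at x)"
  shows "dir_deriv v f x = f' v"
  using frechet_derivative_at[OF assms] by (simp add: dir_deriv_def)

lemma dir_deriv_cong:
  assumes "open S" "x \<in> S" "\<And>y. y \<in> S \<Longrightarrow> f y = g y"
  shows "dir_deriv v f x = dir_deriv v g x"
proof -
  have "(f has_derivative f') (at x) \<longleftrightarrow> (g has_derivative f') (at x)" for f'
    using has_derivative_transform_within_open[OF _ assms(1,2), of f f' UNIV g]
      has_derivative_transform_within_open[OF _ assms(1,2), of g f' UNIV f] assms(3) by auto
  then show ?thesis by (simp add: dir_deriv_def frechet_derivative_def)
qed

lemma differentiable_cong_open:
  assumes "open S" "x \<in> S" "\<And>y. y \<in> S \<Longrightarrow> f y = g y" "f differentiable (at x)"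
  shows "g differentiable (at x)"
  using assms has_derivative_transform_within_open unfolding differentiable_def by metis

lemma has_derivative_dir_deriv:
  fixes f :: "'a::euclidean_space \<Rightarrow> 'b::real_normed_vector"
  assumes "f differentiable (at x)"
  shows "(f has_derivative (\<lambda>h. \<Sum>b\<in>Basis. (h \<bullet> b) *\<^sub>R dir_deriv b f x)) (at x)"
proof -
  obtain f' where f': "(f has_derivative f') (at x)" using assms by (auto simp: differentiable_def)
  interpret bounded_linear f' using f' by (rule has_derivative_bounded_linear)
  have "f' h = (\<Sum>b\<in>Basis. (h \<bullet> b) *\<^sub>R dir_deriv b f x)" for h
  proof -
    have "f' h = f' (\<Sum>b\<in>Basis. (h \<bullet> b) *\<^sub>R b)" by (simp add: euclidean_representation)
    then show ?thesis by (simp add: sum scaleR dir_deriv_eq[OF f'])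
  qed
  then have "f' = (\<lambda>h. \<Sum>b\<in>Basis. (h \<bullet> b) *\<^sub>R dir_deriv b f x)" by (rule ext)
  with f' show ?thesis by simp
qed

text \<open>The index counts the partial derivatives that are still differentiable, so
  \<open>Ck 0\<close> already asks for a derivative. The recursion differentiates \<open>f\<close>
  itself and thus peels off the last entry of the list in \<open>partials\<close>; in this form the
  sum and product rules pass through an induction.\<close>

primrec Ck :: "nat \<Rightarrow> 'a::euclidean_space set \<Rightarrow> ('a \<Rightarrow> 'b::real_normed_vector) \<Rightarrow> bool" where
  "Ck 0 S f \<longleftrightarrow> (\<forall>x\<in>S. f differentiable (at x))"
| "Ck (Suc n) S f \<longleftrightarrow> (\<forall>x\<in>S. f differentiable (at x)) \<and> (\<forall>b\<in>Basis. Ck n S (dir_deriv b f))"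

lemma Ck_differentiable: "Ck n S f \<Longrightarrow> x \<in> S \<Longrightarrow> f differentiable (at x)"
  by (cases n) auto

lemma Ck_Suc: "Ck (Suc n) S f \<Longrightarrow> Ck n S f"
  by (induction n arbitrary: f) auto

lemma Ck_iff_partials:
  "Ck n S f \<longleftrightarrow> (\<forall>vs. set vs \<subseteq> Basis \<and> length vs \<le> n \<longrightarrow> (\<forall>x\<in>S. partials vs f differentiable (at x)))"
proof (induction n arbitrary: f)
  case (Suc n)
  show ?case (is "_ \<longleftrightarrow> ?R")
  proof
    assume *: "Ck (Suc n) S f"
    show ?R
    proof (intro allI impI ballI)
      fix vs :: "'a list" and x assume vs: "set vs \<subseteq> Basis \<and> length vs \<le> Suc n" and x: "x \<in> S"
      show "partials vs f differentiable (at x)"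
      proof (cases vs rule: rev_cases)
        case Nil then show ?thesis using * x by simp
      next
        case (snoc ws b)
        then show ?thesis using * x vs Suc[of "dir_deriv b f"] by (simp add: partials_append)
      qed
    qed
  next
    assume R: ?R
    have "f differentiable (at x)" if "x \<in> S" for x
      using R[rule_format, of "[]" x] that by simp
    moreover have "Ck n S (dir_deriv b f)" if b: "b \<in> Basis" for b
      unfolding Suc
    proof (intro allI impI ballI)
      fix vs :: "'a list" and x assume vs: "set vs \<subseteq> Basis \<and> length vs \<le> n" and x: "x \<in> S"
      show "partials vs (dir_deriv b f) differentiable (at x)"
        using R[rule_format, of "vs @ [b]" x] vs x b by (simp add: partials_append)
    qed
    ultimately show "Ck (Suc n) S f" by simp
  qed
qed auto

lemma C_infinity_on_iff_Ck: "C_infinity_on S f \<longleftrightarrow> (\<forall>n. Ck n S f)"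
  unfolding C_infinity_on_def Ck_iff_partials by auto

lemma C_infinity_on_dir_deriv:
  "C_infinity_on S f \<Longrightarrow> b \<in> Basis \<Longrightarrow> C_infinity_on S (dir_deriv b f)"
  unfolding C_infinity_on_iff_Ck by (metis Ck.simps(2))

lemma C_infinity_on_partials:
  "C_infinity_on S f \<Longrightarrow> set vs \<subseteq> Basis \<Longrightarrow> C_infinity_on S (partials vs f)"
  by (induction vs) (auto intro: C_infinity_on_dir_deriv)

lemma C_infinity_on_differentiable: "C_infinity_on S f \<Longrightarrow> x \<in> S \<Longrightarrow> f differentiable (at x)"
  unfolding C_infinity_on_iff_Ck using Ck_differentiable by blast

lemma Ck_cong:
  assumes "open S" "\<And>x. x \<in> S \<Longrightarrow> f x = g x" "Ck n S f"
  shows "Ck n S g"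
  using assms(2,3)
proof (induction n arbitrary: f g)
  case 0
  then show ?case using differentiable_cong_open[OF assms(1), of _ f g] by auto
next
  case (Suc n)
  have "Ck n S (dir_deriv b g)" if "b \<in> Basis" for b
    by (rule Suc.IH[of "dir_deriv b f"]) (use Suc that dir_deriv_cong[OF assms(1), of _ f g] in auto)
  then show ?case using Suc differentiable_cong_open[OF assms(1), of _ f g] by auto
qed

lemma dir_deriv_const [simp]: "dir_deriv b (\<lambda>x. c) = (\<lambda>x. 0)"
  using dir_deriv_eq[OF has_derivative_const] by (intro ext) blast

lemma Ck_const: "Ck n S (\<lambda>x. c)"
  by (induction n arbitrary: c) auto

lemma dir_deriv_add:
  assumes "f differentiable (at x)" "g differentiable (at x)"
  shows "dir_deriv b (\<lambda>x. f x + g x) x = dir_deriv b f x + dir_deriv b g x"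
proof -
  obtain f' g' where f': "(f has_derivative f') (at x)" and g': "(g has_derivative g') (at x)"
    using assms by (auto simp: differentiable_def)
  show ?thesis
    using dir_deriv_eq[OF has_derivative_add[OF f' g']] dir_deriv_eq[OF f'] dir_deriv_eq[OF g'] by simp
qed

lemma dir_deriv_linear:
  assumes "bounded_linear T" "f differentiable (at x)"
  shows "dir_deriv b (\<lambda>x. T (f x)) x = T (dir_deriv b f x)"
proof -
  obtain f' where f': "(f has_derivative f') (at x)" using assms by (auto simp: differentiable_def)
  show ?thesis
    using dir_deriv_eq[OF bounded_linear.has_derivative[OF assms(1) f']] dir_deriv_eq[OF f'] by simp
qed

lemma dir_deriv_bilinear:
  assumes "bounded_bilinear p" "f differentiable (at x)" "g differentiable (at x)"
  shows "dir_deriv b (\<lambda>x. p (f x) (g x)) x = p (dir_deriv b f x) (g x) + p (f x) (dir_deriv b g x)"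
proof -
  obtain f' g' where f': "(f has_derivative f') (at x)" and g': "(g has_derivative g') (at x)"
    using assms by (auto simp: differentiable_def)
  show ?thesis
    using dir_deriv_eq[OF bounded_bilinear.FDERIV[OF assms(1) f' g']] dir_deriv_eq[OF f'] dir_deriv_eq[OF g']
    by (simp add: add.commute)
qed

lemma differentiable_linear:
  assumes "bounded_linear T" "f differentiable (at x)"
  shows "(\<lambda>x. T (f x)) differentiable (at x)"
  using assms bounded_linear.has_derivative unfolding differentiable_def by blast

lemma differentiable_bilinear:
  assumes "bounded_bilinear p" "f differentiable (at x)" "g differentiable (at x)"
  shows "(\<lambda>x. p (f x) (g x)) differentiable (at x)"
  using assms bounded_bilinear.FDERIV unfolding differentiable_def by blast

lemma Ck_add:
  assumes "open S" "Ck n S f" "Ck n S g"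
  shows "Ck n S (\<lambda>x. f x + g x)"
  using assms(2,3)
proof (induction n arbitrary: f g)
  case (Suc n)
  have "Ck n S (dir_deriv b (\<lambda>x. f x + g x))" if "b \<in> Basis" for b
    by (rule Ck_cong[OF assms(1) _ Suc.IH[of "dir_deriv b f" "dir_deriv b g"]])
      (use Suc.prems that in \<open>auto simp: dir_deriv_add\<close>)
  then show ?case using Suc.prems by auto
qed auto

lemma Ck_linear:
  assumes "open S" "bounded_linear T" "Ck n S f"
  shows "Ck n S (\<lambda>x. T (f x))"
  using assms(3)
proof (induction n arbitrary: f)
  case (Suc n)
  have "Ck n S (dir_deriv b (\<lambda>x. T (f x)))" if "b \<in> Basis" for b
    by (rule Ck_cong[OF assms(1) _ Suc.IH[of "dir_deriv b f"]])
      (use Suc.prems that in \<open>auto simp: dir_deriv_linear[OF assms(2)]\<close>)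
  then show ?case using Suc.prems by (auto intro: differentiable_linear[OF assms(2)])
qed (auto intro: differentiable_linear[OF assms(2)])

lemma Ck_bilinear:
  assumes "open S" "bounded_bilinear p" "Ck n S f" "Ck n S g"
  shows "Ck n S (\<lambda>x. p (f x) (g x))"
  using assms(3,4)
proof (induction n arbitrary: f g)
  case (Suc n)
  have "Ck n S (dir_deriv b (\<lambda>x. p (f x) (g x)))" if "b \<in> Basis" for b
    by (rule Ck_cong[OF assms(1) _ Ck_add[OF assms(1) Suc.IH[of "dir_deriv b f" g] Suc.IH[of f "dir_deriv b g"]]])
      (use Suc.prems that in \<open>auto simp: dir_deriv_bilinear[OF assms(2)] intro: Ck_Suc\<close>)
  then show ?case using Suc.prems by (auto intro: differentiable_bilinear[OF assms(2)])
qed (auto intro: differentiable_bilinear[OF assms(2)])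

lemma C_infinity_on_const: "C_infinity_on S (\<lambda>x. c)"
  unfolding C_infinity_on_iff_Ck using Ck_const by blast

lemma C_infinity_on_add:
  "open S \<Longrightarrow> C_infinity_on S f \<Longrightarrow> C_infinity_on S g \<Longrightarrow> C_infinity_on S (\<lambda>x. f x + g x)"
  unfolding C_infinity_on_iff_Ck using Ck_add by blast

lemma C_infinity_on_linear:
  "open S \<Longrightarrow> bounded_linear T \<Longrightarrow> C_infinity_on S f \<Longrightarrow> C_infinity_on S (\<lambda>x. T (f x))"
  unfolding C_infinity_on_iff_Ck using Ck_linear by blast

lemma C_infinity_on_bilinear:
  "open S \<Longrightarrow> bounded_bilinear p \<Longrightarrow> C_infinity_on S f \<Longrightarrow> C_infinity_on S g
    \<Longrightarrow> C_infinity_on S (\<lambda>x. p (f x) (g x))"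
  unfolding C_infinity_on_iff_Ck using Ck_bilinear by blast

lemma C_infinity_on_minus:
  assumes "open S" "C_infinity_on S f" "C_infinity_on S g"
  shows "C_infinity_on S (\<lambda>x. f x - g x)"
  using C_infinity_on_add[OF assms(1,2) C_infinity_on_linear[OF assms(1) bounded_linear_minus[OF bounded_linear_ident] assms(3)]]
  by simp

lemma C_infinity_on_bounded_linear:
  fixes T :: "'a::euclidean_space \<Rightarrow> 'b::real_normed_vector"
  assumes "bounded_linear T"
  shows "C_infinity_on S T"
proof -
  have "dir_deriv b T = (\<lambda>x. T b)" for b
    using dir_deriv_eq[OF bounded_linear_imp_has_derivative[OF assms]] by auto
  then have "Ck n S T" for n
    using bounded_linear_imp_differentiable[OF assms] by (cases n) (auto simp: Ck_const)
  then show ?thesis by (simp add: C_infinity_on_iff_Ck)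
qed

lemma partials_add:
  assumes "open S" "C_infinity_on S f" "C_infinity_on S g" "x \<in> S" "set vs \<subseteq> Basis"
  shows "partials vs (\<lambda>x. f x + g x) x = partials vs f x + partials vs g x"
  using assms(4,5)
proof (induction vs arbitrary: x)
  case (Cons v vs)
  have "dir_deriv v (partials vs (\<lambda>x. f x + g x)) x = dir_deriv v (\<lambda>x. partials vs f x + partials vs g x) x"
    by (rule dir_deriv_cong[OF assms(1)]) (use Cons in auto)
  also have "\<dots> = dir_deriv v (partials vs f) x + dir_deriv v (partials vs g) x"
    by (rule dir_deriv_add) (use Cons.prems assms(1-3) in \<open>auto intro!: C_infinity_on_differentiable[OF C_infinity_on_partials]\<close>)
  finally show ?case by simp
qed auto

lemma partials_linear:
  assumes "open S" "bounded_linear T" "C_infinity_on S f" "x \<in> S" "set vs \<subseteq> Basis"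
  shows "partials vs (\<lambda>x. T (f x)) x = T (partials vs f x)"
  using assms(4,5)
proof (induction vs arbitrary: x)
  case (Cons v vs)
  have "dir_deriv v (partials vs (\<lambda>x. T (f x))) x = dir_deriv v (\<lambda>x. T (partials vs f x)) x"
    by (rule dir_deriv_cong[OF assms(1)]) (use Cons in auto)
  also have "\<dots> = T (dir_deriv v (partials vs f) x)"
    by (rule dir_deriv_linear[OF assms(2)]) (use Cons.prems assms(1-3) in \<open>auto intro!: C_infinity_on_differentiable[OF C_infinity_on_partials]\<close>)
  finally show ?case by simp
qed auto

lemma partials_minus:
  assumes "open S" "C_infinity_on S f" "C_infinity_on S g" "x \<in> S" "set vs \<subseteq> Basis"
  shows "partials vs (\<lambda>x. f x - g x) x = partials vs f x - partials vs g x"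
  using partials_add[OF assms(1,2) C_infinity_on_linear[OF assms(1) bounded_linear_minus[OF bounded_linear_ident] assms(3)] assms(4,5)]
    partials_linear[OF assms(1) bounded_linear_minus[OF bounded_linear_ident] assms(3-5)]
  by simp

section \<open>Jet norms\<close>

text \<open>
  The jet norm is submultiplicative for every \<open>h\<close>. Since \<open>h\<close> may be chosen small after the order \<open>k\<close>,
  the Picard map contracts all jet norms on one and the same interval.
\<close>
primrec jet :: "nat \<Rightarrow> real \<Rightarrow> ('a::euclidean_space \<Rightarrow> 'b::real_normed_vector) \<Rightarrow> 'a \<Rightarrow> real" where
  "jet 0 h f x = norm (f x)"
| "jet (Suc k) h f x = jet k h f x + h * (\<Sum>b\<in>Basis. jet k h (dir_deriv b f) x)"

lemma jet_nonneg: "0 \<le> h \<Longrightarrow> 0 \<le> jet k h f x"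
  by (induction k arbitrary: f) (auto intro!: add_nonneg_nonneg mult_nonneg_nonneg sum_nonneg)

lemma jet_cong:
  assumes "open S" "x \<in> S" "\<And>y. y \<in> S \<Longrightarrow> f y = g y"
  shows "jet k h f x = jet k h g x"
  using assms(2,3)
proof (induction k arbitrary: f g x)
  case (Suc k)
  have "jet k h (dir_deriv b f) x = jet k h (dir_deriv b g) x" for b
    by (rule Suc.IH) (use Suc.prems in \<open>auto intro: dir_deriv_cong[OF assms(1)]\<close>)
  then show ?case using Suc.IH[OF Suc.prems] by simp
qed auto

lemma jet_const: "jet k h (\<lambda>x. c) x = norm c"
proof -
  have z: "jet k h (\<lambda>x. 0::'b) x = 0" for k
    by (induction k) auto
  show ?thesis by (induction k) (auto simp: z)
qed

lemma jet_add:
  assumes "open S" "0 \<le> h" "x \<in> S" "C_infinity_on S f" "C_infinity_on S g"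
  shows "jet k h (\<lambda>x. f x + g x) x \<le> jet k h f x + jet k h g x"
  using assms(4,5)
proof (induction k arbitrary: f g)
  case (Suc k)
  have "jet k h (dir_deriv b (\<lambda>x. f x + g x)) x \<le> jet k h (dir_deriv b f) x + jet k h (dir_deriv b g) x"
    if b: "b \<in> Basis" for b
  proof -
    have "jet k h (dir_deriv b (\<lambda>x. f x + g x)) x = jet k h (\<lambda>x. dir_deriv b f x + dir_deriv b g x) x"
      by (rule jet_cong[OF assms(1,3)]) (use Suc.prems in \<open>auto intro!: C_infinity_on_differentiable dir_deriv_add\<close>)
    then show ?thesis using Suc.IH[of "dir_deriv b f" "dir_deriv b g"] Suc.prems b C_infinity_on_dir_deriv by metis
  qed
  then have "(\<Sum>b\<in>Basis. jet k h (dir_deriv b (\<lambda>x. f x + g x)) x)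
      \<le> (\<Sum>b\<in>Basis. jet k h (dir_deriv b f) x) + (\<Sum>b\<in>Basis. jet k h (dir_deriv b g) x)"
    unfolding sum.distrib[symmetric] by (rule sum_mono)
  from mult_left_mono[OF this assms(2)] show ?case
    using Suc.IH[OF Suc.prems] by (simp add: algebra_simps)
qed (auto intro: norm_triangle_ineq)

lemma jet_linear:
  assumes "open S" "0 \<le> h" "x \<in> S" "bounded_linear T" "\<And>y. norm (T y) \<le> w * norm y" "C_infinity_on S f"
  shows "jet k h (\<lambda>x. T (f x)) x \<le> w * jet k h f x"
  using assms(6)
proof (induction k arbitrary: f)
  case (Suc k)
  have "jet k h (dir_deriv b (\<lambda>x. T (f x))) x \<le> w * jet k h (dir_deriv b f) x"
    if b: "b \<in> Basis" for b
  proof -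
    have "jet k h (dir_deriv b (\<lambda>x. T (f x))) x = jet k h (\<lambda>x. T (dir_deriv b f x)) x"
      by (rule jet_cong[OF assms(1,3)]) (use Suc.prems in \<open>auto intro!: C_infinity_on_differentiable dir_deriv_linear[OF assms(4)]\<close>)
    then show ?thesis using Suc.IH[of "dir_deriv b f"] Suc.prems b C_infinity_on_dir_deriv by metis
  qed
  then have "(\<Sum>b\<in>Basis. jet k h (dir_deriv b (\<lambda>x. T (f x))) x) \<le> w * (\<Sum>b\<in>Basis. jet k h (dir_deriv b f) x)"
    unfolding sum_distrib_left by (rule sum_mono)
  from mult_left_mono[OF this assms(2)] show ?case
    using Suc.IH[OF Suc.prems] by (simp add: algebra_simps)
qed (use assms in auto)

lemma jet_minus_le:
  assumes "open S" "0 \<le> h" "x \<in> S" "C_infinity_on S f" "C_infinity_on S g"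
  shows "jet k h (\<lambda>x. f x - g x) x \<le> jet k h f x + jet k h g x"
proof -
  have u: "bounded_linear (\<lambda>y::'b. - y)" by (rule bounded_linear_minus[OF bounded_linear_ident])
  show ?thesis
    using jet_add[OF assms(1-4) C_infinity_on_linear[OF assms(1) u assms(5)], of k]
      jet_linear[OF assms(1-3) u _ assms(5), of 1 k] by simp
qed

text \<open>Leibniz's rule without binomial constants: with D for the sum of the jets of the first
  derivatives, the terms of first order in \<open>h\<close> in (Jf + h Df)(Jg + h Dg) majorise the
  product rule, and the h^2 term is to spare.\<close>

lemma jet_bilinear:
  assumes "open S" "0 \<le> h" "x \<in> S" "bounded_bilinear p" "\<And>y z. norm (p y z) \<le> norm y * norm z"
    "C_infinity_on S f" "C_infinity_on S g"
  shows "jet k h (\<lambda>x. p (f x) (g x)) x \<le> jet k h f x * jet k h g x"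
  using assms(6,7)
proof (induction k arbitrary: f g)
  case (Suc k)
  let ?J = "\<lambda>f. jet k h f x"
  have "?J (dir_deriv b (\<lambda>x. p (f x) (g x))) \<le> ?J (dir_deriv b f) * ?J g + ?J f * ?J (dir_deriv b g)"
    if b: "b \<in> Basis" for b
  proof -
    note d = C_infinity_on_dir_deriv[OF Suc.prems(1) b] C_infinity_on_dir_deriv[OF Suc.prems(2) b]
    have "?J (dir_deriv b (\<lambda>x. p (f x) (g x))) = ?J (\<lambda>x. p (dir_deriv b f x) (g x) + p (f x) (dir_deriv b g x))"
      by (rule jet_cong[OF assms(1,3)]) (use Suc.prems in \<open>auto intro!: C_infinity_on_differentiable dir_deriv_bilinear[OF assms(4)]\<close>)
    also have "\<dots> \<le> ?J (\<lambda>x. p (dir_deriv b f x) (g x)) + ?J (\<lambda>x. p (f x) (dir_deriv b g x))"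
      by (intro jet_add[OF assms(1-3)] C_infinity_on_bilinear[OF assms(1,4)] d Suc.prems)
    finally show ?thesis using Suc.IH[OF d(1) Suc.prems(2)] Suc.IH[OF Suc.prems(1) d(2)] by linarith
  qed
  then have "(\<Sum>b\<in>Basis. ?J (dir_deriv b (\<lambda>x. p (f x) (g x))))
    \<le> (\<Sum>b\<in>Basis. ?J (dir_deriv b f)) * ?J g + ?J f * (\<Sum>b\<in>Basis. ?J (dir_deriv b g))"
    unfolding sum_distrib_left sum_distrib_right sum.distrib[symmetric] by (rule sum_mono)
  from mult_left_mono[OF this assms(2)]
  have "?J (\<lambda>x. p (f x) (g x)) + h * (\<Sum>b\<in>Basis. ?J (dir_deriv b (\<lambda>x. p (f x) (g x))))
    \<le> ?J f * ?J g + h * ((\<Sum>b\<in>Basis. ?J (dir_deriv b f)) * ?J g + ?J f * (\<Sum>b\<in>Basis. ?J (dir_deriv b g)))"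
    using Suc.IH[OF Suc.prems] by linarith
  also have "\<dots> \<le> (?J f + h * (\<Sum>b\<in>Basis. ?J (dir_deriv b f))) * (?J g + h * (\<Sum>b\<in>Basis. ?J (dir_deriv b g)))"
  proof -
    have "0 \<le> (h * (\<Sum>b\<in>Basis. ?J (dir_deriv b f))) * (h * (\<Sum>b\<in>Basis. ?J (dir_deriv b g)))"
      using assms(2) by (intro mult_nonneg_nonneg sum_nonneg jet_nonneg)
    then show ?thesis by (simp add: algebra_simps)
  qed
  finally show ?case by simp
qed (use assms in auto)

text \<open>Each differentiation enters the jet with one factor \<open>h\<close>, so recovering a
  derivative costs 1/h per direction.\<close>

lemma norm_partials_le_jet:
  assumes "0 < h" "set vs \<subseteq> Basis" "length vs \<le> k"
  shows "norm (partials vs f x) \<le> jet k h f x / h ^ length vs"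
  using assms(2,3)
proof (induction k arbitrary: f vs)
  case (Suc k)
  show ?case
  proof (cases vs rule: rev_cases)
    case Nil
    have "norm (partials [] f x) \<le> jet k h f x" using Suc.IH[of "[]" f] by simp
    moreover have "0 \<le> h * (\<Sum>b\<in>Basis. jet k h (dir_deriv b f) x)"
      using assms by (intro mult_nonneg_nonneg sum_nonneg jet_nonneg) auto
    ultimately show ?thesis using Nil by simp
  next
    case (snoc ws b)
    have b: "b \<in> Basis" using snoc Suc.prems by auto
    have "jet k h (dir_deriv b f) x \<le> (\<Sum>b\<in>Basis. jet k h (dir_deriv b f) x)"
      using assms b by (intro member_le_sum) (auto intro: jet_nonneg)
    then have "h * jet k h (dir_deriv b f) x \<le> jet (Suc k) h f x"
      using assms(1) jet_nonneg[of h k f x] by (simp add: add_increasing)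
    then have 1: "jet k h (dir_deriv b f) x \<le> jet (Suc k) h f x / h"
      using assms(1) by (simp add: field_simps)
    have "norm (partials ws (dir_deriv b f) x) \<le> jet k h (dir_deriv b f) x / h ^ length ws"
      by (rule Suc.IH) (use snoc Suc.prems in auto)
    also have "\<dots> \<le> (jet (Suc k) h f x / h) / h ^ length ws"
      by (rule divide_right_mono[OF 1]) (use assms in auto)
    finally show ?thesis using snoc by (simp add: partials_append)
  qed
qed auto

text \<open>Derivatives of order two and more vanish, so the excess over the norm is linear in
  \<open>h\<close>. For small \<open>h\<close> a parameter coordinate therefore has jet norm at most
  its modulus plus 1, at every order.\<close>

lemma jet_bounded_linear_le:
  fixes T :: "'a::euclidean_space \<Rightarrow> 'b::real_normed_vector"
  assumes "bounded_linear T" "0 \<le> h" "\<And>b. b \<in> Basis \<Longrightarrow> norm (T b) \<le> 1"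
  shows "jet k h T x \<le> norm (T x) + real k * h * real DIM('a)"
proof (induction k)
  case (Suc k)
  have d: "dir_deriv b T = (\<lambda>x. T b)" for b
    using dir_deriv_eq[OF bounded_linear_imp_has_derivative[OF assms(1)]] by auto
  have "(\<Sum>b\<in>Basis. jet k h (dir_deriv b T) x) \<le> of_nat (card (Basis :: 'a set)) * 1"
    by (rule sum_bounded_above) (use assms in \<open>auto simp: d jet_const\<close>)
  from mult_left_mono[OF this assms(2)] show ?case using Suc by (simp add: algebra_simps)
qed auto

section \<open>Limits of smooth maps under geometric decay of jets\<close>

text \<open>Geometric decay of the jets makes every iterated partial derivative converge uniformly,
  so on a convex set the limit may be taken under one derivative at a time. The limits are first
  collected in a family indexed by lists of directions and only then identified with the derivatives
  of its member at the empty list. Both \<open>h\<close> and \<open>C\<close> may depend on the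
  order.\<close>

lemma C_infinity_on_limit:
  fixes f :: "nat \<Rightarrow> 'a::euclidean_space \<Rightarrow> 'b::banach"
  assumes S: "open S" "convex S"
    and sm: "\<And>m. C_infinity_on S (f m)"
    and jb: "\<And>k. \<exists>h>0. \<exists>C. \<forall>m. \<forall>x\<in>S. jet k h (\<lambda>x. f (Suc m) x - f m x) x \<le> C * (1/2) ^ m"
  shows "\<exists>g. C_infinity_on S g \<and>
    (\<forall>vs x. set vs \<subseteq> Basis \<longrightarrow> x \<in> S \<longrightarrow> (\<lambda>m. partials vs (f m) x) \<longlonglongrightarrow> partials vs g x)"
proof -
  have unif: "\<exists>C. \<forall>m. \<forall>x\<in>S. norm (partials vs (f (Suc m)) x - partials vs (f m) x) \<le> C * (1/2) ^ m"
    if vs: "set vs \<subseteq> Basis" for vs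
  proof -
    obtain h C where h: "h > 0" "\<And>m x. x \<in> S \<Longrightarrow> jet (length vs) h (\<lambda>x. f (Suc m) x - f m x) x \<le> C * (1/2) ^ m"
      using jb[of "length vs"] by blast
    have "norm (partials vs (f (Suc m)) x - partials vs (f m) x) \<le> C / h ^ length vs * (1/2) ^ m" if x: "x \<in> S" for m x
    proof -
      have "norm (partials vs (\<lambda>x. f (Suc m) x - f m x) x) \<le> jet (length vs) h (\<lambda>x. f (Suc m) x - f m x) x / h ^ length vs"
        by (rule norm_partials_le_jet) (use h vs in auto)
      also have "\<dots> \<le> (C * (1/2) ^ m) / h ^ length vs"
        by (rule divide_right_mono) (use h x in auto)
      finally show ?thesis using partials_minus[OF S(1) sm sm x vs, of "Suc m" m] by simp
    qed
    then show ?thesis by blast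
  qed
  have tail: "norm (a (m + j) - a m) \<le> 2 * C * (1/2) ^ m" if a: "\<And>m. norm (a (Suc m) - a m) \<le> C * (1/2) ^ m"
    for a :: "nat \<Rightarrow> 'b" and C m j
  proof -
    \<comment> \<open>The exact remainder of the geometric series is kept because the cruder bound
      is not inductive in \<open>j\<close>.\<close>
    have "norm (a (m + j) - a m) \<le> 2 * C * ((1/2) ^ m - (1/2) ^ (m + j))"
    proof (induction j)
      case (Suc j)
      have "norm (a (m + Suc j) - a m) \<le> norm (a (Suc (m + j)) - a (m + j)) + norm (a (m + j) - a m)"
        using norm_triangle_ineq[of "a (Suc (m + j)) - a (m + j)" "a (m + j) - a m"] by simp
      with Suc a[of "m + j"] show ?case by (simp add: algebra_simps power_add)
    qed simp
    also have "\<dots> \<le> 2 * C * (1/2) ^ m"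
    proof -
      have "0 \<le> C" using order_trans[OF norm_ge_zero a[of 0]] by simp
      then show ?thesis by (simp add: algebra_simps)
    qed
    finally show ?thesis .
  qed
  have conv: "convergent a" if a: "\<And>m. norm (a (Suc m) - a m) \<le> C * (1/2) ^ m" for a :: "nat \<Rightarrow> 'b" and C
  proof -
    have "Cauchy a"
    proof (rule CauchyI')
      fix e :: real assume e: "e > 0"
      have "(\<lambda>m. 2 * C * (1/2) ^ m) \<longlonglongrightarrow> 2 * C * 0"
        by (intro tendsto_intros LIMSEQ_realpow_zero) auto
      then have "\<forall>\<^sub>F m in sequentially. 2 * C * (1/2) ^ m < e" using e by (intro order_tendstoD) auto
      then obtain M where M: "\<And>m. m \<ge> M \<Longrightarrow> 2 * C * (1/2) ^ m < e" by (auto simp: eventually_sequentially)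
      show "\<exists>M. \<forall>m\<ge>M. \<forall>n>m. dist (a m) (a n) < e"
      proof (intro exI[of _ M] allI impI)
        fix m n assume "m \<ge> M" "n > m"
        then show "dist (a m) (a n) < e"
          using tail[OF a, of m "n - m"] M[of m] by (simp add: dist_norm norm_minus_commute)
      qed
    qed
    then show ?thesis by (simp add: Cauchy_convergent_iff)
  qed
  define g where "g vs x = lim (\<lambda>m. partials vs (f m) x)" for vs x
  have lim: "(\<lambda>m. partials vs (f m) x) \<longlonglongrightarrow> g vs x" if "set vs \<subseteq> Basis" "x \<in> S" for vs x
    using conv[of "\<lambda>m. partials vs (f m) x"] unif[OF that(1)] that(2) unfolding g_def convergent_LIMSEQ_iff by blast
  have close: "\<exists>C\<ge>0. \<forall>m. \<forall>x\<in>S. norm (partials vs (f m) x - g vs x) \<le> C * (1/2) ^ m" if vs: "set vs \<subseteq> Basis" for vs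
  proof -
    obtain C where C: "\<And>m x. x \<in> S \<Longrightarrow> norm (partials vs (f (Suc m)) x - partials vs (f m) x) \<le> C * (1/2) ^ m"
      using unif[OF vs] by blast
    have "norm (partials vs (f m) x - g vs x) \<le> 2 * max C 0 * (1/2) ^ m" if x: "x \<in> S" for m x
    proof -
      have "(\<lambda>j. norm (partials vs (f (m + j)) x - partials vs (f m) x)) \<longlonglongrightarrow> norm (g vs x - partials vs (f m) x)"
        using LIMSEQ_ignore_initial_segment[OF lim[OF vs x], of m] by (intro tendsto_intros) (simp add: add.commute)
      then have "norm (g vs x - partials vs (f m) x) \<le> 2 * C * (1/2) ^ m"
        by (rule LIMSEQ_le_const2) (use tail[of "\<lambda>m. partials vs (f m) x"] C[OF x] in blast)
      also have "\<dots> \<le> 2 * max C 0 * (1/2) ^ m" by (intro mult_right_mono) auto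
      finally show ?thesis by (simp add: norm_minus_commute)
    qed
    then show ?thesis by (intro exI[of _ "2 * max C 0"]) auto
  qed
  have der: "(g vs has_derivative (\<lambda>h. \<Sum>b\<in>Basis. (h \<bullet> b) *\<^sub>R g (b # vs) x)) (at x)"
    if vs: "set vs \<subseteq> Basis" and x: "x \<in> S" for vs x
  proof -
    let ?f' = "\<lambda>m x h. \<Sum>b\<in>Basis. (h \<bullet> b) *\<^sub>R partials (b # vs) (f m) x"
    let ?g' = "\<lambda>x h. \<Sum>b\<in>Basis. (h \<bullet> b) *\<^sub>R g (b # vs) x"
    have "\<exists>C\<ge>0. \<forall>m. \<forall>x\<in>S. norm (partials (b # vs) (f m) x - g (b # vs) x) \<le> C * (1/2) ^ m" if "b \<in> Basis" for b
      using close[of "b # vs"] vs that by auto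
    then obtain C where C: "\<And>b. b \<in> Basis \<Longrightarrow> C b \<ge> 0"
      "\<And>b m x. b \<in> Basis \<Longrightarrow> x \<in> S \<Longrightarrow> norm (partials (b # vs) (f m) x - g (b # vs) x) \<le> C b * (1/2) ^ m"
      by metis
    have bd: "norm (?f' m x h - ?g' x h) \<le> (\<Sum>b\<in>Basis. C b) * (1/2) ^ m * norm h" if x: "x \<in> S" for m x h
    proof -
      have "norm (?f' m x h - ?g' x h) = norm (\<Sum>b\<in>Basis. (h \<bullet> b) *\<^sub>R (partials (b # vs) (f m) x - g (b # vs) x))"
        by (simp add: sum_subtractf[symmetric] scaleR_diff_right)
      also have "\<dots> \<le> (\<Sum>b\<in>Basis. norm h * (C b * (1/2) ^ m))"
        by (rule sum_norm_le) (use C x Basis_le_norm in \<open>auto intro!: mult_mono\<close>)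
      also have "\<dots> = (\<Sum>b\<in>Basis. C b) * (1/2) ^ m * norm h"
        by (simp add: sum_distrib_left sum_distrib_right mult_ac)
      finally show ?thesis .
    qed
    have "\<exists>G. \<forall>x\<in>S. (\<lambda>n. partials vs (f n) x) \<longlonglongrightarrow> G x \<and> (G has_derivative ?g' x) (at x within S)"
    proof (rule has_derivative_sequence[OF S(2), where f'="?f'"])
      show "(partials vs (f m) has_derivative ?f' m x) (at x within S)" if "x \<in> S" for m x
        using has_derivative_at_withinI[OF has_derivative_dir_deriv[OF
            C_infinity_on_differentiable[OF C_infinity_on_partials[OF sm[of m] vs] that]], of S] by simp
      show "\<forall>\<^sub>F n in sequentially. \<forall>x\<in>S. \<forall>h. norm (?f' n x h - ?g' x h) \<le> e * norm h" if e: "e > 0" for e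
      proof -
        have "(\<lambda>m. (\<Sum>b\<in>Basis. C b) * (1/2) ^ m) \<longlonglongrightarrow> (\<Sum>b\<in>Basis. C b) * 0"
          by (intro tendsto_intros LIMSEQ_realpow_zero) auto
        then have "\<forall>\<^sub>F m in sequentially. (\<Sum>b\<in>Basis. C b) * (1/2) ^ m < e" using e by (intro order_tendstoD) auto
        then show ?thesis
        proof eventually_elim
          case (elim n)
          show ?case
          proof (intro ballI allI)
            fix x h assume "x \<in> S"
            from bd[OF this, where m=n and h=h] show "norm (?f' n x h - ?g' x h) \<le> e * norm h"
              by (rule order_trans) (use elim in \<open>auto intro!: mult_right_mono\<close>)
          qed
        qed
      qed
      show "x \<in> S" by fact
      show "(\<lambda>n. partials vs (f n) x) \<longlonglongrightarrow> g vs x" by (rule lim[OF vs x])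
    qed
    then obtain G where G: "\<And>x. x \<in> S \<Longrightarrow> (\<lambda>n. partials vs (f n) x) \<longlonglongrightarrow> G x"
      "\<And>x. x \<in> S \<Longrightarrow> (G has_derivative ?g' x) (at x within S)" by blast
    have eq: "G y = g vs y" if "y \<in> S" for y using LIMSEQ_unique[OF G(1)[OF that] lim[OF vs that]] .
    have "(G has_derivative ?g' x) (at x)" using G(2)[OF x] unfolding at_within_open[OF x S(1)] .
    then show ?thesis by (rule has_derivative_transform_within_open[OF _ S(1) x]) (rule eq)
  qed
  have part: "partials vs (g []) x = g vs x" if "set vs \<subseteq> Basis" "x \<in> S" for vs x
    using that
  proof (induction vs arbitrary: x)
    case (Cons v vs)
    have "dir_deriv v (partials vs (g [])) x = dir_deriv v (g vs) x"
      by (rule dir_deriv_cong[OF S(1)]) (use Cons in auto)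
    also have "\<dots> = (\<Sum>b\<in>Basis. (v \<bullet> b) *\<^sub>R g (b # vs) x)"
      by (rule dir_deriv_eq[OF der]) (use Cons in auto)
    also have "\<dots> = (\<Sum>b\<in>Basis. if b = v then g (b # vs) x else 0)"
      by (rule sum.cong) (use Cons in \<open>auto simp: inner_Basis\<close>)
    also have "\<dots> = g (v # vs) x" using Cons by (simp add: sum.delta)
    finally show ?case by simp
  qed simp
  have "C_infinity_on S (g [])"
    unfolding C_infinity_on_def
  proof (intro allI impI ballI)
    fix vs :: "'a list" and x assume vs: "set vs \<subseteq> Basis" and x: "x \<in> S"
    have "g vs differentiable (at x)" by (rule differentiableI[OF der[OF vs x]])
    then show "partials vs (g []) differentiable (at x)"
      using differentiable_cong_open[of S x "g vs" "partials vs (g [])"] S(1) x part[OF vs] by simp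
  qed
  moreover have "(\<lambda>m. partials vs (f m) x) \<longlonglongrightarrow> partials vs (g []) x" if "set vs \<subseteq> Basis" "x \<in> S" for vs x
    using lim[OF that] unfolding part[OF that] .
  ultimately show ?thesis by (intro exI[of _ "g []"]) simp
qed

section \<open>The Banach algebra of bounded continuous functions\<close>

instance bcontfun :: (metric_space, banach) banach ..

lemma apply_Bcontfun:
  fixes f :: "'a::topological_space \<Rightarrow> 'b::real_normed_vector"
  assumes "continuous_on UNIV f" "\<And>x. norm (f x) \<le> b"
  shows "apply_bcontfun (Bcontfun f) = f"
  using bcontfun_normI[OF assms] by (rule Bcontfun_inverse)

text \<open>A parameter-dependent profile is treated as a map from the parameter into this algebra.
  Jets then see only the parameter, uniformity in \<rho> is part of the norm, and the quadratic
  terms of the system are products with a submultiplicative norm.\<close>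

instantiation bcontfun :: (topological_space, real_normed_algebra) real_normed_algebra
begin

definition times_bcontfun :: "('a, 'b) bcontfun \<Rightarrow> ('a, 'b) bcontfun \<Rightarrow> ('a, 'b) bcontfun"
  where "times_bcontfun f g = Bcontfun (\<lambda>x. f x * g x)"

lemma norm_apply_times_le:
  fixes f g :: "('a, 'b) bcontfun"
  shows "norm (f x * g x) \<le> norm f * norm g"
  by (rule order_trans[OF norm_mult_ineq]) (intro mult_mono norm_bounded norm_ge_zero)

lemma apply_times: "apply_bcontfun (f * g) = (\<lambda>x. f x * g x)" for f g :: "('a, 'b) bcontfun"
  unfolding times_bcontfun_def
  by (rule apply_Bcontfun[of _ "norm f * norm g"]) (auto intro!: continuous_intros norm_apply_times_le)

instance
proof
  fix f g k :: "('a, 'b) bcontfun" and a :: real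
  show "norm (f * g) \<le> norm f * norm g"
    by (rule norm_bound) (simp add: apply_times norm_apply_times_le)
qed (auto intro!: bcontfun_eqI simp: apply_times algebra_simps)

end

lemma apply_bcontfun_times [simp]: "apply_bcontfun (f * g) x = f x * g x"
  for f g :: "('a::topological_space, 'b::real_normed_algebra) bcontfun"
  by (simp add: apply_times)

lemma bounded_linear_apply_bcontfun: "bounded_linear (\<lambda>f. apply_bcontfun f x)"
  for x :: "'a::topological_space"
  by (rule bounded_linear_intro[of _ 1]) (auto simp: norm_bounded)

lemma norm_const_bcontfun [simp]: "norm (const_bcontfun c :: ('a::topological_space, 'b::real_normed_vector) bcontfun) = norm c"
proof (rule antisym)
  show "norm (const_bcontfun c :: ('a, 'b) bcontfun) \<le> norm c" by (rule norm_bound) simp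
  show "norm c \<le> norm (const_bcontfun c :: ('a, 'b) bcontfun)"
    using norm_bounded[of "const_bcontfun c :: ('a, 'b) bcontfun" undefined] by simp
qed

lemma bounded_linear_const_bcontfun: "bounded_linear (const_bcontfun :: 'b::real_normed_vector \<Rightarrow> ('a::topological_space, 'b) bcontfun)"
  by (rule bounded_linear_intro[of _ 1]) (auto intro!: bcontfun_eqI)

section \<open>Volterra and averaging operators\<close>

text \<open>Clamping the upper limit at \<open>d\<close> keeps the primitive bounded on the whole line.\<close>
definition vint :: "(real \<Rightarrow> real) \<Rightarrow> real \<Rightarrow> (real \<Rightarrow>\<^sub>C real) \<Rightarrow> (real \<Rightarrow>\<^sub>C real)"
  where "vint a d f = Bcontfun (\<lambda>t. integral {0..max 0 (min d t)} (\<lambda>r. a r * f r))"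

text \<open>In the variable s = t^2, \<open>avg 1\<close> is the mean of \<open>f\<close> over
  [0, s], and \<open>avg 3\<close> is s^(-2) times the integral of \<sigma> \<open>f\<close>
  d\<sigma> over [0, s]. Scaling the domain to [0, 1] removes the division by t, so the result is
  continuous at t = 0 as well.\<close>

definition avg :: "nat \<Rightarrow> (real \<Rightarrow>\<^sub>C real) \<Rightarrow> (real \<Rightarrow>\<^sub>C real)"
  where "avg j f = Bcontfun (\<lambda>t. integral {0..1} (\<lambda>\<tau>. 2 * \<tau> ^ j * f (\<tau> * t)))"

locale weight =
  fixes a :: "real \<Rightarrow> real" and d :: real
  assumes d_pos: "0 < d" and cont: "continuous_on {0..d} a" and bd: "\<And>r. r \<in> {0..d} \<Longrightarrow> \<bar>a r\<bar> \<le> 1"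
begin

lemma integrable: "t \<le> d \<Longrightarrow> (\<lambda>r. a r * apply_bcontfun f r) integrable_on {0..t}"
  by (intro integrable_continuous_real continuous_intros continuous_on_subset[OF cont]) auto

lemma integral_le:
  assumes "0 \<le> t" "t \<le> d"
  shows "norm (integral {0..t} (\<lambda>r. a r * apply_bcontfun f r)) \<le> d * norm f"
proof -
  have "norm (integral {0..t} (\<lambda>r. a r * apply_bcontfun f r)) \<le> norm f * (t - 0)"
  proof (rule integral_bound)
    show "continuous_on {0..t} (\<lambda>r. a r * apply_bcontfun f r)"
      using assms by (intro continuous_intros continuous_on_subset[OF cont]) auto
    fix r assume "r \<in> {0..t}"
    then have "\<bar>a r\<bar> \<le> 1" using bd assms by auto
    then show "norm (a r * apply_bcontfun f r) \<le> norm f"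
      using mult_mono[of "\<bar>a r\<bar>" 1 "norm (f r)" "norm f"] norm_bounded[of f r] by (simp add: abs_mult)
  qed (use assms in auto)
  also have "\<dots> \<le> d * norm f" using assms by (simp add: mult.commute mult_right_mono)
  finally show ?thesis .
qed

lemma apply_vint: "apply_bcontfun (vint a d f) = (\<lambda>t. integral {0..max 0 (min d t)} (\<lambda>r. a r * f r))"
  unfolding vint_def
proof (rule apply_Bcontfun)
  have "continuous_on {0..d} (\<lambda>t. integral {0..t} (\<lambda>r. a r * f r))"
    by (rule indefinite_integral_continuous_1) (rule integrable, simp)
  then show "continuous_on UNIV (\<lambda>t. integral {0..max 0 (min d t)} (\<lambda>r. a r * f r))"
    by (rule continuous_on_compose2) (use d_pos in \<open>auto intro!: continuous_intros\<close>)
  show "norm (integral {0..max 0 (min d t)} (\<lambda>r. a r * f r)) \<le> d * norm f" for t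
    by (rule integral_le) (use d_pos in auto)
qed

lemma norm_vint_le: "norm (vint a d f) \<le> d * norm f"
  by (rule norm_bound) (use d_pos in \<open>auto simp: apply_vint intro!: integral_le[unfolded real_norm_def]\<close>)

lemma bounded_linear_vint: "bounded_linear (vint a d)"
proof (rule bounded_linear_intro[of _ d])
  show "vint a d (f + g) = vint a d f + vint a d g" for f g
    by (rule bcontfun_eqI) (use d_pos in \<open>simp add: apply_vint distrib_left integral_add integrable\<close>)
  show "vint a d (r *\<^sub>R f) = r *\<^sub>R vint a d f" for r f
    by (rule bcontfun_eqI) (simp add: apply_vint mult.left_commute[of _ r])
  show "norm (vint a d f) \<le> norm f * d" for f using norm_vint_le[of f] by (simp add: mult.commute)
qed

lemma vint_deriv:
  assumes "0 < t" "t < d"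
  shows "(apply_bcontfun (vint a d f) has_real_derivative a t * f t) (at t)"
proof -
  have "((\<lambda>t. integral {0..t} (\<lambda>r. a r * f r)) has_real_derivative a t * f t) (at t within {0..d})"
    by (rule integral_has_real_derivative) (use assms in \<open>auto intro!: continuous_intros cont\<close>)
  then have "((\<lambda>t. integral {0..t} (\<lambda>r. a r * f r)) has_real_derivative a t * f t) (at t within {0<..<d})"
    by (rule DERIV_subset) auto
  then have "((\<lambda>t. integral {0..t} (\<lambda>r. a r * f r)) has_real_derivative a t * f t) (at t)"
    using assms at_within_open[of t "{0<..<d}"] by simp
  then show ?thesis
    by (rule has_field_derivative_transform_within_open[of _ _ _ "{0<..<d}"]) (use assms in \<open>auto simp: apply_vint\<close>)
qed

lemma vint_zero: "apply_bcontfun (vint a d f) 0 = 0"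
  using d_pos by (simp add: apply_vint)

end

lemma apply_avg: "apply_bcontfun (avg j f) = (\<lambda>t. integral {0..1} (\<lambda>\<tau>. 2 * \<tau> ^ j * f (\<tau> * t)))"
  and norm_avg_aux: "norm (integral {0..1} (\<lambda>\<tau>. 2 * \<tau> ^ j * f (\<tau> * t))) \<le> 2 / (real j + 1) * norm f"
proof -
  have cf: "continuous_on A (\<lambda>x. f (g x))" if "continuous_on A g" for A :: "'x::topological_space set" and g :: "'x \<Rightarrow> real"
    by (rule continuous_on_compose2[OF continuous_on_apply_bcontfun[of UNIV f] that]) auto
  have pw: "((\<lambda>\<tau>::real. 2 * \<tau> ^ j * norm f) has_integral 2 / (real j + 1) * norm f) {0..1}"
  proof -
    have "((\<lambda>\<tau>::real. 2 * \<tau> ^ j * norm f) has_integral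
       (2 / (real j + 1) * norm f * 1 ^ Suc j - 2 / (real j + 1) * norm f * 0 ^ Suc j)) {0..1}"
      by (rule fundamental_theorem_of_calculus)
        (auto simp: has_real_derivative_iff_has_vector_derivative[symmetric] simp del: power_Suc
           intro!: derivative_eq_intros, simp add: field_simps)
    then show ?thesis by simp
  qed
  show bd: "norm (integral {0..1} (\<lambda>\<tau>. 2 * \<tau> ^ j * f (\<tau> * t))) \<le> 2 / (real j + 1) * norm f" for t
  proof -
    have "norm (integral {0..1} (\<lambda>\<tau>. 2 * \<tau> ^ j * f (\<tau> * t))) \<le> integral {0..1} (\<lambda>\<tau>::real. 2 * \<tau> ^ j * norm f)"
    proof (rule integral_norm_bound_integral)
      show "(\<lambda>\<tau>. 2 * \<tau> ^ j * f (\<tau> * t)) integrable_on {0..1}"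
        by (intro integrable_continuous_real continuous_intros cf)
      show "(\<lambda>\<tau>::real. 2 * \<tau> ^ j * norm f) integrable_on {0..1}" using pw by blast
      show "norm (2 * \<tau> ^ j * f (\<tau> * t)) \<le> 2 * \<tau> ^ j * norm f" if "\<tau> \<in> {0..1}" for \<tau>
        using that norm_bounded[of f "\<tau> * t"] by (auto simp: abs_mult intro!: mult_left_mono)
    qed
    also have "\<dots> = 2 / (real j + 1) * norm f" using pw by (rule integral_unique)
    finally show ?thesis .
  qed
  show "apply_bcontfun (avg j f) = (\<lambda>t. integral {0..1} (\<lambda>\<tau>. 2 * \<tau> ^ j * f (\<tau> * t)))"
    unfolding avg_def
  proof (rule apply_Bcontfun[OF _ bd])
    have "continuous_on UNIV (\<lambda>t. integral (cbox 0 1) (\<lambda>\<tau>. 2 * \<tau> ^ j * f (\<tau> * t)))"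
      by (rule integral_continuous_on_param) (auto simp: split_beta intro!: continuous_intros cf)
    then show "continuous_on UNIV (\<lambda>t. integral {0..1} (\<lambda>\<tau>. 2 * \<tau> ^ j * f (\<tau> * t)))" by simp
  qed
qed

lemma norm_avg_le:
  assumes "1 \<le> j" shows "norm (avg j f) \<le> 1 * norm f"
proof (rule norm_bound)
  fix t
  have "norm (avg j f t) \<le> 2 / (real j + 1) * norm f" using norm_avg_aux[of j f t] by (simp add: apply_avg)
  also have "\<dots> \<le> 1 * norm f" using assms by (intro mult_right_mono) auto
  finally show "norm (avg j f t) \<le> 1 * norm f" .
qed

lemma avg_integrable: "(\<lambda>\<tau>::real. 2 * \<tau> ^ j * apply_bcontfun f (\<tau> * t)) integrable_on {0..1}" for f :: "real \<Rightarrow>\<^sub>C real"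
  by (intro integrable_continuous_real continuous_intros continuous_on_compose2[OF continuous_on_apply_bcontfun[of UNIV f]]) auto

lemma bounded_linear_avg: "bounded_linear (avg j)"
proof (rule bounded_linear_intro[of _ "2 / (real j + 1)"])
  show "avg j (f + g) = avg j f + avg j g" for f g
    by (rule bcontfun_eqI) (simp add: apply_avg distrib_left integral_add avg_integrable)
  show "avg j (r *\<^sub>R f) = r *\<^sub>R avg j f" for r f
    by (rule bcontfun_eqI) (simp add: apply_avg mult.left_commute[of _ r])
  show "norm (avg j f) \<le> norm f * (2 / (real j + 1))" for f
    by (rule norm_bound) (use norm_avg_aux[of j f] in \<open>simp add: apply_avg mult.commute\<close>)
qed

lemma avg_eq:
  assumes "0 < t"
  shows "t ^ Suc j * avg j f t = 2 * integral {0..t} (\<lambda>r. r ^ j * f r)"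
proof -
  have "((\<lambda>r. r ^ j * f r) has_integral integral {0..t} (\<lambda>r. r ^ j * f r)) {0..t}"
    by (auto intro!: integrable_integral integrable_continuous_real continuous_intros)
  from has_integral_stretch_real[OF this, of t] assms
  have "((\<lambda>\<tau>. (t * \<tau>) ^ j * f (t * \<tau>)) has_integral (1 / t) * integral {0..t} (\<lambda>r. r ^ j * f r)) ((\<lambda>x. x / t) ` {0..t})"
    by simp
  moreover have "(\<lambda>x. x / t) ` {0..t} = {0..1}"
    using assms by (force simp: image_iff field_simps)
  ultimately have "((\<lambda>\<tau>. (t * \<tau>) ^ j * f (t * \<tau>)) has_integral (1 / t) * integral {0..t} (\<lambda>r. r ^ j * f r)) {0..1}" by simp
  then have "((\<lambda>\<tau>. 2 / t ^ j * ((t * \<tau>) ^ j * f (t * \<tau>))) has_integral 2 / t ^ j * ((1 / t) * integral {0..t} (\<lambda>r. r ^ j * f r))) {0..1}"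
    by (rule has_integral_mult_right)
  moreover have "(\<lambda>\<tau>. 2 / t ^ j * ((t * \<tau>) ^ j * f (t * \<tau>))) = (\<lambda>\<tau>. 2 * \<tau> ^ j * f (\<tau> * t))"
    using assms by (intro ext) (simp add: power_mult_distrib mult.commute[of t])
  ultimately have "avg j f t = 2 / t ^ j * ((1 / t) * integral {0..t} (\<lambda>r. r ^ j * f r))"
    by (simp add: apply_avg integral_unique)
  then show ?thesis using assms by (simp add: field_simps)
qed

text \<open>The Euler operator t d/dt maps an average to a combination of \<open>f\<close> and the
  average itself, with no derivative of \<open>f\<close>. This is what later lets averages gain
  regularity together with the functions they average.\<close>

lemma avg_deriv:
  assumes "0 < t"
  shows "(apply_bcontfun (avg j f) has_real_derivative (2 * f t - (real j + 1) * avg j f t) / t) (at t)"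
proof -
  let ?I = "\<lambda>t. integral {0..t} (\<lambda>r. r ^ j * f r)"
  have "(?I has_real_derivative t ^ j * f t) (at t within {0..t + 1})"
    by (rule integral_has_real_derivative) (use assms in \<open>auto intro!: continuous_intros\<close>)
  then have "(?I has_real_derivative t ^ j * f t) (at t within {0<..<t + 1})"
    by (rule DERIV_subset) auto
  then have I: "(?I has_real_derivative t ^ j * f t) (at t)"
    using assms at_within_open[of t "{0<..<t + 1}"] by simp
  have "((\<lambda>t. 2 * ?I t / t ^ Suc j) has_real_derivative
     ((2 * (t ^ j * f t)) * t ^ Suc j - (2 * ?I t) * (real (Suc j) * t ^ j)) / (t ^ Suc j * t ^ Suc j)) (at t)"
    using DERIV_divide[OF DERIV_cmult[OF I, of 2] DERIV_pow[of "Suc j" t]] assms by simp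
  also have "((2 * (t ^ j * f t)) * t ^ Suc j - (2 * ?I t) * (real (Suc j) * t ^ j)) / (t ^ Suc j * t ^ Suc j)
      = (2 * f t - (real j + 1) * avg j f t) / t"
    unfolding avg_eq[OF assms, symmetric] using assms by (simp add: field_simps)
  finally have "((\<lambda>t. 2 * ?I t / t ^ Suc j) has_real_derivative (2 * f t - (real j + 1) * avg j f t) / t) (at t)" .
  then show ?thesis
    by (rule has_field_derivative_transform_within_open[of _ _ _ "{0<..}"])
      (use assms avg_eq[of _ j f] in \<open>auto simp: field_simps\<close>)
qed

section \<open>Weights with powers of the logarithm\<close>

text \<open>The factor r comes from ds = 2 r dr and tames the logarithms. Exponents up to 2 occur,
  because the Riccati equation squares n = y - \<mu>_1/2 ln r.\<close>

definition wt :: "nat \<Rightarrow> real \<Rightarrow> real"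
  where "wt i r = r * ln r ^ i / (1 + r\<^sup>2)"

lemma mult_ln_power_le_1:
  assumes "0 \<le> r" "r \<le> 1" "i \<le> 2"
  shows "\<bar>r * ln r ^ i\<bar> \<le> (1::real)"
proof (cases "r = 0")
  case False
  define t where "t = - ln r"
  have t: "0 \<le> t" "r = exp (- t)" using assms False by (auto simp: t_def)
  \<comment> \<open>The quadratic Taylor bound suffices since 1 + t/2 + t^2/8 - t = ((t - 2)^2 +
    4)/8. Squaring the result handles the exponent 2.\<close>
  have "t \<le> exp (t/2)"
  proof -
    have "1 + t/2 + (t/2)\<^sup>2/2 \<le> exp (t/2)" using t by (intro exp_lower_Taylor_quadratic) auto
    moreover have "t \<le> 1 + t/2 + (t/2)\<^sup>2/2" using zero_le_power2[of "t - 2"] by (simp add: power2_eq_square field_simps)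
    ultimately show ?thesis by linarith
  qed
  then have t2: "t\<^sup>2 \<le> exp t" using t power_mono[of t "exp (t/2)" 2] by (simp add: exp_double[symmetric])
  have t1: "t \<le> exp t" using exp_ge_add_one_self[of t] by linarith
  have "t ^ i \<le> exp t" using assms(3) t t1 t2 by (auto simp: le_Suc_eq numeral_2_eq_2)
  then have "exp (- t) * t ^ i \<le> 1" by (simp add: exp_minus field_simps)
  moreover have "\<bar>r * ln r ^ i\<bar> = exp (- t) * t ^ i"
    using t by (simp add: abs_mult power_abs)
  ultimately show ?thesis by simp
qed simp

lemma weight_wt:
  assumes "0 < d" "d \<le> 1" "i \<le> 2"
  shows "weight (wt i) d"
proof
  have "((\<lambda>r::real. r * ln r ^ i) \<longlongrightarrow> 0) (at_right 0)"
    using assms(3) by (auto simp: le_Suc_eq numeral_2_eq_2 power2_eq_square) (real_asymp+)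
  \<comment> \<open>The first factor makes the value at 0 equal to 0, whatever \<open>ln 0\<close>
    is, so the formula itself is the continuous extension.\<close>
  then have "((\<lambda>r::real. r * ln r ^ i) \<longlongrightarrow> 0 * ln 0 ^ i) (at 0 within {0..d})"
    using assms by (simp add: at_within_Icc_at_right)
  moreover have "((\<lambda>r::real. r * ln r ^ i) \<longlongrightarrow> x * ln x ^ i) (at x within {0..d})" if "x \<in> {0..d}" "x \<noteq> 0" for x
    using that by (auto intro!: tendsto_intros)
  ultimately have c: "continuous_on {0..d} (\<lambda>r::real. r * ln r ^ i)"
    unfolding continuous_on_def by metis
  have nz: "1 + r\<^sup>2 \<noteq> (0::real)" for r by (metis add_pos_nonneg less_irrefl zero_le_power2 zero_less_one)
  show "continuous_on {0..d} (wt i)"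
    unfolding wt_def[abs_def] by (intro continuous_intros c) (use nz in auto)
  fix r assume r: "r \<in> {0..d}"
  have "\<bar>r * ln r ^ i\<bar> \<le> 1" using r assms by (intro mult_ln_power_le_1) auto
  moreover have "1 \<le> 1 + r\<^sup>2" by simp
  ultimately have "\<bar>r * ln r ^ i\<bar> \<le> 1 + r\<^sup>2" by linarith
  then show "\<bar>wt i r\<bar> \<le> 1" unfolding wt_def abs_divide by (simp add: divide_le_eq_1 abs_of_nonneg add_pos_nonneg)
qed (use assms in auto)

section \<open>Smooth families of solutions of the integral equations\<close>

definition Cb_infinity :: "'a::euclidean_space set \<Rightarrow> ('a \<Rightarrow> 'b::real_normed_vector) \<Rightarrow> bool"
  where "Cb_infinity S Y \<longleftrightarrow> C_infinity_on S Y \<and>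
    (\<forall>vs. set vs \<subseteq> Basis \<longrightarrow> (\<exists>C. \<forall>x\<in>S. norm (partials vs Y x) \<le> C))"

text \<open>Smoothness, the side conditions on \<open>h\<close> and the numerical bound travel
  together, so a bound for a long expression is assembled by one introduction rule per
  operation.\<close>

definition jet_le :: "'a::euclidean_space set \<Rightarrow> nat \<Rightarrow> real \<Rightarrow> 'a \<Rightarrow> ('a \<Rightarrow> 'b::real_normed_vector) \<Rightarrow> real \<Rightarrow> bool"
  where "jet_le S k h x f a \<longleftrightarrow> open S \<and> 0 \<le> h \<and> x \<in> S \<and> C_infinity_on S f \<and> jet k h f x \<le> a"

lemma jet_le_mono: "jet_le S k h x f a \<Longrightarrow> a \<le> b \<Longrightarrow> jet_le S k h x f b"
  by (auto simp: jet_le_def)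

lemma jet_le_nonneg: "jet_le S k h x f a \<Longrightarrow> 0 \<le> a"
  using jet_nonneg[of h k f x] by (auto simp: jet_le_def)

lemma jet_le_const: "open S \<Longrightarrow> 0 \<le> h \<Longrightarrow> x \<in> S \<Longrightarrow> norm c \<le> a \<Longrightarrow> jet_le S k h x (\<lambda>_. c) a"
  by (auto simp: jet_le_def jet_const C_infinity_on_const)

lemma jet_le_add:
  "jet_le S k h x f a \<Longrightarrow> jet_le S k h x g b \<Longrightarrow> jet_le S k h x (\<lambda>x. f x + g x) (a + b)"
  using jet_add[of S h x f g k] by (auto simp: jet_le_def C_infinity_on_add)

lemma jet_le_diff:
  "jet_le S k h x f a \<Longrightarrow> jet_le S k h x g b \<Longrightarrow> jet_le S k h x (\<lambda>x. f x - g x) (a + b)"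
  using jet_minus_le[of S h x f g k] by (auto simp: jet_le_def C_infinity_on_minus)

lemma jet_le_mult:
  fixes f g :: "'a::euclidean_space \<Rightarrow> 'b::real_normed_algebra"
  assumes "jet_le S k h x f a" "jet_le S k h x g b"
  shows "jet_le S k h x (\<lambda>x. f x * g x) (a * b)"
proof -
  have "jet k h (\<lambda>x. f x * g x) x \<le> jet k h f x * jet k h g x"
    using assms by (intro jet_bilinear[of S]) (auto simp: jet_le_def bounded_bilinear_mult norm_mult_ineq)
  also have "\<dots> \<le> a * b"
    using assms jet_le_nonneg[OF assms(1)] by (intro mult_mono jet_nonneg) (auto simp: jet_le_def)
  finally show ?thesis using assms by (auto simp: jet_le_def intro!: C_infinity_on_bilinear[OF _ bounded_bilinear_mult])
qed

lemma jet_le_scaleR: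
  assumes "jet_le S k h x f a" "jet_le S k h x g b"
  shows "jet_le S k h x (\<lambda>x. f x *\<^sub>R g x) (a * b)"
proof -
  have "jet k h (\<lambda>x. f x *\<^sub>R g x) x \<le> jet k h f x * jet k h g x"
    using assms by (intro jet_bilinear[of S]) (auto simp: jet_le_def bounded_bilinear_scaleR)
  also have "\<dots> \<le> a * b"
    using assms jet_le_nonneg[OF assms(1)] by (intro mult_mono jet_nonneg) (auto simp: jet_le_def)
  finally show ?thesis using assms by (auto simp: jet_le_def intro!: C_infinity_on_bilinear[OF _ bounded_bilinear_scaleR])
qed

lemma jet_le_linear:
  assumes "bounded_linear T" "\<And>y. norm (T y) \<le> w * norm y" "0 \<le> w" "jet_le S k h x f a"
  shows "jet_le S k h x (\<lambda>x. T (f x)) (w * a)"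
proof -
  have "jet k h (\<lambda>x. T (f x)) x \<le> w * jet k h f x"
    by (rule jet_linear[of S]) (use assms(4) in \<open>auto simp: jet_le_def intro: assms(1,2)\<close>)
  also have "\<dots> \<le> w * a" using assms(3,4) by (intro mult_left_mono) (auto simp: jet_le_def)
  finally show ?thesis using assms(1,4) by (auto simp: jet_le_def intro!: C_infinity_on_linear[OF _ assms(1)])
qed

type_synonym BC = "real \<Rightarrow>\<^sub>C real"

abbreviation cst :: "real \<Rightarrow> BC" where "cst \<equiv> const_bcontfun"

text \<open>
  Integral form of the singular system in the variable \<open>\<rho>\<close>, with the logarithm split off as
  \<open>n = y - \<mu>\<^sub>1/2 ln \<rho>\<close>; the three unknowns \<open>\<gamma>\<close>, \<open>e\<close>, \<open>y\<close> are continuous up to \<open>\<rho> = 0\<close>.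
\<close>
definition step_g :: "real \<Rightarrow> real^4 \<Rightarrow> BC \<Rightarrow> BC \<Rightarrow> BC" where
  "step_g d \<mu> g y = cst (\<mu> $ 4) + vint (wt 0) d ((y - cst 3) * g) - (\<mu> $ 1) *\<^sub>R (1/2) *\<^sub>R vint (wt 1) d g"

definition step_e :: "real \<Rightarrow> real^4 \<Rightarrow> BC \<Rightarrow> BC \<Rightarrow> BC" where
  "step_e d \<mu> g e = cst (\<mu> $ 3) - (1/2) *\<^sub>R cst (\<mu> $ 2) - vint (wt 0) d (3 *\<^sub>R e + avg 1 g * g)"

text \<open>The pole -\<mu>_1/(2 \<rho> (1 + \<rho>^2)) of n' and the derivative \<mu>_1/(2 \<rho>)
  of the split-off logarithm add up to the regular term \<mu>_1 \<rho>/(2 (1 + \<rho>^2)). Weights 1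
  and 2 collect the powers of ln \<rho> in n^2/2 - n, and the iterated average is (E/s -
  \<mu>_1/2)/s.\<close>

definition step_y :: "real \<Rightarrow> real^4 \<Rightarrow> BC \<Rightarrow> BC \<Rightarrow> BC" where
  "step_y d \<mu> e y = (1/2) *\<^sub>R cst (\<mu> $ 1) - cst (\<mu> $ 3)
     + vint (wt 0) d ((1/2) *\<^sub>R (y * y) - y + (1/2) *\<^sub>R cst (\<mu> $ 1) - avg 3 (avg 1 e))
     + (\<mu> $ 1) *\<^sub>R (1/2) *\<^sub>R vint (wt 1) d (cst 1 - y)
     + (\<mu> $ 1) *\<^sub>R (\<mu> $ 1) *\<^sub>R (1/8) *\<^sub>R vint (wt 2) d (cst 1)"

primrec picard :: "real \<Rightarrow> nat \<Rightarrow> real^4 \<Rightarrow> BC \<times> BC \<times> BC" where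
  "picard d 0 \<mu> = (0, 0, 0)"
| "picard d (Suc m) \<mu> = (case picard d m \<mu> of (g, e, y) \<Rightarrow>
     (step_g d \<mu> g y, step_e d \<mu> g e, step_y d \<mu> e y))"

section \<open>Convergence of the Picard iteration\<close>

text \<open>\<open>P\<close> bounds the jets of the coordinates of the parameter, the extra 1
  absorbing their derivatives, and \<open>Q\<close> bounds the iterates. In each step the terms
  outside the Volterra operators are at most 3P/2, and the condition on \<open>d\<close> brings the
  rest below 1/4, so the ball of radius \<open>Q\<close> = 2P is preserved.\<close>

locale small_step =
  fixes S :: "(real^4) set" and d P Q :: real
  assumes open_S: "open S" and convex_S: "convex S" and P: "2 \<le> P" and S: "\<And>\<mu>. \<mu> \<in> S \<Longrightarrow> norm \<mu> + 1 \<le> P"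
    and Q: "Q = 2 * P" and d: "0 < d" "d * (8 * Q\<^sup>2) \<le> 1"
begin

lemma Q4: "4 \<le> Q" using P Q by simp

lemma d_le_1: "d \<le> 1"
proof -
  have "1 \<le> 8 * Q\<^sup>2" using Q4 power_mono[of 4 Q 2] by simp
  then have "d * 1 \<le> d * (8 * Q\<^sup>2)" using d by (intro mult_left_mono) auto
  then show ?thesis using d(2) by linarith
qed

lemma d_le: assumes "0 \<le> a" "a \<le> 2 * Q\<^sup>2" shows "d * a \<le> 1/4"
proof -
  have "d * a \<le> d * (2 * Q\<^sup>2)" using d assms by (intro mult_left_mono) auto
  then show ?thesis using d by linarith
qed

lemma jet_le_vint: "i \<le> 2 \<Longrightarrow> jet_le S k h x f a \<Longrightarrow> jet_le S k h x (\<lambda>x. vint (wt i) d (f x)) (d * a)"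
  by (rule jet_le_linear) (use weight_wt[of d i] d d_le_1 in \<open>auto intro: weight.bounded_linear_vint weight.norm_vint_le\<close>)

lemma jet_le_avg: "1 \<le> j \<Longrightarrow> jet_le S k h x f a \<Longrightarrow> jet_le S k h x (\<lambda>x. avg j (f x)) a"
  using jet_le_linear[OF bounded_linear_avg norm_avg_le, of j S k h x f a] by simp

lemma jet_le_cst: "jet_le S k h x f a \<Longrightarrow> jet_le S k h x (\<lambda>x. cst (f x)) a"
  using jet_le_linear[OF bounded_linear_const_bcontfun, of 1 S k h x f a] by simp

lemma jet_le_scaleR_const: "jet_le S k h x f a \<Longrightarrow> jet_le S k h x (\<lambda>x. r *\<^sub>R f x) (\<bar>r\<bar> * a)"
  by (rule jet_le_linear) (auto intro: bounded_linear_scaleR_right)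

text \<open>The 4 is the dimension of the parameter space: under this condition the jet of a
  coordinate exceeds its modulus by at most 1. Only \<open>h\<close> adapts to the order
  \<open>k\<close>; the length \<open>d\<close> of the interval does not.\<close>

context
  fixes k :: nat and h :: real and \<mu> :: "real^4"
  assumes h: "0 < h" "real k * h * 4 \<le> 1" and \<mu>: "\<mu> \<in> S"
begin

lemma jet_le_coord: "jet_le S k h \<mu> (\<lambda>\<mu>. \<mu> $ i) P"
proof -
  have "jet k h (\<lambda>\<mu>::real^4. \<mu> $ i) \<mu> \<le> norm (\<mu> $ i) + real k * h * real DIM(real^4)"
  proof (rule jet_bounded_linear_le[OF bounded_linear_vec_nth])
    show "norm (b $ i) \<le> 1" if "b \<in> Basis" for b :: "real^4"
      using component_le_norm_cart[of b i] norm_Basis[OF that] by simp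
  qed (use h in auto)
  also have "\<dots> \<le> norm \<mu> + 1" using h component_le_norm_cart[of \<mu> i] by simp
  finally show ?thesis using S[OF \<mu>] \<mu> open_S h
    by (auto simp: jet_le_def intro!: C_infinity_on_bounded_linear bounded_linear_vec_nth)
qed

lemma jet_le_cst_const: "jet_le S k h \<mu> (\<lambda>\<mu>. cst c) \<bar>c\<bar>"
  by (rule jet_le_const) (use open_S h \<mu> in auto)

lemma jet_le_real_const: "jet_le S k h \<mu> (\<lambda>\<mu>. c) \<bar>c\<bar>" for c :: real
  by (rule jet_le_const) (use open_S h \<mu> in auto)

lemmas jet_rules = jet_le_add jet_le_diff jet_le_mult jet_le_scaleR_const jet_le_scaleR[OF jet_le_coord] jet_le_avg jet_le_cst
  jet_le_vint[where i=0, OF zero_le] jet_le_vint[where i=1, OF one_le_numeral] jet_le_vint[where i=2, OF order_refl]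
  jet_le_coord jet_le_cst_const jet_le_real_const

lemma step_bounds:
  assumes g: "jet_le S k h \<mu> g Q" and e: "jet_le S k h \<mu> e Q" and y: "jet_le S k h \<mu> y Q"
  shows "jet_le S k h \<mu> (\<lambda>\<mu>. step_g d \<mu> (g \<mu>) (y \<mu>)) Q"
    "jet_le S k h \<mu> (\<lambda>\<mu>. step_e d \<mu> (g \<mu>) (e \<mu>)) Q"
    "jet_le S k h \<mu> (\<lambda>\<mu>. step_y d \<mu> (e \<mu>) (y \<mu>)) Q"
proof -
  \<comment> \<open>As \<open>Q\<close> is at least 4, linear and constant terms are fractions of
    Q^2, and the single estimate d a \<le> 1/4 for a \<le> 2 Q^2 covers all three
    components.\<close>
  have QQ: "4 * Q \<le> Q\<^sup>2" "16 \<le> Q\<^sup>2"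
    using Q4 mult_right_mono[of 4 Q Q] power_mono[of 4 Q 2] by (auto simp: power2_eq_square)
  have PQ: "P * Q = Q\<^sup>2 / 2" "P * P = Q\<^sup>2 / 4" using Q by (auto simp: power2_eq_square)
  have "jet_le S k h \<mu> (\<lambda>\<mu>. step_g d \<mu> (g \<mu>) (y \<mu>)) (P + d * ((Q + \<bar>3\<bar>) * Q) + P * (\<bar>1/2\<bar> * (d * Q)))"
    unfolding step_g_def by (intro jet_rules g e y)
  then show "jet_le S k h \<mu> (\<lambda>\<mu>. step_g d \<mu> (g \<mu>) (y \<mu>)) Q"
  proof (rule jet_le_mono)
    have "d * (Q\<^sup>2 + 3 * Q + Q\<^sup>2 / 4) \<le> 1/4" by (rule d_le) (use QQ Q4 in auto)
    moreover have "P + d * ((Q + \<bar>3\<bar>) * Q) + P * (\<bar>1/2\<bar> * (d * Q)) = P + d * (Q\<^sup>2 + 3 * Q + (P * Q) / 2)"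
      by (simp add: algebra_simps power2_eq_square)
    ultimately show "P + d * ((Q + \<bar>3\<bar>) * Q) + P * (\<bar>1/2\<bar> * (d * Q)) \<le> Q" using P Q unfolding PQ by simp
  qed
  have "jet_le S k h \<mu> (\<lambda>\<mu>. step_e d \<mu> (g \<mu>) (e \<mu>)) (P + \<bar>1/2\<bar> * P + d * (\<bar>3\<bar> * Q + Q * Q))"
    unfolding step_e_def by (intro jet_rules g e y, simp?)
  then show "jet_le S k h \<mu> (\<lambda>\<mu>. step_e d \<mu> (g \<mu>) (e \<mu>)) Q"
  proof (rule jet_le_mono)
    have "d * (\<bar>3\<bar> * Q + Q * Q) \<le> 1/4" by (rule d_le) (use QQ Q4 in \<open>auto simp: power2_eq_square\<close>)
    then show "P + \<bar>1/2\<bar> * P + d * (\<bar>3\<bar> * Q + Q * Q) \<le> Q" using P Q by simp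
  qed
  have "jet_le S k h \<mu> (\<lambda>\<mu>. step_y d \<mu> (e \<mu>) (y \<mu>)) (\<bar>1/2\<bar> * P + P
      + d * (\<bar>1/2\<bar> * (Q * Q) + Q + \<bar>1/2\<bar> * P + Q) + P * (\<bar>1/2\<bar> * (d * (\<bar>1\<bar> + Q))) + P * (P * (\<bar>1/8\<bar> * (d * \<bar>1\<bar>))))"
    unfolding step_y_def by (intro jet_rules g e y, simp_all?)
  then show "jet_le S k h \<mu> (\<lambda>\<mu>. step_y d \<mu> (e \<mu>) (y \<mu>)) Q"
  proof (rule jet_le_mono)
    have "d * (Q\<^sup>2/2 + Q + P/2 + Q + P/2 + Q\<^sup>2/4 + Q\<^sup>2/32) \<le> 1/4" by (rule d_le) (use QQ Q4 Q in auto)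
    moreover have "\<bar>1/2\<bar> * P + P + d * (\<bar>1/2\<bar> * (Q * Q) + Q + \<bar>1/2\<bar> * P + Q) + P * (\<bar>1/2\<bar> * (d * (\<bar>1\<bar> + Q))) + P * (P * (\<bar>1/8\<bar> * (d * \<bar>1\<bar>)))
      = 3/2 * P + d * (Q\<^sup>2/2 + Q + P/2 + Q + P/2 + (P * Q)/2 + (P * P)/8)"
      by (simp add: field_simps power2_eq_square)
    ultimately show "\<bar>1/2\<bar> * P + P + d * (\<bar>1/2\<bar> * (Q * Q) + Q + \<bar>1/2\<bar> * P + Q) + P * (\<bar>1/2\<bar> * (d * (\<bar>1\<bar> + Q))) + P * (P * (\<bar>1/8\<bar> * (d * \<bar>1\<bar>))) \<le> Q"
      using P Q unfolding PQ by simp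
  qed
qed

text \<open>Terms free of the unknowns cancel, and products are polarised as x y - x' y' = (x - x')
  y + x' (y - y'). Whatever remains lies under a Volterra operator, whose norm is at most
  \<open>d\<close>; here \<open>Z\<close> bounds the jets of the differences.\<close>

lemma step_contraction:
  assumes g1: "jet_le S k h \<mu> g1 Q" and e1: "jet_le S k h \<mu> e1 Q" and y1: "jet_le S k h \<mu> y1 Q"
    and g2: "jet_le S k h \<mu> g2 Q" and e2: "jet_le S k h \<mu> e2 Q" and y2: "jet_le S k h \<mu> y2 Q"
    and g: "jet_le S k h \<mu> (\<lambda>\<mu>. g1 \<mu> - g2 \<mu>) Z" and e: "jet_le S k h \<mu> (\<lambda>\<mu>. e1 \<mu> - e2 \<mu>) Z"
    and y: "jet_le S k h \<mu> (\<lambda>\<mu>. y1 \<mu> - y2 \<mu>) Z"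
  shows "jet_le S k h \<mu> (\<lambda>\<mu>. step_g d \<mu> (g1 \<mu>) (y1 \<mu>) - step_g d \<mu> (g2 \<mu>) (y2 \<mu>)) (Z/2)"
    "jet_le S k h \<mu> (\<lambda>\<mu>. step_e d \<mu> (g1 \<mu>) (e1 \<mu>) - step_e d \<mu> (g2 \<mu>) (e2 \<mu>)) (Z/2)"
    "jet_le S k h \<mu> (\<lambda>\<mu>. step_y d \<mu> (e1 \<mu>) (y1 \<mu>) - step_y d \<mu> (e2 \<mu>) (y2 \<mu>)) (Z/2)"
proof -
  have Z: "0 \<le> Z" using jet_le_nonneg[OF g] .
  have QQ: "4 * Q \<le> Q\<^sup>2" "16 \<le> Q\<^sup>2"
    using Q4 mult_right_mono[of 4 Q Q] power_mono[of 4 Q 2] by (auto simp: power2_eq_square)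
  have lin: "linear (vint (wt i) d)" if "i \<le> 2" for i
    using weight.bounded_linear_vint[OF weight_wt[of d i]] d d_le_1 that bounded_linear.linear by blast
  have linavg: "linear (avg j)" for j using bounded_linear_avg bounded_linear.linear by blast
  have small: "d * (a * Z) \<le> Z / 4" if "0 \<le> a" "a \<le> 2 * Q\<^sup>2" for a
    using mult_right_mono[OF d_le[OF that] Z] by (simp add: mult_ac)
  have "step_g d \<mu> (g1 \<mu>) (y1 \<mu>) - step_g d \<mu> (g2 \<mu>) (y2 \<mu>)
     = vint (wt 0) d ((y1 \<mu> - cst 3) * (g1 \<mu> - g2 \<mu>) + (y1 \<mu> - y2 \<mu>) * g2 \<mu>)
        - (\<mu> $ 1) *\<^sub>R (1/2) *\<^sub>R vint (wt 1) d (g1 \<mu> - g2 \<mu>)" for \<mu>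
    by (simp add: step_g_def linear_diff[OF lin] linear_add[OF lin] algebra_simps)
  moreover have "jet_le S k h \<mu> (\<lambda>\<mu>. vint (wt 0) d ((y1 \<mu> - cst 3) * (g1 \<mu> - g2 \<mu>) + (y1 \<mu> - y2 \<mu>) * g2 \<mu>)
        - (\<mu> $ 1) *\<^sub>R (1/2) *\<^sub>R vint (wt 1) d (g1 \<mu> - g2 \<mu>)) (d * ((Q + \<bar>3\<bar>) * Z + Z * Q) + P * (\<bar>1/2\<bar> * (d * Z)))"
    by (intro jet_rules assms)
  moreover have "d * ((Q + \<bar>3\<bar>) * Z + Z * Q) + P * (\<bar>1/2\<bar> * (d * Z)) \<le> Z/2"
    using small[of "2 * Q + 3 + P/2"] QQ Q Q4 Z by (simp add: algebra_simps)
  ultimately show "jet_le S k h \<mu> (\<lambda>\<mu>. step_g d \<mu> (g1 \<mu>) (y1 \<mu>) - step_g d \<mu> (g2 \<mu>) (y2 \<mu>)) (Z/2)"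
    by (simp only:) (erule jet_le_mono, assumption)
  have "step_e d \<mu> (g1 \<mu>) (e1 \<mu>) - step_e d \<mu> (g2 \<mu>) (e2 \<mu>)
     = cst 0 - vint (wt 0) d (3 *\<^sub>R (e1 \<mu> - e2 \<mu>) + (avg 1 (g1 \<mu> - g2 \<mu>) * g1 \<mu> + avg 1 (g2 \<mu>) * (g1 \<mu> - g2 \<mu>)))" for \<mu>
    by (simp add: step_e_def linear_diff[OF lin] linear_add[OF lin] linear_scale[OF lin] linear_diff[OF linavg] algebra_simps)
  moreover have "jet_le S k h \<mu> (\<lambda>\<mu>. cst 0 - vint (wt 0) d (3 *\<^sub>R (e1 \<mu> - e2 \<mu>) + (avg 1 (g1 \<mu> - g2 \<mu>) * g1 \<mu> + avg 1 (g2 \<mu>) * (g1 \<mu> - g2 \<mu>))))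
     (\<bar>0\<bar> + d * (\<bar>3\<bar> * Z + (Z * Q + Q * Z)))"
    by (intro jet_rules assms, simp_all?)
  moreover have "\<bar>0\<bar> + d * (\<bar>3\<bar> * Z + (Z * Q + Q * Z)) \<le> Z/2"
    using small[of "2 * Q + 3"] QQ Q Q4 Z by (simp add: algebra_simps)
  ultimately show "jet_le S k h \<mu> (\<lambda>\<mu>. step_e d \<mu> (g1 \<mu>) (e1 \<mu>) - step_e d \<mu> (g2 \<mu>) (e2 \<mu>)) (Z/2)"
    by (simp only:) (erule jet_le_mono, assumption)
  have "step_y d \<mu> (e1 \<mu>) (y1 \<mu>) - step_y d \<mu> (e2 \<mu>) (y2 \<mu>)
     = vint (wt 0) d ((1/2) *\<^sub>R ((y1 \<mu> - y2 \<mu>) * y1 \<mu> + y2 \<mu> * (y1 \<mu> - y2 \<mu>)) - (y1 \<mu> - y2 \<mu>) - avg 3 (avg 1 (e1 \<mu> - e2 \<mu>)))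
        - (\<mu> $ 1) *\<^sub>R (1/2) *\<^sub>R vint (wt 1) d (y1 \<mu> - y2 \<mu>)" for \<mu>
    by (simp add: step_y_def linear_diff[OF lin] linear_add[OF lin] linear_scale[OF lin] linear_diff[OF linavg] algebra_simps)
  moreover have "jet_le S k h \<mu> (\<lambda>\<mu>. vint (wt 0) d ((1/2) *\<^sub>R ((y1 \<mu> - y2 \<mu>) * y1 \<mu> + y2 \<mu> * (y1 \<mu> - y2 \<mu>)) - (y1 \<mu> - y2 \<mu>) - avg 3 (avg 1 (e1 \<mu> - e2 \<mu>)))
        - (\<mu> $ 1) *\<^sub>R (1/2) *\<^sub>R vint (wt 1) d (y1 \<mu> - y2 \<mu>)) (d * (\<bar>1/2\<bar> * (Z * Q + Q * Z) + Z + Z) + P * (\<bar>1/2\<bar> * (d * Z)))"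
    by (intro jet_rules assms, simp_all?)
  moreover have "d * (\<bar>1/2\<bar> * (Z * Q + Q * Z) + Z + Z) + P * (\<bar>1/2\<bar> * (d * Z)) \<le> Z/2"
    using small[of "Q + 2 + P/2"] QQ Q Q4 Z by (simp add: algebra_simps)
  ultimately show "jet_le S k h \<mu> (\<lambda>\<mu>. step_y d \<mu> (e1 \<mu>) (y1 \<mu>) - step_y d \<mu> (e2 \<mu>) (y2 \<mu>)) (Z/2)"
    by (simp only:) (erule jet_le_mono, assumption)
qed

lemma picard_bounds:
  "jet_le S k h \<mu> (\<lambda>\<mu>. fst (picard d m \<mu>)) Q \<and> jet_le S k h \<mu> (\<lambda>\<mu>. fst (snd (picard d m \<mu>))) Q
    \<and> jet_le S k h \<mu> (\<lambda>\<mu>. snd (snd (picard d m \<mu>))) Q"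
proof (induction m)
  case 0
  show ?case using Q4 open_S h \<mu> by (auto intro!: jet_le_const)
next
  case (Suc m)
  then have *: "jet_le S k h \<mu> (\<lambda>\<mu>. fst (picard d m \<mu>)) Q" "jet_le S k h \<mu> (\<lambda>\<mu>. fst (snd (picard d m \<mu>))) Q"
    "jet_le S k h \<mu> (\<lambda>\<mu>. snd (snd (picard d m \<mu>))) Q" by auto
  show ?case using step_bounds[OF *] by (simp add: case_prod_unfold)
qed

lemma picard_Suc:
  "fst (picard d (Suc j) \<nu>) = step_g d \<nu> (fst (picard d j \<nu>)) (snd (snd (picard d j \<nu>)))"
  "fst (snd (picard d (Suc j) \<nu>)) = step_e d \<nu> (fst (picard d j \<nu>)) (fst (snd (picard d j \<nu>)))"
  "snd (snd (picard d (Suc j) \<nu>)) = step_y d \<nu> (fst (snd (picard d j \<nu>))) (snd (snd (picard d j \<nu>)))"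
  by (simp_all add: case_prod_unfold)

lemma picard_differences:
  "jet_le S k h \<mu> (\<lambda>\<mu>. fst (picard d (Suc m) \<mu>) - fst (picard d m \<mu>)) (2 * Q * (1/2) ^ m)
    \<and> jet_le S k h \<mu> (\<lambda>\<mu>. fst (snd (picard d (Suc m) \<mu>)) - fst (snd (picard d m \<mu>))) (2 * Q * (1/2) ^ m)
    \<and> jet_le S k h \<mu> (\<lambda>\<mu>. snd (snd (picard d (Suc m) \<mu>)) - snd (snd (picard d m \<mu>))) (2 * Q * (1/2) ^ m)"
  (is "?P m")
proof -
  have B: "jet_le S k h \<mu> (\<lambda>\<mu>. fst (picard d m \<mu>)) Q" "jet_le S k h \<mu> (\<lambda>\<mu>. fst (snd (picard d m \<mu>))) Q"
    "jet_le S k h \<mu> (\<lambda>\<mu>. snd (snd (picard d m \<mu>))) Q" for m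
    using picard_bounds[of m] by blast+
  have Q2: "Q + Q = 2 * Q * (1/2) ^ 0" by simp
  have base: "?P 0"
    by (intro conjI jet_le_diff[where a=Q and b=Q, unfolded Q2] B)
  have step: "?P (Suc m)" if IH: "?P m" for m
  proof -
    have half: "2 * Q * (1/2) ^ m / 2 = 2 * Q * (1/2) ^ Suc m" by simp
    from IH have D: "jet_le S k h \<mu> (\<lambda>\<mu>. fst (picard d (Suc m) \<mu>) - fst (picard d m \<mu>)) (2 * Q * (1/2) ^ m)"
      "jet_le S k h \<mu> (\<lambda>\<mu>. fst (snd (picard d (Suc m) \<mu>)) - fst (snd (picard d m \<mu>))) (2 * Q * (1/2) ^ m)"
      "jet_le S k h \<mu> (\<lambda>\<mu>. snd (snd (picard d (Suc m) \<mu>)) - snd (snd (picard d m \<mu>))) (2 * Q * (1/2) ^ m)"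
      by (blast dest: conjunct1 conjunct2)+
    note C = step_contraction[OF B[of "Suc m"] B[of m] D, unfolded half, folded picard_Suc]
    show ?thesis by (intro conjI C)
  qed
  show ?thesis by (rule nat.induct[where P="?P", OF base step])
qed

end

text \<open>The bound on the jets of the iterates does not depend on \<open>m\<close>, so it passes
  to each partial derivative of the limit at the price of a power of 1/h. This gives bounded
  parameter derivatives and not merely smoothness.\<close>

lemma picard_limit_aux:
  fixes f :: "nat \<Rightarrow> real^4 \<Rightarrow> BC"
  assumes b: "\<And>k h \<mu> m. 0 < h \<Longrightarrow> real k * h * 4 \<le> 1 \<Longrightarrow> \<mu> \<in> S \<Longrightarrow> jet_le S k h \<mu> (f m) Q"
    and c: "\<And>k h \<mu> m. 0 < h \<Longrightarrow> real k * h * 4 \<le> 1 \<Longrightarrow> \<mu> \<in> S \<Longrightarrow>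
      jet_le S k h \<mu> (\<lambda>\<mu>. f (Suc m) \<mu> - f m \<mu>) (2 * Q * (1/2) ^ m)"
  shows "\<exists>g. Cb_infinity S g \<and> (\<forall>\<mu>\<in>S. (\<lambda>m. f m \<mu>) \<longlonglongrightarrow> g \<mu>)"
proof (cases "S = {}")
  case False
  \<comment> \<open>Any choice with 4 k h at most 1 would do; k + 1 keeps it finite at order
    0.\<close>
  define h where "h k = 1 / (4 * (real k + 1))" for k
  have h: "0 < h k" "real k * h k * 4 \<le> 1" for k by (auto simp: h_def field_simps)
  obtain \<mu>0 where "\<mu>0 \<in> S" using False by blast
  have "\<exists>g. C_infinity_on S g \<and>
    (\<forall>vs x. set vs \<subseteq> Basis \<longrightarrow> x \<in> S \<longrightarrow> (\<lambda>m. partials vs (f m) x) \<longlonglongrightarrow> partials vs g x)"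
  proof (rule C_infinity_on_limit[OF open_S convex_S])
    show "C_infinity_on S (f m)" for m using b[OF h \<open>\<mu>0 \<in> S\<close>] by (auto simp: jet_le_def)
    show "\<exists>h>0. \<exists>C. \<forall>m. \<forall>x\<in>S. jet k h (\<lambda>x. f (Suc m) x - f m x) x \<le> C * (1/2) ^ m" for k
    proof -
      have "\<forall>m. \<forall>x\<in>S. jet k (h k) (\<lambda>x. f (Suc m) x - f m x) x \<le> 2 * Q * (1/2) ^ m"
        using c[OF h[of k]] unfolding jet_le_def by blast
      then show ?thesis using h(1) by blast
    qed
  qed
  then obtain g where g: "C_infinity_on S g"
    "\<And>vs x. set vs \<subseteq> Basis \<Longrightarrow> x \<in> S \<Longrightarrow> (\<lambda>m. partials vs (f m) x) \<longlonglongrightarrow> partials vs g x" by blast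
  have "norm (partials vs g x) \<le> Q / h (length vs) ^ length vs" if "set vs \<subseteq> Basis" "x \<in> S" for vs x
  proof (rule LIMSEQ_le_const2)
    show "(\<lambda>m. norm (partials vs (f m) x)) \<longlonglongrightarrow> norm (partials vs g x)"
      by (intro tendsto_norm g that)
    have "norm (partials vs (f m) x) \<le> Q / h (length vs) ^ length vs" for m
    proof -
      have "norm (partials vs (f m) x) \<le> jet (length vs) (h (length vs)) (f m) x / h (length vs) ^ length vs"
        by (rule norm_partials_le_jet) (use h that in auto)
      also have "\<dots> \<le> Q / h (length vs) ^ length vs"
        by (rule divide_right_mono) (use b[OF h that(2)] h in \<open>auto simp: jet_le_def less_imp_le\<close>)
      finally show ?thesis .
    qed
    then show "\<exists>N. \<forall>n\<ge>N. norm (partials vs (f n) x) \<le> Q / h (length vs) ^ length vs" by blast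
  qed
  then have "Cb_infinity S g" unfolding Cb_infinity_def using g(1) by blast
  moreover have "\<forall>\<mu>\<in>S. (\<lambda>m. f m \<mu>) \<longlonglongrightarrow> g \<mu>" using g(2)[of "[]"] by simp
  ultimately show ?thesis by blast
qed (auto simp: Cb_infinity_def C_infinity_on_def)

text \<open>The step maps are composed of continuous operations on \<open>BC\<close>, so the Picard
  recursion passes to the limit.\<close>

theorem fixed_point:
  "\<exists>g e y. Cb_infinity S g \<and> Cb_infinity S e \<and> Cb_infinity S y \<and>
    (\<forall>\<mu>\<in>S. g \<mu> = step_g d \<mu> (g \<mu>) (y \<mu>) \<and> e \<mu> = step_e d \<mu> (g \<mu>) (e \<mu>) \<and> y \<mu> = step_y d \<mu> (e \<mu>) (y \<mu>))"
proof -
  obtain g where g: "Cb_infinity S g" "\<And>\<mu>. \<mu> \<in> S \<Longrightarrow> (\<lambda>m. fst (picard d m \<mu>)) \<longlonglongrightarrow> g \<mu>"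
    using picard_limit_aux[of "\<lambda>m \<mu>. fst (picard d m \<mu>)",
      OF picard_bounds[THEN conjunct1] picard_differences[THEN conjunct1]] by blast
  obtain e where e: "Cb_infinity S e" "\<And>\<mu>. \<mu> \<in> S \<Longrightarrow> (\<lambda>m. fst (snd (picard d m \<mu>))) \<longlonglongrightarrow> e \<mu>"
    using picard_limit_aux[of "\<lambda>m \<mu>. fst (snd (picard d m \<mu>))",
      OF picard_bounds[THEN conjunct2, THEN conjunct1] picard_differences[THEN conjunct2, THEN conjunct1]] by blast
  obtain y where y: "Cb_infinity S y" "\<And>\<mu>. \<mu> \<in> S \<Longrightarrow> (\<lambda>m. snd (snd (picard d m \<mu>))) \<longlonglongrightarrow> y \<mu>"
    using picard_limit_aux[of "\<lambda>m \<mu>. snd (snd (picard d m \<mu>))",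
      OF picard_bounds[THEN conjunct2, THEN conjunct2] picard_differences[THEN conjunct2, THEN conjunct2]] by blast
  have bl: "bounded_linear (vint (wt i) d)" if "i \<le> 2" for i
    using weight.bounded_linear_vint[OF weight_wt[of d i]] d d_le_1 that by blast
  note T = bounded_linear.tendsto[OF bl[of 0]] bounded_linear.tendsto[OF bl[of 1]] bounded_linear.tendsto[OF bl[of 2]]
    bounded_linear.tendsto[OF bounded_linear_avg]
  have fp: "g \<mu> = step_g d \<mu> (g \<mu>) (y \<mu>)" "e \<mu> = step_e d \<mu> (g \<mu>) (e \<mu>)" "y \<mu> = step_y d \<mu> (e \<mu>) (y \<mu>)"
    if \<mu>: "\<mu> \<in> S" for \<mu>
  proof -
    note G = g(2)[OF \<mu>] and E = e(2)[OF \<mu>] and Y = y(2)[OF \<mu>]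
    have "(\<lambda>m. fst (picard d (Suc m) \<mu>)) \<longlonglongrightarrow> step_g d \<mu> (g \<mu>) (y \<mu>)"
      unfolding picard.simps(2) case_prod_unfold fst_conv snd_conv step_g_def
      by (intro tendsto_intros T G E Y) simp_all
    then show "g \<mu> = step_g d \<mu> (g \<mu>) (y \<mu>)" using LIMSEQ_Suc[OF G] LIMSEQ_unique by blast
    have "(\<lambda>m. fst (snd (picard d (Suc m) \<mu>))) \<longlonglongrightarrow> step_e d \<mu> (g \<mu>) (e \<mu>)"
      unfolding picard.simps(2) case_prod_unfold fst_conv snd_conv step_e_def
      by (intro tendsto_intros T G E Y) simp_all
    then show "e \<mu> = step_e d \<mu> (g \<mu>) (e \<mu>)" using LIMSEQ_Suc[OF E] LIMSEQ_unique by blast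
    have "(\<lambda>m. snd (snd (picard d (Suc m) \<mu>))) \<longlonglongrightarrow> step_y d \<mu> (e \<mu>) (y \<mu>)"
      unfolding picard.simps(2) case_prod_unfold fst_conv snd_conv step_y_def
      by (intro tendsto_intros T G E Y) simp_all
    then show "y \<mu> = step_y d \<mu> (e \<mu>) (y \<mu>)" using LIMSEQ_Suc[OF Y] LIMSEQ_unique by blast
  qed
  show ?thesis using g(1) e(1) y(1) fp by blast
qed

end

section \<open>Symbol classes\<close>

text \<open>
  \<open>symb n S W f\<close>: up to order \<open>n\<close>, every derivative of \<open>f\<close> with \<open>k\<close> horizontal and \<open>l\<close> vertical
  directions is \<open>O(W k / x\<^sub>3 ^ l)\<close> on \<open>S\<close>; parameter derivatives cost nothing.
\<close>
primrec symb :: "nat \<Rightarrow> ((real^4) \<times> (real^3)) set \<Rightarrow> (nat \<Rightarrow> real^3 \<Rightarrow> real) \<Rightarrow> ((real^4) \<times> (real^3) \<Rightarrow> 'b::real_normed_vector) \<Rightarrow> bool" where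
  "symb 0 S W f \<longleftrightarrow> (\<forall>z\<in>S. f differentiable (at z)) \<and> (\<exists>C. \<forall>z\<in>S. norm (f z) \<le> C * W 0 (snd z))"
| "symb (Suc n) S W f \<longleftrightarrow> (\<forall>z\<in>S. f differentiable (at z)) \<and> (\<exists>C. \<forall>z\<in>S. norm (f z) \<le> C * W 0 (snd z)) \<and>
     (\<forall>i\<in>{1,2}. symb n S (\<lambda>k. W (Suc k)) (dir_deriv (0, axis i 1) f)) \<and>
     symb n S (\<lambda>k x. W k x / x $ 3) (dir_deriv (0, axis 3 1) f) \<and>
     (\<forall>i. symb n S W (dir_deriv (axis i 1, 0) f))"

lemma symb_differentiable: "symb n S W f \<Longrightarrow> z \<in> S \<Longrightarrow> f differentiable (at z)"
  by (cases n) auto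

lemma symb_bound: "symb n S W f \<Longrightarrow> \<exists>C. \<forall>z\<in>S. norm (f z) \<le> C * W 0 (snd z)"
  by (cases n) auto

lemma symb_SucD:
  assumes "symb (Suc n) S W f"
  shows "\<And>z. z \<in> S \<Longrightarrow> f differentiable (at z)" "\<exists>C. \<forall>z\<in>S. norm (f z) \<le> C * W 0 (snd z)"
    "\<And>i. i \<in> {1,2} \<Longrightarrow> symb n S (\<lambda>k. W (Suc k)) (dir_deriv (0, axis i 1) f)"
    "symb n S (\<lambda>k x. W k x / x $ 3) (dir_deriv (0, axis 3 1) f)"
    "\<And>i. symb n S W (dir_deriv (axis i 1, 0) f)"
  using assms unfolding symb.simps(2) by blast+

lemma symb_Suc: "symb (Suc n) S W f \<Longrightarrow> symb n S W f"
proof (induction n arbitrary: W f)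
  case 0
  then show ?case using symb_SucD(1,2)[OF 0] by simp
next
  case (Suc n)
  note D = symb_SucD[OF Suc.prems]
  show ?case unfolding symb.simps(2) using D(1,2) Suc.IH[OF D(3)] Suc.IH[OF D(4)] Suc.IH[OF D(5)] by blast
qed

lemma symb_cong:
  assumes "open S" "\<And>z. z \<in> S \<Longrightarrow> f z = g z" "symb n S W f"
  shows "symb n S W g"
  using assms(2,3)
proof (induction n arbitrary: f g W)
  case 0
  then show ?case using differentiable_cong_open[OF assms(1), of _ f g] by auto
next
  case (Suc n)
  have *: "symb n S V (dir_deriv b g)" if "symb n S V (dir_deriv b f)" for V b
    by (rule Suc.IH[OF _ that]) (rule dir_deriv_cong[OF assms(1) _ Suc.prems(1)])
  show ?case using Suc.prems differentiable_cong_open[OF assms(1), of _ f g] by (auto intro: *)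
qed

lemma symb_SucI:
  assumes "open S" "\<And>z. z \<in> S \<Longrightarrow> (f has_derivative f' z) (at z)"
    and "\<exists>C. \<forall>z\<in>S. norm (f z) \<le> C * W 0 (snd z)"
    and "\<And>i. i \<in> {1,2} \<Longrightarrow> symb n S (\<lambda>k. W (Suc k)) (\<lambda>z. f' z (0, axis i 1))"
    and "symb n S (\<lambda>k x. W k x / x $ 3) (\<lambda>z. f' z (0, axis 3 1))"
    and "\<And>i. symb n S W (\<lambda>z. f' z (axis i 1, 0))"
  shows "symb (Suc n) S W f"
proof -
  have *: "symb n S V (dir_deriv b f)" if "symb n S V (\<lambda>z. f' z b)" for V b
    by (rule symb_cong[OF assms(1) _ that]) (use dir_deriv_eq[OF assms(2)] in auto)
  have "f differentiable (at z)" if "z \<in> S" for z by (rule differentiableI[OF assms(2)[OF that]])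
  then show ?thesis using assms(3) *[OF assms(4)] *[OF assms(5)] *[OF assms(6)] by simp
qed

lemma symb_0I:
  assumes "\<And>z. z \<in> S \<Longrightarrow> (f has_derivative f' z) (at z)"
    and "\<exists>C. \<forall>z\<in>S. norm (f z) \<le> C * W 0 (snd z)"
  shows "symb 0 S W f"
proof -
  have "f differentiable (at z)" if "z \<in> S" for z by (rule differentiableI[OF assms(1)[OF that]])
  then show ?thesis using assms(2) by simp
qed

lemma symb_zero: "symb n S W (\<lambda>z. 0)"
  by (induction n arbitrary: W) (auto intro!: exI[of _ 0])

lemma symb_add:
  assumes "open S" "symb n S W f" "symb n S W g"
  shows "symb n S W (\<lambda>z. f z + g z)"
  using assms(2,3)
proof (induction n arbitrary: f g W)
  case (Suc n)
  have d: "f differentiable (at z)" "g differentiable (at z)" if "z \<in> S" for z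
    using Suc.prems that by auto
  have b: "\<exists>C. \<forall>z\<in>S. norm (f z + g z) \<le> C * W 0 (snd z)"
  proof -
    obtain C1 C2 where "\<And>z. z \<in> S \<Longrightarrow> norm (f z) \<le> C1 * W 0 (snd z)" "\<And>z. z \<in> S \<Longrightarrow> norm (g z) \<le> C2 * W 0 (snd z)"
      using symb_bound[OF Suc.prems(1)] symb_bound[OF Suc.prems(2)] by blast
    then show ?thesis
      by (intro exI[of _ "C1 + C2"] ballI) (auto simp: distrib_right intro!: norm_triangle_le add_mono)
  qed
  have *: "symb n S V (dir_deriv b (\<lambda>z. f z + g z))" if "symb n S V (dir_deriv b f)" "symb n S V (dir_deriv b g)" for V b
    by (rule symb_cong[OF assms(1) _ Suc.IH[OF that]]) (simp add: d dir_deriv_add)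
  show ?case unfolding symb.simps(2)
    using b *[OF symb_SucD(3)[OF Suc.prems(1)] symb_SucD(3)[OF Suc.prems(2)]]
      *[OF symb_SucD(4)[OF Suc.prems(1)] symb_SucD(4)[OF Suc.prems(2)]]
      *[OF symb_SucD(5)[OF Suc.prems(1)] symb_SucD(5)[OF Suc.prems(2)]] differentiable_add[OF d] by blast
next
  case 0
  obtain C1 C2 where "\<And>z. z \<in> S \<Longrightarrow> norm (f z) \<le> C1 * W 0 (snd z)" "\<And>z. z \<in> S \<Longrightarrow> norm (g z) \<le> C2 * W 0 (snd z)"
    using symb_bound[OF 0(1)] symb_bound[OF 0(2)] by blast
  then have "\<exists>C. \<forall>z\<in>S. norm (f z + g z) \<le> C * W 0 (snd z)"
    by (intro exI[of _ "C1 + C2"] ballI) (auto simp: distrib_right intro!: norm_triangle_le add_mono)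
  then show ?case using 0 by auto
qed

text \<open>The condition on the weights ranges over all \<open>i\<close> and \<open>j\<close>
  because Leibniz's rule distributes the horizontal derivatives in every way. The induction
  generalises the weights, as each differentiation shifts the index or divides by x_3; nonnegativity
  is what allows two bounds to be multiplied.\<close>

lemma symb_bilinear:
  assumes "open S" "bounded_bilinear p" and pos: "\<And>z. z \<in> S \<Longrightarrow> 0 < snd z $ 3"
    and "symb n S W1 f" "symb n S W2 g"
    and "\<And>k z. z \<in> S \<Longrightarrow> 0 \<le> W1 k (snd z)" "\<And>k z. z \<in> S \<Longrightarrow> 0 \<le> W2 k (snd z)"
    and "\<And>i j. \<exists>C. \<forall>z\<in>S. W1 i (snd z) * W2 j (snd z) \<le> C * W (i + j) (snd z)"
  shows "symb n S W (\<lambda>z. p (f z) (g z))"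
  using assms(4-8)
proof (induction n arbitrary: f g W1 W2 W)
  case 0
  have b: "\<exists>C. \<forall>z\<in>S. norm (p (f z) (g z)) \<le> C * W 0 (snd z)"
    if b1: "\<exists>C. \<forall>z\<in>S. norm (f z) \<le> C * W1 0 (snd z)" and b2: "\<exists>C. \<forall>z\<in>S. norm (g z) \<le> C * W2 0 (snd z)"
      and n1: "\<And>k z. z \<in> S \<Longrightarrow> 0 \<le> W1 k (snd z)" and n2: "\<And>k z. z \<in> S \<Longrightarrow> 0 \<le> W2 k (snd z)"
      and c: "\<exists>C. \<forall>z\<in>S. W1 0 (snd z) * W2 0 (snd z) \<le> C * W 0 (snd z)" for f g and W1 W2 W :: "nat \<Rightarrow> real^3 \<Rightarrow> real"
  proof -
    obtain C1 C2 C3 where C: "\<And>z. z \<in> S \<Longrightarrow> norm (f z) \<le> C1 * W1 0 (snd z)" "\<And>z. z \<in> S \<Longrightarrow> norm (g z) \<le> C2 * W2 0 (snd z)"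
      "\<And>z. z \<in> S \<Longrightarrow> W1 0 (snd z) * W2 0 (snd z) \<le> C3 * W 0 (snd z)" using b1 b2 c by blast
    obtain K where K: "0 \<le> K" "\<And>a b. norm (p a b) \<le> norm a * norm b * K"
      using bounded_bilinear.nonneg_bounded[OF assms(2)] by blast
    have "norm (p (f z) (g z)) \<le> K * \<bar>C1\<bar> * \<bar>C2\<bar> * C3 * W 0 (snd z)" if z: "z \<in> S" for z
    proof -
      have "norm (f z) \<le> \<bar>C1\<bar> * W1 0 (snd z)" using C(1)[OF z] n1[OF z, of 0] mult_right_mono[of C1 "\<bar>C1\<bar>" "W1 0 (snd z)"] by linarith
      moreover have "norm (g z) \<le> \<bar>C2\<bar> * W2 0 (snd z)" using C(2)[OF z] n2[OF z, of 0] mult_right_mono[of C2 "\<bar>C2\<bar>" "W2 0 (snd z)"] by linarith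
      ultimately have "norm (f z) * norm (g z) \<le> (\<bar>C1\<bar> * W1 0 (snd z)) * (\<bar>C2\<bar> * W2 0 (snd z))"
        by (intro mult_mono mult_nonneg_nonneg n1 z) auto
      also have "\<dots> = \<bar>C1\<bar> * \<bar>C2\<bar> * (W1 0 (snd z) * W2 0 (snd z))" by (simp add: mult_ac)
      also have "\<dots> \<le> \<bar>C1\<bar> * \<bar>C2\<bar> * (C3 * W 0 (snd z))" by (intro mult_left_mono C(3) z) auto
      finally have "norm (f z) * norm (g z) * K \<le> (\<bar>C1\<bar> * \<bar>C2\<bar> * (C3 * W 0 (snd z))) * K" by (rule mult_right_mono) fact
      with K(2)[of "f z" "g z"] show ?thesis by (simp add: mult_ac)
    qed
    then show ?thesis by blast
  qed
  have "\<exists>C. \<forall>z\<in>S. norm (p (f z) (g z)) \<le> C * W 0 (snd z)"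
    by (rule b[where f=f and g=g and ?W1.0=W1 and ?W2.0=W2 and W=W, OF symb_bound[OF 0(1)] symb_bound[OF 0(2)] 0(3,4)])
      (use 0(5)[of 0 0] in auto)
  then show ?case
    using differentiable_bilinear[OF assms(2) symb_differentiable[OF 0(1)] symb_differentiable[OF 0(2)]] by simp
next
  case (Suc n)
  have d: "f differentiable (at z)" "g differentiable (at z)" if "z \<in> S" for z
    using Suc.prems that by auto
  have s0: "symb n S W1 f" "symb n S W2 g" using Suc.prems symb_Suc by blast+
  have bnd: "\<exists>C. \<forall>z\<in>S. norm (p (f z) (g z)) \<le> C * W 0 (snd z)"
    using symb_bound[OF Suc.IH[OF s0 Suc.prems(3-5)]] .
  have *: "symb n S V (dir_deriv b (\<lambda>z. p (f z) (g z)))"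
    if "symb n S V (\<lambda>z. p (dir_deriv b f z) (g z))" "symb n S V (\<lambda>z. p (f z) (dir_deriv b g z))" for V b
    by (rule symb_cong[OF assms(1) _ symb_add[OF assms(1) that]]) (simp add: d dir_deriv_bilinear[OF assms(2)])
  have c1: "\<exists>C. \<forall>z\<in>S. W1 (Suc i) (snd z) * W2 j (snd z) \<le> C * W (Suc (i + j)) (snd z)"
    and c2: "\<exists>C. \<forall>z\<in>S. W1 i (snd z) * W2 (Suc j) (snd z) \<le> C * W (Suc (i + j)) (snd z)" for i j
    using Suc.prems(5)[of "Suc i" j] Suc.prems(5)[of i "Suc j"] by auto
  have h: "symb n S (\<lambda>k. W (Suc k)) (dir_deriv (0, axis i 1) (\<lambda>z. p (f z) (g z)))" if i: "i \<in> {1,2}" for i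
  proof (rule *)
    have df: "symb n S (\<lambda>k. W1 (Suc k)) (dir_deriv (0, axis i 1) f)" and dg: "symb n S (\<lambda>k. W2 (Suc k)) (dir_deriv (0, axis i 1) g)"
      using Suc.prems i by auto
    show "symb n S (\<lambda>k. W (Suc k)) (\<lambda>z. p (dir_deriv (0, axis i 1) f z) (g z))"
      by (rule Suc.IH[OF df s0(2) Suc.prems(3,4) c1])
    show "symb n S (\<lambda>k. W (Suc k)) (\<lambda>z. p (f z) (dir_deriv (0, axis i 1) g z))"
      by (rule Suc.IH[OF s0(1) dg Suc.prems(3,4) c2])
  qed
  have q: "\<exists>C. \<forall>z\<in>S. W1 i (snd z) / snd z $ 3 * W2 j (snd z) \<le> C * (W (i + j) (snd z) / snd z $ 3)"
    "\<exists>C. \<forall>z\<in>S. W1 i (snd z) * (W2 j (snd z) / snd z $ 3) \<le> C * (W (i + j) (snd z) / snd z $ 3)" for i j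
  proof -
    obtain C where C: "\<And>z. z \<in> S \<Longrightarrow> W1 i (snd z) * W2 j (snd z) \<le> C * W (i + j) (snd z)" using Suc.prems(5) by blast
    have "W1 i (snd z) * W2 j (snd z) / snd z $ 3 \<le> C * W (i + j) (snd z) / snd z $ 3" if "z \<in> S" for z
      by (rule divide_right_mono[OF C[OF that]]) (use pos[OF that] in simp)
    then show "\<exists>C. \<forall>z\<in>S. W1 i (snd z) / snd z $ 3 * W2 j (snd z) \<le> C * (W (i + j) (snd z) / snd z $ 3)"
      "\<exists>C. \<forall>z\<in>S. W1 i (snd z) * (W2 j (snd z) / snd z $ 3) \<le> C * (W (i + j) (snd z) / snd z $ 3)"
      by (intro exI[of _ C]; simp)+
  qed
  have w: "0 \<le> W1 k (snd z) / snd z $ 3" "0 \<le> W2 k (snd z) / snd z $ 3" if "z \<in> S" for k z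
    using Suc.prems(3,4)[OF that, of k] pos[OF that] by auto
  have v: "symb n S (\<lambda>k x. W k x / x $ 3) (dir_deriv (0, axis 3 1) (\<lambda>z. p (f z) (g z)))"
  proof (rule *)
    have df: "symb n S (\<lambda>k x. W1 k x / x $ 3) (dir_deriv (0, axis 3 1) f)" and dg: "symb n S (\<lambda>k x. W2 k x / x $ 3) (dir_deriv (0, axis 3 1) g)"
      using Suc.prems by auto
    show "symb n S (\<lambda>k x. W k x / x $ 3) (\<lambda>z. p (dir_deriv (0, axis 3 1) f z) (g z))"
      by (rule Suc.IH[OF df s0(2) w(1) Suc.prems(4) q(1)])
    show "symb n S (\<lambda>k x. W k x / x $ 3) (\<lambda>z. p (f z) (dir_deriv (0, axis 3 1) g z))"
      by (rule Suc.IH[OF s0(1) dg Suc.prems(3) w(2) q(2)])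
  qed
  have m: "symb n S W (dir_deriv (axis i 1, 0) (\<lambda>z. p (f z) (g z)))" for i
  proof (rule *)
    have df: "symb n S W1 (dir_deriv (axis i 1, 0) f)" and dg: "symb n S W2 (dir_deriv (axis i 1, 0) g)"
      using Suc.prems by auto
    show "symb n S W (\<lambda>z. p (dir_deriv (axis i 1, 0) f z) (g z))"
      by (rule Suc.IH[OF df s0(2) Suc.prems(3-5)])
    show "symb n S W (\<lambda>z. p (f z) (dir_deriv (axis i 1, 0) g z))"
      by (rule Suc.IH[OF s0(1) dg Suc.prems(3-5)])
  qed
  show ?case unfolding symb.simps(2)
    using bnd h v m differentiable_bilinear[OF assms(2) d] by blast
qed

lemma symb_linear:
  assumes "open S" "bounded_linear T" "symb n S W f"
  shows "symb n S W (\<lambda>z. T (f z))"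
  using assms(3)
proof (induction n arbitrary: f W)
  case 0
  obtain C where C: "\<And>z. z \<in> S \<Longrightarrow> norm (f z) \<le> C * W 0 (snd z)" using symb_bound[OF 0] by blast
  obtain K where K: "0 \<le> K" "\<And>a. norm (T a) \<le> norm a * K" using bounded_linear.nonneg_bounded[OF assms(2)] by blast
  have "norm (T (f z)) \<le> K * C * W 0 (snd z)" if "z \<in> S" for z
    using K(2)[of "f z"] mult_right_mono[OF C[OF that] K(1)] by (simp add: mult_ac)
  then have "\<exists>C. \<forall>z\<in>S. norm (T (f z)) \<le> C * W 0 (snd z)" by blast
  then show ?case using differentiable_linear[OF assms(2) symb_differentiable[OF 0]] by simp
next
  case (Suc n)
  have d: "f differentiable (at z)" if "z \<in> S" for z using Suc.prems that by auto
  have *: "symb n S V (dir_deriv b (\<lambda>z. T (f z)))" if "symb n S V (dir_deriv b f)" for V b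
    by (rule symb_cong[OF assms(1) _ Suc.IH[OF that]]) (simp add: d dir_deriv_linear[OF assms(2)])
  show ?case unfolding symb.simps(2)
    using symb_bound[OF Suc.IH[OF symb_Suc[OF Suc.prems]]] *[OF symb_SucD(3)[OF Suc.prems]] *[OF symb_SucD(4)[OF Suc.prems]]
      *[OF symb_SucD(5)[OF Suc.prems]] differentiable_linear[OF assms(2) symb_SucD(1)[OF Suc.prems]] by blast
qed

lemma symb_mono:
  assumes pos: "\<And>z. z \<in> S \<Longrightarrow> 0 < snd z $ 3" and "symb n S W f"
    and "\<And>k z. z \<in> S \<Longrightarrow> 0 \<le> W k (snd z)" "\<And>k. \<exists>C. \<forall>z\<in>S. W k (snd z) \<le> C * W' k (snd z)"
  shows "symb n S W' f"
  using assms(2-)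
proof (induction n arbitrary: f W W')
  have b: "\<exists>C. \<forall>z\<in>S. norm (f z) \<le> C * W' 0 (snd z)"
    if b1: "\<exists>C. \<forall>z\<in>S. norm (f z) \<le> C * W 0 (snd z)" and n1: "\<And>k z. z \<in> S \<Longrightarrow> 0 \<le> W k (snd z)"
      and c: "\<exists>C. \<forall>z\<in>S. W 0 (snd z) \<le> C * W' 0 (snd z)" for f and W W' :: "nat \<Rightarrow> real^3 \<Rightarrow> real"
  proof -
    obtain C1 C2 where C: "\<And>z. z \<in> S \<Longrightarrow> norm (f z) \<le> C1 * W 0 (snd z)"
      "\<And>z. z \<in> S \<Longrightarrow> W 0 (snd z) \<le> C2 * W' 0 (snd z)" using b1 c by blast
    have "norm (f z) \<le> \<bar>C1\<bar> * C2 * W' 0 (snd z)" if z: "z \<in> S" for z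
    proof -
      have "norm (f z) \<le> \<bar>C1\<bar> * W 0 (snd z)"
        using C(1)[OF z] n1[OF z, of 0] mult_right_mono[of C1 "\<bar>C1\<bar>" "W 0 (snd z)"] by linarith
      also have "\<dots> \<le> \<bar>C1\<bar> * (C2 * W' 0 (snd z))" by (intro mult_left_mono C(2) z) auto
      finally show ?thesis by (simp add: mult_ac)
    qed
    then show ?thesis by blast
  qed
  {
    case 0
    have "\<exists>C. \<forall>z\<in>S. norm (f z) \<le> C * W' 0 (snd z)"
      by (rule b[of f W W', OF symb_bound[OF 0(1)] 0(2) 0(3)[of 0]])
    then show ?case using symb_differentiable[OF 0(1)] by simp
  next
    case (Suc n)
    have q: "\<exists>C. \<forall>z\<in>S. W k (snd z) / snd z $ 3 \<le> C * (W' k (snd z) / snd z $ 3)" for k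
    proof -
      obtain C where C: "\<And>z. z \<in> S \<Longrightarrow> W k (snd z) \<le> C * W' k (snd z)" using Suc.prems by blast
      have "W k (snd z) / snd z $ 3 \<le> C * W' k (snd z) / snd z $ 3" if "z \<in> S" for z
        by (rule divide_right_mono[OF C[OF that]]) (use pos[OF that] in simp)
      then show ?thesis by (intro exI[of _ C]) simp
    qed
    have 1: "symb n S (\<lambda>k. W' (Suc k)) (dir_deriv (0, axis i 1) f)" if "i \<in> {1,2}" for i
      by (rule Suc.IH[of "\<lambda>k. W (Suc k)", OF symb_SucD(3)[OF Suc.prems(1) that] Suc.prems(2) Suc.prems(3)])
    have 2: "symb n S (\<lambda>k x. W' k x / x $ 3) (dir_deriv (0, axis 3 1) f)"
      by (rule Suc.IH[of "\<lambda>k x. W k x / x $ 3", OF symb_SucD(4)[OF Suc.prems(1)] _ q])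
        (use Suc.prems(2) pos in \<open>auto simp: less_imp_le\<close>)
    have 3: "symb n S W' (dir_deriv (axis i 1, 0) f)" for i
      by (rule Suc.IH[of W, OF symb_SucD(5)[OF Suc.prems(1)] Suc.prems(2) Suc.prems(3)])
    show ?case unfolding symb.simps(2)
      using 1 2 3 b[of f W W', OF symb_SucD(2)[OF Suc.prems(1)] Suc.prems(2) Suc.prems(3)[of 0]] symb_SucD(1)[OF Suc.prems(1)] by blast
  }
qed

lemma Basis_param_space:
  "(b :: (real^4) \<times> (real^3)) \<in> Basis \<longleftrightarrow> (\<exists>i. b = (axis i 1, 0)) \<or> b = (0, axis 1 1) \<or> b = (0, axis 2 1) \<or> b = (0, axis 3 1)"
proof -
  have "(\<exists>i::3. P i) \<longleftrightarrow> P 1 \<or> P 2 \<or> P 3" for P by (metis exhaust_3)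
  then show ?thesis by (auto simp: Basis_prod_def Basis_vec_def image_iff)
qed

lemma symb_Ck: "symb n S W f \<Longrightarrow> Ck n S f"
proof (induction n arbitrary: W f)
  case (Suc n)
  have "Ck n S (dir_deriv b f)" if "b \<in> Basis" for b
    using that Suc.prems Suc.IH unfolding Basis_param_space by (auto intro: Suc.IH)
  then show ?case using Suc.prems by auto
qed auto

lemma C_infinity_on_symb: "(\<And>n. symb n S W f) \<Longrightarrow> C_infinity_on S f"
  unfolding C_infinity_on_iff_Ck using symb_Ck by blast

abbreviation (input) hcount :: "((real^4) \<times> (real^3)) list \<Rightarrow> nat" where
  "hcount vs \<equiv> count_list vs (0, axis 1 1) + count_list vs (0, axis 2 1)"

lemma axis_distinct:
  "(0::real^4, axis 1 1 :: real^3) \<noteq> (0, axis 2 1)" "(0::real^4, axis 1 1 :: real^3) \<noteq> (0, axis 3 1)"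
  "(0::real^4, axis 2 1 :: real^3) \<noteq> (0, axis 3 1)" "(axis i 1 :: real^4, 0 :: real^3) \<noteq> (0, b)"
  by (auto simp: axis_eq_axis axis_eq_0_iff)

lemma symb_partials:
  assumes "symb n S W f" "set vs \<subseteq> Basis" "length vs \<le> n"
  shows "\<exists>C. \<forall>z\<in>S. norm (partials vs f z) \<le> C * (W (hcount vs) (snd z) / (snd z $ 3) ^ count_list vs (0, axis 3 1))"
  using assms
proof (induction n arbitrary: W f vs)
  case 0
  then show ?case by auto
next
  case (Suc n)
  show ?case
  \<comment> \<open>The last entry of the list is the direction applied first, which is the one that
    the recursion of \<open>symb\<close> peels off.\<close>
  proof (cases vs rule: rev_cases)
    case Nil
    then show ?thesis using symb_bound[OF Suc.prems(1)] by simp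
  next
    case (snoc ws b)
    have ws: "set ws \<subseteq> Basis" "length ws \<le> n" and b: "b \<in> Basis" using Suc.prems snoc by auto
    have p: "partials vs f = partials ws (dir_deriv b f)" using snoc by (simp add: partials_append)
    have "(\<exists>i. b = (axis i 1, 0)) \<or> (\<exists>i\<in>{1,2}. b = (0, axis i 1)) \<or> b = (0, axis 3 1)" using b unfolding Basis_param_space by auto
    then consider i where "b = (axis i 1, 0)" | i where "i \<in> {1,2}" "b = (0, axis i 1)" | "b = (0, axis 3 1)"
      by blast
    then show ?thesis
    proof cases
      case 1
      have "symb n S W (dir_deriv b f)" using Suc.prems 1 by auto
      from Suc.IH[OF this ws] show ?thesis unfolding p using snoc 1 axis_distinct(4)[of i] by (simp add: count_list_append)
    next
      case 2
      have s: "symb n S (\<lambda>k. W (Suc k)) (dir_deriv b f)" using Suc.prems 2 by auto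
      have "hcount vs = Suc (hcount ws)" "count_list vs (0, axis 3 1) = count_list ws (0, axis 3 1)"
        using snoc 2 axis_distinct by (auto simp: count_list_append axis_eq_axis)
      with Suc.IH[OF s ws] show ?thesis unfolding p by simp
    next
      case 3
      have s: "symb n S (\<lambda>k x. W k x / x $ 3) (dir_deriv b f)" using Suc.prems 3 by auto
      have "hcount vs = hcount ws" "count_list vs (0, axis 3 1) = Suc (count_list ws (0, axis 3 1))"
        using snoc 3 axis_distinct by (auto simp: count_list_append axis_eq_axis)
      with Suc.IH[OF s ws] show ?thesis unfolding p by (simp add: mult_ac)
    qed
  qed
qed

section \<open>Geometry of the cone\<close>

abbreviation (input) qh :: "real^3 \<Rightarrow> real" where "qh x \<equiv> (x $ 1)\<^sup>2 + (x $ 2)\<^sup>2"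

lemma norm_horiz: "norm (horiz x) = sqrt (qh x)"
  by (simp add: horiz_def norm_vec_def L2_set_def sum_2 )

lemma rho_pos: "x \<in> punctured_cone d \<Longrightarrow> 0 < rho x" "x \<in> punctured_cone d \<Longrightarrow> rho x < d"
  "x \<in> punctured_cone d \<Longrightarrow> 0 < x $ 3" "x \<in> punctured_cone d \<Longrightarrow> 0 < norm (horiz x)" "x \<in> punctured_cone d \<Longrightarrow> 0 < qh x"
proof -
  assume x: "x \<in> punctured_cone d"
  show 3: "0 < x $ 3" and 4: "0 < norm (horiz x)" using x by (auto simp: punctured_cone_def cone_def)
  show "0 < rho x" using 3 4 by (simp add: rho_def)
  show "rho x < d" using x 3 by (simp add: rho_def punctured_cone_def cone_def divide_less_eq)
  show "0 < qh x" using 4 by (simp add: norm_horiz)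
qed

lemma punctured_cone_iff: "x \<in> punctured_cone d \<longleftrightarrow> 0 < x $ 3 \<and> 0 < rho x \<and> rho x < d"
proof
  assume "0 < x $ 3 \<and> 0 < rho x \<and> rho x < d"
  then show "x \<in> punctured_cone d"
    by (auto simp: punctured_cone_def cone_def rho_def divide_less_eq zero_less_divide_iff)
qed (use rho_pos in blast)

lemma open_punctured_cone: "open (punctured_cone d)"
proof -
  have "punctured_cone d = {x. sqrt (qh x) < d * x $ 3} \<inter> {x. 0 < x $ 3} \<inter> {x. 0 < sqrt (qh x)}"
    using norm_horiz by (auto simp: punctured_cone_def cone_def norm_horiz[symmetric])
  also have "open \<dots>" by (intro open_Int open_Collect_less continuous_intros)
  finally show ?thesis .
qed

text \<open>The derivative is written as \<rho> times the differential of ln \<rho>. In the chain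
  rule with Y' = F/\<rho> the factor \<rho> cancels and leaves F times rational functions of x
  alone.\<close>

lemma rho_has_derivative:
  assumes "x \<in> punctured_cone d"
  shows "(rho has_derivative (\<lambda>h. rho x * ((x $ 1 * h $ 1 + x $ 2 * h $ 2) / qh x - h $ 3 / x $ 3))) (at x)"
proof -
  note p = rho_pos(3,5)[OF assms]
  have "((\<lambda>x. sqrt (qh x) / x $ 3) has_derivative
     (\<lambda>h. (((2 * (x $ 1 * h $ 1) + 2 * (x $ 2 * h $ 2)) * (inverse (sqrt (qh x)) / 2)) * x $ 3 - sqrt (qh x) * h $ 3) / (x $ 3 * x $ 3))) (at x)"
    using p by (auto intro!: derivative_eq_intros bounded_linear_imp_has_derivative[OF bounded_linear_vec_nth]
        simp: algebra_simps)
  moreover have "(\<lambda>x. sqrt (qh x) / x $ 3) = rho" by (simp add: rho_def norm_horiz fun_eq_iff)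
  moreover have "(((2 * (x $ 1 * h $ 1) + 2 * (x $ 2 * h $ 2)) * (inverse (sqrt (qh x)) / 2)) * x $ 3 - sqrt (qh x) * h $ 3) / (x $ 3 * x $ 3)
     = rho x * ((x $ 1 * h $ 1 + x $ 2 * h $ 2) / qh x - h $ 3 / x $ 3)" for h :: "real^3"
  proof -
    have key: "((2 * a + 2 * c) * ((r / q) / 2) * z - r * b) / (z * z) = r / z * ((a + c) / q - b / z)"
      if "q \<noteq> 0" "z \<noteq> 0" for a b c r q z :: real
      using that by (simp add: field_simps)
    have "sqrt (qh x) * sqrt (qh x) = qh x" using p by simp
    moreover have "inverse r = r / (r * r)" if "r \<noteq> 0" for r :: real using that by (simp add: field_simps)
    ultimately have i: "inverse (sqrt (qh x)) = sqrt (qh x) / qh x" using p by (metis less_irrefl real_sqrt_gt_zero)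
    show ?thesis unfolding rho_def norm_horiz i by (rule key) (use p in auto)
  qed
  ultimately show ?thesis by simp
qed

section \<open>Smooth maps with bounded derivatives\<close>

lemma Cb_infinity_smooth: "Cb_infinity S f \<Longrightarrow> C_infinity_on S f"
  and Cb_infinity_partials: "Cb_infinity S f \<Longrightarrow> set vs \<subseteq> Basis \<Longrightarrow> \<exists>C. \<forall>x\<in>S. norm (partials vs f x) \<le> C"
  unfolding Cb_infinity_def by blast+

lemma Cb_infinity_bounded: "Cb_infinity S f \<Longrightarrow> \<exists>C. \<forall>x\<in>S. norm (f x) \<le> C"
  using Cb_infinity_partials[of S f "[]"] by simp

lemma Cb_infinity_dir_deriv:
  assumes "Cb_infinity S f" "b \<in> Basis" shows "Cb_infinity S (dir_deriv b f)"
  unfolding Cb_infinity_def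
proof (intro conjI allI impI)
  show "C_infinity_on S (dir_deriv b f)" using Cb_infinity_smooth[OF assms(1)] assms(2) by (rule C_infinity_on_dir_deriv)
  fix vs :: "'a list" assume "set vs \<subseteq> Basis"
  then have "set (vs @ [b]) \<subseteq> Basis" using assms by auto
  from Cb_infinity_partials[OF assms(1) this]
  show "\<exists>C. \<forall>x\<in>S. norm (partials vs (dir_deriv b f) x) \<le> C" by (simp add: partials_append)
qed

lemma Cb_infinity_iff_jet:
  "Cb_infinity S f \<longleftrightarrow> C_infinity_on S f \<and> (\<forall>k. \<exists>C. \<forall>x\<in>S. jet k 1 f x \<le> C)"
proof (intro iffI conjI allI)
  assume f: "Cb_infinity S f"
  show "C_infinity_on S f" using f by (simp add: Cb_infinity_def)
  fix k show "\<exists>C. \<forall>x\<in>S. jet k 1 f x \<le> C" using f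
  proof (induction k arbitrary: f)
    case 0
    then show ?case using Cb_infinity_bounded by simp
  next
    case (Suc k)
    have "Cb_infinity S (dir_deriv b f)" if "b \<in> Basis" for b
      using Cb_infinity_dir_deriv[OF Suc.prems that] .
    then have "\<forall>b\<in>Basis. \<exists>C. \<forall>x\<in>S. jet k 1 (dir_deriv b f) x \<le> C" using Suc.IH by blast
    then obtain C where C: "\<And>b x. b \<in> Basis \<Longrightarrow> x \<in> S \<Longrightarrow> jet k 1 (dir_deriv b f) x \<le> C b" by metis
    obtain C0 where C0: "\<And>x. x \<in> S \<Longrightarrow> jet k 1 f x \<le> C0" using Suc by blast
    have "jet (Suc k) 1 f x \<le> C0 + 1 * (\<Sum>b\<in>Basis. C b)" if "x \<in> S" for x
      unfolding jet.simps(2) using C0[OF that] C that by (intro add_mono mult_left_mono sum_mono) auto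
    then show ?case by blast
  qed
next
  assume f: "C_infinity_on S f \<and> (\<forall>k. \<exists>C. \<forall>x\<in>S. jet k 1 f x \<le> C)"
  show "Cb_infinity S f" unfolding Cb_infinity_def
  proof (intro conjI allI impI)
    show "C_infinity_on S f" using f by blast
    fix vs :: "'a list" assume vs: "set vs \<subseteq> Basis"
    obtain C where "\<And>x. x \<in> S \<Longrightarrow> jet (length vs) 1 f x \<le> C" using f by blast
    then have "norm (partials vs f x) \<le> C" if "x \<in> S" for x
      using norm_partials_le_jet[of 1 vs "length vs" f x] vs that by force
    then show "\<exists>C. \<forall>x\<in>S. norm (partials vs f x) \<le> C" by blast
  qed
qed

lemma Cb_infinity_const: "Cb_infinity S (\<lambda>x. c)"
  unfolding Cb_infinity_iff_jet by (auto simp: C_infinity_on_const jet_const)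

lemma Cb_infinity_add:
  assumes "open S" "Cb_infinity S f" "Cb_infinity S g"
  shows "Cb_infinity S (\<lambda>x. f x + g x)"
  unfolding Cb_infinity_iff_jet
proof (intro conjI allI)
  have s: "C_infinity_on S f" "C_infinity_on S g" using assms by (auto simp: Cb_infinity_def)
  show "C_infinity_on S (\<lambda>x. f x + g x)" by (rule C_infinity_on_add[OF assms(1) s])
  fix k
  obtain C1 C2 where "\<And>x. x \<in> S \<Longrightarrow> jet k 1 f x \<le> C1" "\<And>x. x \<in> S \<Longrightarrow> jet k 1 g x \<le> C2"
    using assms(2,3) unfolding Cb_infinity_iff_jet by blast
  then have "jet k 1 (\<lambda>x. f x + g x) x \<le> C1 + C2" if "x \<in> S" for x
    using jet_add[OF assms(1) _ that s, of 1 k] that by force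
  then show "\<exists>C. \<forall>x\<in>S. jet k 1 (\<lambda>x. f x + g x) x \<le> C" by blast
qed

lemma Cb_infinity_mult:
  fixes f g :: "'a::euclidean_space \<Rightarrow> 'b::real_normed_algebra"
  assumes "open S" "Cb_infinity S f" "Cb_infinity S g"
  shows "Cb_infinity S (\<lambda>x. f x * g x)"
  unfolding Cb_infinity_iff_jet
proof (intro conjI allI)
  have s: "C_infinity_on S f" "C_infinity_on S g" using assms by (auto simp: Cb_infinity_def)
  show "C_infinity_on S (\<lambda>x. f x * g x)" by (rule C_infinity_on_bilinear[OF assms(1) bounded_bilinear_mult s])
  fix k
  obtain C1 C2 where C: "\<And>x. x \<in> S \<Longrightarrow> jet k 1 f x \<le> C1" "\<And>x. x \<in> S \<Longrightarrow> jet k 1 g x \<le> C2"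
    using assms(2,3) unfolding Cb_infinity_iff_jet by blast
  have "jet k 1 (\<lambda>x. f x * g x) x \<le> C1 * C2" if "x \<in> S" for x
  proof -
    have "jet k 1 (\<lambda>x. f x * g x) x \<le> jet k 1 f x * jet k 1 g x"
      by (rule jet_bilinear[OF assms(1) _ that bounded_bilinear_mult norm_mult_ineq s]) simp
    also have "\<dots> \<le> C1 * C2"
      using C[OF that] order_trans[OF jet_nonneg C(1)[OF that]] by (intro mult_mono jet_nonneg) auto
    finally show ?thesis .
  qed
  then show "\<exists>C. \<forall>x\<in>S. jet k 1 (\<lambda>x. f x * g x) x \<le> C" by blast
qed

lemma Cb_infinity_linear:
  assumes "open S" "bounded_linear T" "Cb_infinity S f"
  shows "Cb_infinity S (\<lambda>x. T (f x))"
  unfolding Cb_infinity_iff_jet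
proof (intro conjI allI)
  have s: "C_infinity_on S f" using assms by (auto simp: Cb_infinity_def)
  show "C_infinity_on S (\<lambda>x. T (f x))" by (rule C_infinity_on_linear[OF assms(1,2) s])
  fix k
  obtain K where K: "0 \<le> K" "\<And>a. norm (T a) \<le> norm a * K" using bounded_linear.nonneg_bounded[OF assms(2)] by blast
  obtain C where C: "\<And>x. x \<in> S \<Longrightarrow> jet k 1 f x \<le> C" using assms(3) unfolding Cb_infinity_iff_jet by blast
  have "jet k 1 (\<lambda>x. T (f x)) x \<le> K * C" if "x \<in> S" for x
  proof -
    have "jet k 1 (\<lambda>x. T (f x)) x \<le> K * jet k 1 f x"
      by (rule jet_linear[OF assms(1) _ that assms(2) _ s]) (use K in \<open>simp_all add: mult.commute\<close>)
    also have "\<dots> \<le> K * C" by (intro mult_left_mono C that K)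
    finally show ?thesis .
  qed
  then show "\<exists>C. \<forall>x\<in>S. jet k 1 (\<lambda>x. T (f x)) x \<le> C" by blast
qed

lemma Cb_infinity_coord:
  assumes "bounded S" shows "Cb_infinity S (\<lambda>\<mu>::real^'n. \<mu> $ i)"
  unfolding Cb_infinity_iff_jet
proof (intro conjI allI)
  show "C_infinity_on S (\<lambda>\<mu>::real^'n. \<mu> $ i)" by (rule C_infinity_on_bounded_linear[OF bounded_linear_vec_nth])
  fix k
  obtain R where R: "\<And>x. x \<in> S \<Longrightarrow> norm x \<le> R" using assms by (auto simp: bounded_iff)
  have "jet k 1 (\<lambda>\<mu>::real^'n. \<mu> $ i) x \<le> R + real k * 1 * real DIM(real^'n)" if "x \<in> S" for x
  proof -
    have "jet k 1 (\<lambda>\<mu>::real^'n. \<mu> $ i) x \<le> norm (x $ i) + real k * 1 * real DIM(real^'n)"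
    proof (rule jet_bounded_linear_le[OF bounded_linear_vec_nth])
      show "norm (b $ i) \<le> 1" if "b \<in> Basis" for b :: "real^'n"
        using component_le_norm_cart[of b i] norm_Basis[OF that] by simp
    qed simp
    then show ?thesis using R[OF that] component_le_norm_cart[of x i] by simp
  qed
  then show "\<exists>C. \<forall>x\<in>S. jet k 1 (\<lambda>\<mu>::real^'n. \<mu> $ i) x \<le> C" by blast
qed

section \<open>Families regular under the Euler operator\<close>

text \<open>\<open>tame n V d Y\<close>: the operator \<open>\<rho> d/d\<rho>\<close> can be applied \<open>n\<close> times to \<open>Y\<close>, staying bounded and smooth in the parameter.\<close>
primrec tame :: "nat \<Rightarrow> (real^4) set \<Rightarrow> real \<Rightarrow> (real^4 \<Rightarrow> BC) \<Rightarrow> bool" where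
  "tame 0 V d Y \<longleftrightarrow> Cb_infinity V Y"
| "tame (Suc n) V d Y \<longleftrightarrow> Cb_infinity V Y \<and> (\<exists>F. tame n V d F \<and>
     (\<forall>\<mu>\<in>V. \<forall>\<rho>\<in>{0<..<d}. (apply_bcontfun (Y \<mu>) has_real_derivative F \<mu> \<rho> / \<rho>) (at \<rho>)))"

lemma tame_Cb: "tame n V d Y \<Longrightarrow> Cb_infinity V Y"
  by (cases n) auto

lemma tame_SucD:
  assumes "tame (Suc n) V d Y"
  shows "\<exists>F. tame n V d F \<and> (\<forall>\<mu> \<rho>. \<mu> \<in> V \<longrightarrow> 0 < \<rho> \<longrightarrow> \<rho> < d \<longrightarrow>
    (apply_bcontfun (Y \<mu>) has_real_derivative F \<mu> \<rho> / \<rho>) (at \<rho>))"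
  using assms unfolding tame.simps(2) by auto

lemma tame_SucI:
  assumes "Cb_infinity V Y" "tame n V d F"
    "\<And>\<mu> \<rho>. \<mu> \<in> V \<Longrightarrow> 0 < \<rho> \<Longrightarrow> \<rho> < d \<Longrightarrow> (apply_bcontfun (Y \<mu>) has_real_derivative F \<mu> \<rho> / \<rho>) (at \<rho>)"
  shows "tame (Suc n) V d Y"
  using assms by auto

lemma tame_Suc: "tame (Suc n) V d Y \<Longrightarrow> tame n V d Y"
proof (induction n arbitrary: Y)
  case 0
  then show ?case using tame_Cb by (simp only: tame.simps(1))
next
  case (Suc n)
  obtain F where F: "tame (Suc n) V d F" "\<And>\<mu> \<rho>. \<mu> \<in> V \<Longrightarrow> 0 < \<rho> \<Longrightarrow> \<rho> < d \<Longrightarrow> (apply_bcontfun (Y \<mu>) has_real_derivative F \<mu> \<rho> / \<rho>) (at \<rho>)"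
    using tame_SucD[OF Suc.prems] by blast
  show ?case by (rule tame_SucI[OF tame_Cb[OF Suc.prems] Suc.IH[OF F(1)] F(2)])
qed

context
  fixes V :: "(real^4) set" and d :: real
  assumes V: "open V"
begin

lemma tame_add: "tame n V d Y \<Longrightarrow> tame n V d Z \<Longrightarrow> tame n V d (\<lambda>\<mu>. Y \<mu> + Z \<mu>)"
proof (induction n arbitrary: Y Z)
  case (Suc n)
  obtain F where F: "tame n V d F" "\<And>\<mu> \<rho>. \<mu> \<in> V \<Longrightarrow> 0 < \<rho> \<Longrightarrow> \<rho> < d \<Longrightarrow> (apply_bcontfun (Y \<mu>) has_real_derivative F \<mu> \<rho> / \<rho>) (at \<rho>)"
    using tame_SucD[OF Suc.prems(1)] by blast
  obtain G where G: "tame n V d G" "\<And>\<mu> \<rho>. \<mu> \<in> V \<Longrightarrow> 0 < \<rho> \<Longrightarrow> \<rho> < d \<Longrightarrow> (apply_bcontfun (Z \<mu>) has_real_derivative G \<mu> \<rho> / \<rho>) (at \<rho>)"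
    using tame_SucD[OF Suc.prems(2)] by blast
  show ?case
  proof (rule tame_SucI[OF Cb_infinity_add[OF V tame_Cb[OF Suc.prems(1)] tame_Cb[OF Suc.prems(2)]] Suc.IH[OF F(1) G(1)]])
    fix \<mu> \<rho> assume a: "\<mu> \<in> V" "0 < \<rho>" "\<rho> < d"
    have "apply_bcontfun (Y \<mu> + Z \<mu>) = (\<lambda>t. Y \<mu> t + Z \<mu> t)" by auto
    then show "(apply_bcontfun (Y \<mu> + Z \<mu>) has_real_derivative (F \<mu> + G \<mu>) \<rho> / \<rho>) (at \<rho>)"
      using DERIV_add[OF F(2)[OF a] G(2)[OF a]] by (simp add: add_divide_distrib)
  qed
qed (simp add: Cb_infinity_add[OF V])

lemma tame_mult: "tame n V d Y \<Longrightarrow> tame n V d Z \<Longrightarrow> tame n V d (\<lambda>\<mu>. Y \<mu> * Z \<mu>)"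
proof (induction n arbitrary: Y Z)
  case (Suc n)
  obtain F where F: "tame n V d F" "\<And>\<mu> \<rho>. \<mu> \<in> V \<Longrightarrow> 0 < \<rho> \<Longrightarrow> \<rho> < d \<Longrightarrow> (apply_bcontfun (Y \<mu>) has_real_derivative F \<mu> \<rho> / \<rho>) (at \<rho>)"
    using tame_SucD[OF Suc.prems(1)] by blast
  obtain G where G: "tame n V d G" "\<And>\<mu> \<rho>. \<mu> \<in> V \<Longrightarrow> 0 < \<rho> \<Longrightarrow> \<rho> < d \<Longrightarrow> (apply_bcontfun (Z \<mu>) has_real_derivative G \<mu> \<rho> / \<rho>) (at \<rho>)"
    using tame_SucD[OF Suc.prems(2)] by blast
  note Y = tame_Suc[OF Suc.prems(1)] and Z = tame_Suc[OF Suc.prems(2)]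
  show ?case
  proof (rule tame_SucI[OF Cb_infinity_mult[OF V tame_Cb[OF Suc.prems(1)] tame_Cb[OF Suc.prems(2)]]
        tame_add[OF Suc.IH[OF F(1) Z] Suc.IH[OF Y G(1)]]])
    fix \<mu> \<rho> assume a: "\<mu> \<in> V" "0 < \<rho>" "\<rho> < d"
    have "apply_bcontfun (Y \<mu> * Z \<mu>) = (\<lambda>t. Y \<mu> t * Z \<mu> t)" by auto
    moreover have "F \<mu> \<rho> / \<rho> * Z \<mu> \<rho> + G \<mu> \<rho> / \<rho> * Y \<mu> \<rho> = (F \<mu> * Z \<mu> + Y \<mu> * G \<mu>) \<rho> / \<rho>"
      using a by (simp add: field_simps)
    ultimately show "(apply_bcontfun (Y \<mu> * Z \<mu>) has_real_derivative (F \<mu> * Z \<mu> + Y \<mu> * G \<mu>) \<rho> / \<rho>) (at \<rho>)"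
      using DERIV_mult[OF F(2)[OF a] G(2)[OF a]] by simp
  qed
qed (simp add: Cb_infinity_mult[OF V])

lemma tame_const_fun: 
  assumes "Cb_infinity V c" shows "tame n V d (\<lambda>\<mu>. cst (c \<mu>))"
proof -
  have C: "Cb_infinity V (\<lambda>\<mu>. cst (c \<mu>))" by (rule Cb_infinity_linear[OF V bounded_linear_const_bcontfun assms])
  have z: "tame n V d (\<lambda>\<mu>. 0)" for n
  proof (induction n)
    case (Suc n)
    show ?case
    proof (rule tame_SucI[OF Cb_infinity_const Suc])
      have "apply_bcontfun (0::BC) = (\<lambda>t. 0)" by auto
      then show "(apply_bcontfun (0::BC) has_real_derivative (0::BC) \<rho> / \<rho>) (at \<rho>)" for \<rho> by simp
    qed
  qed (simp add: Cb_infinity_const)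
  show ?thesis
  proof (cases n)
    case (Suc m)
    show ?thesis unfolding Suc
    proof (rule tame_SucI[OF C z])
      have "apply_bcontfun (cst r) = (\<lambda>t. r)" for r by auto
      then show "(apply_bcontfun (cst (c \<mu>)) has_real_derivative (0::BC) \<rho> / \<rho>) (at \<rho>)" for \<mu> \<rho> by simp
    qed
  qed (simp add: C)
qed

lemma tame_const: "tame n V d (\<lambda>\<mu>. cst c)"
  by (rule tame_const_fun[OF Cb_infinity_const])

lemma tame_scaleR: 
  assumes "tame n V d Y" shows "tame n V d (\<lambda>\<mu>. c *\<^sub>R Y \<mu>)"
proof -
  have "(\<lambda>\<mu>. c *\<^sub>R Y \<mu>) = (\<lambda>\<mu>. cst c * Y \<mu>)" by (intro ext bcontfun_eqI) simp
  then show ?thesis using tame_mult[OF tame_const assms] by simp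
qed

lemma tame_diff: "tame n V d Y \<Longrightarrow> tame n V d Z \<Longrightarrow> tame n V d (\<lambda>\<mu>. Y \<mu> - Z \<mu>)"
  using tame_add[OF _ tame_scaleR[of n Z "-1"]] by simp

text \<open>Differentiation in the parameter and in \<rho> are interchanged in integrated form: the
  difference of two values of \<open>Y\<close> is an integral of F/r. Both sides are bounded linear
  functionals of Banach-valued maps, so they can be differentiated in the parameter, and the
  fundamental theorem of calculus then returns to the derivative in \<rho>.\<close>

lemma tame_dir_deriv:
  assumes b: "b \<in> Basis"
  shows "tame n V d Y \<Longrightarrow> tame n V d (dir_deriv b Y)"
proof (induction n arbitrary: Y)
  case 0
  then show ?case using Cb_infinity_dir_deriv[OF _ b] by simp
next
  case (Suc n)
  obtain F where F: "tame n V d F" "\<And>\<mu> \<rho>. \<mu> \<in> V \<Longrightarrow> 0 < \<rho> \<Longrightarrow> \<rho> < d \<Longrightarrow> (apply_bcontfun (Y \<mu>) has_real_derivative F \<mu> \<rho> / \<rho>) (at \<rho>)"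
    using tame_SucD[OF Suc.prems] by blast
  have dY: "Y differentiable (at \<mu>)" if "\<mu> \<in> V" for \<mu>
    using C_infinity_on_differentiable[OF Cb_infinity_smooth[OF tame_Cb[OF Suc.prems]] that] .
  have dF: "F differentiable (at \<mu>)" if "\<mu> \<in> V" for \<mu>
    using C_infinity_on_differentiable[OF Cb_infinity_smooth[OF tame_Cb[OF F(1)]] that] .
  show ?case
  proof (rule tame_SucI[OF Cb_infinity_dir_deriv[OF tame_Cb[OF Suc.prems] b] Suc.IH[OF F(1)]])
    fix \<mu> \<rho> assume a: "\<mu> \<in> V" "0 < \<rho>" "\<rho> < d"
    \<comment> \<open>Any base point strictly between 0 and \<rho> would do; it keeps the kernel 1/r
      bounded.\<close>
    define a0 where "a0 = \<rho> / 2"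
    have a0: "0 < a0" "a0 < \<rho>" using a by (auto simp: a0_def)
    define L where "L t G = integral {a0..t} (\<lambda>r. apply_bcontfun G r / r)" for t and G :: BC
    have int: "(\<lambda>r. apply_bcontfun G r / r) integrable_on {a0..t}" for G t
      using a0 by (intro integrable_continuous_real continuous_intros) auto
    have blL: "bounded_linear (L t)" for t
    proof (rule bounded_linear_intro)
      show "L t (G + H) = L t G + L t H" for G H
        unfolding L_def by (simp add: add_divide_distrib integral_add int)
      show "L t (r *\<^sub>R G) = r *\<^sub>R L t G" for r G
        unfolding L_def by (simp add: times_divide_eq_right[symmetric] del: times_divide_eq_right)
      show "norm (L t G) \<le> norm G * (1 / a0 * \<bar>t - a0\<bar>)" for G
      proof (cases "a0 \<le> t")
        case True
        have "norm (L t G) \<le> (norm G / a0) * (t - a0)"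
          unfolding L_def
        proof (rule integral_bound[OF True])
          show "continuous_on {a0..t} (\<lambda>r. apply_bcontfun G r / r)" using a0 by (intro continuous_intros) auto
          show "norm (apply_bcontfun G r / r) \<le> norm G / a0" if "r \<in> {a0..t}" for r
            using that a0 norm_bounded[of G r] by (auto intro!: frac_le)
        qed
        then show ?thesis using True by simp
      qed (use a0 in \<open>simp add: L_def\<close>)
    qed
    have ftc: "L t (F \<nu>) = Y \<nu> t - Y \<nu> a0" if "\<nu> \<in> V" "a0 \<le> t" "t < d" for \<nu> t
      unfolding L_def
    proof (rule integral_unique, rule fundamental_theorem_of_calculus)
      show "(apply_bcontfun (Y \<nu>) has_vector_derivative F \<nu> r / r) (at r within {a0..t})" if "r \<in> {a0..t}" for r
        using F(2)[OF \<open>\<nu> \<in> V\<close>, of r] that a0 \<open>t < d\<close>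
        by (auto simp: has_real_derivative_iff_has_vector_derivative intro: has_vector_derivative_at_within)
    qed fact
    have eq: "L t (dir_deriv b F \<mu>) = dir_deriv b Y \<mu> t - dir_deriv b Y \<mu> a0" if t: "a0 \<le> t" "t < d" for t
    proof -
      have ev: "bounded_linear (\<lambda>G::BC. G t - G a0)"
        by (intro bounded_linear_sub bounded_linear_apply_bcontfun)
      have "L t (dir_deriv b F \<mu>) = dir_deriv b (\<lambda>\<nu>. L t (F \<nu>)) \<mu>"
        by (rule dir_deriv_linear[OF blL dF[OF a(1)], symmetric])
      also have "\<dots> = dir_deriv b (\<lambda>\<nu>. Y \<nu> t - Y \<nu> a0) \<mu>"
        by (rule dir_deriv_cong[OF V a(1)]) (rule ftc[OF _ t])
      also have "\<dots> = dir_deriv b Y \<mu> t - dir_deriv b Y \<mu> a0"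
        by (rule dir_deriv_linear[OF ev dY[OF a(1)]])
      finally show ?thesis .
    qed
    have "((\<lambda>t. L t (dir_deriv b F \<mu>)) has_real_derivative dir_deriv b F \<mu> \<rho> / \<rho>) (at \<rho> within {a0..d})"
      unfolding L_def
      by (rule integral_has_real_derivative) (use a a0 in \<open>auto intro!: continuous_intros\<close>)
    then have "((\<lambda>t. L t (dir_deriv b F \<mu>)) has_real_derivative dir_deriv b F \<mu> \<rho> / \<rho>) (at \<rho> within {a0<..<d})"
      by (rule DERIV_subset) auto
    then have "((\<lambda>t. L t (dir_deriv b F \<mu>)) has_real_derivative dir_deriv b F \<mu> \<rho> / \<rho>) (at \<rho>)"
      using a a0 at_within_open[of \<rho> "{a0<..<d}"] by simp
    then have "((\<lambda>t. L t (dir_deriv b F \<mu>) + dir_deriv b Y \<mu> a0) has_real_derivative dir_deriv b F \<mu> \<rho> / \<rho>) (at \<rho>)"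
      using DERIV_add[OF _ DERIV_const] by fastforce
    then show "(apply_bcontfun (dir_deriv b Y \<mu>) has_real_derivative dir_deriv b F \<mu> \<rho> / \<rho>) (at \<rho>)"
      by (rule has_field_derivative_transform_within_open[of _ _ _ "{a0<..<d}"]) (use a a0 eq in auto)
  qed
qed

end

section \<open>Symbols on the cone\<close>

text \<open>The zeros in \<open>Wc\<close> and \<open>Wx\<close> record derivatives that vanish
  identically. They keep products sharp: with the generic weight |x'|^(1-k) for a coordinate, its
  second derivative would meet the undifferentiated logarithm, and the estimate for k \<ge> 2 would
  retain a spurious ln \<rho>. \<open>Wn m\<close> is the class of order -m in |x'|.\<close>

definition Wc :: "(real^3 \<Rightarrow> real) \<Rightarrow> nat \<Rightarrow> real^3 \<Rightarrow> real" where
  "Wc g k x = (if k = 0 then g x else 0)"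
definition Wn :: "nat \<Rightarrow> nat \<Rightarrow> real^3 \<Rightarrow> real" where
  "Wn m k x = 1 / norm (horiz x) ^ (m + k)"
definition Wx :: "nat \<Rightarrow> real^3 \<Rightarrow> real" where
  "Wx k x = (if k = 0 then norm (horiz x) else if k = 1 then 1 else 0)"
definition Wl :: "nat \<Rightarrow> real^3 \<Rightarrow> real" where
  "Wl k x = (if k = 0 then \<bar>ln (rho x)\<bar> + 1 else 1 / norm (horiz x) ^ k)"

locale region =
  fixes V :: "(real^4) set" and d :: real
  assumes open_V: "open V" and bounded_V: "bounded V" and d_pos: "0 < d"
begin

abbreviation "S \<equiv> V \<times> punctured_cone d"

lemma open_S: "open S" by (rule open_Times[OF open_V open_punctured_cone])

lemma S_D: assumes "z \<in> S"
  shows "fst z \<in> V" "snd z \<in> punctured_cone d" "0 < snd z $ 3" "0 < norm (horiz (snd z))" "0 < qh (snd z)" "0 < rho (snd z)" "rho (snd z) < d"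
  using assms rho_pos[of "snd z" d] by auto

lemma W_nonneg:
  assumes "z \<in> S"
  shows "0 \<le> Wn m k (snd z)" "0 \<le> Wx k (snd z)" "0 \<le> Wl k (snd z)"
    "0 \<le> Wc (\<lambda>x. 1) k (snd z)" "0 \<le> Wc (\<lambda>x. 1 / x $ 3) k (snd z)"
  using S_D[OF assms] by (auto simp: Wn_def Wx_def Wl_def Wc_def)

lemma symb_product:
  fixes f g :: "(real^4) \<times> (real^3) \<Rightarrow> real"
  assumes "symb n S W1 f" "symb n S W2 g"
    and "\<And>k z. z \<in> S \<Longrightarrow> 0 \<le> W1 k (snd z)" "\<And>k z. z \<in> S \<Longrightarrow> 0 \<le> W2 k (snd z)"
    and "\<And>i j z. z \<in> S \<Longrightarrow> W1 i (snd z) * W2 j (snd z) \<le> W (i + j) (snd z)"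
  shows "symb n S W (\<lambda>z. f z * g z)"
  by (rule symb_bilinear[OF open_S bounded_bilinear_mult S_D(3) assms(1-4)])
    (use assms(5) in \<open>auto intro!: exI[of _ 1]\<close>)

lemma symb_cmult:
  fixes f :: "(real^4) \<times> (real^3) \<Rightarrow> real"
  assumes "symb n S W f" shows "symb n S W (\<lambda>z. c * f z)"
  by (rule symb_linear[OF open_S bounded_linear_mult_right assms])

lemma symb_uminus:
  fixes f :: "(real^4) \<times> (real^3) \<Rightarrow> real"
  assumes "symb n S W f" shows "symb n S W (\<lambda>z. - f z)"
  using symb_cmult[OF assms, of "-1"] by simp

lemma hd_snd: "((\<lambda>z::(real^4) \<times> (real^3). snd z $ j) has_derivative (\<lambda>h. snd h $ j)) (at z)"
  by (rule bounded_linear_imp_has_derivative[OF bounded_linear_compose[OF bounded_linear_vec_nth bounded_linear_snd]])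

lemma hd_fst: "((\<lambda>z::(real^4) \<times> (real^3). fst z $ j) has_derivative (\<lambda>h. fst h $ j)) (at z)"
  by (rule bounded_linear_imp_has_derivative[OF bounded_linear_compose[OF bounded_linear_vec_nth bounded_linear_fst]])

lemma symb_const: "symb n S (Wc (\<lambda>x. 1)) (\<lambda>z. c :: real)"
proof (cases n)
  case 0
  show ?thesis unfolding 0 by (rule symb_0I, rule has_derivative_const) (auto simp: Wc_def)
next
  case (Suc m)
  show ?thesis unfolding Suc
    by (rule symb_SucI[OF open_S], rule has_derivative_const) (auto simp: Wc_def intro: symb_zero)
qed

lemma symb_param: "symb n S (Wc (\<lambda>x. 1)) (\<lambda>z. fst z $ i)"
proof -
  obtain R where R: "\<And>x. x \<in> V \<Longrightarrow> norm x \<le> R" using bounded_V by (auto simp: bounded_iff)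
  then have b: "\<exists>C. \<forall>z\<in>S. norm (fst z $ i) \<le> C * Wc (\<lambda>x. 1) 0 (snd z)"
    using component_le_norm_cart order_trans by (intro exI[of _ R]) (fastforce simp: Wc_def)
  show ?thesis
  proof (cases n)
    case 0
    show ?thesis unfolding 0 by (rule symb_0I, rule hd_fst, rule b)
  next
    case (Suc m)
    show ?thesis unfolding Suc
      by (rule symb_SucI[OF open_S], rule hd_fst, rule b) (auto intro: symb_zero symb_const)
  qed
qed

lemma abs_coord_le: "j \<in> {1,2} \<Longrightarrow> \<bar>x $ j\<bar> \<le> norm (horiz x)"
  unfolding norm_horiz by (auto intro: real_le_rsqrt simp: real_le_rsqrt)

lemma symb_coord: assumes j: "j \<in> {1,2}" shows "symb n S Wx (\<lambda>z. snd z $ j)"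
proof -
  have b: "\<exists>C. \<forall>z\<in>S. norm (snd z $ j) \<le> C * Wx 0 (snd z)"
    using abs_coord_le[OF j] by (intro exI[of _ 1]) (auto simp: Wx_def)
  show ?thesis
  proof (cases n)
    case 0
    show ?thesis unfolding 0 by (rule symb_0I, rule hd_snd, rule b)
  next
    case (Suc m)
    have W: "(\<lambda>k. Wx (Suc k)) = Wc (\<lambda>x. 1)" by (auto simp: Wx_def Wc_def fun_eq_iff)
    have *: "axis 3 1 $ j = (0::real)" using j by (auto simp: axis_def)
    show ?thesis unfolding Suc
      by (rule symb_SucI[OF open_S], rule hd_snd, rule b) (auto intro: symb_zero symb_const simp: W *)
  qed
qed

text \<open>The derivative of 1/x_3 is minus its square, so the product rule for symbols raises the
  order by feeding the class back into itself; 1/|x'|^2 is treated in the same way below.\<close>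

lemma symb_inverse_x3: "symb n S (Wc (\<lambda>x. 1 / x $ 3)) (\<lambda>z. 1 / snd z $ 3)"
proof (induction n)
  have hd: "((\<lambda>z. 1 / snd z $ 3) has_derivative (\<lambda>h. - (1 / snd z $ 3) * (1 / snd z $ 3) * snd h $ 3)) (at z)" if "z \<in> S" for z
    using S_D(3)[OF that] by (auto intro!: derivative_eq_intros hd_snd simp: field_simps power2_eq_square)
  have b: "\<exists>C. \<forall>z\<in>S. norm (1 / snd z $ 3) \<le> C * Wc (\<lambda>x. 1 / x $ 3) 0 (snd z)"
    using S_D(3) by (intro exI[of _ 1]) (force simp: Wc_def)
  {
    case 0
    show ?case by (rule symb_0I, erule hd, rule b)
  next
    case (Suc n)
    have "symb n S (\<lambda>k x. Wc (\<lambda>x. 1 / x $ 3) k x / x $ 3) (\<lambda>z. (1 / snd z $ 3) * (1 / snd z $ 3))"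
      by (rule symb_product[OF Suc Suc]) (auto simp: W_nonneg, auto simp: Wc_def)
    note * = symb_uminus[OF this]
    show ?case
      by (rule symb_SucI[OF open_S], erule hd, rule b) (use * in \<open>auto intro: symb_zero simp: axis_def\<close>)
  }
qed

lemma symb_inverse_qh: "symb n S (Wn 2) (\<lambda>z. 1 / qh (snd z))"
proof (induction n)
  have hd: "((\<lambda>z. 1 / qh (snd z)) has_derivative
      (\<lambda>h. - 2 * ((snd z $ 1 * snd h $ 1 + snd z $ 2 * snd h $ 2) * (1 / qh (snd z) * (1 / qh (snd z)))))) (at z)" if "z \<in> S" for z
    using S_D(5)[OF that] by (auto intro!: derivative_eq_intros hd_snd simp: field_simps power2_eq_square)
  have b: "\<exists>C. \<forall>z\<in>S. norm (1 / qh (snd z)) \<le> C * Wn 2 0 (snd z)"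
    using S_D(5) by (intro exI[of _ 1]) (force simp: Wn_def norm_horiz)
  {
    case 0
    show ?case by (rule symb_0I, erule hd, rule b)
  next
    case (Suc n)
    have 1: "symb n S (Wn 4) (\<lambda>z. 1 / qh (snd z) * (1 / qh (snd z)))"
      by (rule symb_product[OF Suc Suc]) (auto simp: W_nonneg, auto simp: Wn_def eval_nat_numeral power_add mult_ac)
    have "symb n S (\<lambda>k. Wn 2 (Suc k)) (\<lambda>z. snd z $ i * (1 / qh (snd z) * (1 / qh (snd z))))" if "i \<in> {1,2}" for i
    proof (rule symb_product[OF symb_coord[OF that] 1 W_nonneg(2) W_nonneg(1)])
      fix i j z assume "z \<in> S"
      then have "0 < norm (horiz (snd z))" by (rule S_D)
      then show "Wx i (snd z) * Wn 4 j (snd z) \<le> Wn 2 (Suc (i + j)) (snd z)"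
        by (auto simp: Wx_def Wn_def field_simps eval_nat_numeral)
    qed
    note * = symb_cmult[OF this, where c="-2"]
    show ?case
      by (rule symb_SucI[OF open_S], erule hd, rule b) (use *[of 1] *[of 2] in \<open>auto intro: symb_zero simp: axis_def\<close>)
  }
qed

lemma symb_coord_div_qh:
  assumes "i \<in> {1,2}" shows "symb n S (Wn 1) (\<lambda>z. snd z $ i * (1 / qh (snd z)))"
proof (rule symb_product[OF symb_coord[OF assms] symb_inverse_qh W_nonneg(2) W_nonneg(1)])
  fix i j z assume "z \<in> S"
  then have "0 < norm (horiz (snd z))" by (rule S_D)
  then show "Wx i (snd z) * Wn 2 j (snd z) \<le> Wn 1 (i + j) (snd z)"
    by (auto simp: Wx_def Wn_def field_simps eval_nat_numeral)
qed

text \<open>Only the function itself carries a logarithm, as its differential x'.dx'/|x'|^2 -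
  dx_3/x_3 is rational. The summand 1 in \<open>Wl 0\<close> absorbs the bounded vertical derivative
  after scaling by x_3.\<close>

lemma symb_ln_rho: "symb n S Wl (\<lambda>z. ln (rho (snd z)))"
proof -
  have hd: "((\<lambda>z. ln (rho (snd z))) has_derivative
      (\<lambda>h. snd h $ 1 * (snd z $ 1 * (1 / qh (snd z))) + snd h $ 2 * (snd z $ 2 * (1 / qh (snd z))) - snd h $ 3 * (1 / snd z $ 3))) (at z)"
    if "z \<in> S" for z
  proof -
    have r: "((\<lambda>z. rho (snd z)) has_derivative (\<lambda>h. rho (snd z) *
       ((snd z $ 1 * snd h $ 1 + snd z $ 2 * snd h $ 2) / qh (snd z) - snd h $ 3 / snd z $ 3))) (at z)"
      by (rule has_derivative_compose[OF bounded_linear_imp_has_derivative[OF bounded_linear_snd] rho_has_derivative[OF S_D(2)[OF that]]])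
    have "inverse \<rho> * (\<rho> * ((a * b + c * e) / q - f / g)) = b * (a * (1 / q)) + e * (c * (1 / q)) - f * (1 / g)"
      if "\<rho> \<noteq> 0" for \<rho> a b c e q f g :: real using that by (simp add: field_simps add_divide_distrib)
    then show ?thesis using S_D(6)[OF that]
      by (intro has_derivative_eq_rhs[OF has_derivative_compose[OF r DERIV_ln[THEN has_field_derivative_imp_has_derivative]]]) auto
  qed
  have b: "\<exists>C. \<forall>z\<in>S. norm (ln (rho (snd z))) \<le> C * Wl 0 (snd z)"
    by (intro exI[of _ 1]) (auto simp: Wl_def)
  show ?thesis
  proof (cases n)
    case 0
    show ?thesis unfolding 0 by (rule symb_0I, erule hd, rule b)
  next
    case (Suc m)
    have W: "(\<lambda>k. Wl (Suc k)) = Wn 1" by (auto simp: Wl_def Wn_def fun_eq_iff)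
    have "symb m S (\<lambda>k x. Wl k x / x $ 3) (\<lambda>z. 1 / snd z $ 3)"
    proof (rule symb_mono[where S=S and W="Wc (\<lambda>x. 1 / x $ 3)"])
      show "\<exists>C. \<forall>z\<in>S. Wc (\<lambda>x. 1 / x $ 3) k (snd z) \<le> C * (Wl k (snd z) / snd z $ 3)" for k
      proof (intro exI[of _ 1] ballI)
        show "Wc (\<lambda>x. 1 / x $ 3) k (snd z) \<le> 1 * (Wl k (snd z) / snd z $ 3)" if "z \<in> S" for z
          using S_D(3,4)[OF that] by (auto simp: Wc_def Wl_def divide_right_mono)
      qed
    qed (fact S_D(3) symb_inverse_x3 W_nonneg(5))+
    note * = symb_uminus[OF this] symb_coord_div_qh[of 1 m] symb_coord_div_qh[of 2 m]
    show ?thesis unfolding Suc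
      by (rule symb_SucI[OF open_S], erule hd, rule b) (use * in \<open>auto intro: symb_zero simp: axis_def W\<close>)
  qed
qed

section \<open>Evaluation of tame families at (\<mu>, \<rho>(x))\<close>

definition evD :: "(real^4 \<Rightarrow> BC) \<Rightarrow> (real^4 \<Rightarrow> BC) \<Rightarrow> (real^4) \<times> (real^3) \<Rightarrow> (real^4) \<times> (real^3) \<Rightarrow> real" where
  "evD Y F z h = dir_deriv (fst h) Y (fst z) (rho (snd z)) + F (fst z) (rho (snd z)) *
       (snd h $ 1 * (snd z $ 1 * (1 / qh (snd z))) + snd h $ 2 * (snd z $ 2 * (1 / qh (snd z))) - snd h $ 3 * (1 / snd z $ 3))"

text \<open>Joint differentiability in (\<mu>, \<rho>) requires one of the partial derivatives to be
  jointly continuous. For the \<rho>-derivative this follows from continuity of \<open>F\<close>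
  into the sup norm together with continuity of each single profile \<open>F \<mu>\<close>.\<close>

lemma ev_has_derivative:
  assumes Y: "tame (Suc n) V d Y" and F: "tame m V d F"
    and YF: "\<And>\<mu> \<rho>. \<mu> \<in> V \<Longrightarrow> 0 < \<rho> \<Longrightarrow> \<rho> < d \<Longrightarrow> (apply_bcontfun (Y \<mu>) has_real_derivative F \<mu> \<rho> / \<rho>) (at \<rho>)"
    and z: "z \<in> S"
  shows "((\<lambda>z. Y (fst z) (rho (snd z))) has_derivative
    evD Y F z) (at z)"
proof -
  obtain \<mu> x where zz: "z = (\<mu>, x)" by (cases z)
  note p = S_D[OF z, unfolded zz fst_conv snd_conv]
  let ?\<rho> = "rho x"
  have dY: "(Y has_derivative (\<lambda>v. dir_deriv v Y \<mu>)) (at \<mu>)"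
    unfolding dir_deriv_def using C_infinity_on_differentiable[OF Cb_infinity_smooth[OF tame_Cb[OF Y]] p(1)]
    by (simp add: frechet_derivative_works[symmetric])
  have cF: "isCont F \<mu>" using C_infinity_on_differentiable[OF Cb_infinity_smooth[OF tame_Cb[OF F]] p(1)]
    by (rule differentiable_imp_continuous_within)
  have joint: "((\<lambda>(\<mu>, \<rho>). Y \<mu> \<rho>) has_derivative
      (\<lambda>(tx, ty). dir_deriv tx Y \<mu> ?\<rho> + blinfun_scaleR_right (F \<mu> ?\<rho> / ?\<rho>) ty)) (at (\<mu>, ?\<rho>) within V \<times> {0<..<d})"
  proof (rule has_derivative_partialsI[where fy="\<lambda>\<mu> \<rho>. blinfun_scaleR_right (F \<mu> \<rho> / \<rho>)"])
    show "((\<lambda>\<mu>. Y \<mu> ?\<rho>) has_derivative (\<lambda>tx. dir_deriv tx Y \<mu> ?\<rho>)) (at \<mu> within V)"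
      by (rule has_derivative_at_withinI[OF bounded_linear.has_derivative[OF bounded_linear_apply_bcontfun dY]])
    show "((\<lambda>\<rho>. Y \<mu> \<rho>) has_derivative blinfun_apply (blinfun_scaleR_right (F \<mu> \<rho> / \<rho>))) (at \<rho> within {0<..<d})"
      if "\<mu> \<in> V" "\<rho> \<in> {0<..<d}" for \<mu> \<rho>
    proof -
      have *: "blinfun_apply (blinfun_scaleR_right r) = (*) r" for r :: real by (auto simp: fun_eq_iff)
      show ?thesis unfolding *
        by (rule has_derivative_at_withinI[OF has_field_derivative_imp_has_derivative[OF YF]]) (use that in auto)
    qed
    have "((\<lambda>w. F (fst w) (snd w)) \<longlongrightarrow> F \<mu> ?\<rho>) (at (\<mu>, ?\<rho>))"
    proof -
      have "((\<lambda>w. norm (F (fst w) - F \<mu>)) \<longlongrightarrow> 0) (at (\<mu>, ?\<rho>))"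
      proof -
        have "isCont (\<lambda>w. norm (F (fst w) - F \<mu>)) (\<mu>, ?\<rho>)"
          by (intro continuous_intros isCont_o2[OF isCont_fst[OF continuous_ident]]) (simp add: cF)
        then show ?thesis by (simp add: isCont_def)
      qed
      then have 1: "((\<lambda>w. (F (fst w) - F \<mu>) (snd w)) \<longlongrightarrow> 0) (at (\<mu>, ?\<rho>))"
        by (rule Lim_null_comparison[rotated]) (intro always_eventually allI norm_bounded)
      have 2: "((\<lambda>w. F \<mu> (snd w)) \<longlongrightarrow> F \<mu> ?\<rho>) (at (\<mu>, ?\<rho>))"
      proof -
        have A: "isCont (apply_bcontfun (F \<mu>)) ?\<rho>"
          by (rule continuous_on_interior[OF continuous_on_apply_bcontfun[of UNIV]]) simp
        have B: "((\<lambda>w. snd w) \<longlongrightarrow> ?\<rho>) (at (\<mu>, ?\<rho>))" by (intro tendsto_eq_intros) auto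
        show ?thesis by (rule isCont_tendsto_compose[OF A B])
      qed
      show ?thesis using tendsto_add[OF 1 2] by simp
    qed
    then have "((\<lambda>w. F (fst w) (snd w)) \<longlongrightarrow> F \<mu> ?\<rho>) (at (\<mu>, ?\<rho>) within V \<times> {0<..<d})"
      by (rule tendsto_within_subset) simp
    moreover have "((\<lambda>w. snd w) \<longlongrightarrow> ?\<rho>) (at (\<mu>, ?\<rho>) within V \<times> {0<..<d})"
      by (intro tendsto_eq_intros) auto
    ultimately have "((\<lambda>w. F (fst w) (snd w) / snd w) \<longlongrightarrow> F \<mu> ?\<rho> / ?\<rho>) (at (\<mu>, ?\<rho>) within V \<times> {0<..<d})"
      using p by (intro tendsto_divide) auto
    then have "((\<lambda>w. blinfun_scaleR_right (F (fst w) (snd w) / snd w) :: real \<Rightarrow>\<^sub>L real)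
        \<longlongrightarrow> blinfun_scaleR_right (F \<mu> ?\<rho> / ?\<rho>)) (at (\<mu>, ?\<rho>) within V \<times> {0<..<d})"
      by (rule bounded_linear.tendsto[OF bounded_linear_blinfun_scaleR_right])
    then show "continuous (at (\<mu>, ?\<rho>) within V \<times> {0<..<d}) (\<lambda>(\<mu>, \<rho>). blinfun_scaleR_right (F \<mu> \<rho> / \<rho>) :: real \<Rightarrow>\<^sub>L real)"
      by (simp add: continuous_within case_prod_unfold)
    show "?\<rho> \<in> {0<..<d}" using p by simp
    show "convex {0<..<d}" by simp
  qed
  have op: "open (V \<times> {0<..<d})" by (intro open_Times open_V open_greaterThanLessThan)
  have "(\<mu>, ?\<rho>) \<in> V \<times> {0<..<d}" using p by simp
  then have joint': "((\<lambda>(\<mu>, \<rho>). Y \<mu> \<rho>) has_derivative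
      (\<lambda>(tx, ty). dir_deriv tx Y \<mu> ?\<rho> + blinfun_scaleR_right (F \<mu> ?\<rho> / ?\<rho>) ty)) (at (\<mu>, ?\<rho>))"
    using joint op at_within_open by metis
  have r: "((\<lambda>z. (fst z, rho (snd z))) has_derivative (\<lambda>h. (fst h, rho (snd z) *
       ((snd z $ 1 * snd h $ 1 + snd z $ 2 * snd h $ 2) / qh (snd z) - snd h $ 3 / snd z $ 3)))) (at z)"
    by (intro has_derivative_Pair has_derivative_fst[OF has_derivative_ident]
       has_derivative_compose[OF bounded_linear_imp_has_derivative[OF bounded_linear_snd] rho_has_derivative[OF S_D(2)[OF z]]])
  have joint'': "((\<lambda>(\<mu>, \<rho>). Y \<mu> \<rho>) has_derivative
      (\<lambda>(tx, ty). dir_deriv tx Y \<mu> ?\<rho> + blinfun_scaleR_right (F \<mu> ?\<rho> / ?\<rho>) ty)) (at (fst z, rho (snd z)))"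
    using joint' by (simp add: zz)
  have alg: "G / \<rho> * (\<rho> * ((a * b + c * e) / q - f / g)) = G * (b * (a * (1 / q)) + e * (c * (1 / q)) - f * (1 / g))"
    if "\<rho> \<noteq> 0" for G \<rho> a b c e q f g :: real using that by (simp add: field_simps add_divide_distrib)
  show ?thesis
    by (rule has_derivative_eq_rhs[OF has_derivative_compose[OF r joint'', unfolded case_prod_unfold fst_conv snd_conv]])
      (use p alg[of "rho x"] in \<open>auto simp: zz fun_eq_iff evD_def\<close>)
qed

text \<open>The first level of \<open>tame\<close> pays for differentiability, which even order 0
  demands. Every further derivative uses one level and stays in the class: horizontally it yields F
  x_i/|x'|^2, vertically -F/x_3, and in the parameter a derivative of \<open>Y\<close>, which is
  tame again.\<close>

lemma symb_ev: "tame (Suc n) V d Y \<Longrightarrow> symb n S (Wn 0) (\<lambda>z. Y (fst z) (rho (snd z)))"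
proof (induction n arbitrary: Y)
  have b: "\<exists>C. \<forall>z\<in>S. norm (Y (fst z) (rho (snd z))) \<le> C * Wn 0 0 (snd z)" if Y: "tame m V d Y" for m Y
  proof -
    obtain C where C: "\<And>\<mu>. \<mu> \<in> V \<Longrightarrow> norm (Y \<mu>) \<le> C" using Cb_infinity_bounded[OF tame_Cb[OF Y]] by blast
    have "norm (Y (fst z) (rho (snd z))) \<le> C * Wn 0 0 (snd z)" if "z \<in> S" for z
      using order_trans[OF norm_bounded C[OF S_D(1)[OF that]]] by (simp add: Wn_def)
    then show ?thesis by blast
  qed
  {
    case 0
    obtain F where F: "tame 0 V d F" "\<And>\<mu> \<rho>. \<mu> \<in> V \<Longrightarrow> 0 < \<rho> \<Longrightarrow> \<rho> < d \<Longrightarrow> (apply_bcontfun (Y \<mu>) has_real_derivative F \<mu> \<rho> / \<rho>) (at \<rho>)"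
      using tame_SucD[OF 0] by blast
    have hd: "((\<lambda>z. Y (fst z) (rho (snd z))) has_derivative evD Y F z) (at z)" if "z \<in> S" for z
      by (rule ev_has_derivative[OF 0 F that])
    have "\<exists>C. \<forall>z\<in>S. norm (Y (fst z) (rho (snd z))) \<le> C * Wn 0 0 (snd z)" by (rule b[OF 0])
    then show ?case using hd by (intro symb_0I)
  next
    case (Suc n)
    obtain F where F: "tame (Suc n) V d F" "\<And>\<mu> \<rho>. \<mu> \<in> V \<Longrightarrow> 0 < \<rho> \<Longrightarrow> \<rho> < d \<Longrightarrow> (apply_bcontfun (Y \<mu>) has_real_derivative F \<mu> \<rho> / \<rho>) (at \<rho>)"
      using tame_SucD[OF Suc.prems] by blast
    have dY0: "dir_deriv 0 Y \<mu> = 0" if "\<mu> \<in> V" for \<mu>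
      unfolding dir_deriv_def
      using C_infinity_on_differentiable[OF Cb_infinity_smooth[OF tame_Cb[OF Suc.prems]] that]
      by (simp add: linear_0 linear_frechet_derivative)
    note evF = Suc.IH[OF F(1)]
    have h: "symb n S (\<lambda>k. Wn 0 (Suc k)) (\<lambda>z. F (fst z) (rho (snd z)) * (snd z $ i * (1 / qh (snd z))))" if "i \<in> {1,2}" for i
      by (rule symb_product[OF evF symb_coord_div_qh[OF that] W_nonneg(1) W_nonneg(1)]) (auto simp: Wn_def power_add mult_ac)
    have v: "symb n S (\<lambda>k x. Wn 0 k x / x $ 3) (\<lambda>z. F (fst z) (rho (snd z)) * (1 / snd z $ 3))"
      by (rule symb_product[OF evF symb_inverse_x3 W_nonneg(1) W_nonneg(5)])
        (auto simp: Wn_def Wc_def mult_ac intro!: mult_nonneg_nonneg rho_pos(3)[THEN less_imp_le])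
    have m: "symb n S (Wn 0) (\<lambda>z. dir_deriv (axis i 1) Y (fst z) (rho (snd z)))" for i
      by (rule Suc.IH[OF tame_dir_deriv[OF open_V _ tame_Suc[OF Suc.prems]]]) (auto simp: Basis_vec_def)
    show ?case
    proof (rule symb_SucI[of S "\<lambda>z. Y (fst z) (rho (snd z))" "evD Y F"])
      show "open S" by (rule open_S)
      show "((\<lambda>z. Y (fst z) (rho (snd z))) has_derivative evD Y F z) (at z)" if "z \<in> S" for z
        by (rule ev_has_derivative[OF Suc.prems F that])
      show "\<exists>C. \<forall>z\<in>S. norm (Y (fst z) (rho (snd z))) \<le> C * Wn 0 0 (snd z)" by (rule b[OF Suc.prems])
      show "symb n S (\<lambda>k. Wn 0 (Suc k)) (\<lambda>z. evD Y F z (0, axis i 1))" if i: "i \<in> {1,2}" for i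
        by (rule symb_cong[OF open_S _ h[OF i]]) (use i dY0 in \<open>auto simp: axis_def evD_def\<close>)
      show "symb n S (\<lambda>k x. Wn 0 k x / x $ 3) (\<lambda>z. evD Y F z (0, axis 3 1))"
        by (rule symb_cong[OF open_S _ symb_uminus[OF v]]) (use dY0 in \<open>auto simp: axis_def evD_def\<close>)
      show "symb n S (Wn 0) (\<lambda>z. evD Y F z (axis i 1, 0))" for i
        by (rule symb_cong[OF open_S _ m[of i]]) (auto simp: evD_def)
    qed
  }
qed

end

section \<open>The equations for homogeneous axisymmetric fields\<close>

definition sq :: "real^3 \<Rightarrow> real" where "sq x = qh x * (1 / x $ 3)\<^sup>2"

text \<open>For x_3 > 0 this is the (-m)-homogeneous axisymmetric function with profile
  \<open>F\<close> on the plane x_3 = 1.\<close>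

definition scal :: "nat \<Rightarrow> (real \<Rightarrow> real) \<Rightarrow> real^3 \<Rightarrow> real" where
  "scal m F x = F (sq x) * (1 / x $ 3) ^ m"

text \<open>
  With \<open>s = \<rho>\<^sup>2\<close> every homogeneous axisymmetric pair is of the form
  \<open>u' = (A(s) x' + B(s) x'\<^sup>\<bottom>) / x\<^sub>3\<^sup>2\<close>, \<open>u\<^sup>3 = h(s) / x\<^sub>3\<close>, \<open>p = q(s) / x\<^sub>3\<^sup>2\<close>.
\<close>
definition profile_u :: "(real \<Rightarrow> real) \<Rightarrow> (real \<Rightarrow> real) \<Rightarrow> (real \<Rightarrow> real) \<Rightarrow> real^3 \<Rightarrow> real^3" where
  "profile_u A B h x = vector [x $ 1 * scal 2 A x - x $ 2 * scal 2 B x, x $ 2 * scal 2 A x + x $ 1 * scal 2 B x, scal 1 h x]"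

lemma sq_eq_rho: "sq x = (rho x)\<^sup>2"
  unfolding sq_def rho_def norm_horiz power_divide by simp

lemma sq_bounds:
  assumes "x \<in> punctured_cone d" shows "0 < sq x" "sq x < d\<^sup>2"
  using rho_pos(1,2)[OF assms] unfolding sq_eq_rho by (auto intro: power_strict_mono)

lemma hd_coord: "((\<lambda>x::real^'n. x $ j) has_derivative (\<lambda>h. h $ j)) (at x)"
  by (rule bounded_linear_imp_has_derivative[OF bounded_linear_vec_nth])

lemma scal_has_derivative:
  assumes x: "0 < x $ 3" and F: "(F has_real_derivative F1) (at (sq x))"
  shows "(scal m F has_derivative (\<lambda>h. (F1 * (2 * (x $ 1 * h $ 1 + x $ 2 * h $ 2) * (1 / x $ 3)\<^sup>2 - 2 * sq x * (1 / x $ 3) * h $ 3)) * (1 / x $ 3) ^ m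
     - of_nat m * F (sq x) * (1 / x $ 3) ^ Suc m * h $ 3)) (at x)"
proof -
  have w: "((\<lambda>x. 1 / x $ 3) has_derivative (\<lambda>h. - (1 / x $ 3)\<^sup>2 * h $ 3)) (at x)"
    using x by (auto intro!: derivative_eq_intros hd_coord simp: field_simps power2_eq_square)
  have s: "(sq has_derivative (\<lambda>h. 2 * (x $ 1 * h $ 1 + x $ 2 * h $ 2) * (1 / x $ 3)\<^sup>2 - 2 * sq x * (1 / x $ 3) * h $ 3)) (at x)"
  proof -
    have "((\<lambda>x. qh x * (1 / x $ 3)\<^sup>2) has_derivative (\<lambda>h. qh x * (of_nat 2 * (- (1 / x $ 3)\<^sup>2 * h $ 3) * (1 / x $ 3) ^ (2 - 1))
       + (of_nat 2 * h $ 1 * (x $ 1) ^ (2 - 1) + of_nat 2 * h $ 2 * (x $ 2) ^ (2 - 1)) * (1 / x $ 3)\<^sup>2)) (at x)"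
      by (intro has_derivative_mult has_derivative_add has_derivative_power hd_coord w)
    moreover have "(\<lambda>x. qh x * (1 / x $ 3)\<^sup>2) = sq" by (simp add: sq_def fun_eq_iff)
    ultimately have "(sq has_derivative (\<lambda>h. qh x * (of_nat 2 * (- (1 / x $ 3)\<^sup>2 * h $ 3) * (1 / x $ 3) ^ (2 - 1))
       + (of_nat 2 * h $ 1 * (x $ 1) ^ (2 - 1) + of_nat 2 * h $ 2 * (x $ 2) ^ (2 - 1)) * (1 / x $ 3)\<^sup>2)) (at x)" by simp
    then show ?thesis
      by (rule has_derivative_eq_rhs) (auto simp: fun_eq_iff sq_def algebra_simps power2_eq_square add_divide_distrib)
  qed
  have Fs: "((\<lambda>x. F (sq x)) has_derivative (\<lambda>h. F1 * (2 * (x $ 1 * h $ 1 + x $ 2 * h $ 2) * (1 / x $ 3)\<^sup>2 - 2 * sq x * (1 / x $ 3) * h $ 3))) (at x)"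
    by (rule has_derivative_compose[OF s has_field_derivative_imp_has_derivative[OF F]])
  have wm: "((\<lambda>x. (1 / x $ 3) ^ m) has_derivative (\<lambda>h. - of_nat m * (1 / x $ 3) ^ Suc m * h $ 3)) (at x)"
  proof (cases m)
    case (Suc j)
    have alg: "of_nat (Suc j) * (- c\<^sup>2 * k) * c ^ (Suc j - 1) = - of_nat (Suc j) * c ^ Suc (Suc j) * k" for c k :: real
      by (simp add: power2_eq_square algebra_simps)
    show ?thesis unfolding Suc
      using has_derivative_power[OF w, of "Suc j"] unfolding alg .
  qed simp
  have "scal m F = (\<lambda>x. F (sq x) * (1 / x $ 3) ^ m)" by (simp add: scal_def fun_eq_iff)
  then show ?thesis
    by (simp only:) (rule has_derivative_eq_rhs[OF has_derivative_mult[OF Fs wm]], auto simp: fun_eq_iff algebra_simps)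
qed

lemma dir_deriv_mult:
  fixes f g :: "'a::euclidean_space \<Rightarrow> real"
  assumes "f differentiable (at x)" "g differentiable (at x)"
  shows "dir_deriv b (\<lambda>x. f x * g x) x = dir_deriv b f x * g x + f x * dir_deriv b g x"
  by (rule dir_deriv_bilinear[OF bounded_bilinear_mult assms])

lemma dir_deriv_diff:
  assumes "f differentiable (at x)" "g differentiable (at x)"
  shows "dir_deriv b (\<lambda>x. f x - g x) x = dir_deriv b f x - dir_deriv b g x"
proof -
  obtain f' g' where "(f has_derivative f') (at x)" "(g has_derivative g') (at x)"
    using assms by (auto simp: differentiable_def)
  then show ?thesis using dir_deriv_eq[OF has_derivative_diff] dir_deriv_eq by metis
qed

lemma sum_Basis_3: "(\<Sum>b\<in>Basis. f b) = f (axis 1 1 :: real^3) + f (axis 2 1) + f (axis 3 1)"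
proof -
  have *: "Basis = {axis 1 1, axis 2 1, axis 3 1 :: real^3}"
    by (auto simp: Basis_vec_def) (metis exhaust_3)
  show ?thesis unfolding * by (simp add: axis_eq_axis add.assoc)
qed

lemma vector3_eq: "(vector [a, b, c] :: real^3) = a *\<^sub>R axis 1 1 + b *\<^sub>R axis 2 1 + c *\<^sub>R axis 3 1"
  by (simp add: vec_eq_iff forall_3 axis_def)

lemma vector3_has_derivative:
  assumes "(f1 has_derivative g1) (at x)" "(f2 has_derivative g2) (at x)" "(f3 has_derivative g3) (at x)"
  shows "((\<lambda>x. vector [f1 x, f2 x, f3 x] :: real^3) has_derivative (\<lambda>h. vector [g1 h, g2 h, g3 h])) (at x)"
  unfolding vector3_eq by (intro has_derivative_add has_derivative_scaleR_left assms)

lemma dir_deriv_vector3: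
  assumes "f1 differentiable (at x)" "f2 differentiable (at x)" "f3 differentiable (at x)"
  shows "dir_deriv b (\<lambda>x. vector [f1 x, f2 x, f3 x] :: real^3) x = vector [dir_deriv b f1 x, dir_deriv b f2 x, dir_deriv b f3 x]"
proof -
  obtain g1 g2 g3 where g: "(f1 has_derivative g1) (at x)" "(f2 has_derivative g2) (at x)" "(f3 has_derivative g3) (at x)"
    using assms by (auto simp: differentiable_def)
  show ?thesis using dir_deriv_eq[OF vector3_has_derivative[OF g]] by (simp add: g[THEN dir_deriv_eq])
qed

lemma dir_deriv_coord: "dir_deriv b (\<lambda>x::real^'n. x $ j) = (\<lambda>x. b $ j)"
  using dir_deriv_eq[OF hd_coord] by auto

lemma dir_deriv2_mult:
  fixes f g :: "'a::euclidean_space \<Rightarrow> real"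
  assumes "open T" "x \<in> T" "Ck 1 T f" "Ck 1 T g" "b \<in> Basis"
  shows "dir_deriv b (dir_deriv b (\<lambda>x. f x * g x)) x =
    dir_deriv b (dir_deriv b f) x * g x + 2 * dir_deriv b f x * dir_deriv b g x + f x * dir_deriv b (dir_deriv b g) x"
proof -
  have f: "f differentiable (at y)" "g differentiable (at y)" "dir_deriv b f differentiable (at y)" "dir_deriv b g differentiable (at y)" if "y \<in> T" for y
    using assms that by auto
  have "dir_deriv b (dir_deriv b (\<lambda>x. f x * g x)) x = dir_deriv b (\<lambda>x. dir_deriv b f x * g x + f x * dir_deriv b g x) x"
    by (rule dir_deriv_cong[OF assms(1,2)]) (rule dir_deriv_mult[OF f(1,2)])
  also have "\<dots> = dir_deriv b (\<lambda>x. dir_deriv b f x * g x) x + dir_deriv b (\<lambda>x. f x * dir_deriv b g x) x"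
    using f[OF assms(2)] by (intro dir_deriv_add differentiable_mult)
  also have "\<dots> = dir_deriv b (dir_deriv b f) x * g x + 2 * dir_deriv b f x * dir_deriv b g x + f x * dir_deriv b (dir_deriv b g) x"
    using f[OF assms(2)] by (simp add: dir_deriv_mult)
  finally show ?thesis .
qed

lemma dir_deriv2_add:
  fixes f g :: "'a::euclidean_space \<Rightarrow> real"
  assumes "open T" "x \<in> T" "Ck 1 T f" "Ck 1 T g" "b \<in> Basis"
  shows "dir_deriv b (dir_deriv b (\<lambda>x. f x + g x)) x = dir_deriv b (dir_deriv b f) x + dir_deriv b (dir_deriv b g) x"
    "dir_deriv b (dir_deriv b (\<lambda>x. f x - g x)) x = dir_deriv b (dir_deriv b f) x - dir_deriv b (dir_deriv b g) x"
proof -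
  have f: "f differentiable (at y)" "g differentiable (at y)" "dir_deriv b f differentiable (at y)" "dir_deriv b g differentiable (at y)" if "y \<in> T" for y
    using assms that by auto
  have "dir_deriv b (dir_deriv b (\<lambda>x. f x + g x)) x = dir_deriv b (\<lambda>x. dir_deriv b f x + dir_deriv b g x) x"
    by (rule dir_deriv_cong[OF assms(1,2)]) (rule dir_deriv_add[OF f(1,2)])
  then show "dir_deriv b (dir_deriv b (\<lambda>x. f x + g x)) x = dir_deriv b (dir_deriv b f) x + dir_deriv b (dir_deriv b g) x"
    using dir_deriv_add[OF f(3,4)[OF assms(2)]] by simp
  have "dir_deriv b (dir_deriv b (\<lambda>x. f x - g x)) x = dir_deriv b (\<lambda>x. dir_deriv b f x - dir_deriv b g x) x"
    by (rule dir_deriv_cong[OF assms(1,2)]) (rule dir_deriv_diff[OF f(1,2)])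
  then show "dir_deriv b (dir_deriv b (\<lambda>x. f x - g x)) x = dir_deriv b (dir_deriv b f) x - dir_deriv b (dir_deriv b g) x"
    using dir_deriv_diff[OF f(3,4)[OF assms(2)]] by simp
qed

lemma Ck_coord: "Ck n T (\<lambda>x::real^'n. x $ j)"
  using C_infinity_on_bounded_linear[OF bounded_linear_vec_nth] C_infinity_on_iff_Ck by blast

lemma axis_Basis: "axis i 1 \<in> (Basis :: (real^'n) set)" by (auto simp: Basis_vec_def)

lemma scal_dd:
  assumes F: "\<And>s. 0 < s \<Longrightarrow> s < d\<^sup>2 \<Longrightarrow> (F has_real_derivative F1 s) (at s)" and x: "x \<in> punctured_cone d"
  shows "scal m F differentiable (at x)"
    "dir_deriv (axis 1 1) (scal m F) x = 2 * x $ 1 * scal (m + 2) F1 x"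
    "dir_deriv (axis 2 1) (scal m F) x = 2 * x $ 2 * scal (m + 2) F1 x"
    "dir_deriv (axis 3 1) (scal m F) x = - scal (m + 1) (\<lambda>s. 2 * s * F1 s + real m * F s) x"
proof -
  note hd = scal_has_derivative[OF rho_pos(3)[OF x] F[OF sq_bounds[OF x]], of m]
  show "scal m F differentiable (at x)" by (rule differentiableI[OF hd])
  show "dir_deriv (axis 1 1) (scal m F) x = 2 * x $ 1 * scal (m + 2) F1 x"
    "dir_deriv (axis 2 1) (scal m F) x = 2 * x $ 2 * scal (m + 2) F1 x"
    "dir_deriv (axis 3 1) (scal m F) x = - scal (m + 1) (\<lambda>s. 2 * s * F1 s + real m * F s) x"
    unfolding dir_deriv_eq[OF hd] by (simp_all add: axis_def scal_def power2_eq_square algebra_simps)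
qed

locale profile =
  fixes d :: real and F F1 F2 :: "real \<Rightarrow> real"
  assumes F1: "\<And>s. 0 < s \<Longrightarrow> s < d\<^sup>2 \<Longrightarrow> (F has_real_derivative F1 s) (at s)"
    and F2: "\<And>s. 0 < s \<Longrightarrow> s < d\<^sup>2 \<Longrightarrow> (F1 has_real_derivative F2 s) (at s)"
begin

abbreviation "T \<equiv> punctured_cone d"

lemmas op = open_punctured_cone[of d]

text \<open>By Euler's relation this is the profile of minus the x_3-derivative of
  \<open>scal m F\<close>; vertical differentiation thus stays within functions of the form
  \<open>scal\<close>.\<close>

definition G where "G m s = 2 * s * F1 s + real m * F s"
definition G1 where "G1 m s = 2 * F1 s + 2 * s * F2 s + real m * F1 s"

lemma G_deriv:
  assumes "0 < s" "s < d\<^sup>2" shows "(G m has_real_derivative G1 m s) (at s)"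
  unfolding G_def[abs_def] G1_def by (auto intro!: derivative_eq_intros F1 F2 assms simp: algebra_simps)

lemma dd1:
  assumes x: "x \<in> T"
  shows "scal m F differentiable (at x)"
    "dir_deriv (axis 1 1) (scal m F) x = 2 * x $ 1 * scal (m + 2) F1 x"
    "dir_deriv (axis 2 1) (scal m F) x = 2 * x $ 2 * scal (m + 2) F1 x"
    "dir_deriv (axis 3 1) (scal m F) x = - scal (m + 1) (G m) x"
  using scal_dd[OF F1 x, of m] unfolding G_def by blast+

lemma scal_Ck: "Ck 1 T (scal m F)"
  unfolding One_nat_def Ck.simps
proof (intro conjI ballI)
  show "scal m F differentiable (at x)" if "x \<in> T" for x by (rule dd1(1)[OF that])
  fix b :: "real^3" and x assume b: "b \<in> Basis" and x: "x \<in> T"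
  have "Basis = {axis 1 1, axis 2 1, axis 3 1 :: real^3}"
    by (auto simp: Basis_vec_def) (metis exhaust_3)
  then consider "b = axis 1 1" | "b = axis 2 1" | "b = axis 3 1" using b by auto
  then show "dir_deriv b (scal m F) differentiable (at x)"
  proof cases
    case 1
    show ?thesis unfolding 1
      by (rule differentiable_cong_open[OF op x], erule dd1(2)[symmetric],
        intro differentiable_mult differentiable_const scal_dd(1)[OF F2 x] differentiableI[OF hd_coord])
  next
    case 2
    show ?thesis unfolding 2
      by (rule differentiable_cong_open[OF op x], erule dd1(3)[symmetric],
        intro differentiable_mult differentiable_const scal_dd(1)[OF F2 x] differentiableI[OF hd_coord])
  next
    case 3
    show ?thesis unfolding 3
      by (rule differentiable_cong_open[OF op x], erule dd1(4)[symmetric],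
        intro differentiable_minus scal_dd(1)[OF G_deriv x])
  qed
qed

lemma dd2:
  assumes x: "x \<in> T"
  shows "dir_deriv (axis 1 1) (dir_deriv (axis 1 1) (scal m F)) x = 2 * scal (m + 2) F1 x + 4 * (x $ 1)\<^sup>2 * scal (m + 4) F2 x"
    "dir_deriv (axis 2 1) (dir_deriv (axis 2 1) (scal m F)) x = 2 * scal (m + 2) F1 x + 4 * (x $ 2)\<^sup>2 * scal (m + 4) F2 x"
    "dir_deriv (axis 3 1) (dir_deriv (axis 3 1) (scal m F)) x = scal (m + 2) (\<lambda>s. 2 * s * G1 m s + (real m + 1) * G m s) x"
proof -
  note d2 = scal_dd[OF F2 x, of "m + 2"] and dG = scal_dd[OF G_deriv x, of "m + 1" m]
  have c: "(\<lambda>x::real^3. x $ j) differentiable (at x)" for j by (rule differentiableI[OF hd_coord])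
  have "dir_deriv (axis 1 1) (dir_deriv (axis 1 1) (scal m F)) x = dir_deriv (axis 1 1) (\<lambda>x. 2 * x $ 1 * scal (m + 2) F1 x) x"
    by (rule dir_deriv_cong[OF op x]) (rule dd1(2))
  also have "\<dots> = 2 * scal (m + 2) F1 x + 4 * (x $ 1)\<^sup>2 * scal (m + 4) F2 x"
    using d2 c by (simp add: dir_deriv_mult differentiable_mult dir_deriv_coord axis_def eval_nat_numeral)
  finally show "dir_deriv (axis 1 1) (dir_deriv (axis 1 1) (scal m F)) x = 2 * scal (m + 2) F1 x + 4 * (x $ 1)\<^sup>2 * scal (m + 4) F2 x" .
  have "dir_deriv (axis 2 1) (dir_deriv (axis 2 1) (scal m F)) x = dir_deriv (axis 2 1) (\<lambda>x. 2 * x $ 2 * scal (m + 2) F1 x) x"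
    by (rule dir_deriv_cong[OF op x]) (rule dd1(3))
  also have "\<dots> = 2 * scal (m + 2) F1 x + 4 * (x $ 2)\<^sup>2 * scal (m + 4) F2 x"
    using d2 c by (simp add: dir_deriv_mult differentiable_mult dir_deriv_coord axis_def eval_nat_numeral)
  finally show "dir_deriv (axis 2 1) (dir_deriv (axis 2 1) (scal m F)) x = 2 * scal (m + 2) F1 x + 4 * (x $ 2)\<^sup>2 * scal (m + 4) F2 x" .
  have "dir_deriv (axis 3 1) (dir_deriv (axis 3 1) (scal m F)) x = dir_deriv (axis 3 1) (\<lambda>x. - scal (m + 1) (G m) x) x"
    by (rule dir_deriv_cong[OF op x]) (rule dd1(4))
  also have "\<dots> = - dir_deriv (axis 3 1) (scal (m + 1) (G m)) x"
    using dir_deriv_linear[OF bounded_linear_minus[OF bounded_linear_ident] dG(1)] by simp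
  also have "\<dots> = scal (m + 2) (\<lambda>s. 2 * s * G1 m s + (real m + 1) * G m s) x"
    using dG(4) by (simp add: add.commute)
  finally show "dir_deriv (axis 3 1) (dir_deriv (axis 3 1) (scal m F)) x = scal (m + 2) (\<lambda>s. 2 * s * G1 m s + (real m + 1) * G m s) x" .
qed

end

text \<open>An equivalence at a single point serves both purposes: existence reads it from right to
  left, uniqueness from left to right. The horizontal momentum components are the first two profile
  equations transformed by the matrix with rows (x_1, -x_2) and (x_2, x_1), whose determinant |x'|^2
  is positive.\<close>

lemma NS_profile:
  assumes A: "profile d A A1 A2" and B: "profile d B B1 B2" and h: "profile d h h1 h2"
    and q: "\<And>s. 0 < s \<Longrightarrow> s < d\<^sup>2 \<Longrightarrow> (q has_real_derivative q1 s) (at s)"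
    and u: "\<And>x. x \<in> punctured_cone d \<Longrightarrow> u x = profile_u A B h x"
    and p: "\<And>x. x \<in> punctured_cone d \<Longrightarrow> p x = scal 2 q x"
    and x: "x \<in> punctured_cone d"
  defines "s \<equiv> sq x"
  shows "(- laplacian u x + convection u u x + gradient p x = 0 \<and> divergence u x = 0) \<longleftrightarrow>
    (- (4 * s * (1 + s) * A2 s + (8 + 14 * s) * A1 s + 6 * A s) + (A s)\<^sup>2 - (B s)\<^sup>2 + 2 * s * (A s - h s) * A1 s - 2 * h s * A s + 2 * q1 s = 0 \<and>
     - (4 * s * (1 + s) * B2 s + (8 + 14 * s) * B1 s + 6 * B s) + 2 * A s * B s + 2 * s * (A s - h s) * B1 s - 2 * h s * B s = 0 \<and>
     - (4 * s * (1 + s) * h2 s + (4 + 10 * s) * h1 s + 2 * h s) + 2 * s * (A s - h s) * h1 s - (h s)\<^sup>2 - (2 * s * q1 s + 2 * q s) = 0 \<and>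
     2 * A s + 2 * s * A1 s - h s - 2 * s * h1 s = 0)"
proof -
  interpret A: profile d A A1 A2 by fact
  interpret B: profile d B B1 B2 by fact
  interpret h: profile d h h1 h2 by fact
  let ?T = "punctured_cone d"
  note op = open_punctured_cone[of d]
  define f1 where "f1 x = x $ 1 * scal 2 A x - x $ 2 * scal 2 B x" for x
  define f2 where "f2 x = x $ 2 * scal 2 A x + x $ 1 * scal 2 B x" for x
  define f3 where "f3 = scal 1 h"
  have uf: "u y = vector [f1 y, f2 y, f3 y]" if "y \<in> ?T" for y
    using u[OF that] by (simp add: profile_u_def f1_def f2_def f3_def)
  have cm: "Ck 1 ?T (\<lambda>x. x $ j * g x)" if "Ck 1 ?T g" for j and g :: "real^3 \<Rightarrow> real"
    by (rule Ck_bilinear[OF op bounded_bilinear_mult Ck_coord that])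
  have c1: "Ck 1 ?T f1"
    using Ck_add[OF op cm[OF A.scal_Ck] Ck_linear[OF op bounded_linear_minus[OF bounded_linear_ident] cm[OF B.scal_Ck]]]
    unfolding f1_def[abs_def] by simp
  have c2: "Ck 1 ?T f2" unfolding f2_def[abs_def] by (intro Ck_add[OF op] cm A.scal_Ck B.scal_Ck)
  have c3: "Ck 1 ?T f3" unfolding f3_def by (rule h.scal_Ck)
  have df: "f1 differentiable (at y)" "f2 differentiable (at y)" "f3 differentiable (at y)" if "y \<in> ?T" for y
    using c1 c2 c3 that by auto
  have ddf: "dir_deriv b f1 differentiable (at y)" "dir_deriv b f2 differentiable (at y)" "dir_deriv b f3 differentiable (at y)"
    if "y \<in> ?T" "b \<in> Basis" for y b
    using c1 c2 c3 that by auto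
  have du: "dir_deriv b u y = vector [dir_deriv b f1 y, dir_deriv b f2 y, dir_deriv b f3 y]" if "y \<in> ?T" for b y
    using dir_deriv_cong[OF op that uf] dir_deriv_vector3[OF df[OF that]] by simp
  have ddu: "dir_deriv b (dir_deriv b u) x = vector [dir_deriv b (dir_deriv b f1) x, dir_deriv b (dir_deriv b f2) x, dir_deriv b (dir_deriv b f3) x]"
    if b: "b \<in> Basis" for b
    using dir_deriv_cong[OF op x du] dir_deriv_vector3[OF ddf[OF x b]] by simp
  have dp: "dir_deriv b p x = dir_deriv b (scal 2 q) x" for b
    by (rule dir_deriv_cong[OF op x p])
  note q' = scal_dd[OF q x, of 2]
  define w where "w = 1 / x $ 3"
  have w: "0 < w" using rho_pos(3)[OF x] by (simp add: w_def)
  have sx: "s = ((x $ 1)\<^sup>2 + (x $ 2)\<^sup>2) * w\<^sup>2" by (simp add: s_def sq_def w_def)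
  have sc: "scal m F x = F s * w ^ m" for m F by (simp add: scal_def s_def w_def)
  have cd: "(\<lambda>x::real^3. x $ j) differentiable (at x)" for j by (rule differentiableI[OF hd_coord])
  have cm0: "(\<lambda>x::real^3. x $ j * g x) differentiable (at x)" if "g differentiable (at x)" for j and g :: "real^3 \<Rightarrow> real"
    by (intro differentiable_mult cd that)
  note A' = A.dd1(1)[OF x, of 2] A.dd1(2-4)[OF x, of 2] A.dd2[OF x, of 2]
  note B' = B.dd1(1)[OF x, of 2] B.dd1(2-4)[OF x, of 2] B.dd2[OF x, of 2]
  note h' = h.dd1(1)[OF x, of 1, unfolded One_nat_def] h.dd1(2-4)[OF x, of 1, unfolded One_nat_def] h.dd2[OF x, of 1, unfolded One_nat_def]
  have f1d: "dir_deriv b f1 x = b $ 1 * scal 2 A x + x $ 1 * dir_deriv b (scal 2 A) x - (b $ 2 * scal 2 B x + x $ 2 * dir_deriv b (scal 2 B) x)" for b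
    unfolding f1_def[abs_def] using A'(1) B'(1) by (simp add: dir_deriv_diff cm0 dir_deriv_mult cd dir_deriv_coord)
  have f2d: "dir_deriv b f2 x = b $ 2 * scal 2 A x + x $ 2 * dir_deriv b (scal 2 A) x + (b $ 1 * scal 2 B x + x $ 1 * dir_deriv b (scal 2 B) x)" for b
    unfolding f2_def[abs_def] using A'(1) B'(1) by (simp add: dir_deriv_add cm0 dir_deriv_mult cd dir_deriv_coord)
  have m2: "dir_deriv b (dir_deriv b (\<lambda>x. x $ j * g x)) x = 2 * b $ j * dir_deriv b g x + x $ j * dir_deriv b (dir_deriv b g) x"
    if "Ck 1 ?T g" "b \<in> Basis" for b j and g :: "real^3 \<Rightarrow> real"
    using dir_deriv2_mult[OF op x Ck_coord that, of j] by (simp add: dir_deriv_coord)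
  have f1dd: "dir_deriv b (dir_deriv b f1) x = 2 * b $ 1 * dir_deriv b (scal 2 A) x + x $ 1 * dir_deriv b (dir_deriv b (scal 2 A)) x
      - (2 * b $ 2 * dir_deriv b (scal 2 B) x + x $ 2 * dir_deriv b (dir_deriv b (scal 2 B)) x)" if b: "b \<in> Basis" for b
    unfolding f1_def[abs_def] dir_deriv2_add(2)[OF op x cm[OF A.scal_Ck] cm[OF B.scal_Ck] b] m2[OF A.scal_Ck b] m2[OF B.scal_Ck b] ..
  have f2dd: "dir_deriv b (dir_deriv b f2) x = 2 * b $ 2 * dir_deriv b (scal 2 A) x + x $ 2 * dir_deriv b (dir_deriv b (scal 2 A)) x
      + (2 * b $ 1 * dir_deriv b (scal 2 B) x + x $ 1 * dir_deriv b (dir_deriv b (scal 2 B)) x)" if b: "b \<in> Basis" for b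
    unfolding f2_def[abs_def] dir_deriv2_add(1)[OF op x cm[OF A.scal_Ck] cm[OF B.scal_Ck] b] m2[OF A.scal_Ck b] m2[OF B.scal_Ck b] ..
  have ax: "(axis 1 1 :: real^3) $ 1 = (1::real)" "(axis 1 1 :: real^3) $ 2 = (0::real)" "(axis 1 1 :: real^3) $ 3 = (0::real)"
    "(axis 2 1 :: real^3) $ 1 = (0::real)" "(axis 2 1 :: real^3) $ 2 = (1::real)" "(axis 2 1 :: real^3) $ 3 = (0::real)"
    "(axis 3 1 :: real^3) $ 1 = (0::real)" "(axis 3 1 :: real^3) $ 2 = (0::real)" "(axis 3 1 :: real^3) $ 3 = (1::real)"
    by (simp_all add: axis_def)
  have w56: "w ^ 5 = w * w * w * w * w" "w ^ 6 = w * w * w * w * w * w" by (simp_all add: eval_nat_numeral)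
  \<comment> \<open>The values of the profiles are hidden in a list so that expanding
    \<open>s\<close> in the coordinates does not reach into their arguments; what remains is a
    polynomial identity.\<close>
  define v where "v = [A s, A1 s, A2 s, B s, B1 s, B2 s, h s, h1 s, h2 s]"
  define q0 q0' where "q0 = q s" "q0' = q1 s"
  have v: "A s = v ! 0" "A1 s = v ! 1" "A2 s = v ! 2" "B s = v ! 3" "B1 s = v ! 4" "B2 s = v ! 5"
    "h s = v ! 6" "h1 s = v ! 7" "h2 s = v ! 8" "q s = q0" "q1 s = q0'"
    by (simp_all add: v_def q0_q0'_def)
  note defs = laplacian_def convection_def gradient_def divergence_def sum_Basis_3 inner_axis
  let ?Er = "- (4 * s * (1 + s) * A2 s + (8 + 14 * s) * A1 s + 6 * A s) + (A s)\<^sup>2 - (B s)\<^sup>2 + 2 * s * (A s - h s) * A1 s - 2 * h s * A s + 2 * q1 s"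
  let ?Ep = "- (4 * s * (1 + s) * B2 s + (8 + 14 * s) * B1 s + 6 * B s) + 2 * A s * B s + 2 * s * (A s - h s) * B1 s - 2 * h s * B s"
  let ?E3 = "- (4 * s * (1 + s) * h2 s + (4 + 10 * s) * h1 s + 2 * h s) + 2 * s * (A s - h s) * h1 s - (h s)\<^sup>2 - (2 * s * q1 s + 2 * q s)"
  let ?Ed = "2 * A s + 2 * s * A1 s - h s - 2 * s * h1 s"
  let ?N = "- laplacian u x + convection u u x + gradient p x"
  note expand = uf[OF x] du[OF x] ddu[OF axis_Basis] dp f1d f2d f1dd[OF axis_Basis] f2dd[OF axis_Basis] f3_def f1_def f2_def A'(2-) B'(2-) h'(2-) q'(2-4)
      A.G_def A.G1_def B.G_def B.G1_def h.G_def h.G1_def sc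
  have N1: "?N $ 1 = w ^ 4 * (x $ 1 * ?Er - x $ 2 * ?Ep)"
    unfolding defs by (simp add: expand ax v, simp add: sx algebra_simps power2_eq_square power4_eq_xxxx power3_eq_cube w56)
  have N2: "?N $ 2 = w ^ 4 * (x $ 2 * ?Er + x $ 1 * ?Ep)"
    unfolding defs by (simp add: expand ax v, simp add: sx algebra_simps power2_eq_square power4_eq_xxxx power3_eq_cube w56)
  have N3: "?N $ 3 = w ^ 3 * ?E3"
    unfolding defs by (simp add: expand ax v, simp add: sx algebra_simps power2_eq_square power4_eq_xxxx power3_eq_cube w56)
  have D: "divergence u x = w ^ 2 * ?Ed"
    unfolding defs by (simp add: expand ax v, simp add: sx algebra_simps power2_eq_square power4_eq_xxxx power3_eq_cube w56)
  have rot: "(a * r - b * t = 0 \<and> b * r + a * t = 0) \<longleftrightarrow> r = 0 \<and> t = 0" if "0 < a\<^sup>2 + b\<^sup>2" for a b r t :: real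
  proof
    assume "a * r - b * t = 0 \<and> b * r + a * t = 0"
    then have "(a\<^sup>2 + b\<^sup>2) * r = 0" "(a\<^sup>2 + b\<^sup>2) * t = 0" by algebra+
    then show "r = 0 \<and> t = 0" using that by auto
  qed simp
  have "?N = 0 \<longleftrightarrow> ?N $ 1 = 0 \<and> ?N $ 2 = 0 \<and> ?N $ 3 = 0" by (simp add: vec_eq_iff forall_3)
  also have "\<dots> \<longleftrightarrow> (x $ 1 * ?Er - x $ 2 * ?Ep = 0 \<and> x $ 2 * ?Er + x $ 1 * ?Ep = 0) \<and> ?E3 = 0"
    unfolding N1 N2 N3 using w by simp
  also have "\<dots> \<longleftrightarrow> (?Er = 0 \<and> ?Ep = 0) \<and> ?E3 = 0" unfolding rot[OF rho_pos(5)[OF x]] ..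
  finally have N: "?N = 0 \<longleftrightarrow> (?Er = 0 \<and> ?Ep = 0) \<and> ?E3 = 0" .
  have D0: "divergence u x = 0 \<longleftrightarrow> ?Ed = 0" unfolding D using w by simp
  show ?thesis unfolding N D0 by blast
qed

section \<open>Comparison at the singular point\<close>

text \<open>Comparison started at the singular endpoint: the one-sided limit takes the place of an
  initial value, and no differentiability at 0 is involved.\<close>

lemma le_from_right_limit:
  fixes H :: "real \<Rightarrow> real"
  assumes "0 < r" "\<And>t. 0 < t \<Longrightarrow> t \<le> r \<Longrightarrow> (H has_real_derivative H' t) (at t)"
    "\<And>t. 0 < t \<Longrightarrow> t \<le> r \<Longrightarrow> 0 \<le> H' t" "(H \<longlongrightarrow> l) (at_right 0)"
  shows "l \<le> H r"
proof (rule tendsto_upperbound[OF assms(4)])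
  have "H t \<le> H r" if "0 < t" "t < r" for t
  proof (rule DERIV_nonneg_imp_nondecreasing[of t r H])
    show "t \<le> r" using that by simp
    show "\<exists>y. (H has_real_derivative y) (at x) \<and> 0 \<le> y" if "t \<le> x" "x \<le> r" for x
      using assms(2,3)[of x] that \<open>0 < t\<close> by (intro exI[of _ "H' x"]) simp
  qed
  then show "\<forall>\<^sub>F t in at_right 0. H t \<le> H r"
    unfolding eventually_at_right_field using assms(1) by blast
qed simp

lemma abs_le_from_right_limit:
  fixes f H :: "real \<Rightarrow> real"
  assumes "0 < r" "\<And>t. 0 < t \<Longrightarrow> t \<le> r \<Longrightarrow> (f has_real_derivative f' t) (at t)"
    "\<And>t. 0 < t \<Longrightarrow> t \<le> r \<Longrightarrow> (H has_real_derivative H' t) (at t)"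
    "\<And>t. 0 < t \<Longrightarrow> t \<le> r \<Longrightarrow> \<bar>f' t\<bar> \<le> H' t" "(f \<longlongrightarrow> 0) (at_right 0)" "(H \<longlongrightarrow> l) (at_right 0)"
  shows "\<bar>f r\<bar> \<le> H r - l"
proof -
  have lim: "((\<lambda>t. H t - f t) \<longlongrightarrow> l) (at_right 0)" "((\<lambda>t. H t + f t) \<longlongrightarrow> l) (at_right 0)"
    using tendsto_diff[OF assms(6,5)] tendsto_add[OF assms(6,5)] by simp_all
  have "l \<le> H r - f r"
    by (rule le_from_right_limit[where H="\<lambda>t. H t - f t" and H'="\<lambda>t. H' t - f' t", OF assms(1) DERIV_diff[OF assms(3,2)] _ lim(1)])
      (use assms(4) in \<open>auto simp: abs_le_iff\<close>)
  moreover have "l \<le> H r + f r"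
  proof (rule le_from_right_limit[where H="\<lambda>t. H t + f t" and H'="\<lambda>t. H' t + f' t", OF assms(1) DERIV_add[OF assms(3,2)] _ lim(2)])
    show "0 \<le> H' t + f' t" if "0 < t" "t \<le> r" for t using assms(4)[OF that] by linarith
  qed
  ultimately show ?thesis by linarith
qed

lemma quadratic_comparison:
  fixes f :: "real \<Rightarrow> real"
  assumes "0 < r" "\<And>t. 0 < t \<Longrightarrow> t \<le> r \<Longrightarrow> (f has_real_derivative f' t) (at t)"
    "\<And>t. 0 < t \<Longrightarrow> t \<le> r \<Longrightarrow> \<bar>f' t\<bar> \<le> 2 * t * M" "(f \<longlongrightarrow> 0) (at_right 0)"
  shows "\<bar>f r\<bar> \<le> M * r\<^sup>2"
proof -
  have "((\<lambda>t. M * t\<^sup>2) \<longlongrightarrow> M * 0\<^sup>2) (at_right 0)" by (intro tendsto_intros)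
  moreover have "((\<lambda>t. M * t\<^sup>2) has_real_derivative 2 * t * M) (at t)" for t
    by (auto intro!: derivative_eq_intros)
  ultimately show ?thesis
    using abs_le_from_right_limit[where f=f and f'=f' and H="\<lambda>t. M * t\<^sup>2" and H'="\<lambda>t. 2 * t * M" and l=0, OF assms(1,2) _ assms(3,4)]
    by simp
qed

lemma exp_comparison:
  fixes f :: "real \<Rightarrow> real"
  assumes "0 < r" "0 < m" "0 \<le> C" "\<And>t. 0 < t \<Longrightarrow> t \<le> r \<Longrightarrow> (f has_real_derivative f' t) (at t)"
    "\<And>t. 0 < t \<Longrightarrow> t \<le> r \<Longrightarrow> \<bar>f' t\<bar> \<le> C * exp (m * t)" "(f \<longlongrightarrow> 0) (at_right 0)"
  shows "\<bar>f r\<bar> \<le> C / m * exp (m * r)"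
proof -
  have "((\<lambda>t. C / m * exp (m * t)) \<longlongrightarrow> C / m * exp (m * 0)) (at_right 0)" by (intro tendsto_intros)
  moreover have "((\<lambda>t. C / m * exp (m * t)) has_real_derivative C * exp (m * t)) (at t)" for t
    using assms(2) by (auto intro!: derivative_eq_intros)
  ultimately have "\<bar>f r\<bar> \<le> C / m * exp (m * r) - C / m * exp (m * 0)"
    using abs_le_from_right_limit[where f=f and f'=f' and H="\<lambda>t. C / m * exp (m * t)" and H'="\<lambda>t. C * exp (m * t)" and l="C / m * exp (m * 0)", OF assms(1,4) _ assms(5,6)]
    by simp
  also have "\<dots> \<le> C / m * exp (m * r)" using assms(2,3) by simp
  finally show ?thesis .
qed

lemma bounded_from_right_limit:
  fixes f :: "real \<Rightarrow> real"
  assumes "\<And>t. 0 < t \<Longrightarrow> t \<le> r \<Longrightarrow> isCont f t" "(f \<longlongrightarrow> l) (at_right 0)"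
  shows "\<exists>B. \<forall>t. 0 < t \<longrightarrow> t \<le> r \<longrightarrow> \<bar>f t\<bar> \<le> B"
proof -
  have "\<forall>\<^sub>F t in at_right 0. \<bar>f t\<bar> < \<bar>l\<bar> + 1"
    by (rule order_tendstoD(2)[OF tendsto_rabs[OF assms(2)]]) simp
  then obtain b where b: "0 < b" "\<And>t. 0 < t \<Longrightarrow> t < b \<Longrightarrow> \<bar>f t\<bar> < \<bar>l\<bar> + 1"
    unfolding eventually_at_right_field by auto
  have "compact (f ` {b/2..r})"
    by (rule compact_continuous_image) (use assms(1) b in \<open>auto intro!: continuous_at_imp_continuous_on\<close>)
  then obtain M where M: "\<forall>y\<in>f ` {b/2..r}. norm y \<le> M"
    using compact_imp_bounded[of "f ` {b/2..r}"] unfolding bounded_iff by blast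
  have "\<bar>f t\<bar> \<le> max M (\<bar>l\<bar> + 1)" if "0 < t" "t \<le> r" for t
  proof (cases "t < b")
    case True
    then show ?thesis using b(2)[of t] that by simp
  next
    case False
    then have "f t \<in> f ` {b/2..r}" using that b(1) by auto
    then show ?thesis using M by (auto simp: le_max_iff_disj)
  qed
  then show ?thesis by blast
qed

section \<open>The singular ordinary differential system\<close>

text \<open>
  In the variable \<open>s = \<rho>\<^sup>2\<close> the unknowns are \<open>Gm = s B\<close>, \<open>g = Gm'\<close>, \<open>n = A - h\<close>,
  \<open>E = s ((1 + s) h + (s + 2) n + s n\<^sup>2 / 2)\<close>, \<open>k = E'\<close> and \<open>e = E''\<close>. The equations reduce to a closed
  first-order system because the pressure and \<open>h\<close> are algebraic in these quantities; the system is
  written with \<open>t = \<rho>\<close> as independent variable, whence the factors \<open>2 * t\<close>.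
\<close>
locale ode =
  fixes d :: real and \<mu> :: "real^4" and Gm g E k e n :: "real \<Rightarrow> real"
  assumes Gm': "\<And>t. 0 < t \<Longrightarrow> t < d \<Longrightarrow> (Gm has_real_derivative 2 * t * g t) (at t)"
    and g': "\<And>t. 0 < t \<Longrightarrow> t < d \<Longrightarrow> (g has_real_derivative 2 * t * ((n t - 3) * g t / (2 * (1 + t\<^sup>2)))) (at t)"
    and E': "\<And>t. 0 < t \<Longrightarrow> t < d \<Longrightarrow> (E has_real_derivative 2 * t * k t) (at t)"
    and k': "\<And>t. 0 < t \<Longrightarrow> t < d \<Longrightarrow> (k has_real_derivative 2 * t * e t) (at t)"
    and e': "\<And>t. 0 < t \<Longrightarrow> t < d \<Longrightarrow> (e has_real_derivative 2 * t * ((- 3 * e t - Gm t / t\<^sup>2 * g t) / (2 * (1 + t\<^sup>2)))) (at t)"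
    and n': "\<And>t. 0 < t \<Longrightarrow> t < d \<Longrightarrow> (n has_real_derivative 2 * t * ((t\<^sup>2 * ((n t)\<^sup>2 / 2 - n t) - E t / t\<^sup>2) / (2 * t\<^sup>2 * (1 + t\<^sup>2)))) (at t)"
    and Gm0: "(Gm \<longlongrightarrow> 0) (at_right 0)" and g0: "(g \<longlongrightarrow> \<mu> $ 4) (at_right 0)"
    and E0: "(E \<longlongrightarrow> 0) (at_right 0)" and k0: "(k \<longlongrightarrow> \<mu> $ 1 / 2) (at_right 0)"
    and e0: "(e \<longlongrightarrow> \<mu> $ 3 - \<mu> $ 2 / 2) (at_right 0)"
    and n0: "((\<lambda>t. n t + \<mu> $ 1 / 2 * ln t) \<longlongrightarrow> \<mu> $ 1 / 2 - \<mu> $ 3) (at_right 0)"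
begin

lemma tn0: "((\<lambda>t. t * n t) \<longlongrightarrow> 0) (at_right 0)"
proof -
  have "((\<lambda>t. t * (n t + \<mu> $ 1 / 2 * ln t)) \<longlongrightarrow> 0 * (\<mu> $ 1 / 2 - \<mu> $ 3)) (at_right 0)"
    by (intro tendsto_mult n0 tendsto_ident_at)
  moreover have "((\<lambda>t::real. \<mu> $ 1 / 2 * (t * ln t)) \<longlongrightarrow> \<mu> $ 1 / 2 * 0) (at_right 0)"
    by (intro tendsto_mult tendsto_const) real_asymp
  ultimately have "((\<lambda>t. t * (n t + \<mu> $ 1 / 2 * ln t) - \<mu> $ 1 / 2 * (t * ln t)) \<longlongrightarrow> 0 - 0) (at_right 0)"
    by (intro tendsto_diff) simp_all
  then show ?thesis by (simp add: algebra_simps)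
qed

text \<open>\<open>n\<close> itself has a logarithm and is unbounded, but the factor t from ds = 2 t
  dt ensures that only t n enters the coefficients of the equations for differences. The last
  quotient is bounded because it is a mean of \<open>g\<close>.\<close>

lemma bounds:
  assumes "r < d"
  shows "\<exists>B\<ge>1. \<forall>t. 0 < t \<longrightarrow> t \<le> r \<longrightarrow> \<bar>g t\<bar> \<le> B \<and> \<bar>e t\<bar> \<le> B \<and> \<bar>t * n t\<bar> \<le> B \<and> \<bar>Gm t / t\<^sup>2\<bar> \<le> B"
proof -
  obtain B1 where B1: "\<And>t. 0 < t \<Longrightarrow> t \<le> r \<Longrightarrow> \<bar>g t\<bar> \<le> B1"
    using bounded_from_right_limit[OF _ g0, of r] DERIV_isCont[OF g'] assms by force
  obtain B2 where B2: "\<And>t. 0 < t \<Longrightarrow> t \<le> r \<Longrightarrow> \<bar>e t\<bar> \<le> B2"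
    using bounded_from_right_limit[OF _ e0, of r] DERIV_isCont[OF e'] assms by force
  have "isCont (\<lambda>t. t * n t) t" if "0 < t" "t < d" for t
    using DERIV_isCont[OF n'[OF that]] by (intro continuous_intros)
  then obtain B3 where B3: "\<And>t. 0 < t \<Longrightarrow> t \<le> r \<Longrightarrow> \<bar>t * n t\<bar> \<le> B3"
    using bounded_from_right_limit[OF _ tn0, of r] assms by force
  have B4: "\<bar>Gm t / t\<^sup>2\<bar> \<le> B1" if t: "0 < t" "t \<le> r" for t
  proof -
    have "\<bar>Gm t\<bar> \<le> B1 * t\<^sup>2"
    proof (rule quadratic_comparison[OF t(1) _ _ Gm0])
      show "(Gm has_real_derivative 2 * s * g s) (at s)" if "0 < s" "s \<le> t" for s using Gm'[of s] that t assms by auto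
      show "\<bar>2 * s * g s\<bar> \<le> 2 * s * B1" if "0 < s" "s \<le> t" for s
        using B1[of s] that t by (simp add: abs_mult)
    qed
    then show ?thesis using t by (simp add: abs_divide divide_le_eq)
  qed
  show ?thesis
    by (rule exI[of _ "max 1 (max B1 (max B2 B3))"]) (use B1 B2 B3 B4 in \<open>force simp: le_max_iff_disj\<close>)
qed

end

locale ode_pair = ode d \<mu> Gm g E k e n + b: ode d \<mu> Gm2 g2 E2 k2 e2 n2
  for d \<mu> Gm g E k e n Gm2 g2 E2 k2 e2 n2
begin

abbreviation "S t \<equiv> \<bar>g t - g2 t\<bar> + \<bar>e t - e2 t\<bar> + \<bar>n t - n2 t\<bar>"

lemma diff_limits:
  "((\<lambda>t. Gm t - Gm2 t) \<longlongrightarrow> 0) (at_right 0)" "((\<lambda>t. g t - g2 t) \<longlongrightarrow> 0) (at_right 0)"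
  "((\<lambda>t. E t - E2 t) \<longlongrightarrow> 0) (at_right 0)" "((\<lambda>t. k t - k2 t) \<longlongrightarrow> 0) (at_right 0)"
  "((\<lambda>t. e t - e2 t) \<longlongrightarrow> 0) (at_right 0)" "((\<lambda>t. n t - n2 t) \<longlongrightarrow> 0) (at_right 0)"
  using tendsto_diff[OF Gm0 b.Gm0] tendsto_diff[OF g0 b.g0] tendsto_diff[OF E0 b.E0] tendsto_diff[OF k0 b.k0]
    tendsto_diff[OF e0 b.e0] tendsto_diff[OF n0 b.n0] by simp_all

text \<open>The three remaining unknowns are integrals in s = t^2, so each integration contributes a
  factor t^2. The t^4 gained for \<open>E\<close> outweighs the t^(-3) with which \<open>E\<close>
  enters the equation for \<open>n\<close>.\<close>

lemma secondary:
  assumes t: "0 < t" "t < d" and W: "\<And>s. 0 < s \<Longrightarrow> s \<le> t \<Longrightarrow> S s \<le> W"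
  shows "\<bar>Gm t - Gm2 t\<bar> \<le> W * t\<^sup>2" "\<bar>k t - k2 t\<bar> \<le> W * t\<^sup>2" "\<bar>E t - E2 t\<bar> \<le> W * t\<^sup>2 * t\<^sup>2"
proof -
  have W0: "0 \<le> W" using W[of t] t by linarith
  have kk: "\<bar>k r - k2 r\<bar> \<le> W * r\<^sup>2" if r: "0 < r" "r \<le> t" for r
  proof (rule quadratic_comparison[OF r(1) _ _ diff_limits(4)])
    show "((\<lambda>t. k t - k2 t) has_real_derivative 2 * s * e s - 2 * s * e2 s) (at s)" if "0 < s" "s \<le> r" for s
      using that r t by (intro DERIV_diff k' b.k') auto
    show "\<bar>2 * s * e s - 2 * s * e2 s\<bar> \<le> 2 * s * W" if s: "0 < s" "s \<le> r" for s
    proof -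
      have "\<bar>2 * s * e s - 2 * s * e2 s\<bar> = 2 * s * \<bar>e s - e2 s\<bar>"
        using s by (simp add: right_diff_distrib[symmetric] abs_mult)
      also have "\<dots> \<le> 2 * s * W" using W[of s] s r by (intro mult_left_mono) auto
      finally show ?thesis .
    qed
  qed
  show "\<bar>k t - k2 t\<bar> \<le> W * t\<^sup>2" by (rule kk) (use t in auto)
  show "\<bar>Gm t - Gm2 t\<bar> \<le> W * t\<^sup>2"
  proof (rule quadratic_comparison[OF t(1) _ _ diff_limits(1)])
    show "((\<lambda>t. Gm t - Gm2 t) has_real_derivative 2 * s * g s - 2 * s * g2 s) (at s)" if "0 < s" "s \<le> t" for s
      using that t by (intro DERIV_diff Gm' b.Gm') auto
    show "\<bar>2 * s * g s - 2 * s * g2 s\<bar> \<le> 2 * s * W" if s: "0 < s" "s \<le> t" for s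
    proof -
      have "\<bar>2 * s * g s - 2 * s * g2 s\<bar> = 2 * s * \<bar>g s - g2 s\<bar>"
        using s by (simp add: right_diff_distrib[symmetric] abs_mult)
      also have "\<dots> \<le> 2 * s * W" using W[of s] s by (intro mult_left_mono) auto
      finally show ?thesis .
    qed
  qed
  show "\<bar>E t - E2 t\<bar> \<le> W * t\<^sup>2 * t\<^sup>2"
  proof (rule quadratic_comparison[OF t(1) _ _ diff_limits(3)])
    show "((\<lambda>t. E t - E2 t) has_real_derivative 2 * s * k s - 2 * s * k2 s) (at s)" if "0 < s" "s \<le> t" for s
      using that t by (intro DERIV_diff E' b.E') auto
    show "\<bar>2 * s * k s - 2 * s * k2 s\<bar> \<le> 2 * s * (W * t\<^sup>2)" if s: "0 < s" "s \<le> t" for s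
    proof -
      have "\<bar>2 * s * k s - 2 * s * k2 s\<bar> = 2 * s * \<bar>k s - k2 s\<bar>"
        using s by (simp add: right_diff_distrib[symmetric] abs_mult)
      also have "\<dots> \<le> 2 * s * (W * t\<^sup>2)"
        using order_trans[OF kk[OF s] mult_left_mono[OF power_mono[of s t 2] W0]] s by (intro mult_left_mono) auto
      finally show ?thesis .
    qed
  qed
qed

lemma divide_one_plus_le: "\<bar>x\<bar> \<le> c \<Longrightarrow> \<bar>x / (1 + t\<^sup>2)\<bar> \<le> c" for x c t :: real
proof -
  assume "\<bar>x\<bar> \<le> c"
  moreover have "\<bar>x\<bar> \<le> \<bar>x\<bar> * (1 + t\<^sup>2)" by (simp add: algebra_simps)
  moreover have "0 < 1 + t\<^sup>2" by (simp add: add_pos_nonneg)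
  ultimately show ?thesis by (simp add: abs_divide divide_le_eq) (smt (verit) mult_right_mono)
qed

text \<open>
  Gronwall's argument with the weight \<open>exp(60 B\<^sup>2 t)\<close>: the differential system improves any bound
  \<open>S t \<le> M exp(60 B\<^sup>2 t)\<close> to half of it, so that iteration forces \<open>S = 0\<close>.
\<close>
lemma halving:
  assumes r: "r < d" and B1: "1 \<le> B" and rB: "r \<le> B"
    and B: "\<And>t. 0 < t \<Longrightarrow> t \<le> r \<Longrightarrow> \<bar>g t\<bar> \<le> B \<and> \<bar>e t\<bar> \<le> B \<and> \<bar>t * n t\<bar> \<le> B \<and> \<bar>Gm t / t\<^sup>2\<bar> \<le> B"
    and C: "\<And>t. 0 < t \<Longrightarrow> t \<le> r \<Longrightarrow> \<bar>g2 t\<bar> \<le> B \<and> \<bar>e2 t\<bar> \<le> B \<and> \<bar>t * n2 t\<bar> \<le> B \<and> \<bar>Gm2 t / t\<^sup>2\<bar> \<le> B"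
    and M: "0 \<le> M" "\<And>t. 0 < t \<Longrightarrow> t \<le> r \<Longrightarrow> S t \<le> M * exp (60 * B\<^sup>2 * t)"
    and t: "0 < t" "t \<le> r"
  shows "S t \<le> (M / 2) * exp (60 * B\<^sup>2 * t)"
proof -
  \<comment> \<open>As B is at least 1, the right-hand sides of the three difference equations have
    Lipschitz constants at most 5 B^2, hence below \<open>L\<close>. The exponent 6 \<open>L\<close>
    makes each integrated bound M/6, and three of them sum to M/2.\<close>
  define L where "L = 10 * B\<^sup>2"
  have BB: "B \<le> B\<^sup>2" using B1 mult_left_mono[of 1 B B] by (simp add: power2_eq_square)
  have L: "0 < L" using B1 by (simp add: L_def)
  have L60: "60 * B\<^sup>2 = 6 * L" by (simp add: L_def)
  let ?W = "\<lambda>s. M * exp (6 * L * s)"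
  have W: "S q \<le> ?W s" if "0 < q" "q \<le> s" "s \<le> r" for q s
  proof -
    have "S q \<le> ?W q" using M(2)[of q] that unfolding L60 by simp
    also have "\<dots> \<le> ?W s" using M(1) that L by (intro mult_left_mono) auto
    finally show ?thesis .
  qed
  have key: "\<bar>f t\<bar> \<le> M * L / (6 * L) * exp (6 * L * t)"
    if f: "\<And>s. 0 < s \<Longrightarrow> s \<le> r \<Longrightarrow> (f has_real_derivative F s / (1 + s\<^sup>2)) (at s)" "(f \<longlongrightarrow> 0) (at_right 0)"
      and F: "\<And>s. 0 < s \<Longrightarrow> s \<le> r \<Longrightarrow> \<bar>F s\<bar> \<le> L * ?W s" for f F
  proof (rule exp_comparison[OF t(1) _ _ _ _ f(2)])
    show "(f has_real_derivative F s / (1 + s\<^sup>2)) (at s)" if "0 < s" "s \<le> t" for s using f(1) that t by auto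
    show "\<bar>F s / (1 + s\<^sup>2)\<bar> \<le> M * L * exp (6 * L * s)" if "0 < s" "s \<le> t" for s
      using divide_one_plus_le[OF F[of s]] that t by (simp add: mult_ac)
  qed (use L M in auto)
  have nz: "1 + s\<^sup>2 \<noteq> 0" for s :: real by (metis add_pos_nonneg less_irrefl zero_le_power2 zero_less_one)
  have b: "\<bar>g s\<bar> \<le> B" "\<bar>s * n s\<bar> \<le> B" "\<bar>Gm s / s\<^sup>2\<bar> \<le> B" "\<bar>g2 s\<bar> \<le> B" "\<bar>s * n2 s\<bar> \<le> B" "\<bar>Gm2 s / s\<^sup>2\<bar> \<le> B" "0 \<le> s" "s \<le> B" "s < d"
    if "0 < s" "s \<le> r" for s using B[OF that] C[OF that] that rB r by auto
  have Ws: "\<bar>g s - g2 s\<bar> \<le> ?W s" "\<bar>e s - e2 s\<bar> \<le> ?W s" "\<bar>n s - n2 s\<bar> \<le> ?W s" "0 \<le> ?W s" if "0 < s" "s \<le> r" for s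
    using W[of s s] that M(1) by auto
  have sec: "\<bar>(Gm s - Gm2 s) / s\<^sup>2\<bar> \<le> ?W s" "\<bar>(E s - E2 s) / s ^ 3\<bar> \<le> s * ?W s" if s: "0 < s" "s \<le> r" for s
  proof -
    note q = secondary[of s "?W s", OF s(1) b(9)[OF s] W]
    show "\<bar>(Gm s - Gm2 s) / s\<^sup>2\<bar> \<le> ?W s" using q(1) s by (simp add: abs_divide divide_le_eq)
    have "\<bar>E s - E2 s\<bar> \<le> s * ?W s * s ^ 3" using q(3) s by (simp add: power2_eq_square power3_eq_cube mult_ac)
    then show "\<bar>(E s - E2 s) / s ^ 3\<bar> \<le> s * ?W s" using s by (simp add: abs_divide divide_le_eq)
  qed
  have am: "\<bar>x * y\<bar> \<le> a * w" if "\<bar>x\<bar> \<le> a" "\<bar>y\<bar> \<le> w" for x y a w :: real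
    using mult_mono[OF that] that by (simp add: abs_mult)
  have tri3: "\<bar>x - y - z\<bar> \<le> w" if "\<bar>x\<bar> \<le> a" "\<bar>y\<bar> \<le> b" "\<bar>z\<bar> \<le> c" "a + b + c \<le> w" for x y z a b c w :: real
    using that by linarith
  have tri2: "\<bar>x - y\<bar> \<le> w" if "\<bar>x\<bar> \<le> a" "\<bar>y\<bar> \<le> b" "a + b \<le> w" for x y a b w :: real
    using that by linarith
  have half: "\<bar>(x + y) / 2 - z\<bar> \<le> 2 * B" if "\<bar>x\<bar> \<le> B" "\<bar>y\<bar> \<le> B" "0 \<le> z" "z \<le> B" for x y z :: real
  proof -
    have "x \<le> B" "- x \<le> B" "y \<le> B" "- y \<le> B" using that(1,2) by (auto simp: abs_le_iff)
    then show ?thesis using that(3,4) unfolding abs_le_iff by (auto simp: field_simps)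
  qed
  have gd: "\<bar>g t - g2 t\<bar> \<le> M * L / (6 * L) * exp (6 * L * t)"
  proof (rule key[OF _ diff_limits(2)])
    fix s assume s: "0 < s" "s \<le> r"
    have "2 * s * ((n s - 3) * g s / (2 * (1 + s\<^sup>2))) - 2 * s * ((n2 s - 3) * g2 s / (2 * (1 + s\<^sup>2)))
      = ((s * n s - 3 * s) * (g s - g2 s) + s * g2 s * (n s - n2 s)) / (1 + s\<^sup>2)"
    proof -
      have "2 * s * ((a - 3) * x / (2 * c)) - 2 * s * ((a' - 3) * x' / (2 * c)) = ((s * a - 3 * s) * (x - x') + s * x' * (a - a')) / c"
        if "c \<noteq> 0" for a x a' x' c :: real using that by (simp add: field_simps)
      then show ?thesis using nz .
    qed
    then show "((\<lambda>t. g t - g2 t) has_real_derivative ((s * n s - 3 * s) * (g s - g2 s) + s * g2 s * (n s - n2 s)) / (1 + s\<^sup>2)) (at s)"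
      using DERIV_diff[OF g' b.g', of s] b(9)[OF s] s by simp
    have "\<bar>s * n s - 3 * s\<bar> \<le> 4 * B" using b(2,7,8)[OF s] by linarith
    then have "\<bar>(s * n s - 3 * s) * (g s - g2 s)\<bar> \<le> (4 * B) * ?W s"
      by (rule am[OF _ Ws(1)[OF s]])
    moreover have "\<bar>s * g2 s * (n s - n2 s)\<bar> \<le> (B * B) * ?W s"
      by (rule am[OF am[OF _ b(4)[OF s]] Ws(3)[OF s]]) (use b(7,8)[OF s] in simp)
    moreover have "(4 * B) * ?W s + (B * B) * ?W s \<le> L * ?W s"
      unfolding distrib_right[symmetric] using Ws(4)[OF s] BB B1 by (intro mult_right_mono) (auto simp: L_def power2_eq_square)
    ultimately show "\<bar>(s * n s - 3 * s) * (g s - g2 s) + s * g2 s * (n s - n2 s)\<bar> \<le> L * ?W s" by linarith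
  qed
  have ed: "\<bar>e t - e2 t\<bar> \<le> M * L / (6 * L) * exp (6 * L * t)"
  proof (rule key[OF _ diff_limits(5)])
    fix s assume s: "0 < s" "s \<le> r"
    have "2 * s * ((- 3 * e s - Gm s / s\<^sup>2 * g s) / (2 * (1 + s\<^sup>2))) - 2 * s * ((- 3 * e2 s - Gm2 s / s\<^sup>2 * g2 s) / (2 * (1 + s\<^sup>2)))
      = (- (s * 3) * (e s - e2 s) - (s * g s) * ((Gm s - Gm2 s) / s\<^sup>2) - (s * (Gm2 s / s\<^sup>2)) * (g s - g2 s)) / (1 + s\<^sup>2)"
    proof -
      have "2 * s * ((- 3 * x - G / q * y) / (2 * c)) - 2 * s * ((- 3 * x' - G' / q * y') / (2 * c))
          = (- (s * 3) * (x - x') - (s * y) * ((G - G') / q) - (s * (G' / q)) * (y - y')) / c"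
        if "c \<noteq> 0" "q \<noteq> 0" for x y G x' y' G' c q :: real using that by (simp add: field_simps)
      note alg = this
      show ?thesis by (rule alg[OF nz]) (use s in simp)
    qed
    then show "((\<lambda>t. e t - e2 t) has_real_derivative (- (s * 3) * (e s - e2 s) - (s * g s) * ((Gm s - Gm2 s) / s\<^sup>2) - (s * (Gm2 s / s\<^sup>2)) * (g s - g2 s)) / (1 + s\<^sup>2)) (at s)"
      using DERIV_diff[OF e' b.e', of s] b(9)[OF s] s by simp
    have sB: "\<bar>s\<bar> \<le> B" using b(7,8)[OF s] by simp
    have "\<bar>- (s * 3) * (e s - e2 s)\<bar> \<le> (B * 3) * ?W s"
      by (rule am[OF _ Ws(2)[OF s]]) (use b(7,8)[OF s] in simp)
    moreover have "\<bar>(s * g s) * ((Gm s - Gm2 s) / s\<^sup>2)\<bar> \<le> (B * B) * ?W s"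
      by (rule am[OF am[OF sB b(1)[OF s]] sec(1)[OF s]])
    moreover have "\<bar>(s * (Gm2 s / s\<^sup>2)) * (g s - g2 s)\<bar> \<le> (B * B) * ?W s"
      by (rule am[OF am[OF sB b(6)[OF s]] Ws(1)[OF s]])
    moreover have "(B * 3) * ?W s + (B * B) * ?W s + (B * B) * ?W s \<le> L * ?W s"
      unfolding distrib_right[symmetric] using Ws(4)[OF s] BB B1 by (intro mult_right_mono) (auto simp: L_def power2_eq_square)
    ultimately show "\<bar>- (s * 3) * (e s - e2 s) - (s * g s) * ((Gm s - Gm2 s) / s\<^sup>2) - (s * (Gm2 s / s\<^sup>2)) * (g s - g2 s)\<bar> \<le> L * ?W s" by (rule tri3)
  qed
  have nd: "\<bar>n t - n2 t\<bar> \<le> M * L / (6 * L) * exp (6 * L * t)"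
  proof (rule key[OF _ diff_limits(6)])
    fix s assume s: "0 < s" "s \<le> r"
    have alg: "2 * s * ((s\<^sup>2 * (a\<^sup>2 / 2 - a) - x / s\<^sup>2) / (2 * s\<^sup>2 * c)) - 2 * s * ((s\<^sup>2 * (a'\<^sup>2 / 2 - a') - x' / s\<^sup>2) / (2 * s\<^sup>2 * c))
      = (((s * a + s * a') / 2 - s) * (a - a') - (x - x') / s ^ 3) / c" if "c \<noteq> 0" for a a' x x' c :: real
      using s that by (simp add: field_simps power2_eq_square power3_eq_cube)
    have "2 * s * ((s\<^sup>2 * ((n s)\<^sup>2 / 2 - n s) - E s / s\<^sup>2) / (2 * s\<^sup>2 * (1 + s\<^sup>2))) - 2 * s * ((s\<^sup>2 * ((n2 s)\<^sup>2 / 2 - n2 s) - E2 s / s\<^sup>2) / (2 * s\<^sup>2 * (1 + s\<^sup>2)))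
      = (((s * n s + s * n2 s) / 2 - s) * (n s - n2 s) - (E s - E2 s) / s ^ 3) / (1 + s\<^sup>2)"
      by (rule alg[OF nz])
    then show "((\<lambda>t. n t - n2 t) has_real_derivative (((s * n s + s * n2 s) / 2 - s) * (n s - n2 s) - (E s - E2 s) / s ^ 3) / (1 + s\<^sup>2)) (at s)"
      using DERIV_diff[OF n' b.n', of s] b(9)[OF s] s by simp
    have "\<bar>(s * n s + s * n2 s) / 2 - s\<bar> \<le> 2 * B" using half b(2,5,7,8)[OF s] by blast
    then have "\<bar>((s * n s + s * n2 s) / 2 - s) * (n s - n2 s)\<bar> \<le> (2 * B) * ?W s"
      by (rule am[OF _ Ws(3)[OF s]])
    moreover have "\<bar>(E s - E2 s) / s ^ 3\<bar> \<le> B * ?W s"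
      using sec(2)[OF s] mult_right_mono[OF b(8)[OF s] Ws(4)[OF s]] by linarith
    moreover have "(2 * B) * ?W s + B * ?W s \<le> L * ?W s"
      unfolding distrib_right[symmetric] using Ws(4)[OF s] BB B1 by (intro mult_right_mono) (auto simp: L_def power2_eq_square)
    ultimately show "\<bar>((s * n s + s * n2 s) / 2 - s) * (n s - n2 s) - (E s - E2 s) / s ^ 3\<bar> \<le> L * ?W s" by (rule tri2)
  qed
  have "3 * (M * L / (6 * L) * exp (6 * L * t)) = (M / 2) * exp (6 * L * t)" using L by simp
  then show ?thesis using gd ed nd unfolding L60 by linarith
qed

lemma S_zero:
  assumes r: "0 < r" "r < d"
  shows "S r = 0"
proof -
  obtain Ba where Ba: "1 \<le> Ba" "\<And>t. 0 < t \<Longrightarrow> t \<le> r \<Longrightarrow> \<bar>g t\<bar> \<le> Ba \<and> \<bar>e t\<bar> \<le> Ba \<and> \<bar>t * n t\<bar> \<le> Ba \<and> \<bar>Gm t / t\<^sup>2\<bar> \<le> Ba"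
    using bounds[OF r(2)] by blast
  obtain Bb where Bb: "1 \<le> Bb" "\<And>t. 0 < t \<Longrightarrow> t \<le> r \<Longrightarrow> \<bar>g2 t\<bar> \<le> Bb \<and> \<bar>e2 t\<bar> \<le> Bb \<and> \<bar>t * n2 t\<bar> \<le> Bb \<and> \<bar>Gm2 t / t\<^sup>2\<bar> \<le> Bb"
    using b.bounds[OF r(2)] by blast
  define B where "B = max r (max Ba Bb)"
  have B: "1 \<le> B" "r \<le> B" "Ba \<le> B" "Bb \<le> B" using Ba(1) by (auto simp: B_def)
  note h = halving[OF r(2) B(1,2)]
  have hyp1: "\<bar>g t\<bar> \<le> B \<and> \<bar>e t\<bar> \<le> B \<and> \<bar>t * n t\<bar> \<le> B \<and> \<bar>Gm t / t\<^sup>2\<bar> \<le> B" if "0 < t" "t \<le> r" for t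
    using Ba(2)[OF that] B by auto
  have hyp2: "\<bar>g2 t\<bar> \<le> B \<and> \<bar>e2 t\<bar> \<le> B \<and> \<bar>t * n2 t\<bar> \<le> B \<and> \<bar>Gm2 t / t\<^sup>2\<bar> \<le> B" if "0 < t" "t \<le> r" for t
    using Bb(2)[OF that] B by auto
  have cont: "isCont (\<lambda>t. n t - n2 t) t" if "0 < t" "t \<le> r" for t
    using DERIV_isCont[OF n'] DERIV_isCont[OF b.n'] that r by (intro continuous_intros) auto
  obtain N where N: "\<And>t. 0 < t \<Longrightarrow> t \<le> r \<Longrightarrow> \<bar>n t - n2 t\<bar> \<le> N"
    using bounded_from_right_limit[OF cont diff_limits(6)] by blast
  \<comment> \<open>This is the starting bound: 2B for each of the differences of \<open>g\<close>
    and \<open>e\<close>, and \<open>N\<close> for that of \<open>n\<close>, which is bounded since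
    the logarithms of the two solutions cancel.\<close>
  define M where "M = 4 * B + \<bar>N\<bar>"
  have M0: "0 \<le> M" using B(1) by (simp add: M_def)
  have SM: "S t \<le> M * exp (60 * B\<^sup>2 * t)" if t: "0 < t" "t \<le> r" for t
  proof -
    have "\<bar>g t - g2 t\<bar> \<le> 2 * B" "\<bar>e t - e2 t\<bar> \<le> 2 * B"
      using abs_triangle_ineq4[of "g t" "g2 t"] abs_triangle_ineq4[of "e t" "e2 t"] hyp1[OF t] hyp2[OF t] by linarith+
    then have "S t \<le> 2 * B + 2 * B + \<bar>N\<bar>"
      using order_trans[OF N[OF t] abs_ge_self[of N]] by (intro add_mono)
    then have "S t \<le> M * 1" by (simp add: M_def)
    also have "\<dots> \<le> M * exp (60 * B\<^sup>2 * t)" using M0 t by (intro mult_left_mono) auto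
    finally show ?thesis .
  qed
  have iter: "\<forall>t. 0 < t \<longrightarrow> t \<le> r \<longrightarrow> S t \<le> (M / 2 ^ j) * exp (60 * B\<^sup>2 * t)" for j
  proof (induction j)
    case (Suc j)
    have "S t \<le> (M / 2 ^ j / 2) * exp (60 * B\<^sup>2 * t)" if "0 < t" "t \<le> r" for t
    proof (rule halving[OF r(2) B(1,2) hyp1 hyp2 _ _ that])
      show "0 \<le> M / 2 ^ j" using M0 by simp
      show "S t \<le> (M / 2 ^ j) * exp (60 * B\<^sup>2 * t)" if "0 < t" "t \<le> r" for t using Suc that by blast
    qed
    then show ?case by (simp only: power_Suc2 divide_divide_eq_left) blast
  qed (use SM in simp)
  have "(\<lambda>j. (M * exp (60 * B\<^sup>2 * r)) * (1/2) ^ j) \<longlonglongrightarrow> (M * exp (60 * B\<^sup>2 * r)) * 0"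
    by (intro tendsto_intros LIMSEQ_realpow_zero) auto
  moreover have "S r \<le> (M * exp (60 * B\<^sup>2 * r)) * (1/2) ^ j" for j
  proof -
    have "S r \<le> (M / 2 ^ j) * exp (60 * B\<^sup>2 * r)" using iter[of j] r by blast
    also have "\<dots> = (M * exp (60 * B\<^sup>2 * r)) * (1/2) ^ j" by (simp add: power_one_over)
    finally show ?thesis .
  qed
  ultimately have "S r \<le> (M * exp (60 * B\<^sup>2 * r)) * 0"
    by (intro LIMSEQ_le_const[of _ _ "S r"]) blast+
  then have "S r \<le> 0" by (simp only: mult_zero_right)
  then show ?thesis by (intro antisym add_nonneg_nonneg abs_ge_zero)
qed

theorem unique:
  assumes "0 < r" "r < d"
  shows "Gm r = Gm2 r" "E r = E2 r" "k r = k2 r" "g r = g2 r" "e r = e2 r" "n r = n2 r"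
proof -
  have "S s \<le> 0" if "0 < s" "s \<le> r" for s
    using S_zero[OF that(1) order.strict_trans1[OF that(2) assms(2)]] by (rule eq_refl)
  from secondary[OF assms this] S_zero[OF assms]
  show "Gm r = Gm2 r" "E r = E2 r" "k r = k2 r" "g r = g2 r" "e r = e2 r" "n r = n2 r" by auto
qed

end

section \<open>Bounds and limits at a singular endpoint\<close>

text \<open>Gronwall towards the singular point: (f^2 + 1) exp(3 C t) is nondecreasing, so its value
  at \<open>r\<close> bounds it on the whole of (0, r]. The 3 comes from 2 |f| (|f| + 1) \<le> 3
  (f^2 + 1).\<close>

lemma growth_bounded:
  fixes f :: "real \<Rightarrow> real"
  assumes f: "\<And>t. 0 < t \<Longrightarrow> t \<le> r \<Longrightarrow> (f has_real_derivative f' t) (at t)"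
    and b: "\<And>t. 0 < t \<Longrightarrow> t \<le> r \<Longrightarrow> \<bar>f' t\<bar> \<le> C * (\<bar>f t\<bar> + 1)" and C: "0 < C"
  shows "\<exists>B. \<forall>t. 0 < t \<longrightarrow> t \<le> r \<longrightarrow> \<bar>f t\<bar> \<le> B"
proof -
  define w where "w t = ((f t)\<^sup>2 + 1) * exp (3 * C * t)" for t
  have mono: "w t \<le> w r" if t: "0 < t" "t \<le> r" for t
  proof (rule DERIV_nonneg_imp_nondecreasing[of t r w])
    show "t \<le> r" by fact
    fix x assume x: "t \<le> x" "x \<le> r"
    have x0: "0 < x" using x t by simp
    have w': "(w has_real_derivative (2 * f x * f' x + 3 * C * ((f x)\<^sup>2 + 1)) * exp (3 * C * x)) (at x)"
      unfolding w_def[abs_def] by (auto intro!: derivative_eq_intros f x0 x(2) simp: algebra_simps)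
    have "\<bar>2 * f x * f' x\<bar> \<le> 2 * \<bar>f x\<bar> * (C * (\<bar>f x\<bar> + 1))"
      unfolding abs_mult using b[OF x0 x(2)] by (intro mult_mono) auto
    also have "\<dots> \<le> 3 * C * ((f x)\<^sup>2 + 1)"
    proof -
      have "2 * \<bar>f x\<bar> * (\<bar>f x\<bar> + 1) \<le> 3 * ((f x)\<^sup>2 + 1)"
        using zero_le_power2[of "\<bar>f x\<bar> - 1"] by (simp add: power2_eq_square algebra_simps)
      from mult_left_mono[OF this, of C] C show ?thesis by (simp add: algebra_simps)
    qed
    finally have "0 \<le> 2 * f x * f' x + 3 * C * ((f x)\<^sup>2 + 1)" by linarith
    then show "\<exists>y. (w has_real_derivative y) (at x) \<and> 0 \<le> y" using w'
      by (intro exI[of _ "(2 * f x * f' x + 3 * C * ((f x)\<^sup>2 + 1)) * exp (3 * C * x)"]) simp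
  qed
  have "\<bar>f t\<bar> \<le> w r" if t: "0 < t" "t \<le> r" for t
  proof -
    have "\<bar>f t\<bar> \<le> (f t)\<^sup>2 + 1"
      using zero_le_power2[of "\<bar>f t\<bar> - 1"] zero_le_power2[of "f t"] by (simp add: power2_eq_square algebra_simps)
    also have "\<dots> \<le> w t" using t C mult_left_mono[of 1 "exp (3 * C * t)" "(f t)\<^sup>2 + 1"] by (simp add: w_def)
    finally show ?thesis using mono[OF t] by simp
  qed
  then show ?thesis by blast
qed

text \<open>F/t^2 is the mean of \<open>f\<close> over [0, t^2] in the variable s. A function with
  bounded derivative differs from its means by O(t), so their limit is also its own. This recovers
  limits of (s B)' and (s Phi)' from those of B and Phi.\<close>

lemma average_limit:
  fixes F f :: "real \<Rightarrow> real"
  assumes r: "0 < r" and F: "\<And>t. 0 < t \<Longrightarrow> t \<le> r \<Longrightarrow> (F has_real_derivative 2 * t * f t) (at t)"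
    and f: "\<And>t. 0 < t \<Longrightarrow> t \<le> r \<Longrightarrow> (f has_real_derivative f' t) (at t)"
    and b: "\<And>t. 0 < t \<Longrightarrow> t \<le> r \<Longrightarrow> \<bar>f' t\<bar> \<le> B"
    and F0: "(F \<longlongrightarrow> 0) (at_right 0)" and l: "((\<lambda>t. F t / t\<^sup>2) \<longlongrightarrow> l) (at_right 0)"
  shows "(f \<longlongrightarrow> l) (at_right 0)"
proof -
  have B0: "0 \<le> B" using b[of r] r by (meson abs_ge_zero order.refl order.trans)
  have key: "\<bar>F q / q\<^sup>2 - f q\<bar> \<le> B * q" if q: "0 < q" "q \<le> r" for q
  proof -
    have "\<bar>F q - q\<^sup>2 * f q\<bar> \<le> (B * q) * q\<^sup>2"
    proof (rule quadratic_comparison[OF q(1), where f="\<lambda>t. F t - t\<^sup>2 * f q" and f'="\<lambda>t. 2 * t * f t - 2 * t * f q"])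
      show "((\<lambda>t. F t - t\<^sup>2 * f q) has_real_derivative 2 * t * f t - 2 * t * f q) (at t)" if "0 < t" "t \<le> q" for t
        using F[of t] that q by (auto intro!: derivative_eq_intros)
      show "\<bar>2 * t * f t - 2 * t * f q\<bar> \<le> 2 * t * (B * q)" if t: "0 < t" "t \<le> q" for t
      proof -
        have "\<bar>f q - f t\<bar> \<le> B * q"
        proof (cases "t = q")
          case False
          then have "t < q" using t by simp
          then obtain z where z: "t < z" "z < q" "f q - f t = (q - t) * f' z"
            using MVT2[of t q f f'] f t q by auto
          have "\<bar>f q - f t\<bar> = (q - t) * \<bar>f' z\<bar>" using z t by (simp add: abs_mult)
          also have "\<dots> \<le> q * B" using z t q by (intro mult_mono b) auto
          finally show ?thesis by (simp add: mult.commute)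
        qed (use B0 q in simp)
        then have "2 * t * \<bar>f t - f q\<bar> \<le> 2 * t * (B * q)" using t by (intro mult_left_mono) (auto simp: abs_minus_commute)
        moreover have "\<bar>2 * t * f t - 2 * t * f q\<bar> = 2 * t * \<bar>f t - f q\<bar>"
          using t by (simp add: right_diff_distrib[symmetric] abs_mult)
        ultimately show ?thesis by simp
      qed
      have "((\<lambda>t. F t - t\<^sup>2 * f q) \<longlongrightarrow> 0 - 0\<^sup>2 * f q) (at_right 0)" by (intro tendsto_intros F0)
      then show "((\<lambda>t. F t - t\<^sup>2 * f q) \<longlongrightarrow> 0) (at_right 0)" by simp
    qed
    moreover have "\<bar>F q / q\<^sup>2 - f q\<bar> = \<bar>F q - q\<^sup>2 * f q\<bar> / q\<^sup>2"
    proof -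
      have "F q / q\<^sup>2 - f q = (F q - q\<^sup>2 * f q) / q\<^sup>2" using q by (simp add: field_simps)
      then show ?thesis using q by (simp add: abs_divide)
    qed
    ultimately show ?thesis using q by (simp add: divide_le_eq)
  qed
  have "((\<lambda>t. F t / t\<^sup>2 - f t) \<longlongrightarrow> 0) (at_right 0)"
  proof (rule Lim_null_comparison)
    show "\<forall>\<^sub>F t in at_right 0. norm (F t / t\<^sup>2 - f t) \<le> B * t"
      unfolding eventually_at_right_field using r key by (intro exI[of _ r]) auto
    have "((\<lambda>t. B * t) \<longlongrightarrow> B * 0) (at_right 0)" by (intro tendsto_intros)
    then show "((\<lambda>t. B * t) \<longlongrightarrow> 0) (at_right 0)" by simp
  qed
  from tendsto_diff[OF l this] show ?thesis by simp
qed

lemma compose_square_deriv: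
  assumes "(F has_real_derivative D) (at (t\<^sup>2))"
  shows "((\<lambda>t. F (t\<^sup>2)) has_real_derivative 2 * t * D) (at t)"
proof -
  have "((\<lambda>t. t\<^sup>2) has_real_derivative 2 * t) (at t)" by (auto intro!: derivative_eq_intros)
  from DERIV_chain2[where f=F and g="\<lambda>t. t\<^sup>2", OF assms this] show ?thesis by (simp add: mult.commute)
qed

section \<open>Profiles of solutions solve the singular system\<close>

text \<open>The definition E/s = (1 + s) h + (s + 2) n + s n^2/2, solved for \<open>h\<close> at s =
  t^2.\<close>

definition vertical_profile :: "(real \<Rightarrow> real) \<Rightarrow> (real \<Rightarrow> real) \<Rightarrow> real \<Rightarrow> real" where
  "vertical_profile E n t = (E t / t\<^sup>2 - (t\<^sup>2 + 2) * n t - t\<^sup>2 * (n t)\<^sup>2 / 2) / (1 + t\<^sup>2)"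

text \<open>Eliminating second derivatives and the pressure gradient from the momentum equations
  leaves a formula for e = k' in which the pressure occurs undifferentiated; this is that formula
  solved for the pressure.\<close>

definition pressure_profile :: "(real \<Rightarrow> real) \<Rightarrow> (real \<Rightarrow> real) \<Rightarrow> (real \<Rightarrow> real) \<Rightarrow> (real \<Rightarrow> real) \<Rightarrow> (real \<Rightarrow> real) \<Rightarrow> real \<Rightarrow> real" where
  "pressure_profile Gm E k e n t = k t - 2 * (1 + t\<^sup>2) * e t + (1 - t\<^sup>2) * vertical_profile E n t - t\<^sup>2 * n t - t\<^sup>2 * (n t)\<^sup>2 / 2 - t\<^sup>2 * (Gm t / t\<^sup>2)\<^sup>2 / 2"

definition recon_u :: "(real \<Rightarrow> real) \<Rightarrow> (real \<Rightarrow> real) \<Rightarrow> (real \<Rightarrow> real) \<Rightarrow> real^3 \<Rightarrow> real^3" where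
  "recon_u Gm E n = profile_u (\<lambda>s. n (sqrt s) + vertical_profile E n (sqrt s)) (\<lambda>s. Gm (sqrt s) / s) (\<lambda>s. vertical_profile E n (sqrt s))"

definition recon_p :: "(real \<Rightarrow> real) \<Rightarrow> (real \<Rightarrow> real) \<Rightarrow> (real \<Rightarrow> real) \<Rightarrow> (real \<Rightarrow> real) \<Rightarrow> (real \<Rightarrow> real) \<Rightarrow> real^3 \<Rightarrow> real" where
  "recon_p Gm E k e n = scal 2 (\<lambda>s. pressure_profile Gm E k e n (sqrt s))"

lemma one_plus_square_pos: "0 < 1 + t\<^sup>2" for t :: real
  by (simp add: add_pos_nonneg)

locale profile_solution =
  fixes d :: real and \<mu> :: "real^4" and A A1 A2 B B1 B2 h h1 h2 q q1 :: "real \<Rightarrow> real"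
  assumes d: "0 < d" and pA: "profile d A A1 A2" and pB: "profile d B B1 B2" and ph: "profile d h h1 h2"
    and pq: "\<And>s. 0 < s \<Longrightarrow> s < d\<^sup>2 \<Longrightarrow> (q has_real_derivative q1 s) (at s)"
    and Er: "\<And>s. 0 < s \<Longrightarrow> s < d\<^sup>2 \<Longrightarrow> - (4 * s * (1 + s) * A2 s + (8 + 14 * s) * A1 s + 6 * A s) + (A s)\<^sup>2 - (B s)\<^sup>2 + 2 * s * (A s - h s) * A1 s - 2 * h s * A s + 2 * q1 s = 0"
    and Ep: "\<And>s. 0 < s \<Longrightarrow> s < d\<^sup>2 \<Longrightarrow> - (4 * s * (1 + s) * B2 s + (8 + 14 * s) * B1 s + 6 * B s) + 2 * A s * B s + 2 * s * (A s - h s) * B1 s - 2 * h s * B s = 0"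
    and E3: "\<And>s. 0 < s \<Longrightarrow> s < d\<^sup>2 \<Longrightarrow> - (4 * s * (1 + s) * h2 s + (4 + 10 * s) * h1 s + 2 * h s) + 2 * s * (A s - h s) * h1 s - (h s)\<^sup>2 - (2 * s * q1 s + 2 * q s) = 0"
    and Ed: "\<And>s. 0 < s \<Longrightarrow> s < d\<^sup>2 \<Longrightarrow> 2 * A s + 2 * s * A1 s - h s - 2 * s * h1 s = 0"
    and limA: "((\<lambda>t. A (t\<^sup>2) - \<mu> $ 1 / 2 * ln t) \<longlongrightarrow> \<mu> $ 3) (at_right 0)"
    and limB: "((\<lambda>t. B (t\<^sup>2)) \<longlongrightarrow> \<mu> $ 4) (at_right 0)"
    and limh: "((\<lambda>t. t * h (t\<^sup>2)) \<longlongrightarrow> 0) (at_right 0)"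
    and limq: "((\<lambda>t. q (t\<^sup>2) - \<mu> $ 1 * ln t) \<longlongrightarrow> \<mu> $ 2) (at_right 0)"
begin

lemmas A' = profile.F1[OF pA] and A'' = profile.F2[OF pA] and B' = profile.F1[OF pB] and B'' = profile.F2[OF pB]
  and h' = profile.F1[OF ph] and h'' = profile.F2[OF ph]

definition N where "N s = A s - h s"
text \<open>By the divergence equation this is s (N^2/2 - N) - 2 s (1 + s) N', the inhomogeneity of
  the Riccati equation for \<open>N\<close>.\<close>

definition Phi where "Phi s = (1 + s) * h s + (s + 2) * N s + s * (N s)\<^sup>2 / 2"
text \<open>\<open>kk\<close> is (s Phi)' with N' eliminated by the divergence equation, and
  \<open>ee\<close> is its derivative with h'' and q' eliminated by the momentum equations. Freed of
  the highest derivatives, both can be differentiated again although the profiles come with only two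
  derivatives.\<close>

definition kk where "kk s = 3 / 2 * s * h s + s * (1 + s) * h1 s + s * N s - s * N s * h s / 2"
definition ee where "ee s = (kk s - q s + (1 - s) * h s - s * N s - s * (N s)\<^sup>2 / 2 - s * (B s)\<^sup>2 / 2) / (2 * (1 + s))"

context
  fixes s assumes s: "0 < s" "s < d\<^sup>2"
begin

lemma N': "(N has_real_derivative A1 s - h1 s) (at s)"
  unfolding N_def[abs_def] by (intro DERIV_diff A' h' s)

lemma N1_eq: "2 * s * (A1 s - h1 s) = - (2 * N s + h s)"
  using Ed[OF s] by (simp add: N_def algebra_simps)

lemma Ed': "4 * A1 s + 2 * s * A2 s - 3 * h1 s - 2 * s * h2 s = 0"
proof -
  have 1: "((\<lambda>s. 2 * A s + 2 * s * A1 s - h s - 2 * s * h1 s) has_real_derivative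
      4 * A1 s + 2 * s * A2 s - 3 * h1 s - 2 * s * h2 s) (at s)"
    by (auto intro!: derivative_eq_intros A' A'' h' h'' s)
  have "((\<lambda>s. 0) has_real_derivative 0) (at s)" by simp
  then have "((\<lambda>s. 2 * A s + 2 * s * A1 s - h s - 2 * s * h1 s) has_real_derivative 0) (at s)"
    by (rule has_field_derivative_transform_within_open[of _ _ _ "{0<..<d\<^sup>2}"]) (use s Ed in auto)
  with 1 show ?thesis by (rule DERIV_unique)
qed

lemma G_deriv: "((\<lambda>s. s * B s) has_real_derivative B s + s * B1 s) (at s)"
  by (auto intro!: derivative_eq_intros B' s)

text \<open>\<open>s B\<close> equals r u^phi, the circulation around the axis up to 2 pi. The
  azimuthal equation contains no undifferentiated circulation, so it is a linear first-order
  equation for the derivative of \<open>s B\<close>.\<close>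

lemma gam_deriv: "((\<lambda>s. B s + s * B1 s) has_real_derivative (N s - 3) * (B s + s * B1 s) / (2 * (1 + s))) (at s)"
proof -
  have "((\<lambda>s. B s + s * B1 s) has_real_derivative 2 * B1 s + s * B2 s) (at s)"
    by (auto intro!: derivative_eq_intros B' B'' s)
  moreover have "2 * (1 + s) * (2 * B1 s + s * B2 s) = (N s - 3) * (B s + s * B1 s)"
    using Ep[OF s] by (simp add: N_def algebra_simps power2_eq_square)
  then have "2 * B1 s + s * B2 s = (N s - 3) * (B s + s * B1 s) / (2 * (1 + s))" using s by (simp add: field_simps)
  ultimately show ?thesis by simp
qed

lemma E_deriv: "((\<lambda>s. s * Phi s) has_real_derivative kk s) (at s)"
proof -
  have "((\<lambda>s. s * Phi s) has_real_derivative (1 + 2 * s) * h s + s * (1 + s) * h1 s + (2 * s + 2) * N s + (s + 2) * (s * (A1 s - h1 s))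
      + s * (N s)\<^sup>2 + s * N s * (s * (A1 s - h1 s))) (at s)"
    unfolding Phi_def[abs_def]
    by (auto intro!: derivative_eq_intros h' N' s simp: field_simps power2_eq_square)
  moreover have i: "s * (A1 s - h1 s) = - (N s + h s / 2)" using N1_eq by simp
  have "(1 + 2 * s) * h s + s * (1 + s) * h1 s + (2 * s + 2) * N s + (s + 2) * (s * (A1 s - h1 s))
      + s * (N s)\<^sup>2 + s * N s * (s * (A1 s - h1 s)) = kk s"
    unfolding i kk_def by (simp add: field_simps power2_eq_square)
  ultimately show ?thesis by simp
qed

lemma k_deriv_raw: "(kk has_real_derivative h s + (1 + 7/2 * s) * h1 s + s * (1 + s) * h2 s + (h s)\<^sup>2 / 4 - s * N s * h1 s / 2) (at s)"
proof -
  have "(kk has_real_derivative 3/2 * h s + 3/2 * s * h1 s + (1 + 2 * s) * h1 s + s * (1 + s) * h2 s + N s + s * (A1 s - h1 s)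
      - N s * h s / 2 - (s * (A1 s - h1 s)) * h s / 2 - s * N s * h1 s / 2) (at s)"
    unfolding kk_def[abs_def]
    by (auto intro!: derivative_eq_intros h' h'' N' s simp: field_simps)
  moreover have i: "s * (A1 s - h1 s) = - (N s + h s / 2)" using N1_eq by simp
  have "3/2 * h s + 3/2 * s * h1 s + (1 + 2 * s) * h1 s + s * (1 + s) * h2 s + N s + s * (A1 s - h1 s)
      - N s * h s / 2 - (s * (A1 s - h1 s)) * h s / 2 - s * N s * h1 s / 2
    = h s + (1 + 7/2 * s) * h1 s + s * (1 + s) * h2 s + (h s)\<^sup>2 / 4 - s * N s * h1 s / 2"
    unfolding i by (simp add: field_simps power2_eq_square)
  ultimately show ?thesis by (simp only:)
qed

text \<open>Once A'' is removed by the differentiated divergence equation, the radial equation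
  expresses k' through q'; inserting that q' into the vertical equation expresses k' through q. The
  version with q makes e algebraic, and the one with q' removes the q' that appears when e is
  differentiated. Together they close the system.\<close>

lemma k_eq: "h s + (1 + 7/2 * s) * h1 s + s * (1 + s) * h2 s + (h s)\<^sup>2 / 4 - s * N s * h1 s / 2 = ee s" (is "?K = _")
  and e_eq: "2 * ee s = q1 s + h s / 2 - (1 - s) * h1 s - (N s)\<^sup>2 / 2 - N s * h s / 2 - (B s)\<^sup>2 / 2"
proof -
  have alg: "2 * (1 + s') * (h + (1 + 7/2 * s') * h1 + s' * (1 + s') * h2 + h\<^sup>2 / 4 - s' * n * h1 / 2)
        = (3 / 2 * s' * h + s' * (1 + s') * h1 + s' * n - s' * n * h / 2) - q + (1 - s') * h - s' * n - s' * n\<^sup>2 / 2 - s' * B\<^sup>2 / 2"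
      "2 * (h + (1 + 7/2 * s') * h1 + s' * (1 + s') * h2 + h\<^sup>2 / 4 - s' * n * h1 / 2)
        = q1 + h / 2 - (1 - s') * h1 - n\<^sup>2 / 2 - n * h / 2 - B\<^sup>2 / 2"
    if "s' \<noteq> 0" and
      er: "- (4 * s' * (1 + s') * A2 + (8 + 14 * s') * A1 + 6 * (n + h)) + (n + h)\<^sup>2 - B\<^sup>2 + 2 * s' * n * A1 - 2 * h * (n + h) + 2 * q1 = 0" and
      e3: "- (4 * s' * (1 + s') * h2 + (4 + 10 * s') * h1 + 2 * h) + 2 * s' * n * h1 - h\<^sup>2 - (2 * s' * q1 + 2 * q) = 0" and
      ed: "2 * s' * (A1 - h1) = - (2 * n + h)" and ed': "4 * A1 + 2 * s' * A2 - 3 * h1 - 2 * s' * h2 = 0"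
    for s' h h1 h2 n q q1 A1 A2 B :: real
  proof -
    have A2: "2 * s' * A2 = 3 * h1 + 2 * s' * h2 - 4 * A1" using ed' by simp
    have A1: "2 * s' * A1 = 2 * s' * h1 - 2 * n - h" using ed by (simp add: algebra_simps)
    have q1: "2 * q1 = 2 * (1 + s') * (2 * s' * A2) + 8 * A1 + 7 * (2 * s' * A1) + 6 * (n + h) - (n + h)\<^sup>2 + B\<^sup>2 - n * (2 * s' * A1) + 2 * h * (n + h)"
      using er by (simp add: algebra_simps)
    have q1': "2 * q1 = (2 * (1 + s') * (3 * h1 + 2 * s' * h2) - 4 * (2 * s' * h1 - 2 * n - h)) + 7 * (2 * s' * h1 - 2 * n - h) + 6 * (n + h) - (n + h)\<^sup>2 + B\<^sup>2 - n * (2 * s' * h1 - 2 * n - h) + 2 * h * (n + h)"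
    proof -
      have "2 * q1 = 2 * (1 + s') * (3 * h1 + 2 * s' * h2) - 4 * (2 * s' * A1) + 7 * (2 * s' * A1) + 6 * (n + h) - (n + h)\<^sup>2 + B\<^sup>2 - n * (2 * s' * A1) + 2 * h * (n + h)"
        unfolding q1 A2 by (simp add: algebra_simps)
      then show ?thesis unfolding A1 by simp
    qed
    have q: "2 * q = - (4 * s' * (1 + s') * h2 + (4 + 10 * s') * h1 + 2 * h) + 2 * s' * n * h1 - h\<^sup>2 - s' * (2 * q1)"
      using e3 by (simp add: algebra_simps)
    have pressure_profile: "q = (- (4 * s' * (1 + s') * h2 + (4 + 10 * s') * h1 + 2 * h) + 2 * s' * n * h1 - h\<^sup>2 - s' * (2 * q1)) / 2"
      using q by simp
    show "2 * (1 + s') * (h + (1 + 7/2 * s') * h1 + s' * (1 + s') * h2 + h\<^sup>2 / 4 - s' * n * h1 / 2)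
        = (3 / 2 * s' * h + s' * (1 + s') * h1 + s' * n - s' * n * h / 2) - q + (1 - s') * h - s' * n - s' * n\<^sup>2 / 2 - s' * B\<^sup>2 / 2"
      unfolding pressure_profile q1' by (simp add: field_simps power2_eq_square)
    have q1'': "q1 = ((2 * (1 + s') * (3 * h1 + 2 * s' * h2) - 4 * (2 * s' * h1 - 2 * n - h)) + 7 * (2 * s' * h1 - 2 * n - h) + 6 * (n + h) - (n + h)\<^sup>2 + B\<^sup>2 - n * (2 * s' * h1 - 2 * n - h) + 2 * h * (n + h)) / 2"
      using q1' by simp
    show "2 * (h + (1 + 7/2 * s') * h1 + s' * (1 + s') * h2 + h\<^sup>2 / 4 - s' * n * h1 / 2)
        = q1 + h / 2 - (1 - s') * h1 - n\<^sup>2 / 2 - n * h / 2 - B\<^sup>2 / 2"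
      unfolding q1'' by (simp add: field_simps power2_eq_square)
  qed
  have An: "A s = N s + h s" by (simp add: N_def)
  have "2 * (1 + s) * ?K = (3 / 2 * s * h s + s * (1 + s) * h1 s + s * N s - s * N s * h s / 2) - q s + (1 - s) * h s - s * N s - s * (N s)\<^sup>2 / 2 - s * (B s)\<^sup>2 / 2"
    by (rule alg(1)[where ?A1.0="A1 s" and ?A2.0="A2 s" and ?q1.0="q1 s"])
      (use s Er[OF s] E3[OF s] N1_eq Ed' in \<open>simp_all add: An\<close>)
  then show K: "?K = ee s" using s unfolding ee_def kk_def by (simp add: field_simps)
  have "2 * ?K = q1 s + h s / 2 - (1 - s) * h1 s - (N s)\<^sup>2 / 2 - N s * h s / 2 - (B s)\<^sup>2 / 2"
    by (rule alg(2)[where ?A1.0="A1 s" and ?A2.0="A2 s" and q="q s"])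
      (use s Er[OF s] E3[OF s] N1_eq Ed' in \<open>simp_all add: An\<close>)
  then show "2 * ee s = q1 s + h s / 2 - (1 - s) * h1 s - (N s)\<^sup>2 / 2 - N s * h s / 2 - (B s)\<^sup>2 / 2" unfolding K .
qed

lemma k_deriv: "(kk has_real_derivative ee s) (at s)"
  using k_deriv_raw unfolding k_eq .

lemma e_deriv: "(ee has_real_derivative (- 3 * ee s - B s * (B s + s * B1 s)) / (2 * (1 + s))) (at s)"
proof -
  let ?X = "\<lambda>s. kk s - q s + (1 - s) * h s - s * N s - s * (N s)\<^sup>2 / 2 - s * (B s)\<^sup>2 / 2"
  have X: "(?X has_real_derivative ee s - q1 s - h s + (1 - s) * h1 s - N s - s * (A1 s - h1 s) - (N s)\<^sup>2 / 2 - N s * (s * (A1 s - h1 s))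
      - (B s)\<^sup>2 / 2 - s * B s * B1 s) (at s)"
    by (auto intro!: derivative_eq_intros k_deriv pq h' N' B' s simp: field_simps power2_eq_square)
  have "(ee has_real_derivative ((ee s - q1 s - h s + (1 - s) * h1 s - N s - s * (A1 s - h1 s) - (N s)\<^sup>2 / 2 - N s * (s * (A1 s - h1 s))
      - (B s)\<^sup>2 / 2 - s * B s * B1 s) * (2 * (1 + s)) - ?X s * 2) / ((2 * (1 + s)) * (2 * (1 + s)))) (at s)"
  proof -
    have eq: "(\<lambda>s. ?X s / (2 * (1 + s))) = ee" by (simp add: ee_def fun_eq_iff)
    have "((\<lambda>s. 2 * (1 + s)) has_real_derivative 2) (at s)" by (auto intro!: derivative_eq_intros)
    from DERIV_divide[OF X this] s show ?thesis unfolding eq by simp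
  qed
  moreover have i: "s * (A1 s - h1 s) = - (N s + h s / 2)" using N1_eq by simp
  have XX: "?X s = 2 * (1 + s) * ee s" using s by (simp add: ee_def)
  have "((ee s - q1 s - h s + (1 - s) * h1 s - N s - s * (A1 s - h1 s) - (N s)\<^sup>2 / 2 - N s * (s * (A1 s - h1 s))
      - (B s)\<^sup>2 / 2 - s * B s * B1 s) * (2 * (1 + s)) - ?X s * 2) / ((2 * (1 + s)) * (2 * (1 + s)))
    = (- 3 * ee s - B s * (B s + s * B1 s)) / (2 * (1 + s))"
  proof -
    have "(y * c - (c * z) * 2) / (c * c) = (y - 2 * z) / c" if "c \<noteq> 0" for y c z :: real using that by (simp add: field_simps)
    moreover have "ee s - q1 s - h s + (1 - s) * h1 s - N s - s * (A1 s - h1 s) - (N s)\<^sup>2 / 2 - N s * (s * (A1 s - h1 s))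
      - (B s)\<^sup>2 / 2 - s * B s * B1 s - 2 * ee s = - 3 * ee s - B s * (B s + s * B1 s)"
      using e_eq unfolding i by (simp add: algebra_simps power2_eq_square)
    ultimately show ?thesis unfolding XX using s by simp
  qed
  ultimately show ?thesis by simp
qed

text \<open>The coefficients of \<open>Phi\<close> are those for which s (N^2/2 - N) - Phi equals
  -(1 + s)(2 N + h). The divergence equation thereby becomes a Riccati equation without
  \<open>h\<close>.\<close>

lemma N'_eq: "A1 s - h1 s = (s * ((N s)\<^sup>2 / 2 - N s) - s * Phi s / s) / (2 * s * (1 + s))"
proof -
  have "A1 s - h1 s = - (2 * N s + h s) / (2 * s)" using N1_eq s by (simp add: field_simps)
  also have "\<dots> = (s * ((N s)\<^sup>2 / 2 - N s) - Phi s) / (2 * s * (1 + s))"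
  proof -
    have "s * ((N s)\<^sup>2 / 2 - N s) - Phi s = (1 + s) * - (2 * N s + h s)"
      unfolding Phi_def by (simp add: field_simps power2_eq_square)
    moreover have "x / y = c * x / (y * c)" if "c \<noteq> 0" for x y c :: real using that by simp
    ultimately show ?thesis using s by simp
  qed
  finally show ?thesis using s by simp
qed

end

lemma range: "0 < t \<Longrightarrow> t < d \<Longrightarrow> 0 < t\<^sup>2" "0 < t \<Longrightarrow> t < d \<Longrightarrow> t\<^sup>2 < d\<^sup>2" for t
  using d by (auto intro: power_strict_mono)

lemma t_ln: "((\<lambda>t::real. t * ln t) \<longlongrightarrow> 0) (at_right 0)" by real_asymp

lemma tA: "((\<lambda>t. t * A (t\<^sup>2)) \<longlongrightarrow> 0) (at_right 0)"
proof -
  have "((\<lambda>t. t * (A (t\<^sup>2) - \<mu> $ 1 / 2 * ln t) + \<mu> $ 1 / 2 * (t * ln t)) \<longlongrightarrow> 0 * \<mu> $ 3 + \<mu> $ 1 / 2 * 0) (at_right 0)"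
    by (intro tendsto_intros limA t_ln)
  then show ?thesis by (simp add: algebra_simps)
qed

lemma tN: "((\<lambda>t. t * N (t\<^sup>2)) \<longlongrightarrow> 0) (at_right 0)"
  using tendsto_diff[OF tA limh] by (simp add: N_def algebra_simps)

text \<open>The divergence equation says that t N(t^2) has derivative -A(t^2). The condition |u| =
  o(1/r) forces t N to vanish at the axis, so N is minus the mean of A over [0, t], and L'Hopital's
  rule transfers the expansion of A. The mean of ln over [0, t] is ln t - 1, which produces the
  constant \<mu>_1/2.\<close>

lemma limN: "((\<lambda>t. N (t\<^sup>2) + \<mu> $ 1 / 2 * ln t) \<longlongrightarrow> \<mu> $ 1 / 2 - \<mu> $ 3) (at_right 0)"
proof -
  let ?f = "\<lambda>t. t * N (t\<^sup>2) + \<mu> $ 1 / 2 * (t * ln t)"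
  have "((\<lambda>t. ?f t / t) \<longlongrightarrow> \<mu> $ 1 / 2 - \<mu> $ 3) (at_right 0)"
  proof (rule lhopital_right_0[where g'="\<lambda>_. 1" and f'="\<lambda>t. - (A (t\<^sup>2) - \<mu> $ 1 / 2 * ln t) + \<mu> $ 1 / 2"])
    have "(?f \<longlongrightarrow> 0 + \<mu> $ 1 / 2 * 0) (at_right 0)" by (intro tendsto_intros tN t_ln)
    then show "(?f \<longlongrightarrow> 0) (at_right 0)" by simp
    show "((\<lambda>t::real. t) \<longlongrightarrow> 0) (at_right 0)" by (intro tendsto_intros)
    show "\<forall>\<^sub>F x in at_right 0. x \<noteq> (0::real)" by (auto simp: eventually_at_right_field intro: exI[of _ 1])
    show "\<forall>\<^sub>F x in at_right 0. (1::real) \<noteq> 0" by simp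
    show "\<forall>\<^sub>F x in at_right 0. (?f has_real_derivative - (A (x\<^sup>2) - \<mu> $ 1 / 2 * ln x) + \<mu> $ 1 / 2) (at x)"
      unfolding eventually_at_right_field
    proof (intro exI[of _ d] conjI d allI impI)
      fix t assume t: "0 < t" "t < d"
      note dN = compose_square_deriv[OF N'[OF range[OF t]]]
      have "(?f has_real_derivative N (t\<^sup>2) + t * (2 * t * (A1 (t\<^sup>2) - h1 (t\<^sup>2))) + \<mu> $ 1 / 2 * (ln t + 1)) (at t)"
        using t by (auto intro!: derivative_eq_intros dN)
      moreover have "N (t\<^sup>2) + t * (2 * t * (A1 (t\<^sup>2) - h1 (t\<^sup>2))) = - A (t\<^sup>2)"
        using N1_eq[OF range[OF t]] by (simp add: N_def power2_eq_square algebra_simps)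
      then have "N (t\<^sup>2) + t * (2 * t * (A1 (t\<^sup>2) - h1 (t\<^sup>2))) + \<mu> $ 1 / 2 * (ln t + 1) = - (A (t\<^sup>2) - \<mu> $ 1 / 2 * ln t) + \<mu> $ 1 / 2"
        by (simp only:) (simp add: algebra_simps)
      ultimately show "(?f has_real_derivative - (A (t\<^sup>2) - \<mu> $ 1 / 2 * ln t) + \<mu> $ 1 / 2) (at t)"
        by (simp only:)
    qed
    show "\<forall>\<^sub>F x in at_right 0. ((\<lambda>t. t) has_real_derivative 1) (at x)" for x :: real by simp
    have "((\<lambda>t. - (A (t\<^sup>2) - \<mu> $ 1 / 2 * ln t) + \<mu> $ 1 / 2) \<longlongrightarrow> - \<mu> $ 3 + \<mu> $ 1 / 2) (at_right 0)"
      by (intro tendsto_intros limA)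
    then show "((\<lambda>t. (- (A (t\<^sup>2) - \<mu> $ 1 / 2 * ln t) + \<mu> $ 1 / 2) / 1) \<longlongrightarrow> \<mu> $ 1 / 2 - \<mu> $ 3) (at_right 0)" by simp
  qed
  then show ?thesis
  proof (rule Lim_transform_eventually)
    show "\<forall>\<^sub>F t in at_right 0. ?f t / t = N (t\<^sup>2) + \<mu> $ 1 / 2 * ln t"
      unfolding eventually_at_right_field by (intro exI[of _ 1]) (auto simp: field_simps)
  qed
qed

lemma t2: "((\<lambda>t::real. t\<^sup>2) \<longlongrightarrow> 0) (at_right 0)" by real_asymp

lemma t2N2: "((\<lambda>t. t\<^sup>2 * (N (t\<^sup>2))\<^sup>2) \<longlongrightarrow> 0) (at_right 0)" and t2N: "((\<lambda>t. t\<^sup>2 * N (t\<^sup>2)) \<longlongrightarrow> 0) (at_right 0)"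
  and t2A: "((\<lambda>t. t\<^sup>2 * A (t\<^sup>2)) \<longlongrightarrow> 0) (at_right 0)" and t2h: "((\<lambda>t. t\<^sup>2 * h (t\<^sup>2)) \<longlongrightarrow> 0) (at_right 0)"
proof -
  show "((\<lambda>t. t\<^sup>2 * (N (t\<^sup>2))\<^sup>2) \<longlongrightarrow> 0) (at_right 0)"
    using tendsto_mult[OF tN tN] by (simp add: power2_eq_square mult_ac)
  show "((\<lambda>t. t\<^sup>2 * N (t\<^sup>2)) \<longlongrightarrow> 0) (at_right 0)"
    using tendsto_mult[OF tendsto_ident_at tN] by (simp add: power2_eq_square mult_ac)
  show "((\<lambda>t. t\<^sup>2 * A (t\<^sup>2)) \<longlongrightarrow> 0) (at_right 0)"
    using tendsto_mult[OF tendsto_ident_at tA] by (simp add: power2_eq_square mult_ac)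
  show "((\<lambda>t. t\<^sup>2 * h (t\<^sup>2)) \<longlongrightarrow> 0) (at_right 0)"
    using tendsto_mult[OF tendsto_ident_at limh] by (simp add: power2_eq_square mult_ac)
qed

lemma limPhi: "((\<lambda>t. Phi (t\<^sup>2)) \<longlongrightarrow> \<mu> $ 1 / 2) (at_right 0)"
proof -
  have "((\<lambda>t. t\<^sup>2 * A (t\<^sup>2) + (A (t\<^sup>2) - \<mu> $ 1 / 2 * ln t) + (N (t\<^sup>2) + \<mu> $ 1 / 2 * ln t) + (t\<^sup>2 * (N (t\<^sup>2))\<^sup>2) / 2)
      \<longlongrightarrow> 0 + \<mu> $ 3 + (\<mu> $ 1 / 2 - \<mu> $ 3) + 0 / 2) (at_right 0)"
    by (intro tendsto_intros t2A limA limN t2N2) simp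
  moreover have "t\<^sup>2 * A (t\<^sup>2) + (A (t\<^sup>2) - \<mu> $ 1 / 2 * ln t) + (N (t\<^sup>2) + \<mu> $ 1 / 2 * ln t) + (t\<^sup>2 * (N (t\<^sup>2))\<^sup>2) / 2 = Phi (t\<^sup>2)" for t
    by (simp add: Phi_def N_def algebra_simps power2_eq_square)
  ultimately show ?thesis by simp
qed

lemma limE: "((\<lambda>t. t\<^sup>2 * Phi (t\<^sup>2)) \<longlongrightarrow> 0) (at_right 0)"
  using tendsto_mult[OF t2 limPhi] by simp

lemma gam_square: 
  assumes "0 < t" "t < d" 
  shows "((\<lambda>t. B (t\<^sup>2) + t\<^sup>2 * B1 (t\<^sup>2)) has_real_derivative 2 * t * ((N (t\<^sup>2) - 3) * (B (t\<^sup>2) + t\<^sup>2 * B1 (t\<^sup>2)) / (2 * (1 + t\<^sup>2)))) (at t)"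
  using compose_square_deriv[OF gam_deriv[OF range[OF assms]]] .

lemma e_square: 
  assumes "0 < t" "t < d" 
  shows "((\<lambda>t. ee (t\<^sup>2)) has_real_derivative 2 * t * ((- 3 * ee (t\<^sup>2) - B (t\<^sup>2) * (B (t\<^sup>2) + t\<^sup>2 * B1 (t\<^sup>2))) / (2 * (1 + t\<^sup>2)))) (at t)"
  using compose_square_deriv[OF e_deriv[OF range[OF assms]]] .

lemma quotient_le: "\<bar>2 * t * (x / (2 * (1 + t\<^sup>2)))\<bar> \<le> \<bar>t * x\<bar>" for t x :: real
proof -
  have "2 * t * (x / (2 * c)) = t * x / c" for c :: real by simp
  note this[of "1 + t\<^sup>2"]
  moreover have "\<bar>t * x\<bar> / (1 + t\<^sup>2) \<le> \<bar>t * x\<bar> / 1" by (intro divide_left_mono) (auto simp: one_plus_square_pos)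
  ultimately show ?thesis using one_plus_square_pos[of t] by (simp add: abs_divide)
qed

text \<open>\<open>B\<close> is the mean of (s B)' in the variable s. The linear equation first
  bounds this derivative near the axis and with it the right-hand side, after which the limit of the
  means is its limit.\<close>

lemma limgam: "((\<lambda>t. B (t\<^sup>2) + t\<^sup>2 * B1 (t\<^sup>2)) \<longlongrightarrow> \<mu> $ 4) (at_right 0)"
proof -
  \<comment> \<open>Close to the axis the coefficient of the linear equation has modulus below 1, so
    the growth lemma applies with C = 1.\<close>
  have "((\<lambda>t. t * N (t\<^sup>2) - 3 * t) \<longlongrightarrow> 0 - 3 * 0) (at_right 0)" by (intro tendsto_intros tN)
  then have "\<forall>\<^sub>F t in at_right 0. \<bar>t * N (t\<^sup>2) - 3 * t\<bar> < 1"
    by (intro order_tendstoD(2)[OF tendsto_rabs]) auto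
  then obtain b where b: "0 < b" "\<And>t. 0 < t \<Longrightarrow> t < b \<Longrightarrow> \<bar>t * N (t\<^sup>2) - 3 * t\<bar> < 1"
    unfolding eventually_at_right_field by auto
  define r where "r = min b d / 2"
  have r: "0 < r" "r < b" "r < d" using b d by (auto simp: r_def)
  let ?g = "\<lambda>t. B (t\<^sup>2) + t\<^sup>2 * B1 (t\<^sup>2)"
  let ?g' = "\<lambda>t. 2 * t * ((N (t\<^sup>2) - 3) * ?g t / (2 * (1 + t\<^sup>2)))"
  have g': "(?g has_real_derivative ?g' t) (at t)" if "0 < t" "t \<le> r" for t using gam_square[of t] that r by auto
  have gb: "\<bar>?g' t\<bar> \<le> \<bar>?g t\<bar>" if t: "0 < t" "t \<le> r" for t
  proof -
    have "\<bar>?g' t\<bar> \<le> \<bar>t * ((N (t\<^sup>2) - 3) * ?g t)\<bar>" by (rule quotient_le)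
    also have "\<dots> = \<bar>t * N (t\<^sup>2) - 3 * t\<bar> * \<bar>?g t\<bar>" by (simp add: abs_mult[symmetric] algebra_simps)
    also have "\<dots> \<le> 1 * \<bar>?g t\<bar>" using b(2)[of t] t r by (intro mult_right_mono) auto
    finally show ?thesis by simp
  qed
  have "\<exists>M. \<forall>t. 0 < t \<longrightarrow> t \<le> r \<longrightarrow> \<bar>?g t\<bar> \<le> M"
    by (rule growth_bounded[where C=1, OF g']) (use gb in force)+
  then obtain M where M: "\<And>t. 0 < t \<Longrightarrow> t \<le> r \<Longrightarrow> \<bar>?g t\<bar> \<le> M" by blast
  show ?thesis
  proof (rule average_limit[OF r(1) _ g', where F="\<lambda>t. t\<^sup>2 * B (t\<^sup>2)" and B=M])
    show "((\<lambda>t. t\<^sup>2 * B (t\<^sup>2)) has_real_derivative 2 * t * ?g t) (at t)" if "0 < t" "t \<le> r" for t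
      using compose_square_deriv[OF G_deriv[OF range[of t]]] that r by auto
    show "\<bar>?g' t\<bar> \<le> M" if "0 < t" "t \<le> r" for t using gb[OF that] M[OF that] by simp
    show "((\<lambda>t. t\<^sup>2 * B (t\<^sup>2)) \<longlongrightarrow> 0) (at_right 0)" using tendsto_mult[OF t2 limB] by simp
    show "((\<lambda>t. t\<^sup>2 * B (t\<^sup>2) / t\<^sup>2) \<longlongrightarrow> \<mu> $ 4) (at_right 0)"
      by (rule Lim_transform_eventually[OF limB]) (auto simp: eventually_at_right_field intro!: exI[of _ 1])
  qed
qed

text \<open>\<open>Phi\<close> is the mean of \<open>kk\<close> and tends to \<mu>_1/2, so it
  suffices to bound the derivative of \<open>kk\<close>, that is, to bound \<open>ee\<close>. The
  equation for \<open>ee\<close> is linear with an inhomogeneity controlled by the limits of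
  \<open>B\<close> and (s B)'.\<close>

lemma limk: "((\<lambda>t. kk (t\<^sup>2)) \<longlongrightarrow> \<mu> $ 1 / 2) (at_right 0)"
proof -
  define r where "r = d / 2"
  have r: "0 < r" "r < d" using d by (auto simp: r_def)
  have contB: "isCont (\<lambda>t. B (t\<^sup>2)) t" "isCont (\<lambda>t. B (t\<^sup>2) + t\<^sup>2 * B1 (t\<^sup>2)) t" if "0 < t" "t \<le> r" for t
    using DERIV_isCont[OF compose_square_deriv[OF B'[OF range[of t]]]] DERIV_isCont[OF gam_square[of t]] that r by auto
  obtain M1 where M1: "\<And>t. 0 < t \<Longrightarrow> t \<le> r \<Longrightarrow> \<bar>B (t\<^sup>2)\<bar> \<le> M1"
    using bounded_from_right_limit[OF contB(1) limB] by blast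
  obtain M2 where M2: "\<And>t. 0 < t \<Longrightarrow> t \<le> r \<Longrightarrow> \<bar>B (t\<^sup>2) + t\<^sup>2 * B1 (t\<^sup>2)\<bar> \<le> M2"
    using bounded_from_right_limit[OF contB(2) limgam] by blast
  define C where "C = r * (3 + M1 * M2)"
  have M0: "0 \<le> M1" "0 \<le> M2" using M1[of r] M2[of r] r by (meson abs_ge_zero order.refl order.trans)+
  have C: "0 < C" using r M0 by (simp add: C_def add_pos_nonneg)
  have "\<exists>M. \<forall>t. 0 < t \<longrightarrow> t \<le> r \<longrightarrow> \<bar>ee (t\<^sup>2)\<bar> \<le> M"
  proof (rule growth_bounded[OF _ _ C])
    fix t assume t: "0 < t" "t \<le> r"
    then show "((\<lambda>t. ee (t\<^sup>2)) has_real_derivative 2 * t * ((- 3 * ee (t\<^sup>2) - B (t\<^sup>2) * (B (t\<^sup>2) + t\<^sup>2 * B1 (t\<^sup>2))) / (2 * (1 + t\<^sup>2)))) (at t)"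
      using e_square[of t] r by auto
    have "\<bar>2 * t * ((- 3 * ee (t\<^sup>2) - B (t\<^sup>2) * (B (t\<^sup>2) + t\<^sup>2 * B1 (t\<^sup>2))) / (2 * (1 + t\<^sup>2)))\<bar>
        \<le> \<bar>t * (- 3 * ee (t\<^sup>2) - B (t\<^sup>2) * (B (t\<^sup>2) + t\<^sup>2 * B1 (t\<^sup>2)))\<bar>" by (rule quotient_le)
    also have "\<dots> = t * \<bar>- 3 * ee (t\<^sup>2) - B (t\<^sup>2) * (B (t\<^sup>2) + t\<^sup>2 * B1 (t\<^sup>2))\<bar>" using t by (simp add: abs_mult)
    also have "\<dots> \<le> r * (3 * \<bar>ee (t\<^sup>2)\<bar> + M1 * M2)"
    proof (intro mult_mono t)
      have "\<bar>B (t\<^sup>2) * (B (t\<^sup>2) + t\<^sup>2 * B1 (t\<^sup>2))\<bar> \<le> M1 * M2"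
        unfolding abs_mult using M1[OF t] M2[OF t] M0 by (intro mult_mono) auto
      then show "\<bar>- 3 * ee (t\<^sup>2) - B (t\<^sup>2) * (B (t\<^sup>2) + t\<^sup>2 * B1 (t\<^sup>2))\<bar> \<le> 3 * \<bar>ee (t\<^sup>2)\<bar> + M1 * M2" by linarith
    qed (use r in auto)
    also have "\<dots> \<le> C * (\<bar>ee (t\<^sup>2)\<bar> + 1)"
    proof -
      have "3 * \<bar>ee (t\<^sup>2)\<bar> + M1 * M2 \<le> (3 + M1 * M2) * (\<bar>ee (t\<^sup>2)\<bar> + 1)"
        using M0 by (simp add: algebra_simps)
      from mult_left_mono[OF this, of r] r show ?thesis by (simp add: C_def mult_ac)
    qed
    finally show "\<bar>2 * t * ((- 3 * ee (t\<^sup>2) - B (t\<^sup>2) * (B (t\<^sup>2) + t\<^sup>2 * B1 (t\<^sup>2))) / (2 * (1 + t\<^sup>2)))\<bar> \<le> C * (\<bar>ee (t\<^sup>2)\<bar> + 1)" .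
  qed
  then obtain M where M: "\<And>t. 0 < t \<Longrightarrow> t \<le> r \<Longrightarrow> \<bar>ee (t\<^sup>2)\<bar> \<le> M" by blast
  show ?thesis
  proof (rule average_limit[OF r(1), where F="\<lambda>t. t\<^sup>2 * Phi (t\<^sup>2)" and f'="\<lambda>t. 2 * t * ee (t\<^sup>2)" and B="2 * r * M"])
    fix t assume t: "0 < t" "t \<le> r"
    then have td: "t < d" using r by simp
    show "((\<lambda>t. t\<^sup>2 * Phi (t\<^sup>2)) has_real_derivative 2 * t * kk (t\<^sup>2)) (at t)"
      using compose_square_deriv[OF E_deriv[OF range[OF t(1) td]]] .
    show "((\<lambda>t. kk (t\<^sup>2)) has_real_derivative 2 * t * ee (t\<^sup>2)) (at t)"
      using compose_square_deriv[OF k_deriv[OF range[OF t(1) td]]] .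
    show "\<bar>2 * t * ee (t\<^sup>2)\<bar> \<le> 2 * r * M" unfolding abs_mult using t r M[OF t] by (intro mult_mono) auto
  next
    show "((\<lambda>t. t\<^sup>2 * Phi (t\<^sup>2)) \<longlongrightarrow> 0) (at_right 0)" by (rule limE)
    show "((\<lambda>t. t\<^sup>2 * Phi (t\<^sup>2) / t\<^sup>2) \<longlongrightarrow> \<mu> $ 1 / 2) (at_right 0)"
      by (rule Lim_transform_eventually[OF limPhi]) (auto simp: eventually_at_right_field intro!: exI[of _ 1])
  qed
qed

text \<open>The logarithms cancel in the algebraic formula for \<open>ee\<close>: -q contributes
  -\<mu>_1 ln t, while h = A - N contributes \<mu>_1/2 ln t from each of its two terms.\<close>

lemma lime: "((\<lambda>t. ee (t\<^sup>2)) \<longlongrightarrow> \<mu> $ 3 - \<mu> $ 2 / 2) (at_right 0)"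
proof -
  have tB: "((\<lambda>t. t\<^sup>2 * (B (t\<^sup>2))\<^sup>2) \<longlongrightarrow> 0 * (\<mu> $ 4)\<^sup>2) (at_right 0)" by (intro tendsto_intros t2 limB)
  have L: "((\<lambda>t. (kk (t\<^sup>2) - (q (t\<^sup>2) - \<mu> $ 1 * ln t) + ((A (t\<^sup>2) - \<mu> $ 1 / 2 * ln t) - (N (t\<^sup>2) + \<mu> $ 1 / 2 * ln t)) - t\<^sup>2 * h (t\<^sup>2)
      - t\<^sup>2 * N (t\<^sup>2) - (t\<^sup>2 * (N (t\<^sup>2))\<^sup>2) / 2 - (t\<^sup>2 * (B (t\<^sup>2))\<^sup>2) / 2) / (2 * (1 + t\<^sup>2)))
     \<longlongrightarrow> (\<mu> $ 1 / 2 - \<mu> $ 2 + (\<mu> $ 3 - (\<mu> $ 1 / 2 - \<mu> $ 3)) - 0 - 0 - 0 / 2 - (0 * (\<mu> $ 4)\<^sup>2) / 2) / (2 * (1 + 0))) (at_right 0)"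
    by (intro tendsto_intros limk limq limA limN t2h t2N t2N2 tB t2) auto
  have F: "(kk (t\<^sup>2) - (q (t\<^sup>2) - \<mu> $ 1 * ln t) + ((A (t\<^sup>2) - \<mu> $ 1 / 2 * ln t) - (N (t\<^sup>2) + \<mu> $ 1 / 2 * ln t)) - t\<^sup>2 * h (t\<^sup>2)
      - t\<^sup>2 * N (t\<^sup>2) - (t\<^sup>2 * (N (t\<^sup>2))\<^sup>2) / 2 - (t\<^sup>2 * (B (t\<^sup>2))\<^sup>2) / 2) / (2 * (1 + t\<^sup>2)) = ee (t\<^sup>2)" for t
    by (simp add: ee_def N_def algebra_simps)
  have c: "(\<mu> $ 1 / 2 - \<mu> $ 2 + (\<mu> $ 3 - (\<mu> $ 1 / 2 - \<mu> $ 3)) - 0 - 0 - 0 / 2 - (0 * (\<mu> $ 4)\<^sup>2) / 2) / (2 * (1 + 0)) = \<mu> $ 3 - \<mu> $ 2 / 2"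
    by (simp add: field_simps)
  show ?thesis using L unfolding F c .
qed

theorem profile_ode:
  "ode d \<mu> (\<lambda>t. t\<^sup>2 * B (t\<^sup>2)) (\<lambda>t. B (t\<^sup>2) + t\<^sup>2 * B1 (t\<^sup>2)) (\<lambda>t. t\<^sup>2 * Phi (t\<^sup>2)) (\<lambda>t. kk (t\<^sup>2)) (\<lambda>t. ee (t\<^sup>2)) (\<lambda>t. N (t\<^sup>2))"
proof
  fix t assume t: "0 < t" "t < d"
  note r = range[OF t]
  show "((\<lambda>t. t\<^sup>2 * B (t\<^sup>2)) has_real_derivative 2 * t * (B (t\<^sup>2) + t\<^sup>2 * B1 (t\<^sup>2))) (at t)"
    using compose_square_deriv[OF G_deriv[OF r]] .
  show "((\<lambda>t. B (t\<^sup>2) + t\<^sup>2 * B1 (t\<^sup>2)) has_real_derivative 2 * t * ((N (t\<^sup>2) - 3) * (B (t\<^sup>2) + t\<^sup>2 * B1 (t\<^sup>2)) / (2 * (1 + t\<^sup>2)))) (at t)"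
    by (rule gam_square[OF t])
  show "((\<lambda>t. t\<^sup>2 * Phi (t\<^sup>2)) has_real_derivative 2 * t * kk (t\<^sup>2)) (at t)"
    using compose_square_deriv[OF E_deriv[OF r]] .
  show "((\<lambda>t. kk (t\<^sup>2)) has_real_derivative 2 * t * ee (t\<^sup>2)) (at t)"
    using compose_square_deriv[OF k_deriv[OF r]] .
  have "t\<^sup>2 * B (t\<^sup>2) / t\<^sup>2 = B (t\<^sup>2)" using t by simp
  then show "((\<lambda>t. ee (t\<^sup>2)) has_real_derivative 2 * t * ((- 3 * ee (t\<^sup>2) - t\<^sup>2 * B (t\<^sup>2) / t\<^sup>2 * (B (t\<^sup>2) + t\<^sup>2 * B1 (t\<^sup>2))) / (2 * (1 + t\<^sup>2)))) (at t)"
    using e_square[OF t] by simp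
  show "((\<lambda>t. N (t\<^sup>2)) has_real_derivative 2 * t * ((t\<^sup>2 * ((N (t\<^sup>2))\<^sup>2 / 2 - N (t\<^sup>2)) - t\<^sup>2 * Phi (t\<^sup>2) / t\<^sup>2) / (2 * t\<^sup>2 * (1 + t\<^sup>2)))) (at t)"
    using compose_square_deriv[OF N'[OF r]] unfolding N'_eq[OF r] .
next
  show "((\<lambda>t. t\<^sup>2 * B (t\<^sup>2)) \<longlongrightarrow> 0) (at_right 0)" using tendsto_mult[OF t2 limB] by simp
qed (fact limgam limE limk lime limN)+

lemma recon:
  assumes "x \<in> punctured_cone d"
  shows "profile_u A B h x = recon_u (\<lambda>t. t\<^sup>2 * B (t\<^sup>2)) (\<lambda>t. t\<^sup>2 * Phi (t\<^sup>2)) (\<lambda>t. N (t\<^sup>2)) x"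
    "scal 2 q x = recon_p (\<lambda>t. t\<^sup>2 * B (t\<^sup>2)) (\<lambda>t. t\<^sup>2 * Phi (t\<^sup>2)) (\<lambda>t. kk (t\<^sup>2)) (\<lambda>t. ee (t\<^sup>2)) (\<lambda>t. N (t\<^sup>2)) x"
proof -
  have s: "0 < sq x" using sq_bounds[OF assms] by simp
  then have r: "(sqrt (sq x))\<^sup>2 = sq x" by simp
  have vertical_profile: "vertical_profile (\<lambda>t. t\<^sup>2 * Phi (t\<^sup>2)) (\<lambda>t. N (t\<^sup>2)) (sqrt (sq x)) = h (sq x)"
    unfolding vertical_profile_def r using s by (simp add: Phi_def)
  show "profile_u A B h x = recon_u (\<lambda>t. t\<^sup>2 * B (t\<^sup>2)) (\<lambda>t. t\<^sup>2 * Phi (t\<^sup>2)) (\<lambda>t. N (t\<^sup>2)) x"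
    unfolding recon_u_def profile_u_def scal_def vertical_profile r using s by (simp add: N_def)
  show "scal 2 q x = recon_p (\<lambda>t. t\<^sup>2 * B (t\<^sup>2)) (\<lambda>t. t\<^sup>2 * Phi (t\<^sup>2)) (\<lambda>t. kk (t\<^sup>2)) (\<lambda>t. ee (t\<^sup>2)) (\<lambda>t. N (t\<^sup>2)) x"
    unfolding recon_p_def scal_def pressure_profile_def vertical_profile r using s by (simp add: ee_def)
qed

end

section \<open>Cylindrical coordinates\<close>

lemma cyl_nth [simp]: "cyl r \<phi> z $ 1 = r * cos \<phi>" "cyl r \<phi> z $ 2 = r * sin \<phi>" "cyl r \<phi> z $ 3 = z"
  by (simp_all add: cyl_def)

lemma qh_cyl: "qh (cyl r \<phi> z) = r\<^sup>2"
proof -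
  have "qh (cyl r \<phi> z) = r\<^sup>2 * ((cos \<phi>)\<^sup>2 + (sin \<phi>)\<^sup>2)" unfolding cyl_nth power_mult_distrib distrib_left ..
  then show ?thesis by simp
qed

lemma norm_horiz_cyl: "0 \<le> r \<Longrightarrow> norm (horiz (cyl r \<phi> z)) = r"
  unfolding norm_horiz qh_cyl by simp

lemma cyl_in_punctured_cone: "0 < t \<Longrightarrow> t < d \<Longrightarrow> cyl t \<phi> 1 \<in> punctured_cone d"
  by (simp add: punctured_cone_iff rho_def norm_horiz_cyl)

lemma sq_cyl: "sq (cyl t \<phi> 1) = t\<^sup>2"
  unfolding sq_def qh_cyl by simp

lemma obtain_cyl:
  assumes x: "x \<in> punctured_cone d"
  obtains \<phi> where "x = (x $ 3) *\<^sub>R cyl (rho x) \<phi> 1" "x = cyl (x $ 3 * rho x) \<phi> (x $ 3)"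
proof -
  define r where "r = norm (horiz x)"
  have r: "0 < r" "r\<^sup>2 = qh x" using rho_pos(4,5)[OF x] by (simp_all add: r_def norm_horiz)
  have "(x $ 1 / r)\<^sup>2 + (x $ 2 / r)\<^sup>2 = 1" unfolding power_divide add_divide_distrib[symmetric] r(2)[symmetric] using r(1) by simp
  then obtain \<phi> where \<phi>: "x $ 1 / r = cos \<phi>" "x $ 2 / r = sin \<phi>" using sincos_total_2pi by metis
  have c: "x $ 1 = r * cos \<phi>" "x $ 2 = r * sin \<phi>" using \<phi> r by (simp_all add: field_simps)
  have rr: "x $ 3 * rho x = r" using rho_pos(3)[OF x] by (simp add: rho_def r_def)
  show thesis
  proof (rule that)
    show "x = cyl (x $ 3 * rho x) \<phi> (x $ 3)" unfolding vec_eq_iff forall_3 cyl_nth rr using c by simp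
    show "x = (x $ 3) *\<^sub>R cyl (rho x) \<phi> 1" unfolding vec_eq_iff forall_3 vector_scaleR_component cyl_nth
      using c rr by (simp add: mult.assoc[symmetric])
  qed
qed

lemma comp_cyl:
  assumes "0 < r"
  shows "comp_rho u (cyl r \<phi> z) = u (cyl r \<phi> z) $ 1 * cos \<phi> + u (cyl r \<phi> z) $ 2 * sin \<phi>"
    "comp_phi u (cyl r \<phi> z) = u (cyl r \<phi> z) $ 2 * cos \<phi> - u (cyl r \<phi> z) $ 1 * sin \<phi>"
  using assms by (simp_all add: comp_rho_def comp_phi_def e_rho_def e_phi_def norm_horiz_cyl inner_vec_def sum_3 field_simps)

section \<open>Profiles of a solution\<close>

lemma ray_deriv:
  fixes f :: "real^3 \<Rightarrow> real"
  assumes f: "C_infinity_on (punctured_cone d) f" and t: "0 < t" "t < d"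
  shows "((\<lambda>t. f (cyl t 0 1)) has_real_derivative dir_deriv (axis 1 1) f (cyl t 0 1)) (at t)"
proof -
  have "f differentiable (at (cyl t 0 1))"
    by (rule C_infinity_on_differentiable[OF f cyl_in_punctured_cone[OF t]])
  then obtain f' where f': "(f has_derivative f') (at (cyl t 0 1))" by (auto simp: differentiable_def)
  have c: "((\<lambda>t. cyl t 0 1) has_derivative (\<lambda>h. vector [h, 0, 0])) (at t)"
    unfolding cyl_def by (intro vector3_has_derivative) (auto intro!: derivative_eq_intros)
  have "((\<lambda>t. f (cyl t 0 1)) has_derivative (\<lambda>h. f' (vector [h, 0, 0]))) (at t)"
    by (rule has_derivative_compose[OF c f'])
  moreover have "f' (vector [h, 0, 0]) = dir_deriv (axis 1 1) f (cyl t 0 1) * h" for h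
  proof -
    interpret bounded_linear f' using f' by (rule has_derivative_bounded_linear)
    have "(vector [h, 0, 0] :: real^3) = h *\<^sub>R axis 1 1" unfolding vector3_eq by simp
    then show ?thesis using scaleR[of h "axis 1 1"] by (simp add: dir_deriv_eq[OF f'])
  qed
  ultimately show ?thesis unfolding has_field_derivative_def by (simp only:)
qed

text \<open>A ray yields derivatives in \<rho>, whereas \<open>profile\<close> asks for two
  derivatives in s = \<rho>^2. Away from the axis the passage is the chain rule through the square
  root.\<close>

lemma sqrt_profile:
  fixes f0 :: "real \<Rightarrow> real"
  assumes d: "0 < d" and f0: "\<And>t. 0 < t \<Longrightarrow> t < d \<Longrightarrow> (f0 has_real_derivative f1 t) (at t)"
    and f1: "\<And>t. 0 < t \<Longrightarrow> t < d \<Longrightarrow> (f1 has_real_derivative f2 t) (at t)"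
  shows "profile d (\<lambda>s. f0 (sqrt s)) (\<lambda>s. f1 (sqrt s) / (2 * sqrt s)) (\<lambda>s. (f2 (sqrt s) - f1 (sqrt s) / sqrt s) / (4 * s))"
proof
  fix s assume s: "0 < s" "s < d\<^sup>2"
  have r: "0 < sqrt s" "sqrt s < d" using s d real_sqrt_less_mono[OF s(2)] by auto
  have q: "(sqrt has_real_derivative inverse (sqrt s) / 2) (at s)" by (rule DERIV_real_sqrt[OF s(1)])
  show "((\<lambda>s. f0 (sqrt s)) has_real_derivative f1 (sqrt s) / (2 * sqrt s)) (at s)"
    using DERIV_chain2[OF f0[OF r] q] by (simp add: field_simps)
  have e: "(f2 (sqrt s) * (inverse (sqrt s) / 2) * (2 * sqrt s) - f1 (sqrt s) * (2 * (inverse (sqrt s) / 2))) / (2 * sqrt s * (2 * sqrt s))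
      = (f2 (sqrt s) - f1 (sqrt s) / sqrt s) / (4 * s)" using s by (simp add: field_simps)
  have "((\<lambda>s. f1 (sqrt s) / (2 * sqrt s)) has_real_derivative
      (f2 (sqrt s) * (inverse (sqrt s) / 2) * (2 * sqrt s) - f1 (sqrt s) * (2 * (inverse (sqrt s) / 2))) / (2 * sqrt s * (2 * sqrt s))) (at s)"
    by (rule DERIV_divide[OF DERIV_chain2[OF f1[OF r] q] DERIV_cmult[OF q]]) (use s in simp)
  then show "((\<lambda>s. f1 (sqrt s) / (2 * sqrt s)) has_real_derivative (f2 (sqrt s) - f1 (sqrt s) / sqrt s) / (4 * s)) (at s)"
    unfolding e .
qed

lemma quotient_derivs:
  fixes f0 :: "real \<Rightarrow> real"
  assumes t: "0 < t" and f0: "(f0 has_real_derivative f1 t) (at t)" and f1: "(f1 has_real_derivative f2 t) (at t)"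
  shows "((\<lambda>t. f0 t / t) has_real_derivative (f1 t - f0 t / t) / t) (at t)"
    "((\<lambda>t. (f1 t - f0 t / t) / t) has_real_derivative (f2 t - 2 * ((f1 t - f0 t / t) / t)) / t) (at t)"
proof -
  show q: "((\<lambda>t. f0 t / t) has_real_derivative (f1 t - f0 t / t) / t) (at t)"
    using t by (auto intro!: derivative_eq_intros f0 simp: field_simps)
  have e: "((f2 t - (f1 t - f0 t / t) / t) * t - (f1 t - f0 t / t) * 1) / (t * t) = (f2 t - 2 * ((f1 t - f0 t / t) / t)) / t"
    using t by (simp add: field_simps)
  show "((\<lambda>t. (f1 t - f0 t / t) / t) has_real_derivative (f2 t - 2 * ((f1 t - f0 t / t) / t)) / t) (at t)"
    using DERIV_divide[OF DERIV_diff[OF f1 q] DERIV_ident] t unfolding e by simp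
qed

lemma small_near_axis_ray:
  assumes "small_near_axis u"
  shows "((\<lambda>t. t * (u (cyl t 0 1) $ 3)) \<longlongrightarrow> 0) (at_right 0)"
proof (rule tendstoI)
  fix e :: real assume e: "0 < e"
  have o: "(\<lambda>y::real^2. norm (u (vector [y $ 1, y $ 2, 1]))) \<in> o[at 0](\<lambda>y. 1 / norm y)"
    using assms unfolding small_near_axis_def by (meson zero_less_one)
  have "\<forall>\<^sub>F y::real^2 in at 0. norm (norm (u (vector [y $ 1, y $ 2, 1]))) \<le> e / 2 * norm (1 / norm y)"
    using landau_o.smallD[OF o, of "e / 2"] e by simp
  then obtain r where r: "0 < r"
    "\<And>y::real^2. y \<noteq> 0 \<Longrightarrow> dist y 0 < r \<Longrightarrow> norm (norm (u (vector [y $ 1, y $ 2, 1]))) \<le> e / 2 * norm (1 / norm y)"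
    unfolding eventually_at by auto
  have "dist (t * (u (cyl t 0 1) $ 3)) 0 < e" if t: "0 < t" "t < r" for t
  proof -
    define y :: "real^2" where "y = vector [t, 0]"
    have ny: "norm y = t" using t by (simp add: y_def norm_vec_def L2_set_def sum_2)
    have y0: "y \<noteq> 0" using ny t by auto
    have "norm (u (vector [y $ 1, y $ 2, 1])) \<le> e / 2 * (1 / t)"
      using r(2)[OF y0] ny t by simp
    then have u: "norm (u (cyl t 0 1)) \<le> e / 2 * (1 / t)" by (simp add: y_def cyl_def)
    have "t * \<bar>u (cyl t 0 1) $ 3\<bar> \<le> t * (e / 2 * (1 / t))"
      using t order_trans[OF component_le_norm_cart u] by (intro mult_left_mono) auto
    then show ?thesis using t e by (simp add: abs_mult)
  qed
  then show "\<forall>\<^sub>F t in at_right 0. dist (t * (u (cyl t 0 1) $ 3)) 0 < e"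
    unfolding eventually_at_right_field using r(1) by blast
qed

lemma tendsto_right_cong:
  fixes f g :: "real \<Rightarrow> real"
  assumes "(f \<longlongrightarrow> l) (at_right 0)" "0 < r" "\<And>t. 0 < t \<Longrightarrow> t < r \<Longrightarrow> f t = g t"
  shows "(g \<longlongrightarrow> l) (at_right 0)"
  by (rule Lim_transform_eventually[OF assms(1)]) (use assms(2,3) in \<open>auto simp: eventually_at_right_field\<close>)

text \<open>Homogeneity and axisymmetry recover the fields on the whole cone from their values on
  the ray phi = 0, x_3 = 1. The components along this ray supply the profiles, and the parameter
  limits are read there.\<close>

lemma solution_ode:
  assumes d: "0 < d" and sol: "is_solution d \<mu> u p"
  shows "\<exists>Gm g E k e n. ode d \<mu> Gm g E k e n \<and>
    (\<forall>x\<in>punctured_cone d. u x = recon_u Gm E n x \<and> p x = recon_p Gm E k e n x)"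
proof -
  let ?T = "punctured_cone d"
  note sol' = sol[unfolded is_solution_def]
  have up: "C_infinity_on ?T u" "C_infinity_on ?T p" and NS: "stationary_NS_on ?T u p"
    and hu: "homogeneous_on ?T (-1) u" and hp: "homogeneous_on ?T (-2) p"
    and ax: "axisymmetric_on ?T u p" and small: "small_near_axis u" and par: "has_parameter u p \<mu>"
    using sol' by blast+
  have op: "open ?T" by (rule open_punctured_cone)
  have smooth: "C_infinity_on ?T (\<lambda>x. u x $ i)" for i
    by (rule C_infinity_on_linear[OF op bounded_linear_vec_nth up(1)])
  define f where "f = (\<lambda>i t. u (cyl t 0 1) $ i)"
  define f1 where "f1 = (\<lambda>i t. dir_deriv (axis 1 1) (\<lambda>x. u x $ i) (cyl t 0 1))"
  define f2 where "f2 = (\<lambda>i t. dir_deriv (axis 1 1) (dir_deriv (axis 1 1) (\<lambda>x. u x $ i)) (cyl t 0 1))"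
  define w where "w = (\<lambda>t. p (cyl t 0 1))"
  define w1 where "w1 = (\<lambda>t. dir_deriv (axis 1 1) p (cyl t 0 1))"
  have D: "(f i has_real_derivative f1 i t) (at t)" "(f1 i has_real_derivative f2 i t) (at t)" "(w has_real_derivative w1 t) (at t)"
    if t: "0 < t" "t < d" for i t
    unfolding f_def f1_def f2_def w_def w1_def
    by (rule ray_deriv[OF smooth t], rule ray_deriv[OF C_infinity_on_dir_deriv[OF smooth axis_Basis] t], rule ray_deriv[OF up(2) t])
  \<comment> \<open>On the ray the first two components are u^rho and u^phi, equal to t A and t
    B.\<close>
  define v where "v = (\<lambda>i t. f i t / t)"
  define v1 where "v1 = (\<lambda>i t. (f1 i t - f i t / t) / t)"
  define v2 where "v2 = (\<lambda>i t. (f2 i t - 2 * ((f1 i t - f i t / t) / t)) / t)"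
  have Dv: "(v i has_real_derivative v1 i t) (at t)" "(v1 i has_real_derivative v2 i t) (at t)" if t: "0 < t" "t < d" for i t
    unfolding v_def v1_def v2_def
    by (rule quotient_derivs(1)[where ?f1.0="f1 i" and ?f2.0="f2 i", OF t(1) D(1,2)[OF t]],
        rule quotient_derivs(2)[where ?f1.0="f1 i" and ?f2.0="f2 i", OF t(1) D(1,2)[OF t]])
  define A where "A = (\<lambda>i s. v i (sqrt s))"
  define A1 where "A1 = (\<lambda>i s. v1 i (sqrt s) / (2 * sqrt s))"
  define A2 where "A2 = (\<lambda>i s. (v2 i (sqrt s) - v1 i (sqrt s) / sqrt s) / (4 * s))"
  define h where "h = (\<lambda>s. f 3 (sqrt s))"
  define h1 where "h1 = (\<lambda>s. f1 3 (sqrt s) / (2 * sqrt s))"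
  define h2 where "h2 = (\<lambda>s. (f2 3 (sqrt s) - f1 3 (sqrt s) / sqrt s) / (4 * s))"
  define q where "q = (\<lambda>s. w (sqrt s))"
  define q1 where "q1 = (\<lambda>s. w1 (sqrt s) / (2 * sqrt s))"
  have pA: "profile d (A i) (A1 i) (A2 i)" for i
    unfolding A_def A1_def A2_def by (rule sqrt_profile[OF d Dv])
  have ph: "profile d h h1 h2"
    unfolding h_def h1_def h2_def by (rule sqrt_profile[OF d D(1,2)])
  have pq: "(q has_real_derivative q1 s) (at s)" if s: "0 < s" "s < d\<^sup>2" for s
  proof -
    have r: "0 < sqrt s" "sqrt s < d" using s d real_sqrt_less_mono[OF s(2)] by auto
    show ?thesis unfolding q_def q1_def
      using DERIV_chain2[OF D(3)[OF r] DERIV_real_sqrt[OF s(1)]] by (simp add: field_simps)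
  qed
  have form: "u x = profile_u (A 1) (A 2) h x \<and> p x = scal 2 q x" if x: "x \<in> ?T" for x
  proof -
    obtain \<phi> where \<phi>: "x = (x $ 3) *\<^sub>R cyl (rho x) \<phi> 1" "x = cyl (x $ 3 * rho x) \<phi> (x $ 3)" by (rule obtain_cyl[OF x])
    define z r where "z = x $ 3" "r = rho x"
    have zr: "0 < z" "0 < r" "r < d" using rho_pos(1-3)[OF x] by (simp_all add: z_r_def)
    define y y0 where "y = cyl r \<phi> 1" "y0 = cyl r 0 1"
    have T: "y \<in> ?T" "y0 \<in> ?T" unfolding y_y0_def using zr by (simp_all add: cyl_in_punctured_cone)
    have xy: "x = z *\<^sub>R y" using \<phi>(1) by (simp add: z_r_def y_y0_def)
    have ux: "u x = (z powr -1) *\<^sub>R u y" and px: "p x = (z powr -2) * p y"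
      using hu hp zr(1) T(1) unfolding homogeneous_on_def xy by auto
    have zp: "z powr -1 = 1 / z" "z powr -2 = 1 / z ^ 2" using zr by (simp_all add: powr_minus_divide)
    have inv: "F y = F y0" if "indep_of_phi_on ?T F" for F
      using that zr(2) T unfolding indep_of_phi_on_def y_y0_def by blast
    have e: "comp_rho u y = comp_rho u y0" "comp_phi u y = comp_phi u y0" "u y $ 3 = u y0 $ 3" "p y = p y0"
      using ax inv unfolding axisymmetric_on_def by blast+
    have e1: "u y $ 1 * cos \<phi> + u y $ 2 * sin \<phi> = f 1 r" "u y $ 2 * cos \<phi> - u y $ 1 * sin \<phi> = f 2 r"
      using e(1,2) unfolding y_y0_def comp_cyl[OF zr(2)] f_def by simp_all
    have cs: "(sin \<phi>)\<^sup>2 + (cos \<phi>)\<^sup>2 = 1" by simp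
    have rot: "c * (a * c + b * s) - s * (b * c - a * s) = a" "s * (a * c + b * s) + c * (b * c - a * s) = b"
      if "s\<^sup>2 + c\<^sup>2 = 1" for a b c s :: real using that by algebra+
    have e2: "u y $ 1 = cos \<phi> * f 1 r - sin \<phi> * f 2 r" "u y $ 2 = sin \<phi> * f 1 r + cos \<phi> * f 2 r"
      unfolding e1[symmetric] rot[OF cs] by simp_all
    have s: "sqrt (sq x) = r" unfolding sq_eq_rho using zr(2) by (simp add: z_r_def)
    have x12: "x $ 1 = z * r * cos \<phi>" "x $ 2 = z * r * sin \<phi>" unfolding xy y_y0_def by simp_all
    have "u x = profile_u (A 1) (A 2) h x"
      unfolding vec_eq_iff forall_3 ux zp profile_u_def scal_def A_def h_def s v_def vector_scaleR_component vector_3 e2 x12 z_r_def(1)[symmetric]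
      using zr e(3) by (simp add: f_def y_y0_def field_simps power2_eq_square)
    moreover have "p x = scal 2 q x"
      unfolding px zp scal_def q_def s e(4) z_r_def(1)[symmetric] by (simp add: w_def y_y0_def power_divide)
    ultimately show ?thesis by blast
  qed
  have NS_eq: "- (4 * s * (1 + s) * A2 1 s + (8 + 14 * s) * A1 1 s + 6 * A 1 s) + (A 1 s)\<^sup>2 - (A 2 s)\<^sup>2 + 2 * s * (A 1 s - h s) * A1 1 s - 2 * h s * A 1 s + 2 * q1 s = 0 \<and>
     - (4 * s * (1 + s) * A2 2 s + (8 + 14 * s) * A1 2 s + 6 * A 2 s) + 2 * A 1 s * A 2 s + 2 * s * (A 1 s - h s) * A1 2 s - 2 * h s * A 2 s = 0 \<and>
     - (4 * s * (1 + s) * h2 s + (4 + 10 * s) * h1 s + 2 * h s) + 2 * s * (A 1 s - h s) * h1 s - (h s)\<^sup>2 - (2 * s * q1 s + 2 * q s) = 0 \<and>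
     2 * A 1 s + 2 * s * A1 1 s - h s - 2 * s * h1 s = 0" if s: "0 < s" "s < d\<^sup>2" for s
  proof -
    have r: "0 < sqrt s" "sqrt s < d" using s d real_sqrt_less_mono[OF s(2)] by auto
    have x: "cyl (sqrt s) 0 1 \<in> ?T" by (rule cyl_in_punctured_cone[OF r])
    have sx: "sq (cyl (sqrt s) 0 1) = s" unfolding sq_cyl using s by simp
    show ?thesis
      using NS_profile[OF pA[of 1] pA[of 2] ph pq form[THEN conjunct1] form[THEN conjunct2] x] NS x
      unfolding stationary_NS_on_def sx by blast
  qed
  have par0: "((\<lambda>\<rho>. p (cyl \<rho> 0 1) - \<mu> $ 1 * ln \<rho>) \<longlongrightarrow> \<mu> $ 2) (at_right 0)"
    "((\<lambda>\<rho>. (1 / \<rho>) * (comp_rho u (cyl \<rho> 0 1) - 1/2 * \<mu> $ 1 * \<rho> * ln \<rho>)) \<longlongrightarrow> \<mu> $ 3) (at_right 0)"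
    "((\<lambda>\<rho>. (1 / \<rho>) * comp_phi u (cyl \<rho> 0 1)) \<longlongrightarrow> \<mu> $ 4) (at_right 0)"
    using par unfolding has_parameter_def by blast+
  have ps: "profile_solution d \<mu> (A 1) (A1 1) (A2 1) (A 2) (A1 2) (A2 2) h h1 h2 q q1"
  proof (unfold_locales, goal_cases)
    case 1 show ?case by (rule d)
  next
    case (2 s) then show ?case by (rule profile.F1[OF pA])
  next
    case (3 s) then show ?case by (rule profile.F2[OF pA])
  next
    case (4 s) then show ?case by (rule profile.F1[OF pA])
  next
    case (5 s) then show ?case by (rule profile.F2[OF pA])
  next
    case (6 s) then show ?case by (rule profile.F1[OF ph])
  next
    case (7 s) then show ?case by (rule profile.F2[OF ph])
  next
    case (8 s) then show ?case by (rule pq)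
  next
    case 13
    show ?case by (rule tendsto_right_cong[OF par0(2) zero_less_one])
       (simp add: A_def v_def f_def comp_cyl field_simps)
  next
    case 14
    show ?case by (rule tendsto_right_cong[OF par0(3) zero_less_one])
       (simp add: A_def v_def f_def comp_cyl field_simps)
  next
    case 15
    show ?case by (rule tendsto_right_cong[OF small_near_axis_ray[OF small] zero_less_one])
       (simp add: h_def f_def)
  next
    case 16
    show ?case by (rule tendsto_right_cong[OF par0(1) zero_less_one])
       (simp add: q_def w_def)
  next
    case (9 s)
    show ?case using NS_eq[OF 9] by blast
  next
    case (10 s)
    show ?case using NS_eq[OF 10] by blast
  next
    case (11 s)
    show ?case using NS_eq[OF 11] by blast
  next
    case (12 s)
    show ?case using NS_eq[OF 12] by blast
  qed
  interpret profile_solution d \<mu> "A 1" "A1 1" "A2 1" "A 2" "A1 2" "A2 2" h h1 h2 q q1 by (rule ps)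
  have "u x = recon_u (\<lambda>t. t\<^sup>2 * A 2 (t\<^sup>2)) (\<lambda>t. t\<^sup>2 * Phi (t\<^sup>2)) (\<lambda>t. N (t\<^sup>2)) x \<and>
      p x = recon_p (\<lambda>t. t\<^sup>2 * A 2 (t\<^sup>2)) (\<lambda>t. t\<^sup>2 * Phi (t\<^sup>2)) (\<lambda>t. kk (t\<^sup>2)) (\<lambda>t. ee (t\<^sup>2)) (\<lambda>t. N (t\<^sup>2)) x" if "x \<in> ?T" for x
    using form[OF that] recon[OF that] by (simp only: simp_thms)
  then have *: "\<forall>x\<in>?T. u x = recon_u (\<lambda>t. t\<^sup>2 * A 2 (t\<^sup>2)) (\<lambda>t. t\<^sup>2 * Phi (t\<^sup>2)) (\<lambda>t. N (t\<^sup>2)) x \<and>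
      p x = recon_p (\<lambda>t. t\<^sup>2 * A 2 (t\<^sup>2)) (\<lambda>t. t\<^sup>2 * Phi (t\<^sup>2)) (\<lambda>t. kk (t\<^sup>2)) (\<lambda>t. ee (t\<^sup>2)) (\<lambda>t. N (t\<^sup>2)) x"
    by (rule ballI)
  show ?thesis by (rule exI)+ (rule conjI[OF profile_ode *])
qed


section \<open>Solutions of the singular system solve the equations\<close>

lemma deriv_via_sqrt:
  fixes F :: "real \<Rightarrow> real"
  assumes "0 < s" "(F has_real_derivative 2 * sqrt s * D) (at (sqrt s))"
  shows "((\<lambda>s. F (sqrt s)) has_real_derivative D) (at s)"
  using DERIV_chain2[OF assms(2) DERIV_real_sqrt[OF assms(1)]] assms(1) by (simp add: field_simps)

text \<open>The converse elimination as pure algebra: values and derivatives are unrelated real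
  numbers tied only by the relations that the first-order system provides. Highest derivatives are
  replaced first, then \<open>H\<close> and \<open>g\<close>.\<close>

lemma profile_equations:
  fixes s n n1 n2 H H1 H2 k e B B1 B2 g g1 q q1 A A1 A2 :: real
  assumes "s \<noteq> 0" "1 + s \<noteq> 0" and n1: "s * n1 = - (n + H / 2)" and n2: "s * n2 = - (2 * n1 + H1 / 2)"
    and k: "k = s * (1 + s) * H1 + 3 / 2 * s * H + s * n - s * n * H / 2"
    and H2: "s * (1 + s) * H2 = e - 3/2 * H - 3/2 * s * H1 - n - s * n1 + n * H / 2 + s * n1 * H / 2 + s * n * H1 / 2 - H1 * (1 + 2 * s)"
    and B1: "s * B1 = g - B" and B2: "s * B2 = g1 - 2 * B1" and g1: "2 * (1 + s) * g1 = (n - 3) * g"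
    and q: "q = k - 2 * (1 + s) * e + (1 - s) * H - s * n - s * n\<^sup>2 / 2 - s * B\<^sup>2 / 2"
    and q1: "q1 = 2 * e + B * g - H + (1 - s) * H1 - n - s * n1 - n\<^sup>2 / 2 - s * n * n1 - B\<^sup>2 / 2 - s * B * B1"
    and A: "A = n + H" "A1 = n1 + H1" "A2 = n2 + H2"
  shows "- (4 * s * (1 + s) * A2 + (8 + 14 * s) * A1 + 6 * A) + A\<^sup>2 - B\<^sup>2 + 2 * s * (A - H) * A1 - 2 * H * A + 2 * q1 = 0"
    "- (4 * s * (1 + s) * B2 + (8 + 14 * s) * B1 + 6 * B) + 2 * A * B + 2 * s * (A - H) * B1 - 2 * H * B = 0"
    "- (4 * s * (1 + s) * H2 + (4 + 10 * s) * H1 + 2 * H) + 2 * s * (A - H) * H1 - H\<^sup>2 - (2 * s * q1 + 2 * q) = 0"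
    "2 * A + 2 * s * A1 - H - 2 * s * H1 = 0"
proof -
  have H: "H = - 2 * n - 2 * (s * n1)" using n1 by simp
  have g: "g = B + s * B1" using B1 by simp
  show "2 * A + 2 * s * A1 - H - 2 * s * H1 = 0" unfolding A H by (simp add: algebra_simps)
  have "4 * s * (1 + s) * B2 = 2 * (2 * (1 + s) * g1) - 8 * (1 + s) * B1"
  proof -
    have "4 * s * (1 + s) * B2 = 4 * (1 + s) * (s * B2)" by simp
    then show ?thesis unfolding B2 by (simp add: algebra_simps)
  qed
  then show "- (4 * s * (1 + s) * B2 + (8 + 14 * s) * B1 + 6 * B) + 2 * A * B + 2 * s * (A - H) * B1 - 2 * H * B = 0"
    unfolding g1 A g by (simp add: algebra_simps)
  have h2: "4 * s * (1 + s) * H2 = 4 * (s * (1 + s) * H2)" by simp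
  show "- (4 * s * (1 + s) * H2 + (4 + 10 * s) * H1 + 2 * H) + 2 * s * (A - H) * H1 - H\<^sup>2 - (2 * s * q1 + 2 * q) = 0"
    unfolding h2 H2 q q1 k A g H by (simp add: field_simps power2_eq_square)
  have a2: "4 * s * (1 + s) * A2 = 4 * (1 + s) * (s * n2) + 4 * (s * (1 + s) * H2)" unfolding A by (simp add: algebra_simps)
  show "- (4 * s * (1 + s) * A2 + (8 + 14 * s) * A1 + 6 * A) + A\<^sup>2 - B\<^sup>2 + 2 * s * (A - H) * A1 - 2 * H * A + 2 * q1 = 0"
    unfolding a2 n2 H2 q1 A(1,2) g H by (simp add: field_simps power2_eq_square)
qed

lemma sq_scaleR: "0 < s \<Longrightarrow> sq (s *\<^sub>R x) = sq x"
proof -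
  assume s: "0 < s"
  have "((s * a)\<^sup>2 + (s * b)\<^sup>2) * (1 / (s * c))\<^sup>2 = (a\<^sup>2 + b\<^sup>2) * (1 / c)\<^sup>2" for a b c :: real
    using s by (cases "c = 0") (simp_all add: field_simps power2_eq_square)
  then show ?thesis by (simp add: sq_def)
qed

lemma homogeneous_scal: "homogeneous_on S (-2) (scal 2 q)"
  unfolding homogeneous_on_def scal_def
  by (auto simp: sq_scaleR powr_minus_divide power_divide power_mult_distrib)

lemma homogeneous_profile_u: "homogeneous_on S (-1) (profile_u A B h)"
  unfolding homogeneous_on_def
proof (intro allI impI ballI)
  fix s :: real and x assume s: "0 < s"
  have p: "s powr -1 = 1 / s" using s by (simp add: powr_minus_divide)
  show "profile_u A B h (s *\<^sub>R x) = (s powr -1) *\<^sub>R profile_u A B h x"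
    unfolding p vec_eq_iff forall_3 profile_u_def scal_def sq_scaleR[OF s] vector_scaleR_component vector_3
    using s by (simp add: power_divide power_mult_distrib field_simps power2_eq_square)
qed

lemma profile_u_cyl:
  assumes "0 < r"
  shows "comp_rho (profile_u A B h) (cyl r \<phi> z) = r * A (r\<^sup>2 * (1 / z)\<^sup>2) * (1 / z)\<^sup>2"
    "comp_phi (profile_u A B h) (cyl r \<phi> z) = r * B (r\<^sup>2 * (1 / z)\<^sup>2) * (1 / z)\<^sup>2"
    "profile_u A B h (cyl r \<phi> z) $ 3 = h (r\<^sup>2 * (1 / z)\<^sup>2) * (1 / z)"
    "scal 2 q (cyl r \<phi> z) = q (r\<^sup>2 * (1 / z)\<^sup>2) * (1 / z)\<^sup>2"
proof -
  have s: "sq (cyl r \<phi> z) = r\<^sup>2 * (1 / z)\<^sup>2" unfolding sq_def qh_cyl by simp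
  have cs: "(sin \<phi>)\<^sup>2 + (cos \<phi>)\<^sup>2 = 1" by simp
  have rot: "(r * c * a - r * s * b) * c + (r * s * a + r * c * b) * s = r * a"
    "(r * s * a + r * c * b) * c - (r * c * a - r * s * b) * s = r * b" if "s\<^sup>2 + c\<^sup>2 = 1" for a b c s r :: real
    using that by algebra+
  show "comp_rho (profile_u A B h) (cyl r \<phi> z) = r * A (r\<^sup>2 * (1 / z)\<^sup>2) * (1 / z)\<^sup>2"
    "comp_phi (profile_u A B h) (cyl r \<phi> z) = r * B (r\<^sup>2 * (1 / z)\<^sup>2) * (1 / z)\<^sup>2"
    unfolding comp_cyl[OF assms] profile_u_def vector_3 cyl_nth rot[OF cs] scal_def s by simp_all
  show "profile_u A B h (cyl r \<phi> z) $ 3 = h (r\<^sup>2 * (1 / z)\<^sup>2) * (1 / z)"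
    "scal 2 q (cyl r \<phi> z) = q (r\<^sup>2 * (1 / z)\<^sup>2) * (1 / z)\<^sup>2"
    unfolding profile_u_def vector_3 scal_def s cyl_nth by simp_all
qed

lemma axisymmetric_profile: "axisymmetric_on S (profile_u A B h) (scal 2 q)"
  unfolding axisymmetric_on_def indep_of_phi_on_def by (auto simp: profile_u_cyl)

lemma small_near_axis_profile:
  assumes A: "((\<lambda>t. t\<^sup>2 * A (t\<^sup>2)) \<longlongrightarrow> 0) (at_right 0)" and B: "((\<lambda>t. t\<^sup>2 * B (t\<^sup>2)) \<longlongrightarrow> 0) (at_right 0)"
    and h: "((\<lambda>t. t * h (t\<^sup>2)) \<longlongrightarrow> 0) (at_right 0)"
  shows "small_near_axis (profile_u A B h)"
  unfolding small_near_axis_def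
proof (intro allI impI)
  fix z :: real assume z: "0 < z"
  \<comment> \<open>A majorant of |x'| |u| as a function of t = |x'|/x_3: each horizontal component
    contributes at most |t^2 A| + |t^2 B|, the vertical one |t h|, and all powers of x_3
    cancel.\<close>
  define W where "W t = 2 * (\<bar>t\<^sup>2 * A (t\<^sup>2)\<bar> + \<bar>t\<^sup>2 * B (t\<^sup>2)\<bar>) + \<bar>t * h (t\<^sup>2)\<bar>" for t
  have "((\<lambda>t. 2 * (\<bar>t\<^sup>2 * A (t\<^sup>2)\<bar> + \<bar>t\<^sup>2 * B (t\<^sup>2)\<bar>) + \<bar>t * h (t\<^sup>2)\<bar>) \<longlongrightarrow> 2 * (\<bar>0\<bar> + \<bar>0\<bar>) + \<bar>0\<bar>) (at_right 0)"
    by (intro tendsto_intros A B h)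
  then have W: "(W \<longlongrightarrow> 0) (at_right 0)" unfolding W_def[abs_def] by simp
  have "filterlim (\<lambda>y::real^2. norm y / z) (at_right 0) (at 0)"
  unfolding filterlim_at
  proof
    have "((\<lambda>y::real^2. norm y / z) \<longlongrightarrow> norm (0::real^2) / z) (at 0)" using z by (intro tendsto_intros) auto
    then show "((\<lambda>y::real^2. norm y / z) \<longlongrightarrow> 0) (at 0)" by simp
    show "\<forall>\<^sub>F y::real^2 in at 0. norm y / z \<in> {0<..} \<and> norm y / z \<noteq> 0" unfolding eventually_at using z by (auto intro!: exI[of _ 1])
  qed
  from filterlim_compose[OF W this] have L: "((\<lambda>y::real^2. W (norm y / z)) \<longlongrightarrow> 0) (at 0)" .
  let ?u = "\<lambda>y::real^2. profile_u A B h (vector [y $ 1, y $ 2, z])"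
  have bound: "norm (norm (?u y) / (1 / norm y)) \<le> W (norm y / z)" for y
  proof -
    define t where "t = norm y / z"
    have ny: "norm y = z * t" "0 \<le> t" using z by (simp_all add: t_def)
    have n2: "(y $ 1)\<^sup>2 + (y $ 2)\<^sup>2 = (norm y)\<^sup>2" by (simp add: norm_vec_def L2_set_def sum_2)
    have s: "sq (vector [y $ 1, y $ 2, z]) = t\<^sup>2" unfolding sq_def vector_3 n2 ny power_mult_distrib using z by (simp add: power_divide)
    have c: "\<bar>y $ 1\<bar> \<le> z * t" "\<bar>y $ 2\<bar> \<le> z * t" using component_le_norm_cart[of y] ny by metis+
    have aux: "\<bar>x * (a * (1 / z)\<^sup>2) + x' * (b * (1 / z)\<^sup>2)\<bar> * (z * t) \<le> \<bar>t\<^sup>2 * a\<bar> + \<bar>t\<^sup>2 * b\<bar>"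
      if "\<bar>x\<bar> \<le> z * t" "\<bar>x'\<bar> \<le> z * t" for x x' a b
    proof -
      have "\<bar>x * (a * (1 / z)\<^sup>2) + x' * (b * (1 / z)\<^sup>2)\<bar> \<le> z * t * (\<bar>a\<bar> * (1 / z)\<^sup>2) + z * t * (\<bar>b\<bar> * (1 / z)\<^sup>2)"
      proof (rule order_trans[OF abs_triangle_ineq], rule add_mono)
        show "\<bar>x * (a * (1 / z)\<^sup>2)\<bar> \<le> z * t * (\<bar>a\<bar> * (1 / z)\<^sup>2)" unfolding abs_mult using that(1) by (intro mult_mono) auto
        show "\<bar>x' * (b * (1 / z)\<^sup>2)\<bar> \<le> z * t * (\<bar>b\<bar> * (1 / z)\<^sup>2)" unfolding abs_mult using that(2) by (intro mult_mono) auto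
      qed
      from mult_right_mono[OF this, of "z * t"] z ny(2) show ?thesis by (simp add: abs_mult power2_eq_square field_simps)
    qed
    have "norm (?u y) \<le> \<bar>?u y $ 1\<bar> + \<bar>?u y $ 2\<bar> + \<bar>?u y $ 3\<bar>" using norm_le_l1_cart[of "?u y"] by (simp add: sum_3)
    then have u0: "norm (?u y) * (z * t) \<le> \<bar>?u y $ 1\<bar> * (z * t) + \<bar>?u y $ 2\<bar> * (z * t) + \<bar>?u y $ 3\<bar> * (z * t)"
      using mult_right_mono[of "norm (?u y)" "\<bar>?u y $ 1\<bar> + \<bar>?u y $ 2\<bar> + \<bar>?u y $ 3\<bar>" "z * t"] z ny(2)
      by (simp only: distrib_right mult_nonneg_nonneg less_imp_le)
    have u1: "\<bar>?u y $ 1\<bar> * (z * t) \<le> \<bar>t\<^sup>2 * A (t\<^sup>2)\<bar> + \<bar>t\<^sup>2 * B (t\<^sup>2)\<bar>"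
      using aux[OF c(1), of "- y $ 2" "A (t\<^sup>2)" "B (t\<^sup>2)"] c(2) by (simp add: profile_u_def scal_def s)
    have u2: "\<bar>?u y $ 2\<bar> * (z * t) \<le> \<bar>t\<^sup>2 * A (t\<^sup>2)\<bar> + \<bar>t\<^sup>2 * B (t\<^sup>2)\<bar>"
      using aux[OF c(2,1), of "A (t\<^sup>2)" "B (t\<^sup>2)"] by (simp add: profile_u_def scal_def s)
    have u3: "\<bar>?u y $ 3\<bar> * (z * t) = \<bar>t * h (t\<^sup>2)\<bar>"
      using z ny(2) by (simp add: profile_u_def scal_def s abs_mult field_simps)
    have u4: "norm (norm (?u y) / (1 / norm y)) = norm (?u y) * (z * t)" using ny z by (simp add: abs_mult)
    have comb: "N' \<le> 2 * (b + c) + c'" if "N \<le> x + y + w" "x \<le> b + c" "y \<le> b + c" "w = c'" "N' = N" for N N' x y w b c c' :: real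
      using that by auto
    show ?thesis unfolding W_def t_def[symmetric] by (rule comb[OF u0 u1 u2 u3 u4])
  qed
  show "(\<lambda>y. norm (?u y)) \<in> o[at 0](\<lambda>y. 1 / norm y)"
  proof (rule smalloI_tendsto)
    show "((\<lambda>y. norm (?u y) / (1 / norm y)) \<longlongrightarrow> 0) (at 0)"
      by (rule Lim_null_comparison[OF _ L]) (use bound in simp)
    show "\<forall>\<^sub>F y::real^2 in at 0. 1 / norm y \<noteq> 0" unfolding eventually_at by (auto intro!: exI[of _ 1])
  qed
qed

section \<open>Profiles reconstructed from the first-order system\<close>

context ode
begin

abbreviation "H \<equiv> vertical_profile E n"

text \<open>\<open>n1\<close> is the divergence equation solved for n', \<open>H1\<close> the
  formula for k = (s Phi)' solved for h', and \<open>R1\<close> the derivative of the numerator of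
  \<open>H1\<close>. Being built from the unknowns of a first-order system, \<open>n1\<close> and
  \<open>H1\<close> can be differentiated once more.\<close>

definition "n1 s = - (2 * n (sqrt s) + H (sqrt s)) / (2 * s)"
definition "H1 s = (k (sqrt s) - 3/2 * s * H (sqrt s) - s * n (sqrt s) + s * n (sqrt s) * H (sqrt s) / 2) / (s * (1 + s))"
definition "R1 s = e (sqrt s) - 3/2 * H (sqrt s) - 3/2 * s * H1 s - n (sqrt s) - s * n1 s + n (sqrt s) * H (sqrt s) / 2
  + s * n1 s * H (sqrt s) / 2 + s * n (sqrt s) * H1 s / 2"
definition "H2 s = (R1 s - H1 s * (1 + 2 * s)) / (s * (1 + s))"
definition "n2 s = - (4 * n1 s + H1 s) / (2 * s)"
definition "B s = Gm (sqrt s) / s"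
definition "B1 s = (g (sqrt s) - B s) / s"
definition "B2 s = ((n (sqrt s) - 3) * g (sqrt s) / (2 * (1 + s)) - 2 * B1 s) / s"
definition "q1 s = 2 * e (sqrt s) + B s * g (sqrt s) - H (sqrt s) + (1 - s) * H1 s - n (sqrt s) - s * n1 s - (n (sqrt s))\<^sup>2 / 2
  - s * n (sqrt s) * n1 s - (B s)\<^sup>2 / 2 - s * B s * B1 s"

context
  fixes s assumes s: "0 < s" "s < d\<^sup>2" and d: "0 < d"
begin

lemma r: "0 < sqrt s" "sqrt s < d" "(sqrt s)\<^sup>2 = s"
  using s d real_sqrt_less_mono[OF s(2)] by auto

lemma phi: "E (sqrt s) / s = (1 + s) * H (sqrt s) + (s + 2) * n (sqrt s) + s * (n (sqrt s))\<^sup>2 / 2"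
  unfolding vertical_profile_def r(3) using s by simp

lemma n_s: "((\<lambda>s. n (sqrt s)) has_real_derivative n1 s) (at s)"
proof -
  have "(s * ((n (sqrt s))\<^sup>2 / 2 - n (sqrt s)) - E (sqrt s) / s) / (2 * s * (1 + s)) = n1 s"
  proof -
    have "s * (m\<^sup>2 / 2 - m) - ((1 + s) * h + (s + 2) * m + s * m\<^sup>2 / 2) = (- (2 * m + h)) * (1 + s)" for m h
      by (simp add: field_simps)
    then show ?thesis unfolding phi n1_def using s by simp
  qed
  then show ?thesis using deriv_via_sqrt[OF s(1) n'[OF r(1,2)]] unfolding r(3) by simp
qed

lemma H_s: "((\<lambda>s. H (sqrt s)) has_real_derivative H1 s) (at s)"
proof -
  let ?F = "\<lambda>s. (E (sqrt s) / s - (s + 2) * n (sqrt s) - s * (n (sqrt s))\<^sup>2 / 2) / (1 + s)"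
  have Es: "((\<lambda>s. E (sqrt s)) has_real_derivative k (sqrt s)) (at s)" by (rule deriv_via_sqrt[OF s(1) E'[OF r(1,2)]])
  have Eq: "((\<lambda>s. E (sqrt s) / s) has_real_derivative (k (sqrt s) - E (sqrt s) / s) / s) (at s)"
  proof -
    have "(a * s - b * 1) / (s * s) = (a - b / s) / s" for a b using s by (simp add: field_simps)
    then show ?thesis using DERIV_divide[OF Es DERIV_ident] s by simp
  qed
  have "(?F has_real_derivative ((k (sqrt s) - E (sqrt s) / s) / s - (n (sqrt s) + (s + 2) * n1 s) - ((n (sqrt s))\<^sup>2 / 2 + s * n (sqrt s) * n1 s) - ?F s) / (1 + s)) (at s)"
  proof -
    have N: "((\<lambda>s. E (sqrt s) / s - (s + 2) * n (sqrt s) - s * (n (sqrt s))\<^sup>2 / 2) has_real_derivative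
       (k (sqrt s) - E (sqrt s) / s) / s - (n (sqrt s) + (s + 2) * n1 s) - ((n (sqrt s))\<^sup>2 / 2 + s * n (sqrt s) * n1 s)) (at s)"
    proof (intro DERIV_diff Eq)
      show "((\<lambda>s. (s + 2) * n (sqrt s)) has_real_derivative n (sqrt s) + (s + 2) * n1 s) (at s)"
        by (auto intro!: derivative_eq_intros n_s)
      show "((\<lambda>s. s * (n (sqrt s))\<^sup>2 / 2) has_real_derivative (n (sqrt s))\<^sup>2 / 2 + s * n (sqrt s) * n1 s) (at s)"
        by (auto intro!: derivative_eq_intros n_s simp: field_simps)
    qed
    have "(?F has_real_derivative (((k (sqrt s) - E (sqrt s) / s) / s - (n (sqrt s) + (s + 2) * n1 s) - ((n (sqrt s))\<^sup>2 / 2 + s * n (sqrt s) * n1 s)) * (1 + s)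
      - (E (sqrt s) / s - (s + 2) * n (sqrt s) - s * (n (sqrt s))\<^sup>2 / 2) * 1) / ((1 + s) * (1 + s))) (at s)"
      by (rule DERIV_divide[OF N]) (use s in \<open>auto intro!: derivative_eq_intros\<close>)
    moreover have "(D * (1 + s) - X * 1) / ((1 + s) * (1 + s)) = (D - X / (1 + s)) / (1 + s)" for D X using s by (simp add: field_simps)
    ultimately show ?thesis by (simp only:)
  qed
  moreover have "?F s = H (sqrt s)" unfolding vertical_profile_def r(3) ..
  moreover have "((k' - ((1 + s) * h + (s + 2) * m + s * m\<^sup>2 / 2)) / s - (m + (s + 2) * m1) - (m\<^sup>2 / 2 + s * m * m1) - h) / (1 + s)
     = (k' - 3/2 * s * h - s * m + s * m * h / 2) / (s * (1 + s))" if "s * m1 = - (m + h / 2)" for k' h m m1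
  proof -
    have h: "h = - 2 * m - 2 * (s * m1)" using that by simp
    show ?thesis unfolding h using s by (simp add: field_simps power2_eq_square)
  qed
  moreover have "s * n1 s = - (n (sqrt s) + H (sqrt s) / 2)" unfolding n1_def using s by (simp add: field_simps)
  ultimately have "(?F has_real_derivative H1 s) (at s)" unfolding phi H1_def by (simp only:)
  then show ?thesis
    by (rule has_field_derivative_transform_within_open[of _ _ _ "{0<..<d\<^sup>2}"]) (use s in \<open>auto simp: vertical_profile_def\<close>)
qed

lemma B_s: "(B has_real_derivative B1 s) (at s)"
proof -
  have "((\<lambda>s. Gm (sqrt s)) has_real_derivative g (sqrt s)) (at s)" by (rule deriv_via_sqrt[OF s(1) Gm'[OF r(1,2)]])
  then show ?thesis unfolding B_def[abs_def] B1_def using s by (auto intro!: derivative_eq_intros simp: field_simps B_def)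
qed

lemma g_s: "((\<lambda>s. g (sqrt s)) has_real_derivative (n (sqrt s) - 3) * g (sqrt s) / (2 * (1 + s))) (at s)"
  using deriv_via_sqrt[OF s(1) g'[OF r(1,2)]] unfolding r(3) .

lemma B1_s: "(B1 has_real_derivative B2 s) (at s)"
proof -
  have alg: "((a - x / s) * s - x * 1) / (s * s) = (a - 2 * (x / s)) / s" for a x using s by (simp add: field_simps)
  have "((\<lambda>s. (g (sqrt s) - B s) / s) has_real_derivative
      (((n (sqrt s) - 3) * g (sqrt s) / (2 * (1 + s)) - B1 s) * s - (g (sqrt s) - B s) * 1) / (s * s)) (at s)"
    by (rule DERIV_divide[OF DERIV_diff[OF g_s B_s] DERIV_ident]) (use s in simp)
  then show ?thesis unfolding B2_def B1_def[abs_def] alg .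
qed

lemma k_s: "((\<lambda>s. k (sqrt s)) has_real_derivative e (sqrt s)) (at s)"
  by (rule deriv_via_sqrt[OF s(1) k'[OF r(1,2)]])

lemma n1_s: "(n1 has_real_derivative n2 s) (at s)"
proof -
  have e: "(- (2 * a1 + b1) * (2 * s) - (- (2 * a + b)) * 2) / (2 * s * (2 * s)) = - (4 * a1 + b1) / (2 * s)"
    if "a1 = - (2 * a + b) / (2 * s)" for a a1 b b1 unfolding that using s by (simp add: field_simps)
  have "((\<lambda>s. - (2 * n (sqrt s) + H (sqrt s))) has_real_derivative - (2 * n1 s + H1 s)) (at s)"
    by (intro DERIV_minus DERIV_add DERIV_cmult n_s H_s)
  from DERIV_divide[OF this DERIV_cmult[OF DERIV_ident, of 2]] s
  show ?thesis unfolding n1_def[abs_def] n2_def using e[OF n1_def] by (simp add: n1_def)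
qed

lemma H1_s: "(H1 has_real_derivative H2 s) (at s)"
proof -
  let ?R = "\<lambda>s. k (sqrt s) - 3/2 * s * H (sqrt s) - s * n (sqrt s) + s * n (sqrt s) * H (sqrt s) / 2"
  have R: "(?R has_real_derivative R1 s) (at s)"
    unfolding R1_def by (auto intro!: derivative_eq_intros k_s H_s n_s simp: field_simps)
  have S: "((\<lambda>s. s * (1 + s)) has_real_derivative 1 + 2 * s) (at s)" by (auto intro!: derivative_eq_intros)
  have D: "((\<lambda>s. ?R s / (s * (1 + s))) has_real_derivative (R1 s * (s * (1 + s)) - ?R s * (1 + 2 * s)) / (s * (1 + s) * (s * (1 + s)))) (at s)"
    by (rule DERIV_divide[OF R S]) (use s in simp)
  have "(a * c - b * (1 + 2 * s)) / (c * c) = (a - b / c * (1 + 2 * s)) / c" if "c \<noteq> 0" for a b c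
    using that by (simp add: field_simps)
  note alg = this[of "s * (1 + s)"]
  have nz: "s * (1 + s) \<noteq> 0" using s by simp
  show ?thesis using D unfolding alg[OF nz] H2_def H1_def[abs_def] .
qed

lemma q_s: "((\<lambda>s. pressure_profile Gm E k e n (sqrt s)) has_real_derivative q1 s) (at s)"
proof -
  have es: "((\<lambda>s. e (sqrt s)) has_real_derivative (- 3 * e (sqrt s) - B s * g (sqrt s)) / (2 * (1 + s))) (at s)"
    using deriv_via_sqrt[OF s(1) e'[OF r(1,2)]] unfolding r(3) B_def .
  have c: "2 * (1 + s) * ((- 3 * e (sqrt s) - B s * g (sqrt s)) / (2 * (1 + s))) = - 3 * e (sqrt s) - B s * g (sqrt s)" using s by simp
  have "((\<lambda>s. k (sqrt s) - 2 * (1 + s) * e (sqrt s) + (1 - s) * H (sqrt s) - s * n (sqrt s) - s * (n (sqrt s))\<^sup>2 / 2 - s * (B s)\<^sup>2 / 2) has_real_derivative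
     e (sqrt s) - (2 * e (sqrt s) + 2 * (1 + s) * ((- 3 * e (sqrt s) - B s * g (sqrt s)) / (2 * (1 + s)))) + (- H (sqrt s) + (1 - s) * H1 s) - (n (sqrt s) + s * n1 s)
      - ((n (sqrt s))\<^sup>2 / 2 + s * n (sqrt s) * n1 s) - ((B s)\<^sup>2 / 2 + s * B s * B1 s)) (at s)"
    by (rule derivative_eq_intros k_s es H_s n_s B_s refl | simp add: field_simps)+
  then have "((\<lambda>s. k (sqrt s) - 2 * (1 + s) * e (sqrt s) + (1 - s) * H (sqrt s) - s * n (sqrt s) - s * (n (sqrt s))\<^sup>2 / 2 - s * (B s)\<^sup>2 / 2) has_real_derivative q1 s) (at s)"
    unfolding c q1_def by (simp add: algebra_simps)
  then show ?thesis
    by (rule has_field_derivative_transform_within_open[of _ _ _ "{0<..<d\<^sup>2}"]) (use s in \<open>auto simp: pressure_profile_def B_def\<close>)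
qed

lemma recon_equations:
  "- (4 * s * (1 + s) * (n2 s + H2 s) + (8 + 14 * s) * (n1 s + H1 s) + 6 * (n (sqrt s) + H (sqrt s))) + (n (sqrt s) + H (sqrt s))\<^sup>2 - (B s)\<^sup>2
    + 2 * s * (n (sqrt s) + H (sqrt s) - H (sqrt s)) * (n1 s + H1 s) - 2 * H (sqrt s) * (n (sqrt s) + H (sqrt s)) + 2 * q1 s = 0"
  "- (4 * s * (1 + s) * B2 s + (8 + 14 * s) * B1 s + 6 * B s) + 2 * (n (sqrt s) + H (sqrt s)) * B s
    + 2 * s * (n (sqrt s) + H (sqrt s) - H (sqrt s)) * B1 s - 2 * H (sqrt s) * B s = 0"
  "- (4 * s * (1 + s) * H2 s + (4 + 10 * s) * H1 s + 2 * H (sqrt s)) + 2 * s * (n (sqrt s) + H (sqrt s) - H (sqrt s)) * H1 s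
    - (H (sqrt s))\<^sup>2 - (2 * s * q1 s + 2 * pressure_profile Gm E k e n (sqrt s)) = 0"
  "2 * (n (sqrt s) + H (sqrt s)) + 2 * s * (n1 s + H1 s) - H (sqrt s) - 2 * s * H1 s = 0"
proof -
  have 1: "s \<noteq> 0" "1 + s \<noteq> 0" using s by auto
  have 2: "s * n1 s = - (n (sqrt s) + H (sqrt s) / 2)" unfolding n1_def using 1 by (simp add: field_simps)
  have 3: "s * n2 s = - (2 * n1 s + H1 s / 2)" unfolding n2_def using 1 by (simp add: field_simps)
  have 4: "k (sqrt s) = s * (1 + s) * H1 s + 3 / 2 * s * H (sqrt s) + s * n (sqrt s) - s * n (sqrt s) * H (sqrt s) / 2"
    unfolding H1_def using 1 by simp
  have 5: "s * (1 + s) * H2 s = e (sqrt s) - 3/2 * H (sqrt s) - 3/2 * s * H1 s - n (sqrt s) - s * n1 s + n (sqrt s) * H (sqrt s) / 2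
      + s * n1 s * H (sqrt s) / 2 + s * n (sqrt s) * H1 s / 2 - H1 s * (1 + 2 * s)"
    unfolding H2_def R1_def using 1 by simp
  have 6: "s * B1 s = g (sqrt s) - B s" "s * B2 s = (n (sqrt s) - 3) * g (sqrt s) / (2 * (1 + s)) - 2 * B1 s"
    "2 * (1 + s) * ((n (sqrt s) - 3) * g (sqrt s) / (2 * (1 + s))) = (n (sqrt s) - 3) * g (sqrt s)"
    unfolding B1_def B2_def using 1 by simp_all
  have 7: "pressure_profile Gm E k e n (sqrt s) = k (sqrt s) - 2 * (1 + s) * e (sqrt s) + (1 - s) * H (sqrt s) - s * n (sqrt s) - s * (n (sqrt s))\<^sup>2 / 2 - s * (B s)\<^sup>2 / 2"
    unfolding pressure_profile_def r(3) B_def ..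
  note eqs = profile_equations[OF 1 2 3 4 5 6 7 q1_def refl refl refl]
  show "- (4 * s * (1 + s) * (n2 s + H2 s) + (8 + 14 * s) * (n1 s + H1 s) + 6 * (n (sqrt s) + H (sqrt s))) + (n (sqrt s) + H (sqrt s))\<^sup>2 - (B s)\<^sup>2
    + 2 * s * (n (sqrt s) + H (sqrt s) - H (sqrt s)) * (n1 s + H1 s) - 2 * H (sqrt s) * (n (sqrt s) + H (sqrt s)) + 2 * q1 s = 0"
    by (rule eqs(1))
  show "- (4 * s * (1 + s) * B2 s + (8 + 14 * s) * B1 s + 6 * B s) + 2 * (n (sqrt s) + H (sqrt s)) * B s
    + 2 * s * (n (sqrt s) + H (sqrt s) - H (sqrt s)) * B1 s - 2 * H (sqrt s) * B s = 0" by (rule eqs(2))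
  show "- (4 * s * (1 + s) * H2 s + (4 + 10 * s) * H1 s + 2 * H (sqrt s)) + 2 * s * (n (sqrt s) + H (sqrt s) - H (sqrt s)) * H1 s
    - (H (sqrt s))\<^sup>2 - (2 * s * q1 s + 2 * pressure_profile Gm E k e n (sqrt s)) = 0" by (rule eqs(3))
  show "2 * (n (sqrt s) + H (sqrt s)) + 2 * s * (n1 s + H1 s) - H (sqrt s) - 2 * s * H1 s = 0" by (rule eqs(4))
qed

end

lemma recon_NS:
  assumes d: "0 < d"
  shows "stationary_NS_on (punctured_cone d) (recon_u Gm E n) (recon_p Gm E k e n)"
  unfolding stationary_NS_on_def
proof
  fix x assume x: "x \<in> punctured_cone d"
  note s = sq_bounds[OF x]
  have A: "profile d (\<lambda>s. n (sqrt s) + H (sqrt s)) (\<lambda>s. n1 s + H1 s) (\<lambda>s. n2 s + H2 s)"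
    by unfold_locales (intro DERIV_add n_s H_s n1_s H1_s d; assumption)+
  have B: "profile d B B1 B2"
    by unfold_locales (intro B_s B1_s d; assumption)+
  have h: "profile d (\<lambda>s. H (sqrt s)) H1 H2"
    by unfold_locales (intro H_s H1_s d; assumption)+
  show "- laplacian (recon_u Gm E n) x + convection (recon_u Gm E n) (recon_u Gm E n) x + gradient (recon_p Gm E k e n) x = 0 \<and>
    divergence (recon_u Gm E n) x = 0"
  proof (rule NS_profile[OF A B h q_s _ _ x, THEN iffD2])
    show "recon_u Gm E n y = profile_u (\<lambda>s. n (sqrt s) + H (sqrt s)) B (\<lambda>s. H (sqrt s)) y" for y
      unfolding recon_u_def B_def[abs_def] ..
    show "recon_p Gm E k e n y = scal 2 (\<lambda>s. pressure_profile Gm E k e n (sqrt s)) y" for y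
      unfolding recon_p_def ..
  qed (use recon_equations[OF s d] d in \<open>simp_all only: simp_thms\<close>)
qed


section \<open>Expansions of the reconstructed profiles at the axis\<close>

lemma E_quotient: "((\<lambda>t. E t / t\<^sup>2) \<longlongrightarrow> \<mu> $ 1 / 2) (at_right 0)"
  and Gm_quotient: "((\<lambda>t. Gm t / t\<^sup>2) \<longlongrightarrow> \<mu> $ 4) (at_right 0)" if d: "0 < d"
proof -
  have *: "((\<lambda>t. F t / t\<^sup>2) \<longlongrightarrow> l) (at_right 0)"
    if F': "\<And>t. 0 < t \<Longrightarrow> t < d \<Longrightarrow> (F has_real_derivative 2 * t * f t) (at t)"
      and F: "(F \<longlongrightarrow> 0) (at_right 0)" and f: "(f \<longlongrightarrow> l) (at_right 0)" for F f :: "real \<Rightarrow> real" and l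
  proof (rule lhopital_right_0[of F "\<lambda>t. t\<^sup>2" "\<lambda>t. 2 * t" "\<lambda>t. 2 * t * f t"])
    have ev: "\<forall>\<^sub>F t in at_right 0. P t" if "\<And>t. 0 < t \<Longrightarrow> t < d \<Longrightarrow> P t" for P :: "real \<Rightarrow> bool"
      unfolding eventually_at_right_field using d that by blast
    show "(F \<longlongrightarrow> 0) (at_right 0)" by (rule F)
    have "((\<lambda>t::real. t\<^sup>2) \<longlongrightarrow> 0\<^sup>2) (at_right 0)" by (intro tendsto_intros)
    then show "((\<lambda>t::real. t\<^sup>2) \<longlongrightarrow> 0) (at_right 0)" by simp
    show "\<forall>\<^sub>F t::real in at_right 0. t\<^sup>2 \<noteq> 0" by (rule ev) simp
    show "\<forall>\<^sub>F t::real in at_right 0. 2 * t \<noteq> 0" by (rule ev) simp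
    show "\<forall>\<^sub>F t in at_right 0. (F has_real_derivative 2 * t * f t) (at t)" by (rule ev) (rule F')
    show "\<forall>\<^sub>F t::real in at_right 0. ((\<lambda>t. t\<^sup>2) has_real_derivative 2 * t) (at t)"
      by (rule ev) (auto intro!: derivative_eq_intros)
    show "((\<lambda>t. 2 * t * f t / (2 * t)) \<longlongrightarrow> l) (at_right 0)"
      by (rule tendsto_right_cong[OF f zero_less_one]) simp
  qed
  show "((\<lambda>t. E t / t\<^sup>2) \<longlongrightarrow> \<mu> $ 1 / 2) (at_right 0)" by (rule *[OF E' E0 k0])
  show "((\<lambda>t. Gm t / t\<^sup>2) \<longlongrightarrow> \<mu> $ 4) (at_right 0)" by (rule *[OF Gm' Gm0 g0])
qed

lemma ident_0: "((\<lambda>t::real. t) \<longlongrightarrow> 0) (at_right 0)" by (rule tendsto_ident_at)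

lemma square_0: "((\<lambda>t::real. t\<^sup>2) \<longlongrightarrow> 0) (at_right 0)"
  using tendsto_mult[OF ident_0 ident_0] by (simp add: power2_eq_square)

lemma ttn0: "((\<lambda>t. t\<^sup>2 * n t) \<longlongrightarrow> 0) (at_right 0)"
  using tendsto_mult[OF ident_0 tn0] by (simp add: power2_eq_square mult.assoc)

lemma ttnn0: "((\<lambda>t. t\<^sup>2 * (n t)\<^sup>2) \<longlongrightarrow> 0) (at_right 0)"
  using tendsto_mult[OF tn0 tn0] by (simp add: power2_eq_square algebra_simps)

lemma tln0: "((\<lambda>t. \<mu> $ 1 * t * ln t) \<longlongrightarrow> 0) (at_right 0)"
proof -
  have "((\<lambda>t. 2 * (t * (n t + \<mu> $ 1 / 2 * ln t)) - 2 * (t * n t)) \<longlongrightarrow> 2 * (0 * (\<mu> $ 1 / 2 - \<mu> $ 3)) - 2 * 0) (at_right 0)"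
    by (intro tendsto_intros ident_0 n0 tn0)
  then show ?thesis by (simp add: algebra_simps)
qed

context
  assumes d: "0 < d"
begin

text \<open>The logarithm \<mu>_1 ln t comes entirely from -2 n. Dividing by 1 + t^2 alters it only
  by a multiple of t^2 ln t, which tends to 0.\<close>

lemma H_limit: "((\<lambda>t. H t - \<mu> $ 1 * ln t) \<longlongrightarrow> 2 * \<mu> $ 3 - \<mu> $ 1 / 2) (at_right 0)"
proof -
  have "((\<lambda>t. (E t / t\<^sup>2 - 2 * (n t + \<mu> $ 1 / 2 * ln t) - t\<^sup>2 * n t - t\<^sup>2 * (n t)\<^sup>2 / 2 - t * (\<mu> $ 1 * t * ln t)) / (1 + t\<^sup>2))
    \<longlongrightarrow> (\<mu> $ 1 / 2 - 2 * (\<mu> $ 1 / 2 - \<mu> $ 3) - 0 - 0 / 2 - 0 * 0) / (1 + 0)) (at_right 0)"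
    by (rule E_quotient[OF d] n0 ttn0 ttnn0 ident_0 tln0 square_0 tendsto_intros | (simp; fail))+
  moreover
  have "(x - 2 * (m + c / 2 * l) - t\<^sup>2 * m - t\<^sup>2 * m\<^sup>2 / 2 - t * (c * t * l)) / (1 + t\<^sup>2)
      = (x - (t\<^sup>2 + 2) * m - t\<^sup>2 * m\<^sup>2 / 2) / (1 + t\<^sup>2) - c * l" for x m c l t :: real
    using one_plus_square_pos[of t] by (simp add: field_simps power2_eq_square)
  then have "(E t / t\<^sup>2 - 2 * (n t + \<mu> $ 1 / 2 * ln t) - t\<^sup>2 * n t - t\<^sup>2 * (n t)\<^sup>2 / 2 - t * (\<mu> $ 1 * t * ln t)) / (1 + t\<^sup>2)
      = H t - \<mu> $ 1 * ln t" for t unfolding vertical_profile_def .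
  moreover have "(\<mu> $ 1 / 2 - 2 * (\<mu> $ 1 / 2 - \<mu> $ 3) - 0 - 0 / 2 - 0 * 0) / (1 + 0) = 2 * \<mu> $ 3 - \<mu> $ 1 / 2" by simp
  ultimately show ?thesis by (simp only:)
qed

lemma tH0: "((\<lambda>t. t * H t) \<longlongrightarrow> 0) (at_right 0)"
  using tendsto_add[OF tendsto_mult[OF ident_0 H_limit] tln0] by (simp add: algebra_simps)

lemma ttH0: "((\<lambda>t. t\<^sup>2 * H t) \<longlongrightarrow> 0) (at_right 0)"
  using tendsto_mult[OF ident_0 tH0] by (simp add: power2_eq_square mult.assoc)

lemma A_limit: "((\<lambda>t. n t + H t - \<mu> $ 1 / 2 * ln t) \<longlongrightarrow> \<mu> $ 3) (at_right 0)"
  using tendsto_add[OF n0 H_limit] by (simp add: algebra_simps)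

text \<open>The initial value of \<open>e\<close> is decoded here: \<mu>_1/2 - 2 (\<mu>_3 -
  \<mu>_2/2) + (2 \<mu>_3 - \<mu>_1/2) = \<mu>_2.\<close>

lemma q_limit: "((\<lambda>t. pressure_profile Gm E k e n t - \<mu> $ 1 * ln t) \<longlongrightarrow> \<mu> $ 2) (at_right 0)"
proof -
  have "((\<lambda>t. k t - 2 * (1 + t\<^sup>2) * e t + (H t - \<mu> $ 1 * ln t) - t\<^sup>2 * H t - t\<^sup>2 * n t - t\<^sup>2 * (n t)\<^sup>2 / 2 - t\<^sup>2 * (Gm t / t\<^sup>2)\<^sup>2 / 2)
    \<longlongrightarrow> \<mu> $ 1 / 2 - 2 * (1 + 0) * (\<mu> $ 3 - \<mu> $ 2 / 2) + (2 * \<mu> $ 3 - \<mu> $ 1 / 2) - 0 - 0 - 0 / 2 - 0 * (\<mu> $ 4)\<^sup>2 / 2) (at_right 0)"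
    by (intro tendsto_intros k0 e0 H_limit ttH0 ttn0 ttnn0 square_0 Gm_quotient d) simp_all
  moreover have "k t - 2 * (1 + t\<^sup>2) * e t + (H t - \<mu> $ 1 * ln t) - t\<^sup>2 * H t - t\<^sup>2 * n t - t\<^sup>2 * (n t)\<^sup>2 / 2 - t\<^sup>2 * (Gm t / t\<^sup>2)\<^sup>2 / 2
     = pressure_profile Gm E k e n t - \<mu> $ 1 * ln t" for t unfolding pressure_profile_def left_diff_distrib by linarith
  moreover have "\<mu> $ 1 / 2 - 2 * (1 + 0) * (\<mu> $ 3 - \<mu> $ 2 / 2) + (2 * \<mu> $ 3 - \<mu> $ 1 / 2) - 0 - 0 - 0 / 2 - 0 * (\<mu> $ 4)\<^sup>2 / 2 = \<mu> $ 2"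
    by (simp add: algebra_simps)
  ultimately show ?thesis by (simp only:)
qed

lemma q_deriv: "0 < t \<Longrightarrow> t < d \<Longrightarrow> (pressure_profile Gm E k e n has_real_derivative 2 * t * q1 (t\<^sup>2)) (at t)"
proof -
  assume t: "0 < t" "t < d"
  have "0 < t\<^sup>2" "t\<^sup>2 < d\<^sup>2" using t by (auto intro: power_strict_mono)
  from compose_square_deriv[OF q_s[OF this d]]
  have "((\<lambda>t. pressure_profile Gm E k e n (sqrt (t\<^sup>2))) has_real_derivative 2 * t * q1 (t\<^sup>2)) (at t)" .
  then show ?thesis
    by (rule has_field_derivative_transform_within_open[of _ _ _ "{0<..}"]) (use t in auto)
qed

text \<open>Convergence of p - \<mu>_1 ln \<rho> alone says nothing about its derivative, so the
  limit is computed from the formula for q'. After multiplication by 2 s only the term (1 - s) h'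
  survives, where s h' tends to k(0) = \<mu>_1/2.\<close>

lemma q1_limit: "((\<lambda>t. t * (2 * t * q1 (t\<^sup>2))) \<longlongrightarrow> \<mu> $ 1) (at_right 0)"
proof -
  let ?h = "\<lambda>t. (k t - 3/2 * (t\<^sup>2 * H t) - t\<^sup>2 * n t + (t * n t) * (t * H t) / 2) / (1 + t\<^sup>2)"
  let ?n = "\<lambda>t. - (t\<^sup>2 * n t + t\<^sup>2 * H t / 2)"
  let ?B = "\<lambda>t. Gm t / t\<^sup>2"
  have h: "(?h \<longlongrightarrow> (\<mu> $ 1 / 2 - 3/2 * 0 - 0 + 0 * 0 / 2) / (1 + 0)) (at_right 0)"
    by (rule k0 ttH0 ttn0 tn0 tH0 square_0 tendsto_intros | (simp; fail))+
  have L: "((\<lambda>t. 2 * (2 * (t\<^sup>2 * e t) + t\<^sup>2 * (?B t * g t) - t\<^sup>2 * H t + (1 - t\<^sup>2) * ?h t - t\<^sup>2 * n t - ?n t - t\<^sup>2 * (n t)\<^sup>2 / 2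
      + t\<^sup>2 * (n t)\<^sup>2 + (t * n t) * (t * H t) / 2 - t\<^sup>2 * (?B t)\<^sup>2 / 2 - t\<^sup>2 * (?B t * (g t - ?B t))))
     \<longlongrightarrow> 2 * (2 * (0 * (\<mu> $ 3 - \<mu> $ 2 / 2)) + 0 * (\<mu> $ 4 * \<mu> $ 4) - 0 + (1 - 0) * ((\<mu> $ 1 / 2 - 3/2 * 0 - 0 + 0 * 0 / 2) / (1 + 0)) - 0 - (- (0 + 0 / 2)) - 0 / 2
      + 0 + 0 * 0 / 2 - 0 * (\<mu> $ 4)\<^sup>2 / 2 - 0 * (\<mu> $ 4 * (\<mu> $ 4 - \<mu> $ 4)))) (at_right 0)"
    by (rule h e0 g0 ttH0 ttn0 ttnn0 tn0 tH0 square_0 Gm_quotient[OF d] tendsto_intros | (simp; fail))+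
  have e: "2 * (2 * (t\<^sup>2 * e t) + t\<^sup>2 * (?B t * g t) - t\<^sup>2 * H t + (1 - t\<^sup>2) * ?h t - t\<^sup>2 * n t - ?n t - t\<^sup>2 * (n t)\<^sup>2 / 2
      + t\<^sup>2 * (n t)\<^sup>2 + (t * n t) * (t * H t) / 2 - t\<^sup>2 * (?B t)\<^sup>2 / 2 - t\<^sup>2 * (?B t * (g t - ?B t))) = t * (2 * t * q1 (t\<^sup>2))"
    if t: "0 < t" for t
  proof -
    have r: "sqrt (t\<^sup>2) = t" using t by simp
    define s where "s = t\<^sup>2"
    have s: "0 < s" using t by (simp add: s_def)
    have tn: "(t * n t) * (t * H t) = s * (n t * H t)" by (simp add: s_def power2_eq_square)
    have "s * (X / (s * (1 + s))) = X / (1 + s)" for X using s by simp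
    then have h1: "s * H1 s = ?h t" unfolding H1_def r[folded s_def] s_def[symmetric] tn by (simp only: mult.assoc)
    have n1: "s * (s * n1 s) = ?n t" unfolding n1_def r[folded s_def] s_def[symmetric] using s by (simp add: field_simps)
    have b: "B s = ?B t" unfolding B_def s_def r ..
    have b1: "s * B1 s = g t - ?B t" unfolding B1_def b using s unfolding s_def r by simp
    have nn: "s * (s * n t * n1 s) = - (s * (n t)\<^sup>2) - s * (n t * H t) / 2"
    proof -
      have "s * (s * n t * n1 s) = n t * (s * (s * n1 s))" by simp
      then show ?thesis unfolding n1 s_def[symmetric] by (simp add: field_simps power2_eq_square)
    qed
    have q: "s * (2 * e' + b * g' - h + (1 - s) * h1 - m - s * m1 - m\<^sup>2 / 2 - s * m * m1 - b\<^sup>2 / 2 - s * b * b1)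
      = 2 * (s * e') + s * (b * g') - s * h + (1 - s) * (s * h1) - s * m - s * (s * m1) - s * m\<^sup>2 / 2 - s * (s * m * m1) - s * b\<^sup>2 / 2 - s * (b * (s * b1))"
      for b b1 h h1 m m1 e' g' by (simp add: field_simps power2_eq_square)
    have cg: "2 * (X - (- a - b) - c - d) = 2 * (X + a + b - c - d)" for X a b c d :: real by simp
    have "t * (2 * t * q1 (t\<^sup>2)) = 2 * (s * q1 s)" by (simp add: s_def power2_eq_square)
    also have "\<dots> = 2 * (2 * (s * e t) + s * (?B t * g t) - s * H t + (1 - s) * ?h t - s * n t - ?n t - s * (n t)\<^sup>2 / 2
        - (- (s * (n t)\<^sup>2) - s * (n t * H t) / 2) - s * (?B t)\<^sup>2 / 2 - s * (?B t * (g t - ?B t)))"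
      unfolding q1_def r[folded s_def] q h1 n1 b b1 nn ..
    also have "\<dots> = 2 * (2 * (t\<^sup>2 * e t) + t\<^sup>2 * (?B t * g t) - t\<^sup>2 * H t + (1 - t\<^sup>2) * ?h t - t\<^sup>2 * n t - ?n t - t\<^sup>2 * (n t)\<^sup>2 / 2
      + t\<^sup>2 * (n t)\<^sup>2 + (t * n t) * (t * H t) / 2 - t\<^sup>2 * (?B t)\<^sup>2 / 2 - t\<^sup>2 * (?B t * (g t - ?B t)))"
      unfolding tn s_def[symmetric] by (rule cg)
    finally show ?thesis by (rule sym)
  qed
  have "2 * (2 * (0 * (\<mu> $ 3 - \<mu> $ 2 / 2)) + 0 * (\<mu> $ 4 * \<mu> $ 4) - 0 + (1 - 0) * ((\<mu> $ 1 / 2 - 3/2 * 0 - 0 + 0 * 0 / 2) / (1 + 0)) - 0 - (- (0 + 0 / 2)) - 0 / 2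
      + 0 + 0 * 0 / 2 - 0 * (\<mu> $ 4)\<^sup>2 / 2 - 0 * (\<mu> $ 4 * (\<mu> $ 4 - \<mu> $ 4))) = \<mu> $ 1" by simp
  with L have "((\<lambda>t. 2 * (2 * (t\<^sup>2 * e t) + t\<^sup>2 * (?B t * g t) - t\<^sup>2 * H t + (1 - t\<^sup>2) * ?h t - t\<^sup>2 * n t - ?n t - t\<^sup>2 * (n t)\<^sup>2 / 2
      + t\<^sup>2 * (n t)\<^sup>2 + (t * n t) * (t * H t) / 2 - t\<^sup>2 * (?B t)\<^sup>2 / 2 - t\<^sup>2 * (?B t * (g t - ?B t)))) \<longlongrightarrow> \<mu> $ 1) (at_right 0)"
    by (simp only:)
  then show ?thesis by (rule tendsto_right_cong[OF _ zero_less_one]) (rule e)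
qed

lemma recon_parameter: "has_parameter (recon_u Gm E n) (recon_p Gm E k e n) \<mu>"
  unfolding has_parameter_def
proof (intro allI conjI)
  fix \<phi>
  have p: "recon_p Gm E k e n (cyl t \<phi> 1) = pressure_profile Gm E k e n t" if "0 < t" for t
    unfolding recon_p_def profile_u_cyl(4)[OF that] using that by simp
  have u: "comp_rho (recon_u Gm E n) (cyl t \<phi> 1) = t * (n t + H t)" "comp_phi (recon_u Gm E n) (cyl t \<phi> 1) = t * (Gm t / t\<^sup>2)" if "0 < t" for t
    unfolding recon_u_def profile_u_cyl(1,2)[OF that] using that by simp_all
  show "((\<lambda>t. recon_p Gm E k e n (cyl t \<phi> 1) - \<mu> $ 1 * ln t) \<longlongrightarrow> \<mu> $ 2) (at_right 0)"
    by (rule tendsto_right_cong[OF q_limit zero_less_one]) (simp add: p)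
  show "((\<lambda>t. (1 / t) * (comp_rho (recon_u Gm E n) (cyl t \<phi> 1) - 1/2 * \<mu> $ 1 * t * ln t)) \<longlongrightarrow> \<mu> $ 3) (at_right 0)"
    by (rule tendsto_right_cong[OF A_limit zero_less_one]) (simp add: u field_simps)
  show "((\<lambda>t. (1 / t) * comp_phi (recon_u Gm E n) (cyl t \<phi> 1)) \<longlongrightarrow> \<mu> $ 4) (at_right 0)"
    by (rule tendsto_right_cong[OF Gm_quotient[OF d] zero_less_one]) (simp add: u)
  show "((\<lambda>t. t * deriv (\<lambda>s. recon_p Gm E k e n (cyl s \<phi> 1)) t) \<longlongrightarrow> \<mu> $ 1) (at_right 0)"
  proof (rule tendsto_right_cong[OF q1_limit d])
    fix t assume t: "0 < t" "t < d"
    have "((\<lambda>s. recon_p Gm E k e n (cyl s \<phi> 1)) has_real_derivative 2 * t * q1 (t\<^sup>2)) (at t)"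
      by (rule has_field_derivative_transform_within_open[OF q_deriv[OF t], of "{0<..}"]) (use t p in auto)
    then have "deriv (\<lambda>s. recon_p Gm E k e n (cyl s \<phi> 1)) t = 2 * t * q1 (t\<^sup>2)" by (rule DERIV_imp_deriv)
    then show "t * (2 * t * q1 (t\<^sup>2)) = t * deriv (\<lambda>s. recon_p Gm E k e n (cyl s \<phi> 1)) t" by simp
  qed
qed

lemma recon_small: "small_near_axis (recon_u Gm E n)"
  unfolding recon_u_def
proof (rule small_near_axis_profile)
  show "((\<lambda>t. t\<^sup>2 * (n (sqrt (t\<^sup>2)) + H (sqrt (t\<^sup>2)))) \<longlongrightarrow> 0) (at_right 0)"
    by (rule tendsto_right_cong[where f="\<lambda>t. t\<^sup>2 * n t + t\<^sup>2 * H t", OF _ zero_less_one])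
      (use tendsto_add[OF ttn0 ttH0] in \<open>simp_all add: distrib_left\<close>)
  show "((\<lambda>t. t\<^sup>2 * (Gm (sqrt (t\<^sup>2)) / t\<^sup>2)) \<longlongrightarrow> 0) (at_right 0)"
    by (rule tendsto_right_cong[where f="Gm", OF Gm0 zero_less_one]) simp
  show "((\<lambda>t. t * H (sqrt (t\<^sup>2))) \<longlongrightarrow> 0) (at_right 0)"
    by (rule tendsto_right_cong[OF tH0 zero_less_one]) simp
qed

theorem recon_solution:
  assumes "C_infinity_on (punctured_cone d) (recon_u Gm E n)" "C_infinity_on (punctured_cone d) (recon_p Gm E k e n)"
  shows "is_solution d \<mu> (recon_u Gm E n) (recon_p Gm E k e n)"
  unfolding is_solution_def
proof (intro conjI)
  show "homogeneous_on (punctured_cone d) (- 1) (recon_u Gm E n)" unfolding recon_u_def by (rule homogeneous_profile_u)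
  show "homogeneous_on (punctured_cone d) (- 2) (recon_p Gm E k e n)" unfolding recon_p_def by (rule homogeneous_scal)
  show "axisymmetric_on (punctured_cone d) (recon_u Gm E n) (recon_p Gm E k e n)"
    unfolding recon_u_def recon_p_def by (rule axisymmetric_profile)
qed (fact assms recon_NS[OF d] recon_small recon_parameter)+

end

end

section \<open>The solution family\<close>

definition clamp :: "real \<Rightarrow> real \<Rightarrow> real" where "clamp d t = max 0 (min d t)"

text \<open>Bounded continuous functions on the whole line that stand in for \<rho>, \<rho> ln
  \<rho> and 1/(1 + \<rho>^2); the first two agree with their models on (0, d). They let the
  right-hand sides of the equations be written inside the Banach algebra.\<close>

definition bid :: "real \<Rightarrow> BC" where "bid d = Bcontfun (clamp d)"
definition bln :: "real \<Rightarrow> BC" where "bln d = Bcontfun (\<lambda>t. wt 1 (clamp d t) * (1 + (clamp d t)\<^sup>2))"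
definition binv :: BC where "binv = Bcontfun (\<lambda>t. 1 / (1 + t\<^sup>2))"

lemma apply_binv: "binv t = 1 / (1 + t\<^sup>2)"
proof -
  have "apply_bcontfun binv = (\<lambda>t. 1 / (1 + t\<^sup>2))" unfolding binv_def
  proof (rule apply_Bcontfun[of _ 1])
    show "continuous_on UNIV (\<lambda>t::real. 1 / (1 + t\<^sup>2))"
      using one_plus_square_pos by (intro continuous_intros) (auto simp: less_imp_neq[symmetric])
    show "norm (1 / (1 + t\<^sup>2)) \<le> 1" for t :: real using one_plus_square_pos[of t] by simp
  qed
  then show ?thesis by simp
qed

lemma continuous_clamp: "continuous_on A (clamp d)"
  unfolding clamp_def by (intro continuous_intros)

lemma clamp_range: "0 \<le> d \<Longrightarrow> clamp d t \<in> {0..d}"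
  by (auto simp: clamp_def)

lemma clamp_eq: "0 < t \<Longrightarrow> t < d \<Longrightarrow> clamp d t = t"
  by (simp add: clamp_def)

lemma apply_bid: "0 < t \<Longrightarrow> t < d \<Longrightarrow> bid d t = t"
proof -
  assume t: "0 < t" "t < d"
  have "apply_bcontfun (bid d) = clamp d" unfolding bid_def
    by (rule apply_Bcontfun[OF continuous_clamp, of _ d]) (use clamp_range[of d] t in \<open>simp add: abs_le_iff\<close>)
  then show ?thesis using clamp_eq[OF t] by simp
qed

lemma apply_bln:
  assumes d: "d \<le> 1" and t: "0 < t" "t < d" shows "bln d t = t * ln t"
proof -
  interpret weight "wt 1" d by (rule weight_wt) (use d t in auto)
  have "apply_bcontfun (bln d) = (\<lambda>t. wt 1 (clamp d t) * (1 + (clamp d t)\<^sup>2))" unfolding bln_def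
  proof (rule apply_Bcontfun[of _ 2])
    have r: "clamp d s \<in> {0..d}" for s using clamp_range[of d s] t by simp
    have c: "continuous_on UNIV (\<lambda>t. wt 1 (clamp d t))"
      by (rule continuous_on_compose2[OF cont continuous_clamp]) (use r in auto)
    show "continuous_on UNIV (\<lambda>t. wt 1 (clamp d t) * (1 + (clamp d t)\<^sup>2))"
      by (intro continuous_intros c continuous_clamp)
    show "norm (wt 1 (clamp d s) * (1 + (clamp d s)\<^sup>2)) \<le> 2" for s
    proof -
      have "(clamp d s)\<^sup>2 \<le> 1\<^sup>2" using r[of s] d by (intro power_mono) auto
      then have "\<bar>wt 1 (clamp d s)\<bar> * \<bar>1 + (clamp d s)\<^sup>2\<bar> \<le> 1 * 2" using bd[OF r[of s]] by (intro mult_mono) auto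
      then show ?thesis by (simp add: abs_mult)
    qed
  qed
  then show ?thesis using one_plus_square_pos[of t] by (simp add: clamp_eq[OF t] wt_def)
qed

lemma isCont_bcontfun: "isCont (apply_bcontfun f) (t::real)" for f :: BC
  by (rule continuous_on_interior[OF continuous_on_apply_bcontfun[of UNIV]]) simp

lemma bcontfun_limit: "(apply_bcontfun f \<longlongrightarrow> apply_bcontfun f 0) (at_right 0)" for f :: BC
  using isCont_bcontfun[where f=f and t=0] unfolding isCont_def by (rule tendsto_within_subset) simp

text \<open>The weight of a horizontal coordinate times a symbol of class \<open>Wl\<close>: like
  x_i ln \<rho>, such a product keeps the logarithm under one horizontal derivative and loses it
  from the second on.\<close>

definition Wxl :: "nat \<Rightarrow> real^3 \<Rightarrow> real" where
  "Wxl k x = (if k = 0 then norm (horiz x) * (\<bar>ln (rho x)\<bar> + 1) else if k = 1 then \<bar>ln (rho x)\<bar> + 1 else 1 / norm (horiz x) ^ (k - 1))"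

locale integral_system = region +
  fixes g e y :: "real^4 \<Rightarrow> BC"
  assumes d1: "d \<le> 1" and Cb: "Cb_infinity V g" "Cb_infinity V e" "Cb_infinity V y"
    and fp: "\<And>\<mu>. \<mu> \<in> V \<Longrightarrow> g \<mu> = step_g d \<mu> (g \<mu>) (y \<mu>)" "\<And>\<mu>. \<mu> \<in> V \<Longrightarrow> e \<mu> = step_e d \<mu> (g \<mu>) (e \<mu>)"
      "\<And>\<mu>. \<mu> \<in> V \<Longrightarrow> y \<mu> = step_y d \<mu> (e \<mu>) (y \<mu>)"
begin

text \<open>These are Gm/s, (k - \<mu>_1/2)/s and (E/s - \<mu>_1/2)/s with s = t^2. As averages of
  continuous unknowns the three quotients extend continuously to the axis.\<close>

definition "G \<mu> = avg 1 (g \<mu>)"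
definition "F \<mu> = avg 1 (e \<mu>)"
definition "\<Phi> \<mu> = avg 3 (F \<mu>)"

definition "Gm \<mu> t = t\<^sup>2 * G \<mu> t"
definition "E \<mu> t = t\<^sup>2 * (\<mu> $ 1 / 2 + t\<^sup>2 * \<Phi> \<mu> t)"
definition "k \<mu> t = \<mu> $ 1 / 2 + t\<^sup>2 * F \<mu> t"
definition "n \<mu> t = y \<mu> t - \<mu> $ 1 / 2 * ln t"

lemma w: "i \<le> 2 \<Longrightarrow> weight (wt i) d"
  by (rule weight_wt[OF d_pos d1])

context
  fixes \<mu> assumes \<mu>: "\<mu> \<in> V"
begin

lemma g_eq: "g \<mu> t = \<mu> $ 4 + vint (wt 0) d ((y \<mu> - cst 3) * g \<mu>) t - \<mu> $ 1 * (1 / 2 * vint (wt 1) d (g \<mu>) t)"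
  using arg_cong[OF fp(1)[OF \<mu>], of "\<lambda>f. apply_bcontfun f t"] unfolding step_g_def by simp

lemma e_eq: "e \<mu> t = \<mu> $ 3 - 1 / 2 * \<mu> $ 2 - vint (wt 0) d (3 *\<^sub>R e \<mu> + G \<mu> * g \<mu>) t"
  using arg_cong[OF fp(2)[OF \<mu>], of "\<lambda>f. apply_bcontfun f t"] unfolding step_e_def G_def[symmetric] by simp

lemma y_eq: "y \<mu> t = 1 / 2 * \<mu> $ 1 - \<mu> $ 3 + vint (wt 0) d ((1/2) *\<^sub>R (y \<mu> * y \<mu>) - y \<mu> + (1/2) *\<^sub>R cst (\<mu> $ 1) - \<Phi> \<mu>) t
     + \<mu> $ 1 * (1 / 2 * vint (wt 1) d (cst 1 - y \<mu>) t) + \<mu> $ 1 * (\<mu> $ 1 * (1 / 8 * vint (wt 2) d (cst 1) t))"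
  using arg_cong[OF fp(3)[OF \<mu>], of "\<lambda>f. apply_bcontfun f t"] unfolding step_y_def F_def[symmetric] \<Phi>_def[symmetric] by simp

lemma at_0: "g \<mu> 0 = \<mu> $ 4" "e \<mu> 0 = \<mu> $ 3 - \<mu> $ 2 / 2" "y \<mu> 0 = \<mu> $ 1 / 2 - \<mu> $ 3"
  unfolding g_eq[of 0] e_eq[of 0] y_eq[of 0] using w by (simp_all add: weight.vint_zero)

context
  fixes t assumes t: "0 < t" "t < d"
begin

lemma vint_derivs: "(vint (wt 0) d f has_real_derivative wt 0 t * f t) (at t)" "(vint (wt 1) d f has_real_derivative wt 1 t * f t) (at t)"
  "(vint (wt 2) d f has_real_derivative wt 2 t * f t) (at t)"
  using weight.vint_deriv[OF w t] by simp_all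

lemma g_deriv: "(g \<mu> has_real_derivative t / (1 + t\<^sup>2) * ((y \<mu> t - 3) * g \<mu> t - \<mu> $ 1 / 2 * (ln t * g \<mu> t))) (at t)"
proof -
  have "((\<lambda>t. \<mu> $ 4 + vint (wt 0) d ((y \<mu> - cst 3) * g \<mu>) t - \<mu> $ 1 * (1 / 2 * vint (wt 1) d (g \<mu>) t)) has_real_derivative
     0 + wt 0 t * apply_bcontfun ((y \<mu> - cst 3) * g \<mu>) t - \<mu> $ 1 * (1 / 2 * (wt 1 t * g \<mu> t))) (at t)"
    by (rule DERIV_diff[OF DERIV_add[OF DERIV_const vint_derivs(1)] DERIV_cmult[OF DERIV_cmult[OF vint_derivs(2)]]])
  moreover have "0 + wt 0 t * apply_bcontfun ((y \<mu> - cst 3) * g \<mu>) t - \<mu> $ 1 * (1 / 2 * (wt 1 t * g \<mu> t))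
      = t / (1 + t\<^sup>2) * ((y \<mu> t - 3) * g \<mu> t - \<mu> $ 1 / 2 * (ln t * g \<mu> t))"
  proof -
    have "t * 1 / c * x - m * (1 / 2 * (t * l / c * G)) = t / c * (x - m / 2 * (l * G))" if "c \<noteq> 0" for c x m l G :: real
      using that by (simp add: field_simps)
    from this[of "1 + t\<^sup>2"] show ?thesis unfolding wt_def using one_plus_square_pos[of t] by simp
  qed
  ultimately show ?thesis unfolding g_eq[symmetric] by (simp only:)
qed

lemma e_deriv: "(e \<mu> has_real_derivative - (t / (1 + t\<^sup>2) * (3 * e \<mu> t + G \<mu> t * g \<mu> t))) (at t)"
proof -
  have "((\<lambda>t. \<mu> $ 3 - 1 / 2 * \<mu> $ 2 - vint (wt 0) d (3 *\<^sub>R e \<mu> + G \<mu> * g \<mu>) t) has_real_derivative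
     0 - wt 0 t * apply_bcontfun (3 *\<^sub>R e \<mu> + G \<mu> * g \<mu>) t) (at t)"
    by (rule DERIV_diff[OF DERIV_const vint_derivs(1)])
  moreover have "0 - wt 0 t * apply_bcontfun (3 *\<^sub>R e \<mu> + G \<mu> * g \<mu>) t = - (t / (1 + t\<^sup>2) * (3 * e \<mu> t + G \<mu> t * g \<mu> t))"
    unfolding wt_def by simp
  ultimately show ?thesis unfolding e_eq[symmetric] by (simp only:)
qed

lemma y_deriv: "(y \<mu> has_real_derivative t / (1 + t\<^sup>2) * (1 / 2 * (y \<mu> t * y \<mu> t) - y \<mu> t + \<mu> $ 1 / 2 - \<Phi> \<mu> t
    + \<mu> $ 1 / 2 * (ln t * (1 - y \<mu> t)) + (\<mu> $ 1)\<^sup>2 / 8 * (ln t)\<^sup>2)) (at t)"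
proof -
  have "((\<lambda>t. 1 / 2 * \<mu> $ 1 - \<mu> $ 3 + vint (wt 0) d ((1/2) *\<^sub>R (y \<mu> * y \<mu>) - y \<mu> + (1/2) *\<^sub>R cst (\<mu> $ 1) - \<Phi> \<mu>) t
     + \<mu> $ 1 * (1 / 2 * vint (wt 1) d (cst 1 - y \<mu>) t) + \<mu> $ 1 * (\<mu> $ 1 * (1 / 8 * vint (wt 2) d (cst 1) t))) has_real_derivative
     0 + wt 0 t * apply_bcontfun ((1/2) *\<^sub>R (y \<mu> * y \<mu>) - y \<mu> + (1/2) *\<^sub>R cst (\<mu> $ 1) - \<Phi> \<mu>) t
     + \<mu> $ 1 * (1 / 2 * (wt 1 t * apply_bcontfun (cst 1 - y \<mu>) t)) + \<mu> $ 1 * (\<mu> $ 1 * (1 / 8 * (wt 2 t * apply_bcontfun (cst 1) t)))) (at t)"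
    by (rule DERIV_add[OF DERIV_add[OF DERIV_add[OF DERIV_const vint_derivs(1)] DERIV_cmult[OF DERIV_cmult[OF vint_derivs(2)]]] DERIV_cmult[OF DERIV_cmult[OF DERIV_cmult[OF vint_derivs(3)]]]])
  moreover have "0 + wt 0 t * apply_bcontfun ((1/2) *\<^sub>R (y \<mu> * y \<mu>) - y \<mu> + (1/2) *\<^sub>R cst (\<mu> $ 1) - \<Phi> \<mu>) t
     + \<mu> $ 1 * (1 / 2 * (wt 1 t * apply_bcontfun (cst 1 - y \<mu>) t)) + \<mu> $ 1 * (\<mu> $ 1 * (1 / 8 * (wt 2 t * apply_bcontfun (cst 1) t)))
     = t / (1 + t\<^sup>2) * (1 / 2 * (y \<mu> t * y \<mu> t) - y \<mu> t + \<mu> $ 1 / 2 - \<Phi> \<mu> t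
      + \<mu> $ 1 / 2 * (ln t * (1 - y \<mu> t)) + (\<mu> $ 1)\<^sup>2 / 8 * (ln t)\<^sup>2)"
  proof -
    have "t * 1 / c * x + m * (1 / 2 * (t * l / c * z)) + m * (m * (1 / 8 * (t * l\<^sup>2 / c * 1))) = t / c * (x + m / 2 * (l * z) + m\<^sup>2 / 8 * l\<^sup>2)" if "c \<noteq> 0"
      for c x m l z :: real using that by (simp add: field_simps power2_eq_square)
    from this[of "1 + t\<^sup>2"] show ?thesis unfolding wt_def using one_plus_square_pos[of t] by simp
  qed
  ultimately show ?thesis unfolding y_eq[symmetric] by (simp only:)
qed

lemma avg_derivs:
  "(G \<mu> has_real_derivative (2 * g \<mu> t - 2 * G \<mu> t) / t) (at t)"
  "(F \<mu> has_real_derivative (2 * e \<mu> t - 2 * F \<mu> t) / t) (at t)"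
  "(\<Phi> \<mu> has_real_derivative (2 * F \<mu> t - 4 * \<Phi> \<mu> t) / t) (at t)"
  using avg_deriv[OF t(1), of 1 "g \<mu>"] avg_deriv[OF t(1), of 1 "e \<mu>"] avg_deriv[OF t(1), of 3 "F \<mu>"]
  unfolding G_def[symmetric] F_def[symmetric] \<Phi>_def[symmetric] by simp_all

end

text \<open>The required right limits are the values at 0 of continuous functions, where the
  Volterra terms vanish and leave the constants of the integral equations.\<close>

theorem ode: "ode d \<mu> (Gm \<mu>) (g \<mu>) (E \<mu>) (k \<mu>) (e \<mu>) (n \<mu>)"
proof
  fix t assume t: "0 < t" "t < d"
  have c: "1 + t\<^sup>2 \<noteq> 0" using one_plus_square_pos[of t] by simp
  have q: "Gm \<mu> t / t\<^sup>2 = G \<mu> t" "E \<mu> t / t\<^sup>2 = \<mu> $ 1 / 2 + t\<^sup>2 * \<Phi> \<mu> t" using t by (simp_all add: Gm_def E_def)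
  have sq: "((\<lambda>t. t\<^sup>2) has_real_derivative 2 * t) (at t)" by (auto intro!: derivative_eq_intros)
  have prod: "((\<lambda>t. t\<^sup>2 * f t) has_real_derivative 2 * t * x) (at t)"
    if "(f has_real_derivative (2 * x - 2 * f t) / t) (at t)" for f x
    using DERIV_mult[OF sq that] t by (simp add: field_simps power2_eq_square)
  show "(Gm \<mu> has_real_derivative 2 * t * g \<mu> t) (at t)"
    unfolding Gm_def[abs_def] by (rule prod[OF avg_derivs(1)[OF t]])
  show "(g \<mu> has_real_derivative 2 * t * ((n \<mu> t - 3) * g \<mu> t / (2 * (1 + t\<^sup>2)))) (at t)"
  proof -
    have "t / c * ((Y - 3) * G - m / 2 * (l * G)) = 2 * t * ((Y - m / 2 * l - 3) * G / (2 * c))" if "c \<noteq> 0" for c Y G m l :: real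
      using that by (simp add: field_simps)
    from this[OF c] show ?thesis using g_deriv[OF t] unfolding n_def by (simp only:)
  qed
  show "(k \<mu> has_real_derivative 2 * t * e \<mu> t) (at t)"
    unfolding k_def[abs_def] using DERIV_add[OF DERIV_const prod[OF avg_derivs(2)[OF t]]] by simp
  show "(E \<mu> has_real_derivative 2 * t * k \<mu> t) (at t)"
    unfolding E_def[abs_def]
  proof (rule prod)
    have "((\<lambda>t. \<mu> $ 1 / 2 + t\<^sup>2 * \<Phi> \<mu> t) has_real_derivative 0 + (2 * t * \<Phi> \<mu> t + (2 * F \<mu> t - 4 * \<Phi> \<mu> t) / t * t\<^sup>2)) (at t)"
      by (intro DERIV_add DERIV_const DERIV_mult sq avg_derivs t)
    moreover have "0 + (2 * t * \<Phi> \<mu> t + (2 * F \<mu> t - 4 * \<Phi> \<mu> t) / t * t\<^sup>2) = (2 * k \<mu> t - 2 * (\<mu> $ 1 / 2 + t\<^sup>2 * \<Phi> \<mu> t)) / t"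
      using t by (simp add: k_def field_simps power2_eq_square)
    ultimately show "((\<lambda>t. \<mu> $ 1 / 2 + t\<^sup>2 * \<Phi> \<mu> t) has_real_derivative (2 * k \<mu> t - 2 * (\<mu> $ 1 / 2 + t\<^sup>2 * \<Phi> \<mu> t)) / t) (at t)"
      by (simp only:)
  qed
  show "(e \<mu> has_real_derivative 2 * t * ((- 3 * e \<mu> t - Gm \<mu> t / t\<^sup>2 * g \<mu> t) / (2 * (1 + t\<^sup>2)))) (at t)"
  proof -
    have "- (t / c * (3 * e' + G' * g')) = 2 * t * ((- 3 * e' - G' * g') / (2 * c))" if "c \<noteq> 0" for c e' G' g' :: real
      using that by (simp add: field_simps)
    from this[OF c] show ?thesis using e_deriv[OF t] unfolding q by (simp only:)
  qed
  have ln': "((\<lambda>t. \<mu> $ 1 / 2 * ln t) has_real_derivative \<mu> $ 1 / 2 * (1 / t)) (at t)"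
    using DERIV_cmult[OF DERIV_ln_divide[OF t(1)]] .
  have "t / c * (1 / 2 * (Y * Y) - Y + m / 2 - p + m / 2 * (l * (1 - Y)) + m\<^sup>2 / 8 * l\<^sup>2) - m / 2 * (1 / t)
      = 2 * t * ((t\<^sup>2 * ((Y - m / 2 * l)\<^sup>2 / 2 - (Y - m / 2 * l)) - (m / 2 + t\<^sup>2 * p)) / (2 * t\<^sup>2 * c))" if c: "c \<noteq> 0" "c = 1 + t\<^sup>2"
    for c Y m p l :: real
  proof -
    have "2 * t * ((t\<^sup>2 * ((Y - m / 2 * l)\<^sup>2 / 2 - (Y - m / 2 * l)) - (m / 2 + t\<^sup>2 * p)) / (2 * t\<^sup>2 * c))
      = (t\<^sup>2 * ((Y - m / 2 * l)\<^sup>2 / 2 - (Y - m / 2 * l) - p + m / 2) - m / 2 * (1 + t\<^sup>2)) / (t * c)"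
      using t c(1) by (simp add: field_simps power2_eq_square)
    also have "\<dots> = t / c * ((Y - m / 2 * l)\<^sup>2 / 2 - (Y - m / 2 * l) - p + m / 2) - m / 2 * (1 / t)"
      unfolding c(2)[symmetric] using t c(1) by (simp add: field_simps power2_eq_square)
    also have "(Y - m / 2 * l)\<^sup>2 / 2 - (Y - m / 2 * l) - p + m / 2 = 1 / 2 * (Y * Y) - Y + m / 2 - p + m / 2 * (l * (1 - Y)) + m\<^sup>2 / 8 * l\<^sup>2"
      by (simp add: field_simps power2_eq_square)
    finally show ?thesis by (rule sym)
  qed
  note alg = this[OF c refl]
  show "(n \<mu> has_real_derivative 2 * t * ((t\<^sup>2 * ((n \<mu> t)\<^sup>2 / 2 - n \<mu> t) - E \<mu> t / t\<^sup>2) / (2 * t\<^sup>2 * (1 + t\<^sup>2)))) (at t)"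
    unfolding q n_def[abs_def] alg[symmetric] by (rule DERIV_diff[OF y_deriv[OF t] ln'])
next
  have t2: "((\<lambda>t::real. t\<^sup>2) \<longlongrightarrow> 0\<^sup>2) (at_right 0)" by (intro tendsto_intros)
  have z: "((\<lambda>t. t\<^sup>2 * f t) \<longlongrightarrow> 0) (at_right 0)" for f :: BC
    using tendsto_mult[OF t2 bcontfun_limit[of f]] by simp
  show "(Gm \<mu> \<longlongrightarrow> 0) (at_right 0)" unfolding Gm_def[abs_def] by (rule z)
  show "(g \<mu> \<longlongrightarrow> \<mu> $ 4) (at_right 0)" using bcontfun_limit[of "g \<mu>"] unfolding at_0 .
  have "((\<lambda>t. t\<^sup>2 * (\<mu> $ 1 / 2 + t\<^sup>2 * \<Phi> \<mu> t)) \<longlongrightarrow> 0\<^sup>2 * (\<mu> $ 1 / 2 + 0)) (at_right 0)"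
    by (intro tendsto_mult t2 tendsto_add tendsto_const z)
  then show "(E \<mu> \<longlongrightarrow> 0) (at_right 0)" unfolding E_def[abs_def] by simp
  show "(k \<mu> \<longlongrightarrow> \<mu> $ 1 / 2) (at_right 0)" unfolding k_def[abs_def] using tendsto_add[OF tendsto_const z] by simp
  show "(e \<mu> \<longlongrightarrow> \<mu> $ 3 - \<mu> $ 2 / 2) (at_right 0)" using bcontfun_limit[of "e \<mu>"] unfolding at_0 .
  show "((\<lambda>t. n \<mu> t + \<mu> $ 1 / 2 * ln t) \<longlongrightarrow> \<mu> $ 1 / 2 - \<mu> $ 3) (at_right 0)"
    unfolding n_def using bcontfun_limit[of "y \<mu>"] unfolding at_0 by simp
qed

end

section \<open>Regularity of the profiles under the Euler operator\<close>

lemmas tame_rules = tame_mult[OF open_V] tame_add[OF open_V] tame_diff[OF open_V] tame_scaleR[OF open_V]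

lemma tame_bid: "tame m V d (\<lambda>\<mu>. bid d)"
proof (induction m)
  case (Suc m)
  show ?case
  proof (rule tame_SucI[OF Cb_infinity_const Suc])
    show "(apply_bcontfun (bid d) has_real_derivative bid d t / t) (at t)" if "0 < t" "t < d" for t
      by (rule has_field_derivative_transform_within_open[of "\<lambda>t. t" _ _ "{0<..<d}"]) (use that in \<open>auto simp: apply_bid\<close>)
  qed
qed (simp add: Cb_infinity_const)

lemma tame_bln: "tame m V d (\<lambda>\<mu>. bln d)"
proof (induction m)
  case (Suc m)
  show ?case
  proof (rule tame_SucI[OF Cb_infinity_const tame_add[OF open_V Suc tame_bid]])
    show "(apply_bcontfun (bln d) has_real_derivative apply_bcontfun (bln d + bid d) t / t) (at t)" if t: "0 < t" "t < d" for t
    proof (rule has_field_derivative_transform_within_open[of "\<lambda>t. t * ln t" _ _ "{0<..<d}"])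
      show "((\<lambda>t. t * ln t) has_real_derivative apply_bcontfun (bln d + bid d) t / t) (at t)"
        using t by (auto intro!: derivative_eq_intros simp: apply_bln[OF d1] apply_bid field_simps)
    qed (use t in \<open>auto simp: apply_bln[OF d1]\<close>)
  qed
qed (simp add: Cb_infinity_const)

lemma tame_binv: "tame m V d (\<lambda>\<mu>. binv)"
proof (induction m)
  case (Suc m)
  have T: "tame m V d (\<lambda>\<mu>. (-2) *\<^sub>R ((bid d * bid d) * (binv * binv)))"
    by (rule tame_rules tame_bid Suc)+
  show ?case
  proof (rule tame_SucI[OF Cb_infinity_const T])
    fix t assume t: "0 < t" "t < d"
    have "((\<lambda>t. 1 / (1 + t\<^sup>2)) has_real_derivative - (2 * t) / ((1 + t\<^sup>2) * (1 + t\<^sup>2))) (at t)"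
      using one_plus_square_pos[of t] by (auto intro!: derivative_eq_intros)
    moreover have "apply_bcontfun ((-2) *\<^sub>R ((bid d * bid d) * (binv * binv))) t / t = - (2 * t) / ((1 + t\<^sup>2) * (1 + t\<^sup>2))"
      using t by (simp add: apply_bid[OF t] apply_binv)
    ultimately show "(apply_bcontfun binv has_real_derivative apply_bcontfun ((-2) *\<^sub>R ((bid d * bid d) * (binv * binv))) t / t) (at t)"
      unfolding apply_binv by (simp only: apply_binv)
  qed
qed (simp add: Cb_infinity_const)

abbreviation "C \<mu> \<equiv> cst (\<mu> $ 1)"

lemma tame_C: "tame m V d C"
  by (rule tame_const_fun[OF open_V Cb_infinity_coord[OF bounded_V]])

lemma Cb_avg: "Cb_infinity V G" "Cb_infinity V F" "Cb_infinity V \<Phi>"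
proof -
  show "Cb_infinity V G" unfolding G_def[abs_def] by (rule Cb_infinity_linear[OF open_V bounded_linear_avg Cb(1)])
  show F: "Cb_infinity V F" unfolding F_def[abs_def] by (rule Cb_infinity_linear[OF open_V bounded_linear_avg Cb(2)])
  show "Cb_infinity V \<Phi>" unfolding \<Phi>_def[abs_def] by (rule Cb_infinity_linear[OF open_V bounded_linear_avg F])
qed

text \<open>The six families are treated at once because the Euler derivative of each is a
  polynomial in the six, the coordinate \<mu>_1 and the fixed functions \<open>bid\<close>,
  \<open>bln\<close> and \<open>binv\<close>. The extra factor t of the Euler operator joins the t
  already in the equations, so each ln t occurs as t ln t and its square as (t ln t)^2.\<close>

lemma tame_all: "tame m V d g \<and> tame m V d e \<and> tame m V d y \<and> tame m V d G \<and> tame m V d F \<and> tame m V d \<Phi>"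
proof (induction m)
  case 0
  then show ?case using Cb Cb_avg by simp
next
  case (Suc m)
  then have t: "tame m V d g" "tame m V d e" "tame m V d y" "tame m V d G" "tame m V d F" "tame m V d \<Phi>" by blast+
  note R = t tame_C tame_bid tame_bln tame_binv tame_const[OF open_V] tame_rules
  have g: "tame m V d (\<lambda>\<mu>. binv * ((bid d * bid d) * ((y \<mu> - cst 3) * g \<mu>) - (1/2) *\<^sub>R (C \<mu> * ((bid d * bln d) * g \<mu>))))"
    by (rule R)+
  have e: "tame m V d (\<lambda>\<mu>. (-1) *\<^sub>R (binv * ((bid d * bid d) * (3 *\<^sub>R e \<mu> + G \<mu> * g \<mu>))))"
    by (rule R)+
  have y: "tame m V d (\<lambda>\<mu>. binv * ((bid d * bid d) * ((1/2) *\<^sub>R (y \<mu> * y \<mu>) - y \<mu> + (1/2) *\<^sub>R C \<mu> - \<Phi> \<mu>)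
      + (1/2) *\<^sub>R (C \<mu> * ((bid d * bln d) * (cst 1 - y \<mu>))) + (1/8) *\<^sub>R ((C \<mu> * C \<mu>) * (bln d * bln d))))"
    by (rule R)+
  have G: "tame m V d (\<lambda>\<mu>. 2 *\<^sub>R g \<mu> - 2 *\<^sub>R G \<mu>)" and F: "tame m V d (\<lambda>\<mu>. 2 *\<^sub>R e \<mu> - 2 *\<^sub>R F \<mu>)"
    and \<Phi>: "tame m V d (\<lambda>\<mu>. 2 *\<^sub>R F \<mu> - 4 *\<^sub>R \<Phi> \<mu>)"
    by (rule R)+
  have a: "apply_bcontfun binv t = 1 / (1 + t\<^sup>2)" "apply_bcontfun (bid d) t = t" "apply_bcontfun (bln d) t = t * ln t" if "0 < t" "t < d" for t
    using that by (simp_all add: apply_binv apply_bid apply_bln[OF d1])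
  have f: "1 / c * (t * t * x) / t = t / c * x" "1 / c * (t * t * x - 1 / 2 * (m * (t * (t * l) * z))) / t = t / c * (x - m / 2 * (l * z))"
    "(- 1) * (1 / c * (t * t * x)) / t = - (t / c * x)"
    "1 / c * (t * t * x + 1 / 2 * (m * (t * (t * l) * z)) + 1 / 8 * (m * m * (t * l * (t * l)))) / t = t / c * (x + m / 2 * (l * z) + m\<^sup>2 / 8 * l\<^sup>2)"
    if "t \<noteq> 0" "c \<noteq> 0" for t c x m l z :: real
    using that by (simp_all add: field_simps power2_eq_square)
  have c0: "1 + t\<^sup>2 \<noteq> 0" for t :: real using one_plus_square_pos[of t] by simp
  show ?case
  proof (intro conjI)
    show "tame (Suc m) V d g"
    proof (rule tame_SucI[OF Cb(1) g])
      fix \<mu> t assume \<mu>: "\<mu> \<in> V" and t: "0 < t" "t < d"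
      show "(g \<mu> has_real_derivative apply_bcontfun (binv * ((bid d * bid d) * ((y \<mu> - cst 3) * g \<mu>) - (1/2) *\<^sub>R (C \<mu> * ((bid d * bln d) * g \<mu>)))) t / t) (at t)"
        using g_deriv[OF \<mu> t] f(2)[of t, OF _ c0] t by (simp add: a)
    qed
    show "tame (Suc m) V d e"
    proof (rule tame_SucI[OF Cb(2) e])
      fix \<mu> t assume \<mu>: "\<mu> \<in> V" and t: "0 < t" "t < d"
      show "(e \<mu> has_real_derivative apply_bcontfun ((-1) *\<^sub>R (binv * ((bid d * bid d) * (3 *\<^sub>R e \<mu> + G \<mu> * g \<mu>)))) t / t) (at t)"
        using e_deriv[OF \<mu> t] f(3)[of t, OF _ c0] t by (simp add: a)
    qed
    show "tame (Suc m) V d y"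
    proof (rule tame_SucI[OF Cb(3) y])
      fix \<mu> t assume \<mu>: "\<mu> \<in> V" and t: "0 < t" "t < d"
      show "(y \<mu> has_real_derivative apply_bcontfun (binv * ((bid d * bid d) * ((1/2) *\<^sub>R (y \<mu> * y \<mu>) - y \<mu> + (1/2) *\<^sub>R C \<mu> - \<Phi> \<mu>)
      + (1/2) *\<^sub>R (C \<mu> * ((bid d * bln d) * (cst 1 - y \<mu>))) + (1/8) *\<^sub>R ((C \<mu> * C \<mu>) * (bln d * bln d)))) t / t) (at t)"
        using y_deriv[OF \<mu> t] f(4)[of t, OF _ c0] t by (simp add: a)
    qed
    show "tame (Suc m) V d G" by (rule tame_SucI[OF Cb_avg(1) G]) (use avg_derivs(1) in simp)
    show "tame (Suc m) V d F" by (rule tame_SucI[OF Cb_avg(2) F]) (use avg_derivs(2) in simp)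
    show "tame (Suc m) V d \<Phi>" by (rule tame_SucI[OF Cb_avg(3) \<Phi>]) (use avg_derivs(3) in simp)
  qed
qed

text \<open>
  The profiles without their logarithms: \<open>TN = \<rho> n\<close>, \<open>h = \<mu>\<^sub>1 ln \<rho> + SH\<close>, \<open>A = (\<mu>\<^sub>1/2) ln \<rho> + SA\<close> and
  \<open>q = \<mu>\<^sub>1 ln \<rho> + SQ\<close>.
\<close>
definition "TN \<mu> = bid d * y \<mu> - (1/2) *\<^sub>R (C \<mu> * bln d)"
definition "SH \<mu> = binv * ((1/2) *\<^sub>R C \<mu> + (bid d * bid d) * \<Phi> \<mu> + bid d * TN \<mu> - (1/2) *\<^sub>R (TN \<mu> * TN \<mu>)) - 2 *\<^sub>R y \<mu>"
definition "SA \<mu> = y \<mu> + SH \<mu>"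
definition "SQ \<mu> = (1/2) *\<^sub>R C \<mu> + (bid d * bid d) * F \<mu> - 2 *\<^sub>R e \<mu> - 2 *\<^sub>R ((bid d * bid d) * e \<mu>) + SH \<mu>
  - C \<mu> * (bid d * bln d) - (bid d * bid d) * SH \<mu> - bid d * TN \<mu> - (1/2) *\<^sub>R (TN \<mu> * TN \<mu>) - (1/2) *\<^sub>R ((bid d * bid d) * (G \<mu> * G \<mu>))"

lemma tame_profiles: "tame m V d SH" "tame m V d SA" "tame m V d SQ" "tame m V d G"
proof -
  have t: "tame m V d g" "tame m V d e" "tame m V d y" "tame m V d G" "tame m V d F" "tame m V d \<Phi>" using tame_all by blast+
  note R = t tame_C tame_bid tame_bln tame_binv tame_rules
  have TN: "tame m V d TN" unfolding TN_def[abs_def] by (rule R)+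
  have SH: "tame m V d SH" unfolding SH_def[abs_def] by (rule TN R)+
  show "tame m V d SH" by fact
  show "tame m V d SA" unfolding SA_def[abs_def] by (rule SH R)+
  show "tame m V d SQ" unfolding SQ_def[abs_def] by (rule SH TN R)+
  show "tame m V d G" by fact
qed

lemma profiles_eq:
  assumes t: "0 < t" "t < d"
  shows "vertical_profile (E \<mu>) (n \<mu>) t = \<mu> $ 1 * ln t + SH \<mu> t"
    "n \<mu> t + vertical_profile (E \<mu>) (n \<mu>) t = 1 / 2 * (\<mu> $ 1 * ln t) + SA \<mu> t"
    "pressure_profile (Gm \<mu>) (E \<mu>) (k \<mu>) (e \<mu>) (n \<mu>) t = \<mu> $ 1 * ln t + SQ \<mu> t"
    "Gm \<mu> t / t\<^sup>2 = G \<mu> t"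
proof -
  have a: "apply_bcontfun binv t = 1 / (1 + t\<^sup>2)" "apply_bcontfun (bid d) t = t" "apply_bcontfun (bln d) t = t * ln t"
    using t by (simp_all add: apply_binv apply_bid apply_bln[OF d1])
  have TN: "TN \<mu> t = t * n \<mu> t" unfolding TN_def n_def by (simp add: a algebra_simps)
  show q: "Gm \<mu> t / t\<^sup>2 = G \<mu> t" using t by (simp add: Gm_def)
  have qE: "E \<mu> t / t\<^sup>2 = \<mu> $ 1 / 2 + t\<^sup>2 * \<Phi> \<mu> t" using t by (simp add: E_def)
  have alg: "(x - (t\<^sup>2 + 2) * m - t\<^sup>2 * m\<^sup>2 / 2) / (1 + t\<^sup>2) = 1 / (1 + t\<^sup>2) * (x + t * (t * m) - 1 / 2 * (t * m * (t * m))) - 2 * m" for x m :: real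
    using one_plus_square_pos[of t] by (simp add: field_simps power2_eq_square)
  show H: "vertical_profile (E \<mu>) (n \<mu>) t = \<mu> $ 1 * ln t + SH \<mu> t"
    unfolding vertical_profile_def qE alg SH_def by (simp add: a TN, simp add: n_def power2_eq_square)
  show "n \<mu> t + vertical_profile (E \<mu>) (n \<mu>) t = 1 / 2 * (\<mu> $ 1 * ln t) + SA \<mu> t"
    unfolding H SA_def n_def by simp
  show "pressure_profile (Gm \<mu>) (E \<mu>) (k \<mu>) (e \<mu>) (n \<mu>) t = \<mu> $ 1 * ln t + SQ \<mu> t"
    unfolding pressure_profile_def q H SQ_def by (simp add: a TN k_def power2_eq_square algebra_simps)
qed


section \<open>Symbol estimates for velocity and pressure\<close>

definition "U \<mu> = recon_u (Gm \<mu>) (E \<mu>) (n \<mu>)"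
definition "P \<mu> = recon_p (Gm \<mu>) (E \<mu>) (k \<mu>) (e \<mu>) (n \<mu>)"

definition "w3 z = 1 / snd z $ 3" for z :: "(real^4) \<times> (real^3)"
definition "ev c Y z = c * (fst z $ 1 * ln (rho (snd z))) + Y (fst z) (rho (snd z))" for Y :: "real^4 \<Rightarrow> BC" and z :: "(real^4) \<times> (real^3)"
definition "Ge z = G (fst z) (rho (snd z))"

lemma Wxl_nonneg: "z \<in> S \<Longrightarrow> 0 \<le> Wxl j (snd z)"
  using S_D(4)[of z] by (auto simp: Wxl_def)

lemma symb_ev_Wl:
  assumes "tame (Suc m) V d Y" shows "symb m S Wl (\<lambda>z. Y (fst z) (rho (snd z)))"
proof (rule symb_mono[where S=S and W="Wn 0"])
  show "symb m S (Wn 0) (\<lambda>z. Y (fst z) (rho (snd z)))" by (rule symb_ev[OF assms])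
  show "\<exists>C. \<forall>z\<in>S. Wn 0 j (snd z) \<le> C * Wl j (snd z)" for j
    by (intro exI[of _ 1]) (simp add: Wn_def Wl_def)
qed (fact S_D(3) W_nonneg(1))+

lemma symb_log: "symb m S Wl (\<lambda>z. c * (fst z $ 1 * ln (rho (snd z))))"
  by (rule symb_cmult, rule symb_product[OF symb_param symb_ln_rho W_nonneg(4) W_nonneg(3)])
    (auto simp: Wc_def Wl_def)

lemma symb_ev_log: "tame (Suc m) V d Y \<Longrightarrow> symb m S Wl (ev c Y)"
  unfolding ev_def[abs_def] by (rule symb_add[OF open_S symb_log symb_ev_Wl])

lemma symb_w3:
  fixes f :: "(real^4) \<times> (real^3) \<Rightarrow> real"
  assumes "symb m S W f" "\<And>j z. z \<in> S \<Longrightarrow> 0 \<le> W j (snd z)"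
  shows "symb m S (\<lambda>j x. W j x / x $ 3) (\<lambda>z. f z * w3 z)"
  unfolding w3_def
proof (rule symb_product[OF assms(1) symb_inverse_x3 assms(2) W_nonneg(5)])
  fix i j :: nat and z assume z: "z \<in> S"
  have "0 \<le> W (i + j) (snd z) / snd z $ 3" using assms(2)[OF z, of "i + j"] S_D(3)[OF z] by simp
  then show "W i (snd z) * Wc (\<lambda>x. 1 / x $ 3) j (snd z) \<le> W (i + j) (snd z) / snd z $ 3" by (simp add: Wc_def)
qed

lemma symb_coord_Wl:
  fixes f :: "(real^4) \<times> (real^3) \<Rightarrow> real"
  assumes f: "symb m S Wl f" and i: "i \<in> {1,2}"
  shows "symb m S (\<lambda>j x. Wxl j x / x $ 3 / x $ 3) (\<lambda>z. snd z $ i * f z * w3 z * w3 z)"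
proof -
  have 1: "symb m S Wxl (\<lambda>z. snd z $ i * f z)"
  proof (rule symb_product[OF symb_coord[OF i] f W_nonneg(2) W_nonneg(3)])
    fix i j :: nat and z assume "z \<in> S"
    then have r: "0 < norm (horiz (snd z))" by (rule S_D)
    \<comment> \<open>Here \<open>i\<close> counts the derivatives on the coordinate. For
      \<open>i\<close> at least 2 the product is zero, and a logarithm is left only when
      \<open>j\<close> = 0 and \<open>i\<close> is 0 or 1.\<close>
    consider "i = 0" "j = 0" | "i = 0" "j = 1" | "i = 0" "j \<ge> 2" | "i = 1" "j = 0" | "i = 1" "j \<ge> 1" | "i \<ge> 2" by linarith
    then show "Wx i (snd z) * Wl j (snd z) \<le> Wxl (i + j) (snd z)"
    proof cases
      case 3
      then obtain j' where "j = Suc (Suc j')" by (metis add_2_eq_Suc le_Suc_ex)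
      then show ?thesis using r 3 by (simp add: Wx_def Wl_def Wxl_def)
    next
      case 5
      then obtain j' where "j = Suc j'" by (metis not_one_le_zero not0_implies_Suc)
      then show ?thesis using 5 by (simp add: Wx_def Wl_def Wxl_def)
    next
      case 6
      then show ?thesis using r by (simp add: Wx_def Wxl_def)
    qed (use r in \<open>auto simp: Wx_def Wl_def Wxl_def\<close>)
  qed
  have 2: "symb m S (\<lambda>j x. Wxl j x / x $ 3) (\<lambda>z. snd z $ i * f z * w3 z)"
    by (rule symb_w3[OF 1 Wxl_nonneg])
  have n: "0 \<le> Wxl j (snd z) / snd z $ 3" if "z \<in> S" for j z using Wxl_nonneg[OF that, of j] S_D(3)[OF that] by simp
  show ?thesis by (rule symb_w3[OF 2 n])
qed

lemma U_coords:
  assumes z: "z \<in> S"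
  shows "U (fst z) (snd z) $ 1 = snd z $ 1 * ev (1/2) SA z * w3 z * w3 z - snd z $ 2 * Ge z * w3 z * w3 z"
    "U (fst z) (snd z) $ 2 = snd z $ 2 * ev (1/2) SA z * w3 z * w3 z + snd z $ 1 * Ge z * w3 z * w3 z"
    "U (fst z) (snd z) $ 3 = ev 1 SH z * w3 z"
    "P (fst z) (snd z) = ev 1 SQ z * w3 z * w3 z"
proof -
  have s: "sqrt (sq (snd z)) = rho (snd z)" using S_D(6)[OF z] by (simp add: sq_eq_rho)
  note pr = profiles_eq[OF S_D(6,7)[OF z], of "fst z"]
  have g: "Gm (fst z) (rho (snd z)) / sq (snd z) = Ge z" using pr(4) by (simp add: sq_eq_rho Ge_def)
  show "U (fst z) (snd z) $ 1 = snd z $ 1 * ev (1/2) SA z * w3 z * w3 z - snd z $ 2 * Ge z * w3 z * w3 z"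
    "U (fst z) (snd z) $ 2 = snd z $ 2 * ev (1/2) SA z * w3 z * w3 z + snd z $ 1 * Ge z * w3 z * w3 z"
    "U (fst z) (snd z) $ 3 = ev 1 SH z * w3 z"
    "P (fst z) (snd z) = ev 1 SQ z * w3 z * w3 z"
    unfolding U_def P_def recon_u_def recon_p_def profile_u_def vector_3 scal_def s g ev_def w3_def pr(2)
    unfolding pr(1,3) by (simp_all add: power2_eq_square)
qed

lemma vector2_eq: "(vector [a, b] :: real^2) = a *\<^sub>R axis 1 1 + b *\<^sub>R axis 2 1"
  by (simp add: vec_eq_iff forall_2 axis_def)

lemma symb_Ge: "symb m S Wl Ge"
  unfolding Ge_def[abs_def] by (rule symb_ev_Wl[OF tame_profiles(4)])

lemma symb_U12:
  "symb m S (\<lambda>j x. Wxl j x / x $ 3 / x $ 3) (\<lambda>z. U (fst z) (snd z) $ 1)"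
  "symb m S (\<lambda>j x. Wxl j x / x $ 3 / x $ 3) (\<lambda>z. U (fst z) (snd z) $ 2)"
proof -
  note A = symb_coord_Wl[OF symb_ev_log[OF tame_profiles(2)]] and B = symb_coord_Wl[OF symb_Ge]
  have i: "1 \<in> {1, 2::3}" "2 \<in> {1, 2::3}" by simp_all
  show "symb m S (\<lambda>j x. Wxl j x / x $ 3 / x $ 3) (\<lambda>z. U (fst z) (snd z) $ 1)"
    by (rule symb_cong[OF open_S _ symb_add[OF open_S A[OF i(1), of m "1/2"] symb_uminus[OF B[OF i(2)]]]]) (simp add: U_coords)
  show "symb m S (\<lambda>j x. Wxl j x / x $ 3 / x $ 3) (\<lambda>z. U (fst z) (snd z) $ 2)"
    by (rule symb_cong[OF open_S _ symb_add[OF open_S A[OF i(2), of m "1/2"] B[OF i(1)]]]) (simp add: U_coords)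
qed

lemma symb_horiz: "symb m S (\<lambda>j x. Wxl j x / x $ 3 / x $ 3) (\<lambda>(\<mu>, x). horiz (U \<mu> x))"
proof -
  have "symb m S (\<lambda>j x. Wxl j x / x $ 3 / x $ 3)
    (\<lambda>z. U (fst z) (snd z) $ 1 *\<^sub>R (axis 1 1 :: real^2) + U (fst z) (snd z) $ 2 *\<^sub>R axis 2 1)"
    by (intro symb_add[OF open_S] symb_linear[OF open_S bounded_linear_scaleR_left] symb_U12)
  then show ?thesis unfolding horiz_def vector2_eq case_prod_unfold .
qed

lemma symb_U3: "symb m S (\<lambda>j x. Wl j x / x $ 3) (\<lambda>(\<mu>, x). U \<mu> x $ 3)"
proof -
  have "symb m S (\<lambda>j x. Wl j x / x $ 3) (\<lambda>z. U (fst z) (snd z) $ 3)"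
    by (rule symb_cong[OF open_S _ symb_w3[OF symb_ev_log[OF tame_profiles(1), of m 1] W_nonneg(3)]]) (simp_all add: U_coords)
  then show ?thesis unfolding case_prod_unfold .
qed

lemma symb_P: "symb m S (\<lambda>j x. Wl j x / x $ 3 / x $ 3) (\<lambda>(\<mu>, x). P \<mu> x)"
proof -
  have n: "0 \<le> Wl j (snd z) / snd z $ 3" if "z \<in> S" for j z using W_nonneg(3)[OF that, of j] S_D(3)[OF that] by simp
  have "symb m S (\<lambda>j x. Wl j x / x $ 3 / x $ 3) (\<lambda>z. P (fst z) (snd z))"
    by (rule symb_cong[OF open_S _ symb_w3[OF symb_w3[OF symb_ev_log[OF tame_profiles(3), of m 1] W_nonneg(3)] n]]) (simp_all add: U_coords)
  then show ?thesis unfolding case_prod_unfold .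
qed

lemma smooth_UP: "C_infinity_on S (\<lambda>(\<mu>, x). U \<mu> x)" "C_infinity_on S (\<lambda>(\<mu>, x). P \<mu> x)"
proof -
  have c: "C_infinity_on S (\<lambda>z. U (fst z) (snd z) $ i)" for i
  proof -
    have "C_infinity_on S (\<lambda>z. U (fst z) (snd z) $ 1)" "C_infinity_on S (\<lambda>z. U (fst z) (snd z) $ 2)"
      by (rule C_infinity_on_symb, rule symb_U12)+
    moreover have "C_infinity_on S (\<lambda>z. U (fst z) (snd z) $ 3)"
      using C_infinity_on_symb[OF symb_U3] unfolding case_prod_unfold .
    ultimately show ?thesis using exhaust_3[of i] by auto
  qed
  have "C_infinity_on S (\<lambda>z. U (fst z) (snd z) $ 1 *\<^sub>R axis 1 1 + U (fst z) (snd z) $ 2 *\<^sub>R axis 2 1 + U (fst z) (snd z) $ 3 *\<^sub>R (axis 3 1 :: real^3))"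
    by (intro C_infinity_on_add[OF open_S] C_infinity_on_linear[OF open_S bounded_linear_scaleR_left] c)
  moreover have "U (fst z) (snd z) $ 1 *\<^sub>R axis 1 1 + U (fst z) (snd z) $ 2 *\<^sub>R axis 2 1 + U (fst z) (snd z) $ 3 *\<^sub>R (axis 3 1 :: real^3) = U (fst z) (snd z)" for z
    by (simp add: vec_eq_iff forall_3 axis_def)
  ultimately show "C_infinity_on S (\<lambda>(\<mu>, x). U \<mu> x)" unfolding case_prod_unfold by simp
  show "C_infinity_on S (\<lambda>(\<mu>, x). P \<mu> x)" by (rule C_infinity_on_symb[OF symb_P])
qed

end

section \<open>Fixed parameter values and uniqueness\<close>

lemma C_infinity_on_slice:
  fixes f :: "'a::euclidean_space \<times> 'b::euclidean_space \<Rightarrow> 'c::real_normed_vector"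
  assumes T: "open T" and \<mu>: "\<mu> \<in> V" and f: "C_infinity_on (V \<times> T) f"
  shows "C_infinity_on T (\<lambda>x. f (\<mu>, x))"
proof -
  have hd: "((\<lambda>x. F (\<mu>, x)) has_derivative (\<lambda>h. F' (0, h))) (at x)" if "(F has_derivative F') (at (\<mu>, x))" for F F' and x :: 'b
    by (rule has_derivative_compose[OF has_derivative_Pair[OF has_derivative_const has_derivative_ident] that])
  have dd: "dir_deriv b (\<lambda>x. F (\<mu>, x)) x = dir_deriv (0, b) F (\<mu>, x)" "(\<lambda>x. F (\<mu>, x)) differentiable (at x)"
    if F: "F differentiable (at (\<mu>, x))" for F :: "'a \<times> 'b \<Rightarrow> 'c" and b x
  proof -
    obtain F' where F': "(F has_derivative F') (at (\<mu>, x))" using F by (auto simp: differentiable_def)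
    show "dir_deriv b (\<lambda>x. F (\<mu>, x)) x = dir_deriv (0, b) F (\<mu>, x)"
      unfolding dir_deriv_eq[OF hd[OF F']] dir_deriv_eq[OF F'] ..
    show "(\<lambda>x. F (\<mu>, x)) differentiable (at x)" by (rule differentiableI[OF hd[OF F']])
  qed
  have F: "partials (map (Pair 0) vs) f differentiable (at (\<mu>, x))" if "set vs \<subseteq> Basis" "x \<in> T" for vs x
  proof -
    have "set (map (Pair 0) vs) \<subseteq> (Basis :: ('a \<times> 'b) set)" using that by (auto simp: Basis_prod_def)
    then show ?thesis using f \<mu> that(2) unfolding C_infinity_on_def by blast
  qed
  have P: "partials vs (\<lambda>x. f (\<mu>, x)) x = partials (map (Pair 0) vs) f (\<mu>, x)" if "set vs \<subseteq> Basis" "x \<in> T" for vs x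
    using that
  proof (induction vs arbitrary: x)
    case (Cons b vs)
    then have vs: "set vs \<subseteq> Basis" by simp
    have "partials (b # vs) (\<lambda>x. f (\<mu>, x)) x = dir_deriv b (\<lambda>x. partials (map (Pair 0) vs) f (\<mu>, x)) x"
      unfolding partials.simps by (rule dir_deriv_cong[OF T Cons.prems(2) Cons.IH[OF vs]])
    also have "\<dots> = partials (map (Pair 0) (b # vs)) f (\<mu>, x)"
      using dd(1)[OF F[OF vs Cons.prems(2)]] by simp
    finally show ?case .
  qed simp
  show ?thesis unfolding C_infinity_on_def
  proof (intro allI impI ballI)
    fix vs :: "'b list" and x assume vs: "set vs \<subseteq> Basis" and x: "x \<in> T"
    show "partials vs (\<lambda>x. f (\<mu>, x)) differentiable (at x)"
      by (rule differentiable_cong_open[OF T x _ dd(2)[OF F[OF vs x]]]) (rule P[OF vs, symmetric])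
  qed
qed

lemma recon_cong:
  assumes x: "x \<in> punctured_cone d"
    and eq: "\<And>t. 0 < t \<Longrightarrow> t < d \<Longrightarrow> Gm t = Gm' t \<and> E t = E' t \<and> k t = k' t \<and> e t = e' t \<and> n t = n' t"
  shows "recon_u Gm E n x = recon_u Gm' E' n' x" "recon_p Gm E k e n x = recon_p Gm' E' k' e' n' x"
proof -
  have s: "sqrt (sq x) = rho x" using rho_pos(1)[OF x] by (simp add: sq_eq_rho)
  note eq' = eq[OF rho_pos(1,2)[OF x]]
  show "recon_u Gm E n x = recon_u Gm' E' n' x" "recon_p Gm E k e n x = recon_p Gm' E' k' e' n' x"
    unfolding recon_u_def recon_p_def profile_u_def scal_def s vertical_profile_def pressure_profile_def using eq' by simp_all
qed

context integral_system
begin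

lemma solution:
  assumes \<mu>: "\<mu> \<in> V" shows "is_solution d \<mu> (U \<mu>) (P \<mu>)"
proof -
  interpret ode d \<mu> "Gm \<mu>" "g \<mu>" "E \<mu>" "k \<mu>" "e \<mu>" "n \<mu>" by (rule ode[OF \<mu>])
  show ?thesis unfolding U_def P_def
  proof (rule recon_solution[OF d_pos])
    show "C_infinity_on (punctured_cone d) (recon_u (Gm \<mu>) (E \<mu>) (n \<mu>))"
      using C_infinity_on_slice[OF open_punctured_cone \<mu> smooth_UP(1)] by (simp add: U_def[symmetric])
    show "C_infinity_on (punctured_cone d) (recon_p (Gm \<mu>) (E \<mu>) (k \<mu>) (e \<mu>) (n \<mu>))"
      using C_infinity_on_slice[OF open_punctured_cone \<mu> smooth_UP(2)] by (simp add: P_def[symmetric])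
  qed
qed

text \<open>A competitor on the same cone yields a solution of the singular system on the same
  interval with the same limits at the axis. Since velocity and pressure are algebraic in those
  unknowns, uniqueness for the system carries over.\<close>

lemma solution_unique:
  assumes \<mu>: "\<mu> \<in> V" and sol: "is_solution d \<mu> u p" and x: "x \<in> punctured_cone d"
  shows "u x = U \<mu> x \<and> p x = P \<mu> x"
proof -
  obtain Gm' g' E' k' e' n' where o: "ode d \<mu> Gm' g' E' k' e' n'"
    "\<forall>x\<in>punctured_cone d. u x = recon_u Gm' E' n' x \<and> p x = recon_p Gm' E' k' e' n' x"
    using solution_ode[OF d_pos sol] by blast
  have pair: "ode_pair d \<mu> Gm' g' E' k' e' n' (Gm \<mu>) (g \<mu>) (E \<mu>) (k \<mu>) (e \<mu>) (n \<mu>)"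
    unfolding ode_pair_def using o(1) ode[OF \<mu>] by blast
  have eq: "Gm' t = Gm \<mu> t \<and> E' t = E \<mu> t \<and> k' t = k \<mu> t \<and> e' t = e \<mu> t \<and> n' t = n \<mu> t" if t: "0 < t" "t < d" for t
    using ode_pair.unique[OF pair t] by (intro conjI)
  note c = recon_cong[where Gm=Gm' and E=E' and k=k' and e=e' and n=n' and Gm'="Gm \<mu>" and E'="E \<mu>" and k'="k \<mu>" and e'="e \<mu>" and n'="n \<mu>", OF x eq]
  have "recon_u Gm' E' n' x = U \<mu> x" "recon_p Gm' E' k' e' n' x = P \<mu> x"
    unfolding U_def P_def by (rule c; assumption)+
  then show ?thesis using o(2) x by simp
qed

end


section \<open>Assembling the estimates\<close>

text \<open>Each basis direction belongs to exactly one of the counted groups, so a bound on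
  |\<beta>| + k + l is a bound on the length, and only finitely many lists of directions are
  concerned.\<close>

lemma length_eq_counts:
  fixes vs :: "((real^4) \<times> (real^3)) list"
  assumes "set vs \<subseteq> Basis"
  shows "length vs = (\<Sum>i\<in>UNIV. count_list vs (axis i 1, 0)) + hcount vs + count_list vs (0, axis 3 1)"
  using assms
proof (induction vs)
  case (Cons b vs)
  have b: "b \<in> Basis" and IH: "length vs = (\<Sum>i\<in>UNIV. count_list vs (axis i 1, 0)) + hcount vs + count_list vs (0, axis 3 1)"
    using Cons by auto
  have d: "(axis i 1 :: real^4, 0 :: real^3) \<noteq> (0, c)" "(0, c) \<noteq> (axis i 1 :: real^4, 0 :: real^3)" for i c
    by (auto simp: axis_eq_0_iff)
  consider i where "b = (axis i 1, 0)" | "b = (0, axis 1 1)" | "b = (0, axis 2 1)" | "b = (0, axis 3 1)"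
    using b unfolding Basis_param_space by blast
  then show ?case
  proof cases
    case (1 i)
    have "(\<Sum>j\<in>UNIV. count_list (b # vs) (axis j 1, 0)) = (\<Sum>j\<in>UNIV. (if j = i then 1 else 0) + count_list vs (axis j 1, 0))"
      unfolding 1 by (rule sum.cong) (auto simp: axis_eq_axis)
    then have "(\<Sum>j\<in>UNIV. count_list (b # vs) (axis j 1, 0)) = 1 + (\<Sum>j\<in>UNIV. count_list vs (axis j 1, 0))"
      by (simp add: sum.distrib)
    moreover have "count_list (b # vs) (0, c) = count_list vs (0, c)" for c unfolding 1 using d(1)[of i c] by simp
    ultimately show ?thesis using IH by simp
  qed (use IH d axis_distinct in \<open>auto simp: axis_eq_axis\<close>)
qed simp

text \<open>Allowing every larger constant lets the three estimates for u', u^3 and p later share a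
  single one.\<close>

lemma uniform_bound:
  fixes f g :: "'v \<Rightarrow> 'z \<Rightarrow> real"
  assumes "finite A" "\<And>v. v \<in> A \<Longrightarrow> \<exists>C. \<forall>z\<in>S. f v z \<le> C * g v z" "\<And>v z. v \<in> A \<Longrightarrow> z \<in> S \<Longrightarrow> 0 \<le> g v z"
  shows "\<exists>C>0. \<forall>C'\<ge>C. \<forall>v\<in>A. \<forall>z\<in>S. f v z \<le> C' * g v z"
proof -
  obtain C where C: "\<And>v z. v \<in> A \<Longrightarrow> z \<in> S \<Longrightarrow> f v z \<le> C v * g v z" using assms(2) by metis
  define M where "M = 1 + (\<Sum>v\<in>A. \<bar>C v\<bar>)"
  have "f v z \<le> C' * g v z" if "M \<le> C'" "v \<in> A" "z \<in> S" for C' v z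
  proof -
    have "\<bar>C v\<bar> \<le> (\<Sum>v\<in>A. \<bar>C v\<bar>)" using assms(1) that(2) by (intro member_le_sum) auto
    then have "C v \<le> C'" using that(1) by (simp add: M_def)
    then show ?thesis using C[OF that(2,3)] mult_right_mono[OF _ assms(3)[OF that(2,3)]] by (meson order_trans)
  qed
  moreover have "0 < M" unfolding M_def by (simp add: add_pos_nonneg sum_nonneg)
  ultimately show ?thesis by (intro exI[of _ M]) blast
qed

lemma weights_powi:
  fixes r z :: real
  assumes "0 < r" "0 < z" "\<rho> = r / z"
  shows "1 / r ^ k / z / z ^ l = z powi (- int k - int l - 1) * \<rho> powi (- int k)"
    "1 / r ^ k / z / z / z ^ l = z powi (- int k - int l - 2) * \<rho> powi (- int k)"
    "0 < k \<Longrightarrow> 1 / r ^ (k - 1) / z / z / z ^ l = z powi (- int k - int l - 1) * \<rho> powi (- int k + 1)"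
proof -
  have p: "x powi (- int k) = 1 / x ^ k" for x :: real and k by (simp add: power_int_minus divide_inverse)
  have a: "- int k - int l - 1 = - int (k + l + 1)" "- int k - int l - 2 = - int (k + l + 2)" by simp_all
  show "1 / r ^ k / z / z ^ l = z powi (- int k - int l - 1) * \<rho> powi (- int k)"
    "1 / r ^ k / z / z / z ^ l = z powi (- int k - int l - 2) * \<rho> powi (- int k)"
    unfolding a p assms(3) using assms(1,2) by (simp_all add: field_simps power_add power_divide)
  assume "0 < k"
  then obtain j where j: "k = Suc j" by (cases k) auto
  have b: "- int k + 1 = - int j" unfolding j by simp
  show "1 / r ^ (k - 1) / z / z / z ^ l = z powi (- int k - int l - 1) * \<rho> powi (- int k + 1)"
    unfolding a b p assms(3) using assms(1,2) by (simp add: field_simps power_add power_divide j)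
qed

context integral_system
begin

lemma weight_forms:
  assumes z: "z \<in> S"
  shows "Wxl j (snd z) / snd z $ 3 / snd z $ 3 / (snd z $ 3) ^ l =
      (if j \<le> 1 then snd z $ 3 powi (- int j - int l - 1) * rho (snd z) powi (- int j + 1) * (\<bar>ln (rho (snd z))\<bar> + 1)
       else snd z $ 3 powi (- int j - int l - 1) * rho (snd z) powi (- int j + 1))" (is ?A)
    "Wl j (snd z) / snd z $ 3 / (snd z $ 3) ^ l =
      (if j = 0 then snd z $ 3 powi (- int j - int l - 1) * (\<bar>ln (rho (snd z))\<bar> + 1)
       else snd z $ 3 powi (- int j - int l - 1) * rho (snd z) powi (- int j))" (is ?B)
    "Wl j (snd z) / snd z $ 3 / snd z $ 3 / (snd z $ 3) ^ l =
      (if j = 0 then snd z $ 3 powi (- int j - int l - 2) * (\<bar>ln (rho (snd z))\<bar> + 1)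
       else snd z $ 3 powi (- int j - int l - 2) * rho (snd z) powi (- int j))" (is ?C)
proof -
  define r t \<rho> L where "r = norm (horiz (snd z))" "t = snd z $ 3" "\<rho> = rho (snd z)" "L = \<bar>ln (rho (snd z))\<bar> + 1"
  have rt: "0 < r" "0 < t" "\<rho> = r / t" using S_D[OF z] by (simp_all add: r_t_\<rho>_L_def rho_def)
  note p = weights_powi[OF rt]
  have p0: "1 / t / t ^ l = t powi (- int 0 - int l - 1)" "1 / t / t / t ^ l = t powi (- int 0 - int l - 2)"
    using p(1,2)[of 0 l] by simp_all
  have q0: "r / t / t / t ^ l = t powi (- int 0 - int l - 1) * \<rho> powi (- int 0 + 1)"
  proof -
    have "r / t / t / t ^ l = (1 / t / t ^ l) * (r / t)" by simp
    then show ?thesis unfolding p0(1) rt(3) by simp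
  qed
  show ?A
  proof -
    consider "j = 0" | "j = 1" | "1 < j" by linarith
    then show ?thesis
    proof cases
      case 1
      have "r * L / t / t / t ^ l = (r / t / t / t ^ l) * L" by simp
      then show ?thesis unfolding q0 using 1 by (simp add: Wxl_def r_t_\<rho>_L_def)
    next
      case 2
      have "L / t / t / t ^ l = (1 / r ^ (1 - 1) / t / t / t ^ l) * L" by simp
      then show ?thesis unfolding p(3)[of 1 l, OF zero_less_one] using 2 by (simp add: Wxl_def r_t_\<rho>_L_def)
    next
      case 3
      then show ?thesis using p(3)[of j l] by (simp add: Wxl_def r_t_\<rho>_L_def)
    qed
  qed
  show ?B
  proof (cases "j = 0")
    case True
    have "L / t / t ^ l = (1 / t / t ^ l) * L" by simp
    then show ?thesis unfolding p0 using True by (simp add: Wl_def r_t_\<rho>_L_def)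
  next
    case False
    then show ?thesis using p(1)[of j l] by (simp add: Wl_def r_t_\<rho>_L_def)
  qed
  show ?C
  proof (cases "j = 0")
    case True
    have "L / t / t / t ^ l = (1 / t / t / t ^ l) * L" by simp
    then show ?thesis unfolding p0 using True by (simp add: Wl_def r_t_\<rho>_L_def)
  next
    case False
    then show ?thesis using p(2)[of j l] by (simp add: Wl_def r_t_\<rho>_L_def)
  qed
qed

lemma uniform_partials:
  fixes f :: "(real^4) \<times> (real^3) \<Rightarrow> 'b::real_normed_vector"
  assumes "symb m S W f" "\<And>j z. z \<in> S \<Longrightarrow> 0 \<le> W j (snd z)"
  shows "\<exists>C>0. \<forall>C'\<ge>C. \<forall>vs\<in>{vs. set vs \<subseteq> Basis \<and> length vs \<le> m}. \<forall>z\<in>S.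
    norm (partials vs f z) \<le> C' * (W (hcount vs) (snd z) / (snd z $ 3) ^ count_list vs (0, axis 3 1))"
proof (rule uniform_bound)
  show "finite {vs. set vs \<subseteq> (Basis :: ((real^4) \<times> (real^3)) set) \<and> length vs \<le> m}"
    by (rule finite_lists_length_le) simp
  show "\<exists>C. \<forall>z\<in>S. norm (partials vs f z) \<le> C * (W (hcount vs) (snd z) / (snd z $ 3) ^ count_list vs (0, axis 3 1))"
    if "vs \<in> {vs. set vs \<subseteq> Basis \<and> length vs \<le> m}" for vs
    using symb_partials[OF assms(1)] that by blast
  show "0 \<le> W (hcount vs) (snd z) / (snd z $ 3) ^ count_list vs (0, axis 3 1)" if "z \<in> S" for vs z
    using assms(2)[OF that, of "hcount vs"] S_D(3)[OF that] by simp
qed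

lemma estimates:
  "\<exists>C>0. \<forall>\<mu>\<in>V. \<forall>(\<beta> :: nat^4) (k::nat) (l::nat). (\<Sum>i\<in>UNIV. \<beta> $ i) + k + l \<le> L \<longrightarrow>
      (\<forall>vs. mixed_directions k l \<beta> vs \<longrightarrow> (\<forall>x\<in>punctured_cone d.
        norm (partials vs (\<lambda>(\<mu>, x). horiz (U \<mu> x)) (\<mu>, x)) \<le>
          (if k \<le> 1
           then C * x $ 3 powi (- int k - int l - 1) * rho x powi (- int k + 1) * (\<bar>ln (rho x)\<bar> + 1)
           else C * x $ 3 powi (- int k - int l - 1) * rho x powi (- int k + 1)) \<and>
        \<bar>partials vs (\<lambda>(\<mu>, x). U \<mu> x $ 3) (\<mu>, x)\<bar> \<le>
          (if k = 0
           then C * x $ 3 powi (- int k - int l - 1) * (\<bar>ln (rho x)\<bar> + 1)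
           else C * x $ 3 powi (- int k - int l - 1) * rho x powi (- int k)) \<and>
        \<bar>partials vs (\<lambda>(\<mu>, x). P \<mu> x) (\<mu>, x)\<bar> \<le>
          (if k = 0
           then C * x $ 3 powi (- int k - int l - 2) * (\<bar>ln (rho x)\<bar> + 1)
           else C * x $ 3 powi (- int k - int l - 2) * rho x powi (- int k))))"
proof -
  have n: "0 \<le> Wxl j (snd z) / snd z $ 3 / snd z $ 3" "0 \<le> Wl j (snd z) / snd z $ 3" "0 \<le> Wl j (snd z) / snd z $ 3 / snd z $ 3"
    if "z \<in> S" for j z
    using Wxl_nonneg[OF that, of j] W_nonneg(3)[OF that, of j] S_D(3)[OF that] by simp_all
  let ?A = "{vs. set vs \<subseteq> (Basis :: ((real^4) \<times> (real^3)) set) \<and> length vs \<le> L}"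
  obtain C1 where C1: "C1 > 0" "\<And>C' vs z. C1 \<le> C' \<Longrightarrow> vs \<in> ?A \<Longrightarrow> z \<in> S \<Longrightarrow>
    norm (partials vs (\<lambda>(\<mu>, x). horiz (U \<mu> x)) z) \<le> C' * (Wxl (hcount vs) (snd z) / snd z $ 3 / snd z $ 3 / (snd z $ 3) ^ count_list vs (0, axis 3 1))"
    using uniform_partials[OF symb_horiz[of L] n(1)] by blast
  obtain C2 where C2: "C2 > 0" "\<And>C' vs z. C2 \<le> C' \<Longrightarrow> vs \<in> ?A \<Longrightarrow> z \<in> S \<Longrightarrow>
    norm (partials vs (\<lambda>(\<mu>, x). U \<mu> x $ 3) z) \<le> C' * (Wl (hcount vs) (snd z) / snd z $ 3 / (snd z $ 3) ^ count_list vs (0, axis 3 1))"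
    using uniform_partials[OF symb_U3[of L] n(2)] by blast
  obtain C3 where C3: "C3 > 0" "\<And>C' vs z. C3 \<le> C' \<Longrightarrow> vs \<in> ?A \<Longrightarrow> z \<in> S \<Longrightarrow>
    norm (partials vs (\<lambda>(\<mu>, x). P \<mu> x) z) \<le> C' * (Wl (hcount vs) (snd z) / snd z $ 3 / snd z $ 3 / (snd z $ 3) ^ count_list vs (0, axis 3 1))"
    using uniform_partials[OF symb_P[of L] n(3)] by blast
  define C where "C = C1 + C2 + C3"
  have C: "0 < C" "C1 \<le> C" "C2 \<le> C" "C3 \<le> C" using C1(1) C2(1) C3(1) by (simp_all add: C_def)
  show ?thesis
  proof (rule exI[of _ C], rule conjI[OF C(1)], intro ballI allI impI conjI)
    fix \<mu> \<beta> k l vs x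
    assume \<mu>: "\<mu> \<in> V" and le: "(\<Sum>i\<in>UNIV. \<beta> $ i) + k + l \<le> L" and md: "mixed_directions k l \<beta> vs" and x: "x \<in> punctured_cone d"
    have z: "(\<mu>, x) \<in> S" using \<mu> x by simp
    have vs: "set vs \<subseteq> Basis" "hcount vs = k" "count_list vs (0, axis 3 1) = l" "\<And>i. count_list vs (axis i 1, 0) = \<beta> $ i"
      using md unfolding mixed_directions_def by blast+
    have "length vs \<le> L" using length_eq_counts[OF vs(1)] le unfolding vs(2-4) by simp
    then have A: "vs \<in> ?A" using vs(1) by simp
    note wf = weight_forms[OF z, unfolded snd_conv]
    note b1 = C1(2)[OF C(2) A z, unfolded snd_conv vs(2,3) wf]
      and b2 = C2(2)[OF C(3) A z, unfolded snd_conv vs(2,3) wf]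
      and b3 = C3(2)[OF C(4) A z, unfolded snd_conv vs(2,3) wf]
    show "norm (partials vs (\<lambda>(\<mu>, x). horiz (U \<mu> x)) (\<mu>, x)) \<le>
          (if k \<le> 1
           then C * x $ 3 powi (- int k - int l - 1) * rho x powi (- int k + 1) * (\<bar>ln (rho x)\<bar> + 1)
           else C * x $ 3 powi (- int k - int l - 1) * rho x powi (- int k + 1))"
      using b1 by (cases "k \<le> 1") (simp_all only: if_True if_False mult.assoc)
    show "\<bar>partials vs (\<lambda>(\<mu>, x). U \<mu> x $ 3) (\<mu>, x)\<bar> \<le>
          (if k = 0
           then C * x $ 3 powi (- int k - int l - 1) * (\<bar>ln (rho x)\<bar> + 1)
           else C * x $ 3 powi (- int k - int l - 1) * rho x powi (- int k))"
      using b2 by (cases "k = 0") (simp_all only: if_True if_False mult.assoc real_norm_def simp_thms)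
    show "\<bar>partials vs (\<lambda>(\<mu>, x). P \<mu> x) (\<mu>, x)\<bar> \<le>
          (if k = 0
           then C * x $ 3 powi (- int k - int l - 2) * (\<bar>ln (rho x)\<bar> + 1)
           else C * x $ 3 powi (- int k - int l - 2) * rho x powi (- int k))"
      using b3 by (cases "k = 0") (simp_all only: if_True if_False mult.assoc real_norm_def simp_thms)
  qed
qed

end


theorem proposition1p1:
  fixes K :: "(real^4) set"
  assumes "compact K"
  shows "\<exists>\<delta>>0. \<exists>(V :: (real^4) set) (U :: real^4 \<Rightarrow> real^3 \<Rightarrow> real^3) (P :: real^4 \<Rightarrow> real^3 \<Rightarrow> real).
    open V \<and> K \<subseteq> V \<and>
    (\<forall>\<mu>\<in>V. is_solution \<delta> \<mu> (U \<mu>) (P \<mu>) \<and>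
      (\<forall>u p. is_solution \<delta> \<mu> u p \<longrightarrow> (\<forall>x\<in>punctured_cone \<delta>. u x = U \<mu> x \<and> p x = P \<mu> x))) \<and>
    C_infinity_on (V \<times> punctured_cone \<delta>) (\<lambda>(\<mu>, x). U \<mu> x) \<and>
    C_infinity_on (V \<times> punctured_cone \<delta>) (\<lambda>(\<mu>, x). P \<mu> x) \<and>
    (\<forall>L::nat. \<exists>C>0. \<forall>\<mu>\<in>K. \<forall>(\<beta> :: nat^4) (k::nat) (l::nat). (\<Sum>i\<in>UNIV. \<beta> $ i) + k + l \<le> L \<longrightarrow>
      (\<forall>vs. mixed_directions k l \<beta> vs \<longrightarrow> (\<forall>x\<in>punctured_cone \<delta>.
        norm (partials vs (\<lambda>(\<mu>, x). horiz (U \<mu> x)) (\<mu>, x)) \<le>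
          (if k \<le> 1
           then C * x $ 3 powi (- int k - int l - 1) * rho x powi (- int k + 1) * (\<bar>ln (rho x)\<bar> + 1)
           else C * x $ 3 powi (- int k - int l - 1) * rho x powi (- int k + 1)) \<and>
        \<bar>partials vs (\<lambda>(\<mu>, x). U \<mu> x $ 3) (\<mu>, x)\<bar> \<le>
          (if k = 0
           then C * x $ 3 powi (- int k - int l - 1) * (\<bar>ln (rho x)\<bar> + 1)
           else C * x $ 3 powi (- int k - int l - 1) * rho x powi (- int k)) \<and>
        \<bar>partials vs (\<lambda>(\<mu>, x). P \<mu> x) (\<mu>, x)\<bar> \<le>
          (if k = 0
           then C * x $ 3 powi (- int k - int l - 2) * (\<bar>ln (rho x)\<bar> + 1)
           else C * x $ 3 powi (- int k - int l - 2) * rho x powi (- int k)))))"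
proof -
  obtain R where R: "0 < R" "\<And>\<mu>. \<mu> \<in> K \<Longrightarrow> norm \<mu> < R"
    using compact_imp_bounded[OF assms] unfolding bounded_pos_less by blast
  \<comment> \<open>A ball is taken as the neighbourhood of \<open>K\<close> because the limit
    theorem for the Picard iterates works on convex sets. Its radius depends on \<open>K\<close>
    only, and so do all constants derived from it.\<close>
  define V :: "(real^4) set" where "V = ball 0 R"
  \<comment> \<open>R + 2 plays the role of \<open>P\<close>: it is at least 2 and exceeds the norm
    plus 1 on the ball. The \<open>d\<close> defined next is the largest value that
    \<open>small_step\<close> admits.\<close>
  define Q where "Q = 2 * (R + 2)"
  define d where "d = 1 / (8 * Q\<^sup>2)"
  have Q: "0 < Q" using R(1) by (simp add: Q_def)
  have KV: "K \<subseteq> V" using R(2) by (auto simp: V_def)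
  have step: "small_step V d (R + 2) Q"
  proof
    show "open V" "convex V" by (simp_all add: V_def)
    show "2 \<le> R + 2" using R(1) by simp
    show "norm \<mu> + 1 \<le> R + 2" if "\<mu> \<in> V" for \<mu> using that by (simp add: V_def)
    show "Q = 2 * (R + 2)" by (rule Q_def)
    show "0 < d" "d * (8 * Q\<^sup>2) \<le> 1" using Q by (simp_all add: d_def)
  qed
  obtain g e y where gey: "Cb_infinity V g" "Cb_infinity V e" "Cb_infinity V y"
    "\<forall>\<mu>\<in>V. g \<mu> = step_g d \<mu> (g \<mu>) (y \<mu>) \<and> e \<mu> = step_e d \<mu> (g \<mu>) (e \<mu>) \<and> y \<mu> = step_y d \<mu> (e \<mu>) (y \<mu>)"
    using small_step.fixed_point[OF step] by blast
  interpret integral_system V d g e y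
  proof
    show "open V" "bounded V" by (simp_all add: V_def)
    show "0 < d" using Q by (simp add: d_def)
    show "d \<le> 1" by (rule small_step.d_le_1[OF step])
  qed (use gey in blast)+
  show ?thesis
  proof (rule exI[of _ d], rule conjI[OF d_pos], rule exI[of _ V], rule exI[of _ U], rule exI[of _ P], intro conjI allI)
    show "open V" by (rule open_V)
    show "K \<subseteq> V" by (rule KV)
    show "\<forall>\<mu>\<in>V. is_solution d \<mu> (U \<mu>) (P \<mu>) \<and>
      (\<forall>u p. is_solution d \<mu> u p \<longrightarrow> (\<forall>x\<in>punctured_cone d. u x = U \<mu> x \<and> p x = P \<mu> x))"
      using solution solution_unique by blast
    show "C_infinity_on S (\<lambda>(\<mu>, x). U \<mu> x)" "C_infinity_on S (\<lambda>(\<mu>, x). P \<mu> x)" by (rule smooth_UP)+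
    fix L :: nat
    obtain C where "0 < C" and C: "\<forall>\<mu>\<in>V. \<forall>(\<beta> :: nat^4) (k::nat) (l::nat). (\<Sum>i\<in>UNIV. \<beta> $ i) + k + l \<le> L \<longrightarrow>
      (\<forall>vs. mixed_directions k l \<beta> vs \<longrightarrow> (\<forall>x\<in>punctured_cone d.
        norm (partials vs (\<lambda>(\<mu>, x). horiz (U \<mu> x)) (\<mu>, x)) \<le>
          (if k \<le> 1
           then C * x $ 3 powi (- int k - int l - 1) * rho x powi (- int k + 1) * (\<bar>ln (rho x)\<bar> + 1)
           else C * x $ 3 powi (- int k - int l - 1) * rho x powi (- int k + 1)) \<and>
        \<bar>partials vs (\<lambda>(\<mu>, x). U \<mu> x $ 3) (\<mu>, x)\<bar> \<le>
          (if k = 0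
           then C * x $ 3 powi (- int k - int l - 1) * (\<bar>ln (rho x)\<bar> + 1)
           else C * x $ 3 powi (- int k - int l - 1) * rho x powi (- int k)) \<and>
        \<bar>partials vs (\<lambda>(\<mu>, x). P \<mu> x) (\<mu>, x)\<bar> \<le>
          (if k = 0
           then C * x $ 3 powi (- int k - int l - 2) * (\<bar>ln (rho x)\<bar> + 1)
           else C * x $ 3 powi (- int k - int l - 2) * rho x powi (- int k))))"
      using estimates[of L] by (elim exE conjE)
    show "\<exists>C>0. \<forall>\<mu>\<in>K. \<forall>(\<beta> :: nat^4) (k::nat) (l::nat). (\<Sum>i\<in>UNIV. \<beta> $ i) + k + l \<le> L \<longrightarrow>
      (\<forall>vs. mixed_directions k l \<beta> vs \<longrightarrow> (\<forall>x\<in>punctured_cone d.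
        norm (partials vs (\<lambda>(\<mu>, x). horiz (U \<mu> x)) (\<mu>, x)) \<le>
          (if k \<le> 1
           then C * x $ 3 powi (- int k - int l - 1) * rho x powi (- int k + 1) * (\<bar>ln (rho x)\<bar> + 1)
           else C * x $ 3 powi (- int k - int l - 1) * rho x powi (- int k + 1)) \<and>
        \<bar>partials vs (\<lambda>(\<mu>, x). U \<mu> x $ 3) (\<mu>, x)\<bar> \<le>
          (if k = 0
           then C * x $ 3 powi (- int k - int l - 1) * (\<bar>ln (rho x)\<bar> + 1)
           else C * x $ 3 powi (- int k - int l - 1) * rho x powi (- int k)) \<and>
        \<bar>partials vs (\<lambda>(\<mu>, x). P \<mu> x) (\<mu>, x)\<bar> \<le>
          (if k = 0
           then C * x $ 3 powi (- int k - int l - 2) * (\<bar>ln (rho x)\<bar> + 1)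
           else C * x $ 3 powi (- int k - int l - 2) * rho x powi (- int k))))"
      by (rule exI[of _ C], rule conjI[OF \<open>0 < C\<close>], rule ballI, rule bspec[OF C subsetD[OF KV]])
  qed
qed

end
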